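(* Let $N\ge 4$, let $m,k\ge1$ be integers, and let $\lambda_0,\Lambda_1,\dots,\Lambda_m\in\mathbb R$, $r_1,\dots,r_m\in\mathbb R^+$ satisfy $$\lambda_0^++\sum_{\ell=1}^m\Lambda_\ell^+<\frac{(N-2)^2}{4}.$$ If either (i) $\Lambda_\ell<0$ for all $\ell=1,\dots,m$, or (ii) $\lambda_0>0$ and $\Lambda_\ell>0$ for all $\ell=1,\dots,m$, then neither $S_k(\lambda_0,\Lambda_1,\dots,\Lambda_m)$ nor $S_{\rm circ}(\lambda_0,\Lambda_1,\dots,\Lambda_m)$ is attained.
   Context: $t^+=\max\{t,0\}$, $2^*=\frac{2N}{N-2}$. $\mathcal D^{1,2}(\mathbb R^N)$ is the closure of the smooth compactly supported functions with respect to the norm $\big(\int_{\mathbb R^N}|\nabla u|^2dx\big)^{1/2}$. Write $\mathbb R^N=\mathbb R^2\times\mathbb R^{N-2}$ with points $(z,y)$, identifying $\mathbb R^2$ with $\mathbb C$. $\mathcal D^{1,2}_k(\mathbb R^N)=\{u\in\mathcal D^{1,2}(\mathbb R^N): u(e^{2\pi\sqrt{-1}/k}z,y)=u(z,|y|)\}$, i.e. $u$ is invariant under rotation of $z$ by $2\pi/k$ and depends on $y$ only through $|y|$. $\mathcal D^{1,2}_{\rm circ}(\mathbb R^N)=\{u\in\mathcal D^{1,2}(\mathbb R^N): u(z,y)=u(|z|,|y|)\}$. For $\ell=1,\dots,m$, $a_1^\ell,\dots,a_k^\ell$ are the vertices of a regular $k$-sided polygon of radius $r_\ell$ centered at the origin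 in the plane $\mathbb R^2\times\{0\}$, with $a_i^\ell=e^{2\pi\sqrt{-1}/k}a_{i-1}^\ell$ and $|a_i^\ell|=r_\ell$. $S_r=\{(x,0)\in\mathbb R^2\times\mathbb R^{N-2}:|x|=r\}$, and $d\sigma$ is the line element on it. Define $$S_k(\lambda_0,\Lambda_1,\dots,\Lambda_m)=\inf_{u\in\mathcal D^{1,2}_k(\mathbb R^N)\setminus\{0\}}\frac{\int_{\mathbb R^N}|\nabla u|^2dx-\int_{\mathbb R^N}\Big(\frac{\lambda_0}{|x|^2}+\sum_{\ell=1}^m\sum_{i=1}^k\frac{\Lambda_\ell}{k|x-a_i^\ell|^2}\Big)u^2dx}{\big(\int_{\mathbb R^N}|u|^{2^*}dx\big)^{2/2^*}},$$ $$S_{\rm circ}(\lambda_0,\Lambda_1,\dots,\Lambda_m)=\inf_{u\in\mathcal D^{1,2}_{\rm circ}(\mathbb R^N)\setminus\{0\}}\frac{\int_{\mathbb R^N}|\nabla u|^2dy-\int_{\mathbb R^N}\Big(\frac{\lambda_0}{|y|^2}+\sum_{\ell=1}^m\frac{\Lambda_\ell}{2\pi r_\ell}\int_{S_{r_\ell}}\frac{d\sigma(x)}{|x-y|^2}\Big)u^2(y)\,dy}{\big(\int_{\mathbb R^N}|u|^{2^*}dx\big)^{2/2^*}}.$$ An infimum is attained if some nonzero function of the corresponding space realizes it. *)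

theory Defs
  imports "HOL-Analysis.Analysis"
begin

text \<open>
  Functions are representatives of classes modulo equality Lebesgue-almost everywhere, and are
  taken Borel measurable, which every class of Lebesgue measurable functions allows. Hence
  being zero and being symmetric are understood almost everywhere below.
\<close>

definition critical_exponent :: "nat \<Rightarrow> real" where
  "critical_exponent N = 2 * real N / (real N - 2)"

definition null_functions :: "('a::euclidean_space \<Rightarrow> real) set" where
  "null_functions = {u. AE x in lborel. u x = 0}"

primrec Ck :: "nat \<Rightarrow> ('a::euclidean_space \<Rightarrow> real) \<Rightarrow> bool" where
  "Ck 0 f \<longleftrightarrow> continuous_on UNIV f"
| "Ck (Suc n) f \<longleftrightarrow> (\<forall>x. f differentiable (at x)) \<and>
     (\<forall>b\<in>Basis. Ck n (\<lambda>x. frechet_derivative f (at x) b))"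

definition test_functions :: "('a::euclidean_space \<Rightarrow> real) set" where
  "test_functions = {\<phi>. (\<forall>n. Ck n \<phi>) \<and> compact (closure {x. \<phi> x \<noteq> 0})}"

definition locally_integrable :: "('a::euclidean_space \<Rightarrow> 'b::euclidean_space) \<Rightarrow> bool" where
  "locally_integrable f \<longleftrightarrow> f \<in> borel_measurable lborel \<and>
     (\<forall>K. compact K \<longrightarrow> set_integrable lborel K f)"

definition has_weak_gradient ::
  "('a::euclidean_space \<Rightarrow> real) \<Rightarrow> ('a \<Rightarrow> 'a) \<Rightarrow> bool" where
  "has_weak_gradient u g \<longleftrightarrow> locally_integrable u \<and> locally_integrable g \<and>
     (\<forall>\<phi>\<in>test_functions. \<forall>b\<in>Basis.
        (LINT x|lborel. u x * frechet_derivative \<phi> (at x) b) = - (LINT x|lborel. (g x \<bullet> b) * \<phi> x))"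

text \<open>A weak gradient is unique only up to null sets; it is used only under integrals.\<close>

definition weak_gradient :: "('a::euclidean_space \<Rightarrow> real) \<Rightarrow> 'a \<Rightarrow> 'a" where
  "weak_gradient u = (SOME g. has_weak_gradient u g)"

definition dirichlet_energy :: "('a::euclidean_space \<Rightarrow> real) \<Rightarrow> real" where
  "dirichlet_energy u = (LINT x|lborel. (norm (weak_gradient u x))\<^sup>2)"

text \<open>
  The closure of the test functions in the gradient norm needs an ambient space of functions.
  By the Sobolev inequality (dimension at least 3) the abstract completion embeds into the
  functions in \<open>L\<close> to the critical exponent with square integrable weak gradient. On that space
  the gradient seminorm is a norm, since constants other than zero are excluded.
\<close>

definition D12_ambient :: "('a::euclidean_space \<Rightarrow> real) set" where
  "D12_ambient = {u. u \<in> borel_measurable lborel \<and>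
     integrable lborel (\<lambda>x. \<bar>u x\<bar> powr critical_exponent DIM('a)) \<and>
     (\<exists>g. has_weak_gradient u g \<and> integrable lborel (\<lambda>x. (norm (g x))\<^sup>2))}"

definition D12 :: "('a::euclidean_space \<Rightarrow> real) set" where
  "D12 = {u \<in> D12_ambient. \<exists>\<phi>. (\<forall>n. \<phi> n \<in> test_functions) \<and>
     (\<lambda>n. sqrt (dirichlet_energy (\<lambda>x. \<phi> n x - u x))) \<longlonglongrightarrow> 0}"

text \<open>
  The space \<open>\<real>\<^sup>N = \<real>\<^sup>2 \<times> \<real>\<^sup>N\<^sup>-\<^sup>2\<close>, with points \<open>(z, y)\<close>, is \<^typ>\<open>complex \<times> (real^'n)\<close>, whose norm is
  the Euclidean one and whose dimension is \<open>N = 2 + CARD('n)\<close>.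
\<close>

text \<open>
  Rotating \<open>z\<close> by \<open>2\<pi>/k\<close> preserves \<open>u\<close>, and \<open>u\<close> depends on \<open>y\<close> only through its norm.
\<close>

definition D12_k :: "nat \<Rightarrow> (complex \<times> (real^'n) \<Rightarrow> real) set" where
  "D12_k k = {u \<in> D12.
     (AE (z, y) in lborel. u (cis (2 * pi / real k) * z, y) = u (z, y)) \<and>
     (\<exists>v. AE (z, y) in lborel. u (z, y) = v z (norm y))}"

definition D12_circ :: "(complex \<times> (real^'n) \<Rightarrow> real) set" where
  "D12_circ = {u \<in> D12. \<exists>v. AE (z, y) in lborel. u (z, y) = v (norm z) (norm y)}"

text \<open>
  Potentials are singular on null sets only; the default values taken there by division by zero
  and by divergent integrals do not matter.
\<close>

definition potential_k ::
  "real \<Rightarrow> nat \<Rightarrow> (nat \<Rightarrow> real) \<Rightarrow> nat \<Rightarrow> (nat \<Rightarrow> nat \<Rightarrow> 'a::euclidean_space) \<Rightarrow> 'a \<Rightarrow> real" where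
  "potential_k lam0 m \<Lambda> k a x = lam0 / (norm x)\<^sup>2 +
     (\<Sum>l=1..m. \<Sum>i=1..k. \<Lambda> l / (real k * (norm (x - a l i))\<^sup>2))"

definition arc_length_integral ::
  "(real \<Rightarrow> 'a::euclidean_space) \<Rightarrow> real \<Rightarrow> real \<Rightarrow> ('a \<Rightarrow> real) \<Rightarrow> real" where
  "arc_length_integral \<gamma> s t f =
     (LINT \<theta>:{s..t}|lborel. f (\<gamma> \<theta>) * norm (vector_derivative \<gamma> (at \<theta>)))"

definition circle_integral :: "real \<Rightarrow> (complex \<times> (real^'n) \<Rightarrow> real) \<Rightarrow> real" where
  "circle_integral r f = arc_length_integral (\<lambda>\<theta>. (of_real r * cis \<theta>, 0)) 0 (2 * pi) f"

definition potential_circ ::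
  "real \<Rightarrow> nat \<Rightarrow> (nat \<Rightarrow> real) \<Rightarrow> (nat \<Rightarrow> real) \<Rightarrow> complex \<times> (real^'n) \<Rightarrow> real" where
  "potential_circ lam0 m \<Lambda> r y = lam0 / (norm y)\<^sup>2 +
     (\<Sum>l=1..m. \<Lambda> l / (2 * pi * r l) * circle_integral (r l) (\<lambda>x. 1 / (norm (x - y))\<^sup>2))"

definition rayleigh_quotient ::
  "('a::euclidean_space \<Rightarrow> real) \<Rightarrow> ('a \<Rightarrow> real) \<Rightarrow> real" where
  "rayleigh_quotient V u =
     (dirichlet_energy u - (LINT x|lborel. V x * (u x)\<^sup>2)) /
     (LINT x|lborel. \<bar>u x\<bar> powr critical_exponent DIM('a)) powr (2 / critical_exponent DIM('a))"

text \<open>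
  When the positive parts of the masses sum to less than \<open>(N-2)\<^sup>2/4\<close>, the quotients are
  nonnegative by the Hardy inequality, so these are genuine real infima.
\<close>

definition S_k ::
  "real \<Rightarrow> nat \<Rightarrow> (nat \<Rightarrow> real) \<Rightarrow> nat \<Rightarrow> (nat \<Rightarrow> nat \<Rightarrow> complex \<times> (real^'n)) \<Rightarrow> real" where
  "S_k lam0 m \<Lambda> k a =
     (INF u\<in>D12_k k - null_functions. rayleigh_quotient (potential_k lam0 m \<Lambda> k a) u)"

definition S_circ ::
  "'n::finite itself \<Rightarrow> real \<Rightarrow> nat \<Rightarrow> (nat \<Rightarrow> real) \<Rightarrow> (nat \<Rightarrow> real) \<Rightarrow> real" where
  "S_circ _ lam0 m \<Lambda> r =
     (INF u\<in>(D12_circ :: (complex \<times> (real^'n) \<Rightarrow> real) set) - null_functions.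
        rayleigh_quotient (potential_circ lam0 m \<Lambda> r) u)"

text \<open>
  For each \<open>l\<close>, the points \<open>a l 1, \<dots>, a l k\<close> are the vertices, in order, of a regular
  polygon with \<open>k\<close> sides and circumradius \<open>r l\<close> about the origin of the plane \<open>\<real>\<^sup>2 \<times> {0}\<close>.
\<close>

definition polygon_vertices ::
  "nat \<Rightarrow> nat \<Rightarrow> (nat \<Rightarrow> real) \<Rightarrow> (nat \<Rightarrow> nat \<Rightarrow> complex \<times> (real^'n)) \<Rightarrow> bool" where
  "polygon_vertices m k r a \<longleftrightarrow> (\<forall>l\<in>{1..m}.
     (\<forall>i\<in>{1..k}. snd (a l i) = 0 \<and> norm (a l i) = r l) \<and>
     (\<forall>i\<in>{2..k}. fst (a l i) = cis (2 * pi / real k) * fst (a l (i - 1))))"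

end

theory Submission
  imports Defs "HOL-Complex_Analysis.Great_Picard" "HOL-Computational_Algebra.Polynomial"
begin

text \<open>
  Both potentials have the form \<open>lam0 / |x|\<^sup>2\<close> plus \<open>\<Lambda> l\<close> times a mean of Hardy potentials
  \<open>1 / |x - b|\<^sup>2\<close> over points \<open>b\<close> with \<open>|b| = r l\<close>: the mean over the vertices of a polygon, or the mean over a
  circle. Write \<open>h u b\<close> for the integral of \<open>u\<^sup>2 / |x - b|\<^sup>2\<close>. A dilation of \<open>u\<close> leaves every other
  term of the Rayleigh quotient in proportion and only rescales the radii \<open>r l\<close>. Let \<open>S\<close> be the
  infimum, and suppose that \<open>u\<close> attains it.

  Negative masses. Dilations that send the radii to infinity make the contribution of the means
  vanish (\<open>hardy_integral_vanishes\<close>), so \<open>S\<close> is at most the quotient of \<open>u\<close> with the central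
  potential alone. The means contribute a strictly positive amount to the quotient of \<open>u\<close>, which
  is therefore larger than \<open>S\<close>.

  Positive masses. Let \<open>M\<close> be the total mass. Dilations that send the radii to zero move all mass to
  the origin, so that \<open>S \<parallel>v\<parallel>\<^sup>2 \<le> \<integral>|\<nabla>v|\<^sup>2 - M h v 0\<close> for each radial test function \<open>v\<close>, with the norm
  of the critical Lebesgue space. The same inequality then holds for all test functions
  (\<open>radial_reduction\<close>), hence by translation for the Hardy potential with an arbitrary centre \<open>b\<close>,
  and by density for all functions \<open>v\<close> of the Dirichlet space (\<open>D12_approximation\<close>,
  \<open>D12_extension\<close>). For \<open>v = u\<close> it bounds \<open>h u b\<close> by one number, uniformly in \<open>b\<close>, and the average
  of \<open>h u\<close> that enters the quotient of \<open>u\<close> equals this number. As \<open>lam0\<close> and the \<open>\<Lambda> l\<close> are positive,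
  the bound is attained at the origin and at some point on the circle of radius \<open>r 1\<close>. So \<open>u\<close> is
  optimal for two Hardy potentials with different centres; by comparing first variations, \<open>u\<close> is
  orthogonal to all test functions times the difference of the two potentials, and \<open>u = 0\<close>
  (\<open>two_centres\<close>).

  The reduction to radial functions is a symmetrization argument that works with Lipschitz functions
  and two-point rearrangements (polarizations). A polarization of a nonnegative function towards the origin
  keeps all Lebesgue norms, does not increase the energies
  of differences at distance less than \<open>e\<close> (\<open>polarize_nonlocal_energy\<close>), which determine the Dirichlet energy as \<open>e\<close> tends to
  zero (\<open>dirichlet_le_of_nonlocal_le\<close>), and does not decrease \<open>h u 0\<close>. By compactness some function
  maximizes \<open>h\<close> at the origin among all functions with the same norm, no larger energies and a common
  modulus of continuity. Since no polarization improves it, it is radially decreasing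
  (\<open>maximizer_decreasing\<close>), and mollification turns it into a test function (\<open>mollify\<close>).
\<close>

section \<open>Smooth functions\<close>

definition smooth :: "('a::euclidean_space \<Rightarrow> real) \<Rightarrow> bool" where
  "smooth f \<longleftrightarrow> (\<forall>n. Ck n f)"

text \<open>
  Smoothness is used through coinduction: a set of differentiable functions that is closed under
  partial derivatives consists of smooth functions.
\<close>

lemma smooth_coinduct:
  assumes "f \<in> S"
    and "\<And>g x. g \<in> S \<Longrightarrow> g differentiable (at x)"
    and "\<And>g b. g \<in> S \<Longrightarrow> b \<in> Basis \<Longrightarrow> (\<lambda>x. frechet_derivative g (at x) b) \<in> S"
  shows "smooth f"
proof -
  have "Ck n g" if "g \<in> S" for n g
    using that
  proof (induction n arbitrary: g)
    case 0
    then show ?case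
      using assms(2) by (auto intro!: differentiable_imp_continuous_on simp: differentiable_on_def
        intro: differentiable_at_withinI)
  next
    case (Suc n)
    then show ?case using assms(2,3) by auto
  qed
  then show ?thesis using assms(1) by (simp add: smooth_def)
qed

lemma smooth_differentiable: "smooth f \<Longrightarrow> f differentiable (at x)"
  unfolding smooth_def by (metis Ck.simps(2))

lemma smooth_deriv: "smooth f \<Longrightarrow> b \<in> Basis \<Longrightarrow> smooth (\<lambda>x. frechet_derivative f (at x) b)"
  unfolding smooth_def by (metis Ck.simps(2))

lemma smooth_continuous: "smooth f \<Longrightarrow> continuous_on A f"
  unfolding smooth_def by (metis Ck.simps(1) continuous_on_subset subset_UNIV)

text \<open>
  The functions \<open>P(1/t) exp(-1/t)\<close>, continued by zero, are closed under differentiation. They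
  yield bump functions.
\<close>

definition flat :: "real poly \<Rightarrow> real \<Rightarrow> real" where
  "flat P t = (if t \<le> 0 then 0 else poly P (1 / t) * exp (- (1 / t)))"

lemma tendsto_poly_div_exp_0: "((\<lambda>x. poly P x * exp (- x)) \<longlongrightarrow> 0) (at_top :: real filter)"
proof -
  have "((\<lambda>x. \<Sum>i\<le>degree P. coeff P i * (x ^ i / exp x)) \<longlongrightarrow> (\<Sum>i\<le>degree P. coeff P i * 0)) at_top"
    by (intro tendsto_intros tendsto_power_div_exp_0)
  then show ?thesis
    by (simp add: poly_altdef sum_distrib_right exp_minus divide_inverse mult.assoc)
qed

lemma flat_has_derivative:
  "(flat P has_real_derivative flat (monom 1 2 * (P - pderiv P)) t) (at t)"
proof -
  consider "t < 0" | "t = 0" | "t > 0" by linarith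
  then show ?thesis
  proof cases
    case 1
    have "((\<lambda>_. 0) has_real_derivative 0) (at t)" by simp
    then have "(flat P has_real_derivative 0) (at t)"
      by (rule DERIV_cong_ev[THEN iffD1, rotated -1])
         (use 1 eventually_at_topological[of _ t UNIV] in \<open>auto simp: flat_def eventually_nhds
            intro!: exI[of _ "{..<0}"]\<close>)
    then show ?thesis using 1 by (simp add: flat_def)
  next
    case 3
    have "((\<lambda>t. poly P (1 / t) * exp (- (1 / t))) has_real_derivative
        (poly (pderiv P) (1/t) * (- (1 / t^2))) * exp (- (1/t)) + poly P (1/t) * (exp (- (1/t)) * (1 / t^2))) (at t)"
      using 3 by (auto intro!: derivative_eq_intros DERIV_chain2[OF poly_DERIV] simp: power2_eq_square divide_simps)
    then have "(flat P has_real_derivative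
        (poly (pderiv P) (1/t) * (- (1 / t^2))) * exp (- (1/t)) + poly P (1/t) * (exp (- (1/t)) * (1 / t^2))) (at t)"
      by (rule DERIV_cong_ev[THEN iffD1, rotated -1])
         (use 3 in \<open>auto simp: flat_def eventually_nhds intro!: exI[of _ "{0<..}"]\<close>)
    moreover have "(poly (pderiv P) (1/t) * (- (1 / t^2))) * exp (- (1/t)) + poly P (1/t) * (exp (- (1/t)) * (1 / t^2))
      = flat (monom 1 2 * (P - pderiv P)) t"
      using 3 by (simp add: flat_def poly_monom power_divide field_simps)
    ultimately show ?thesis by simp
  next
    case 2
    have "((\<lambda>h. poly ([:0,1:] * P) (inverse h) * exp (- inverse h)) \<longlongrightarrow> 0) (at_right 0)"
      by (rule filterlim_compose[OF tendsto_poly_div_exp_0 filterlim_inverse_at_top_right])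
    then have R: "((\<lambda>h. flat P h / h) \<longlongrightarrow> 0) (at_right 0)"
      by (rule Lim_transform_eventually)
         (auto simp: eventually_at_filter flat_def field_simps)
    have L: "((\<lambda>h. flat P h / h) \<longlongrightarrow> 0) (at_left 0)"
      by (rule Lim_transform_eventually[of "\<lambda>_. 0"])
         (auto simp: eventually_at_filter flat_def)
    have "((\<lambda>h. flat P h / h) \<longlongrightarrow> 0) (at 0)"
      using R L filterlim_split_at by blast
    then show ?thesis
      using 2 by (simp add: has_field_derivative_iff flat_def)
  qed
qed

text \<open>
  Closed under partial derivatives by the sum, product and chain rules, because \<open>flat\<close> is; hence it
  consists of smooth functions and contains products of one-dimensional bumps as well as radial bumps.
\<close>

inductive_set smooth_algebra :: "('a::euclidean_space \<Rightarrow> real) set" where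
  base: "smooth f \<Longrightarrow> f \<in> smooth_algebra"
| add: "f \<in> smooth_algebra \<Longrightarrow> g \<in> smooth_algebra \<Longrightarrow> (\<lambda>x. f x + g x) \<in> smooth_algebra"
| mult: "f \<in> smooth_algebra \<Longrightarrow> g \<in> smooth_algebra \<Longrightarrow> (\<lambda>x. f x * g x) \<in> smooth_algebra"
| flat: "f \<in> smooth_algebra \<Longrightarrow> (\<lambda>x. flat P (f x)) \<in> smooth_algebra"

lemma frechet_derivative_eq: "(f has_derivative f') (at x) \<Longrightarrow> frechet_derivative f (at x) = f'"
  by (metis frechet_derivative_at)

lemma differentiable_deriv:
  fixes f :: "'a::euclidean_space \<Rightarrow> real"
  shows "f differentiable (at x) \<Longrightarrow> (f has_derivative frechet_derivative f (at x)) (at x)"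
  using frechet_derivative_works by blast

lemma smooth_algebra_derivatives:
  assumes "f \<in> smooth_algebra"
  shows "(\<forall>x. f differentiable (at x)) \<and>
    (\<forall>b\<in>Basis. (\<lambda>x. frechet_derivative f (at x) b) \<in> smooth_algebra)"
  using assms
proof induction
  case (base f)
  then show ?case by (auto intro: smooth_algebra.base smooth_deriv smooth_differentiable)
next
  case (add f g)
  have "((\<lambda>x. f x + g x) has_derivative (\<lambda>h. frechet_derivative f (at x) h + frechet_derivative g (at x) h)) (at x)" for x
    using add by (intro derivative_intros differentiable_deriv) auto
  note d = this frechet_derivative_eq[OF this]
  show ?case
    unfolding d(2) using add.IH d(1) by (auto simp: differentiable_def intro!: smooth_algebra.add)
next
  case (mult f g)
  have "((\<lambda>x. f x * g x) has_derivative (\<lambda>h. f x * frechet_derivative g (at x) h + frechet_derivative f (at x) h * g x)) (at x)" for x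
    using mult by (intro derivative_intros differentiable_deriv) auto
  note d = this frechet_derivative_eq[OF this]
  show ?case
    unfolding d(2) using mult.IH mult.hyps d(1) by (auto simp: differentiable_def
       intro!: smooth_algebra.mult smooth_algebra.add)
next
  case (flat f P)
  have "((\<lambda>x. flat P (f x)) has_derivative (\<lambda>h. flat (monom 1 2 * (P - pderiv P)) (f x) * frechet_derivative f (at x) h)) (at x)" for x
    using flat.IH has_derivative_compose[OF differentiable_deriv[of f x]
      flat_has_derivative[of P "f x", unfolded has_field_derivative_def]] by simp
  note d = this frechet_derivative_eq[OF this]
  show ?case
    unfolding d(2) using flat.IH flat.hyps d(1) by (auto simp: differentiable_def
       intro!: smooth_algebra.mult smooth_algebra.flat)
qed

lemma smooth_algebra_smooth: "f \<in> smooth_algebra \<Longrightarrow> smooth f"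
  by (rule smooth_coinduct[of f smooth_algebra]) (use smooth_algebra_derivatives in blast)+

lemma smooth_add: "smooth f \<Longrightarrow> smooth g \<Longrightarrow> smooth (\<lambda>x. f x + g x)"
  and smooth_mult: "smooth f \<Longrightarrow> smooth g \<Longrightarrow> smooth (\<lambda>x. f x * g x)"
  and smooth_flat: "smooth f \<Longrightarrow> smooth (\<lambda>x. flat P (f x))"
  by (rule smooth_algebra_smooth; intro smooth_algebra.intros; assumption)+

lemma smooth_affine: "smooth (\<lambda>x. x \<bullet> v + c)"
proof (rule smooth_coinduct[of _ "{\<lambda>x. x \<bullet> v + c |v c. True}"])
  fix g :: "'a \<Rightarrow> real" and x assume "g \<in> {\<lambda>x. x \<bullet> v + c |v c. True}"
  then obtain v c where g: "g = (\<lambda>x. x \<bullet> v + c)" by auto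
  have d: "(g has_derivative (\<lambda>h. h \<bullet> v)) (at x)" for x
    unfolding g by (auto intro!: derivative_eq_intros)
  then show "g differentiable (at x)" by (auto simp: differentiable_def)
  fix b :: 'a
  show "(\<lambda>x. frechet_derivative g (at x) b) \<in> {\<lambda>x. x \<bullet> v + c |v c. True}"
    unfolding frechet_derivative_eq[OF d] mem_Collect_eq by (rule exI[of _ 0], rule exI[of _ "b \<bullet> v"]) simp
qed auto

lemma smooth_const: "smooth (\<lambda>x. c)"
  using smooth_affine[of 0 c] by simp

lemma smooth_diff: "smooth f \<Longrightarrow> smooth g \<Longrightarrow> smooth (\<lambda>x. f x - g x)"
  using smooth_add[OF _ smooth_mult[OF smooth_const[of "-1"]], of f g] by simp

lemma smooth_sum: "(\<And>i. i \<in> I \<Longrightarrow> smooth (f i)) \<Longrightarrow> smooth (\<lambda>x. \<Sum>i\<in>I. f i x)"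
  by (induction I rule: infinite_finite_induct) (auto intro: smooth_const smooth_add)

lemma smooth_prod: "(\<And>i. i \<in> I \<Longrightarrow> smooth (f i)) \<Longrightarrow> smooth (\<lambda>x. \<Prod>i\<in>I. f i x)"
  by (induction I rule: infinite_finite_induct) (auto intro: smooth_const smooth_mult)

lemma smooth_norm2: "smooth (\<lambda>x. (norm (x - c))\<^sup>2)"
proof -
  have "(\<lambda>x. (norm (x - c))\<^sup>2) = (\<lambda>x. \<Sum>b\<in>Basis. (x \<bullet> b + - (c \<bullet> b)) * (x \<bullet> b + - (c \<bullet> b)))"
  proof
    fix x
    have "(norm (x - c))\<^sup>2 = (\<Sum>b\<in>Basis. ((x - c) \<bullet> b) * ((x - c) \<bullet> b))"
      unfolding power2_norm_eq_inner by (rule euclidean_inner)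
    then show "(norm (x - c))\<^sup>2 = (\<Sum>b\<in>Basis. (x \<bullet> b + - (c \<bullet> b)) * (x \<bullet> b + - (c \<bullet> b)))"
      by (simp add: inner_diff_left)
  qed
  moreover have "smooth (\<lambda>x. \<Sum>b\<in>Basis. (x \<bullet> b + - (c \<bullet> b)) * (x \<bullet> b + - (c \<bullet> b)))"
    by (intro smooth_sum smooth_mult smooth_affine)
  ultimately show ?thesis by (simp only:)
qed

text \<open>
  Differentiating \<open>f (s x + v)\<close> produces a factor \<open>s\<close>; constant multiples make the set of such functions
  closed under derivatives.
\<close>

lemma smooth_rescale: assumes "smooth f" shows "smooth (\<lambda>x. f (s *\<^sub>R x + v))"
proof (rule smooth_coinduct[of _ "{\<lambda>x. c * f (s *\<^sub>R x + v) |c f. smooth f}"])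
  show "(\<lambda>x. f (s *\<^sub>R x + v)) \<in> {\<lambda>x. c * f (s *\<^sub>R x + v) |c f. smooth f}"
    using assms by (auto intro!: exI[of _ 1] exI[of _ f])
next
  fix g :: "'a \<Rightarrow> real" and x assume "g \<in> {\<lambda>x. c * f (s *\<^sub>R x + v) |c f. smooth f}"
  then obtain c f where g: "g = (\<lambda>x. c * f (s *\<^sub>R x + v))" and f: "smooth f" by auto
  have d: "(g has_derivative (\<lambda>h. c * frechet_derivative f (at (s *\<^sub>R x + v)) (s *\<^sub>R h))) (at x)" for x
  proof -
    have "((\<lambda>x. s *\<^sub>R x + v) has_derivative (\<lambda>h. s *\<^sub>R h)) (at x)"
      by (auto intro!: derivative_eq_intros)
    from has_derivative_mult_right[OF has_derivative_compose[OF this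
        differentiable_deriv[OF smooth_differentiable[OF f]]], of c]
    show ?thesis unfolding g .
  qed
  then show "g differentiable (at x)" by (auto simp: differentiable_def)
  fix b :: 'a assume b: "b \<in> Basis"
  have "linear (frechet_derivative f (at y))" for y
    using f smooth_differentiable linear_frechet_derivative by blast
  then have "(\<lambda>x. frechet_derivative g (at x) b) = (\<lambda>x. (c * s) * frechet_derivative f (at (s *\<^sub>R x + v)) b)"
    unfolding frechet_derivative_eq[OF d] by (auto simp: linear_scale mult.assoc)
  then show "(\<lambda>x. frechet_derivative g (at x) b) \<in> {\<lambda>x. c * f (s *\<^sub>R x + v) |c f. smooth f}"
    unfolding mem_Collect_eq using smooth_deriv[OF f b]
    by (intro exI[of _ "c * s"] exI[of _ "\<lambda>x. frechet_derivative f (at x) b"]) simp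
qed

section \<open>Test functions\<close>

lemma test_functionsI:
  assumes "smooth f" "\<And>x. R < norm x \<Longrightarrow> f x = 0"
  shows "f \<in> test_functions"
proof -
  have "{x. f x \<noteq> 0} \<subseteq> cball 0 R" using assms(2) by (auto simp: not_less[symmetric])
  then have "bounded {x. f x \<noteq> 0}" using bounded_cball bounded_subset by blast
  then show ?thesis using assms(1) by (auto simp: test_functions_def smooth_def compact_eq_bounded_closed)
qed

lemma test_smooth: "f \<in> test_functions \<Longrightarrow> smooth f"
  by (simp add: test_functions_def smooth_def)

lemma test_support:
  assumes "f \<in> test_functions"
  obtains R where "R > 0" "\<And>x. R < norm x \<Longrightarrow> f x = 0"
proof -
  have "bounded {x. f x \<noteq> 0}"
    using assms bounded_subset[OF compact_imp_bounded closure_subset]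
    unfolding test_functions_def by simp
  then obtain R where "R > 0" "\<forall>x\<in>{x. f x \<noteq> 0}. norm x \<le> R" using bounded_pos by blast
  then show ?thesis using that by (meson linorder_not_le mem_Collect_eq)
qed

lemma test_mult_smooth: "f \<in> test_functions \<Longrightarrow> smooth g \<Longrightarrow> (\<lambda>x. g x * f x) \<in> test_functions"
  by (rule test_support[of f], assumption, rule test_functionsI) (auto intro: smooth_mult test_smooth)

lemma test_add: assumes "f \<in> test_functions" "g \<in> test_functions"
  shows "(\<lambda>x. f x + g x) \<in> test_functions"
proof -
  obtain R where "\<And>x. R < norm x \<Longrightarrow> f x = 0" using test_support[OF assms(1)] by blast
  moreover obtain R' where "\<And>x. R' < norm x \<Longrightarrow> g x = 0" using test_support[OF assms(2)] by blast
  ultimately show ?thesis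
    by (intro test_functionsI[where R="max R R'"]) (auto intro: smooth_add test_smooth assms)
qed

lemma test_diff: "f \<in> test_functions \<Longrightarrow> g \<in> test_functions \<Longrightarrow> (\<lambda>x. f x - g x) \<in> test_functions"
  using test_add[OF _ test_mult_smooth[OF _ smooth_const[of "-1"]], of f g] by simp

lemma test_rescale:
  fixes f :: "'a::euclidean_space \<Rightarrow> real"
  assumes "f \<in> test_functions" "s \<noteq> 0"
  shows "(\<lambda>x. f (s *\<^sub>R x + v)) \<in> test_functions"
proof -
  obtain R where R: "R > 0" "\<And>x. R < norm x \<Longrightarrow> f x = 0" using test_support[OF assms(1)] by blast
  show ?thesis
  proof (rule test_functionsI[where R="(R + norm v) / \<bar>s\<bar>"])
    fix x :: 'a assume "(R + norm v) / \<bar>s\<bar> < norm x"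
    then have "R + norm v < norm (s *\<^sub>R x)" using assms(2) by (simp add: field_simps)
    also have "\<dots> \<le> norm (s *\<^sub>R x + v) + norm v"
      by (metis add_diff_cancel norm_triangle_ineq4)
    finally show "f (s *\<^sub>R x + v) = 0" using R by simp
  qed (intro smooth_rescale test_smooth assms)
qed

lemma test_deriv:
  fixes f :: "'a::euclidean_space \<Rightarrow> real"
  assumes "f \<in> test_functions" "b \<in> Basis"
  shows "(\<lambda>x. frechet_derivative f (at x) b) \<in> test_functions"
proof -
  obtain R where R: "R > 0" "\<And>x. R < norm x \<Longrightarrow> f x = 0" using test_support[OF assms(1)] by blast
  show ?thesis
  proof (rule test_functionsI[where R=R])
    fix x :: 'a assume "R < norm x"
    then have "x \<in> - cball 0 R" "open (- cball (0::'a) R)" by auto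
    then have "(f has_derivative (\<lambda>_. 0)) (at x)"
      using R by (intro has_derivative_transform_within_open[OF has_derivative_const[of 0]]) auto
    then show "frechet_derivative f (at x) b = 0" by (simp add: frechet_derivative_eq)
  qed (intro smooth_deriv test_smooth assms)
qed

definition gradient :: "('a::euclidean_space \<Rightarrow> real) \<Rightarrow> 'a \<Rightarrow> 'a" where
  "gradient f x = (\<Sum>b\<in>Basis. frechet_derivative f (at x) b *\<^sub>R b)"

lemma gradient_inner_basis: "b \<in> Basis \<Longrightarrow> gradient f x \<bullet> b = frechet_derivative f (at x) b"
  unfolding gradient_def by (simp add: inner_sum_left inner_Basis if_distrib cong: if_cong)

lemma gradient_has_derivative:
  assumes "f differentiable (at x)"
  shows "(f has_derivative (\<lambda>h. gradient f x \<bullet> h)) (at x)"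
proof -
  interpret linear "frechet_derivative f (at x)"
    using assms linear_frechet_derivative by blast
  have "frechet_derivative f (at x) h = gradient f x \<bullet> h" for h
  proof -
    have "frechet_derivative f (at x) h = frechet_derivative f (at x) (\<Sum>b\<in>Basis. (h \<bullet> b) *\<^sub>R b)"
      by (simp add: euclidean_representation)
    also have "\<dots> = (\<Sum>b\<in>Basis. (h \<bullet> b) * frechet_derivative f (at x) b)"
      by (simp add: sum scale)
    also have "\<dots> = gradient f x \<bullet> h"
      unfolding euclidean_inner[of "gradient f x" h]
      by (intro sum.cong refl) (simp add: gradient_inner_basis)
    finally show ?thesis .
  qed
  then have "frechet_derivative f (at x) = (\<lambda>h. gradient f x \<bullet> h)" by auto
  then show ?thesis using differentiable_deriv[OF assms] by simp
qed

lemma gradient_eqI: "(f has_derivative (\<lambda>h. v \<bullet> h)) (at x) \<Longrightarrow> gradient f x = v"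
  by (simp add: gradient_def frechet_derivative_eq euclidean_representation)

lemma smooth_gradient: "smooth f \<Longrightarrow> (f has_derivative (\<lambda>h. gradient f x \<bullet> h)) (at x)"
  by (intro gradient_has_derivative smooth_differentiable)

lemma continuous_gradient: "smooth f \<Longrightarrow> continuous_on A (gradient f)"
  unfolding gradient_def by (intro continuous_intros smooth_continuous smooth_deriv)

lemma gradient_support:
  fixes f :: "'a::euclidean_space \<Rightarrow> real"
  assumes "\<And>x. R < norm x \<Longrightarrow> f x = 0" "R < norm x" shows "gradient f x = 0"
proof -
  have "x \<in> - cball 0 R" "open (- cball (0::'a) R)" using assms by auto
  then have "(f has_derivative (\<lambda>_. 0)) (at x)"
    using assms by (intro has_derivative_transform_within_open[OF has_derivative_const[of 0]]) auto
  then show ?thesis using gradient_eqI[of f 0 x] by simp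
qed

section \<open>Invariances of Lebesgue measure\<close>

lemma nn_integral_translate:
  fixes f :: "'a::euclidean_space \<Rightarrow> ennreal"
  assumes [measurable]: "f \<in> borel_measurable borel"
  shows "(\<integral>\<^sup>+x. f (x + c) \<partial>lborel) = (\<integral>\<^sup>+x. f x \<partial>lborel)"
  by (subst lborel_distr_plus[of c, symmetric])
     (simp add: nn_integral_distr add.commute)

lemma integral_translate:
  fixes f :: "'a::euclidean_space \<Rightarrow> 'b::euclidean_space"
  assumes [measurable]: "f \<in> borel_measurable borel"
  shows "(LINT x|lborel. f (x + c)) = (LINT x|lborel. f x)"
  by (subst (2) lborel_distr_plus[of c, symmetric])
     (simp add: integral_distr add.commute)

lemma integrable_translate:
  fixes f :: "'a::euclidean_space \<Rightarrow> 'b::euclidean_space"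
  assumes "integrable lborel f"
  shows "integrable lborel (\<lambda>x. f (x + c))"
proof -
  have "integrable (distr lborel borel ((+) c)) f"
    using assms by (simp add: lborel_distr_plus)
  then show ?thesis by (subst (asm) integrable_distr_eq) (use assms in \<open>auto simp: add.commute\<close>)
qed

lemma AE_rescale:
  fixes c :: real
  assumes "AE x in lborel. P (x::'a::euclidean_space)" "c \<noteq> 0"
  shows "AE x in lborel. P (c *\<^sub>R x)"
proof -
  have L: "lborel = density (distr lborel borel (\<lambda>x::'a. c *\<^sub>R x)) (\<lambda>_. ennreal (\<bar>c\<bar> ^ DIM('a)))"
    using lborel_affine[OF assms(2), of "0::'a"] by simp
  have "AE x in density (distr lborel borel (\<lambda>x::'a. c *\<^sub>R x)) (\<lambda>_. ennreal (\<bar>c\<bar> ^ DIM('a))). P x"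
    using assms(1) unfolding L[symmetric] .
  then have "AE x in distr lborel borel (\<lambda>x::'a. c *\<^sub>R x). P x"
    using assms(2) by (subst (asm) AE_density) auto
  then obtain N where N: "{x. \<not> P x} \<subseteq> N" "N \<in> null_sets (distr lborel borel (\<lambda>x::'a. c *\<^sub>R x))"
    unfolding eventually_ae_filter by auto
  then have "(\<lambda>x. c *\<^sub>R x) -` N \<in> null_sets lborel"
    using measurable_sets[of "\<lambda>x. c *\<^sub>R x" lborel "borel :: 'a measure" N]
    by (auto simp: null_sets_def emeasure_distr)
  then show ?thesis
    by (rule AE_I') (use N in auto)
qed

lemma integral_rescale:
  fixes f :: "'a::euclidean_space \<Rightarrow> real" and c :: real
  assumes [measurable]: "f \<in> borel_measurable borel" and c: "c > 0"
  shows "(LINT x|lborel. f (c *\<^sub>R x)) = (LINT x|lborel. f x) / c ^ DIM('a)"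
proof -
  have "(LINT x|lborel. f x) = (LINT x|density (distr lborel borel (\<lambda>x::'a. 0 + c *\<^sub>R x)) (\<lambda>_. ennreal (\<bar>c\<bar> ^ DIM('a))). f x)"
    using c lborel_affine[of c "0::'a"] by simp
  also have "\<dots> = c ^ DIM('a) * (LINT x|lborel. f (c *\<^sub>R x))"
    using c by (subst integral_density) (auto simp: integral_distr)
  finally show ?thesis using c by simp
qed

lemma integrable_rescale:
  fixes f :: "'a::euclidean_space \<Rightarrow> 'b::euclidean_space" and c :: real
  assumes "integrable lborel f" "c \<noteq> 0"
  shows "integrable lborel (\<lambda>x. f (c *\<^sub>R x))"
proof -
  have [measurable]: "f \<in> borel_measurable borel" using assms by auto
  have "integrable (density (distr lborel borel (\<lambda>x::'a. 0 + c *\<^sub>R x)) (\<lambda>_. ennreal (\<bar>c\<bar> ^ DIM('a)))) f"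
    using assms lborel_affine[of c "0::'a"] by simp
  then have "integrable (distr lborel borel (\<lambda>x::'a. 0 + c *\<^sub>R x)) (\<lambda>x. (\<bar>c\<bar> ^ DIM('a)) *\<^sub>R f x)"
    by (subst (asm) integrable_density) auto
  then have "integrable lborel (\<lambda>x. (\<bar>c\<bar> ^ DIM('a)) *\<^sub>R f (c *\<^sub>R x))"
    by (subst (asm) integrable_distr_eq) auto
  from integrable_scaleR_right[OF this, of "1 / (\<bar>c\<bar> ^ DIM('a))"] show ?thesis
    using assms(2) by simp
qed

text \<open>
  A translation-invariant measure is determined by the measure of one ball, since
  \<open>\<nu>(A) \<lambda>(B) = \<lambda>(A) \<nu>(B)\<close> by Fubini. An isometric linear involution preserves balls, hence it
  preserves Lebesgue measure.
\<close>

lemma lborel_distr_isometric_involution: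
  fixes f :: "'a::euclidean_space \<Rightarrow> 'a"
  assumes lin: "linear f" and iso: "\<And>x. norm (f x) = norm x" and inv: "\<And>x. f (f x) = x"
  shows "distr lborel borel f = lborel"
proof (rule measure_eqI)
  have [measurable]: "f \<in> borel_measurable borel"
    using lin by (intro borel_measurable_continuous_onI linear_continuous_on linear_conv_bounded_linear[THEN iffD1])
  fix A assume "A \<in> sets (distr lborel borel f)"
  then have A[measurable]: "A \<in> sets borel" by simp
  define B where "B = ball (0::'a) 1"
  have [measurable]: "B \<in> sets borel" by (simp add: B_def)
  have B: "emeasure lborel B = (\<integral>\<^sup>+x. indicator B x \<partial>lborel)" by simp
  have "emeasure (distr lborel borel f) A * emeasure lborel B
    = (\<integral>\<^sup>+x. indicator A (f x) \<partial>lborel) * (\<integral>\<^sup>+y. indicator B y \<partial>lborel)"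
  proof -
    have "emeasure (distr lborel borel f) A = (\<integral>\<^sup>+x. indicator A x \<partial>distr lborel borel f)" by simp
    also have "\<dots> = (\<integral>\<^sup>+x. indicator A (f x) \<partial>lborel)" by (rule nn_integral_distr) auto
    finally show ?thesis by (simp only: B)
  qed
  also have "\<dots> = (\<integral>\<^sup>+y. (\<integral>\<^sup>+x. indicator A (f x) * indicator B y \<partial>lborel) \<partial>lborel)"
    by (simp add: nn_integral_cmult nn_integral_multc del: nn_integral_indicator)
  also have "\<dots> = (\<integral>\<^sup>+y. (\<integral>\<^sup>+x. indicator A (f (x + f y)) * indicator B y \<partial>lborel) \<partial>lborel)"
    by (subst nn_integral_translate[where f="\<lambda>x. indicator A (f x) * indicator B y" for y]) auto
  also have "\<dots> = (\<integral>\<^sup>+y. (\<integral>\<^sup>+x. indicator A (f x + y) * indicator B y \<partial>lborel) \<partial>lborel)"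
    by (simp add: linear_add[OF lin] inv)
  also have "\<dots> = (\<integral>\<^sup>+x. (\<integral>\<^sup>+y. indicator A (f x + y) * indicator B y \<partial>lborel) \<partial>lborel)"
    by (rule lborel_pair.Fubini') measurable
  also have "\<dots> = (\<integral>\<^sup>+x. (\<integral>\<^sup>+y. indicator A y * indicator B (y - f x) \<partial>lborel) \<partial>lborel)"
    by (subst nn_integral_translate[where f="\<lambda>y. indicator A y * indicator B (y - f x)" and c="f x" for x, symmetric])
       (auto simp: add.commute)
  also have "\<dots> = (\<integral>\<^sup>+y. (\<integral>\<^sup>+x. indicator A y * indicator B (y - f x) \<partial>lborel) \<partial>lborel)"
    by (rule lborel_pair.Fubini') measurable
  also have "\<dots> = (\<integral>\<^sup>+y. indicator A y * (\<integral>\<^sup>+x. indicator B x \<partial>lborel) \<partial>lborel)"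
  proof (rule nn_integral_cong)
    fix y
    have "indicator B (y - f x) = (indicator B (x + (- f y)) :: ennreal)" for x
    proof -
      have "norm (y - f x) = norm (f (y - f x))" by (simp add: iso)
      also have "\<dots> = norm (x - f y)" by (simp add: linear_diff[OF lin] inv norm_minus_commute)
      finally show ?thesis by (simp add: B_def indicator_def)
    qed
    then show "(\<integral>\<^sup>+x. indicator A y * indicator B (y - f x) \<partial>lborel) = indicator A y * (\<integral>\<^sup>+x. indicator B x \<partial>lborel)"
      using nn_integral_translate[of "indicator B" "- f y"]
      by (simp add: nn_integral_cmult del: nn_integral_indicator)
  qed
  also have "\<dots> = emeasure lborel A * emeasure lborel B"
    by (simp add: nn_integral_multc)
  finally have *: "emeasure (distr lborel borel f) A * emeasure lborel B = emeasure lborel A * emeasure lborel B" .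
  have "emeasure lborel B \<noteq> 0"
    using content_ball_pos[of 1 "0::'a"] by (auto simp: B_def measure_def)
  moreover have "emeasure lborel B \<noteq> \<infinity>"
    unfolding B_def using emeasure_lborel_ball_finite[of "0::'a" 1] by (simp add: less_top)
  ultimately show "emeasure (distr lborel borel f) A = emeasure lborel A"
    using * ennreal_mult_cancel_left[of "emeasure lborel B" "emeasure (distr lborel borel f) A" "emeasure lborel A"]
    by (simp add: mult.commute)
qed simp

definition reflection :: "'a::euclidean_space \<Rightarrow> 'a \<Rightarrow> 'a" where
  "reflection w x = x - (2 * (x \<bullet> w) / (w \<bullet> w)) *\<^sub>R w"

lemma reflection_self: "w \<noteq> 0 \<Longrightarrow> reflection w (c *\<^sub>R w) = - (c *\<^sub>R w)"
proof -
  assume "w \<noteq> 0"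
  then have "2 * (c *\<^sub>R w \<bullet> w) / (w \<bullet> w) = c + c" by simp
  then show ?thesis by (simp only: reflection_def scaleR_add_left) simp
qed

lemma linear_reflection: "linear (reflection w)"
proof (rule linearI)
  fix x y :: 'a and r :: real
  show "reflection w (x + y) = reflection w x + reflection w y"
    by (simp add: reflection_def inner_add_left distrib_left add_divide_distrib scaleR_add_left)
  show "reflection w (r *\<^sub>R x) = r *\<^sub>R reflection w x"
    by (simp add: reflection_def scaleR_diff_right mult.left_commute)
qed

lemma reflection_inner: "reflection w x \<bullet> w = - (x \<bullet> w)"
proof (cases "w = 0")
  case False
  then have "w \<bullet> w \<noteq> 0" by simp
  then have "2 * (x \<bullet> w) / (w \<bullet> w) * (w \<bullet> w) = 2 * (x \<bullet> w)" by simp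
  then show ?thesis unfolding reflection_def inner_diff_left inner_scaleR_left by linarith
qed (simp add: reflection_def)

lemma reflection_reflection [simp]: "reflection w (reflection w x) = x"
  by (subst reflection_def) (simp add: reflection_inner, simp add: reflection_def)

lemma norm_reflection [simp]: "norm (reflection w x) = norm x"
proof -
  have "reflection w x \<bullet> reflection w x = reflection w x \<bullet> x + 2 * (x \<bullet> w) / (w \<bullet> w) * (x \<bullet> w)"
    by (subst (2) reflection_def) (simp add: inner_diff_right reflection_inner)
  also have "\<dots> = x \<bullet> x"
    by (simp add: reflection_def inner_diff_left inner_commute[of w x])
  finally show ?thesis by (simp add: norm_eq_sqrt_inner)
qed

lemma lborel_distr_reflection: "distr lborel borel (reflection w) = lborel"
  by (rule lborel_distr_isometric_involution) (auto simp: linear_reflection)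

text \<open>The reflection in the hyperplane that bisects the segment from \<open>p\<close> to \<open>q\<close>.\<close>

definition bisect :: "'a::euclidean_space \<Rightarrow> 'a \<Rightarrow> 'a \<Rightarrow> 'a" where
  "bisect p q x = reflection (p - q) (x - (p + q) /\<^sub>R 2) + (p + q) /\<^sub>R 2"

lemma bisect_bisect [simp]: "bisect p q (bisect p q x) = x"
  by (simp add: bisect_def)

lemma norm_bisect_diff [simp]: "norm (bisect p q x - bisect p q y) = norm (x - y)"
proof -
  have "bisect p q x - bisect p q y = reflection (p - q) (x - y)"
    unfolding bisect_def linear_diff[OF linear_reflection] by simp
  then show ?thesis by simp
qed

lemma bisect_swap: "bisect p q p = q"
proof (cases "p = q")
  case False
  have 1: "p - (p + q) /\<^sub>R 2 = (p - q) /\<^sub>R 2" by (simp add: algebra_simps flip: scaleR_add_left)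
  have "reflection (p - q) ((p - q) /\<^sub>R 2) = - ((p - q) /\<^sub>R 2)"
    using False by (intro reflection_self) simp
  then have "bisect p q p = - ((p - q) /\<^sub>R 2) + (p + q) /\<^sub>R 2"
    unfolding bisect_def 1 by simp
  also have "\<dots> = (1 / 2) *\<^sub>R q + (1 / 2) *\<^sub>R q" by (simp add: algebra_simps)
  also have "\<dots> = q" by (simp flip: scaleR_add_left)
  finally show ?thesis .
qed (simp add: bisect_def reflection_def)

lemma measurable_bisect [measurable]: "bisect p q \<in> borel_measurable borel"
  unfolding bisect_def reflection_def by measurable

lemma measurable_reflection [measurable]: "reflection w \<in> borel_measurable borel"
  unfolding reflection_def by measurable

lemma lborel_distr_bisect: "distr lborel borel (bisect p q) = lborel"
proof -
  define m where "m = (p + q) /\<^sub>R 2"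
  define T where "T = (\<lambda>x. - m + x)"
  have [measurable]: "T \<in> borel_measurable borel" by (simp add: T_def)
  have "bisect p q = (\<lambda>x. m + x) \<circ> (reflection (p - q) \<circ> T)"
    by (rule ext) (simp add: bisect_def m_def T_def add.commute)
  then have "distr lborel borel (bisect p q) = distr lborel borel ((\<lambda>x. m + x) \<circ> (reflection (p - q) \<circ> T))"
    by (rule arg_cong)
  also have "\<dots> = distr (distr (distr lborel borel T) borel (reflection (p - q))) borel ((+) m)"
    by (simp add: distr_distr)
  also have "distr lborel borel T = lborel"
    unfolding T_def by (rule lborel_distr_plus)
  finally show ?thesis by (simp add: lborel_distr_plus lborel_distr_reflection)
qed

lemma nn_integral_bisect:
  assumes [measurable]: "f \<in> borel_measurable borel"
  shows "(\<integral>\<^sup>+x. f (bisect p q x) \<partial>lborel) = (\<integral>\<^sup>+x. f x \<partial>lborel)"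
  by (subst (2) lborel_distr_bisect[of p q, symmetric]) (simp add: nn_integral_distr)

lemma nn_integral_reflection:
  assumes [measurable]: "f \<in> borel_measurable borel"
  shows "(\<integral>\<^sup>+x. f (reflection w x) \<partial>lborel) = (\<integral>\<^sup>+x. f x \<partial>lborel)"
  by (subst (2) lborel_distr_reflection[of w, symmetric]) (simp add: nn_integral_distr)

section \<open>Integration by parts and the fundamental lemma\<close>

lemma integrable_compact_support:
  fixes f :: "'a::euclidean_space \<Rightarrow> 'b::euclidean_space"
  assumes cont: "continuous_on UNIV f" and supp: "\<And>x. R < norm x \<Longrightarrow> f x = 0"
  shows "integrable lborel f"
proof -
  have "integrable lborel (\<lambda>x. indicator (cball 0 R) x *\<^sub>R f x)"
    by (rule borel_integrable_compact) (auto intro: continuous_on_subset[OF cont])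
  moreover have "(\<lambda>x. indicator (cball 0 R) x *\<^sub>R f x) = f"
    using supp by (auto simp: indicator_def fun_eq_iff not_le)
  ultimately show ?thesis by simp
qed

lemma bounded_compact_support:
  fixes f :: "'a::euclidean_space \<Rightarrow> 'b::euclidean_space"
  assumes cont: "continuous_on UNIV f" and supp: "\<And>x. R < norm x \<Longrightarrow> f x = 0"
  obtains B where "B > 0" "\<And>x. norm (f x) \<le> B"
proof -
  have "compact (f ` cball 0 R)"
    by (intro compact_continuous_image continuous_on_subset[OF cont]) auto
  then obtain B where B: "B > 0" "\<forall>y\<in>f ` cball 0 R. norm y \<le> B"
    using compact_imp_bounded bounded_pos by blast
  have "norm (f x) \<le> B" for x
    using B supp[of x] by (cases "norm x \<le> R") auto
  then show ?thesis using that B by blast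
qed

lemma has_derivative_lipschitz:
  fixes f :: "'a::euclidean_space \<Rightarrow> real"
  assumes d: "\<And>x. (f has_derivative (\<lambda>h. F x \<bullet> h)) (at x)" and B: "\<And>x. norm (F x) \<le> B"
  shows "\<bar>f x - f y\<bar> \<le> B * norm (x - y)"
proof -
  have "norm (f x - f y) \<le> B * norm (x - y)"
  proof (rule differentiable_bound[of UNIV])
    fix x
    show "onorm (\<lambda>h. F x \<bullet> h) \<le> B"
    proof (rule onorm_bound)
      show "0 \<le> B" using B[of x] norm_ge_zero order_trans by blast
      fix h
      have "\<bar>F x \<bullet> h\<bar> \<le> norm (F x) * norm h" by (rule Cauchy_Schwarz_ineq2)
      also have "\<dots> \<le> B * norm h" using B by (intro mult_right_mono) auto
      finally show "norm (F x \<bullet> h) \<le> B * norm h" by simp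
    qed
  qed (use d in auto)
  then show ?thesis by simp
qed

lemma directional_difference_quotient:
  fixes f :: "'a::euclidean_space \<Rightarrow> real"
  assumes "(f has_derivative (\<lambda>h. F \<bullet> h)) (at x)"
  shows "((\<lambda>t. (f (x + t *\<^sub>R v) - f x) / t) \<longlongrightarrow> F \<bullet> v) (at 0)"
proof -
  have "((\<lambda>t. x + t *\<^sub>R v) has_derivative (\<lambda>t. t *\<^sub>R v)) (at (0::real))"
    by (auto intro!: derivative_eq_intros)
  from has_derivative_compose[OF this, of f "\<lambda>h. F \<bullet> h"] assms
  have "((\<lambda>t. f (x + t *\<^sub>R v)) has_derivative (\<lambda>t. F \<bullet> (t *\<^sub>R v))) (at (0::real))" by simp
  then have "((\<lambda>t. f (x + t *\<^sub>R v)) has_real_derivative (F \<bullet> v)) (at 0)"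
    by (simp add: has_field_derivative_def mult.commute[of "F \<bullet> v", abs_def])
  then show ?thesis by (simp add: DERIV_def)
qed

text \<open>
  The integral of a difference quotient vanishes by translation invariance; its limit is the
  integral of a directional derivative.
\<close>

lemma integral_derivative_eq_0:
  fixes f :: "'a::euclidean_space \<Rightarrow> real"
  assumes d: "\<And>x. (f has_derivative (\<lambda>h. F x \<bullet> h)) (at x)" and cF: "continuous_on UNIV F"
    and supp: "\<And>x. R < norm x \<Longrightarrow> f x = 0"
  shows "(LINT x|lborel. F x \<bullet> v) = 0"
proof -
  have cf: "continuous_on UNIV f"
    using d has_derivative_continuous by (intro continuous_at_imp_continuous_on) blast
  have [measurable]: "f \<in> borel_measurable borel" "F \<in> borel_measurable borel"
    using cf cF by (auto intro: borel_measurable_continuous_onI)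
  have suppF: "F x = 0" if "R < norm x" for x
    using gradient_support[of R f x] gradient_eqI[OF d] supp that by simp
  obtain B where B: "B > 0" "\<And>x. norm (F x) \<le> B"
    using bounded_compact_support[OF cF suppF] by blast
  note lip = has_derivative_lipschitz[OF d B(2)]
  define q where "q n x = (f (x + inverse (real (Suc n)) *\<^sub>R v) - f x) / inverse (real (Suc n))" for n x
  have "(\<lambda>n. LINT x|lborel. q n x) \<longlonglongrightarrow> (LINT x|lborel. F x \<bullet> v)"
  proof (rule integral_dominated_convergence[where w="\<lambda>x. indicator (cball 0 (R + norm v)) x * (B * norm v)"])
    show "(\<lambda>x. F x \<bullet> v) \<in> borel_measurable lborel" by measurable
    show "q n \<in> borel_measurable lborel" for n unfolding q_def by measurable
    show "integrable lborel (\<lambda>x. indicator (cball (0::'a) (R + norm v)) x * (B * norm v))"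
      using borel_integrable_compact[of "cball (0::'a) (R + norm v)" "\<lambda>_. B * norm v"] by simp
    show "AE x in lborel. (\<lambda>n. q n x) \<longlonglongrightarrow> F x \<bullet> v"
    proof (rule AE_I2)
      fix x
      have "filterlim (\<lambda>n. inverse (real (Suc n))) (at 0) sequentially"
        using LIMSEQ_inverse_real_of_nat by (simp add: filterlim_at)
      from filterlim_compose[OF directional_difference_quotient[OF d] this]
      show "(\<lambda>n. q n x) \<longlonglongrightarrow> F x \<bullet> v" unfolding q_def .
    qed
    show "AE x in lborel. norm (q n x) \<le> indicator (cball 0 (R + norm v)) x * (B * norm v)" for n
    proof (rule AE_I2)
      fix x
      define t where "t = inverse (real (Suc n))"
      have t: "0 < t" "t \<le> 1" by (auto simp: t_def inverse_le_1_iff)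
      have q: "q n x = (f (x + t *\<^sub>R v) - f x) / t" by (simp only: q_def t_def)
      show "norm (q n x) \<le> indicator (cball 0 (R + norm v)) x * (B * norm v)"
      proof (cases "norm x \<le> R + norm v")
        case True
        have "\<bar>f (x + t *\<^sub>R v) - f x\<bar> \<le> B * (t * norm v)"
          using lip[of "x + t *\<^sub>R v" x] t by simp
        then have "\<bar>f (x + t *\<^sub>R v) - f x\<bar> / t \<le> B * norm v"
          using t by (simp add: pos_divide_le_eq mult.assoc mult.left_commute mult.commute)
        then show ?thesis using True t by (simp add: q)
      next
        case False
        have "norm (t *\<^sub>R v) \<le> norm v" using t by (simp add: mult_left_le_one_le)
        moreover have "norm x \<le> norm (x + t *\<^sub>R v) + norm (t *\<^sub>R v)"
          by (metis add_diff_cancel norm_triangle_ineq4)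
        ultimately have "R < norm (x + t *\<^sub>R v)" using False by linarith
        moreover have "R < norm x" using False norm_ge_zero[of v] by linarith
        ultimately show ?thesis using supp B(1) by (auto simp: q indicator_def)
      qed
    qed
  qed
  moreover have "(LINT x|lborel. q n x) = 0" for n
  proof -
    have i: "integrable lborel f" using integrable_compact_support[OF cf supp] .
    define c where "c = inverse (real (Suc n)) *\<^sub>R v"
    have "(LINT x|lborel. f (x + c) - f x) = 0"
      using Bochner_Integration.integral_diff[OF integrable_translate[OF i, of c] i]
        integral_translate[of f c] \<open>f \<in> borel_measurable borel\<close> by linarith
    then show ?thesis unfolding q_def c_def[symmetric] by (simp only: integral_divide_zero div_0)
  qed
  ultimately show ?thesis by (simp add: LIMSEQ_const_iff)
qed

lemma integrable_loc_times_test: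
  fixes u :: "'a::euclidean_space \<Rightarrow> real"
  assumes u: "locally_integrable u" and cont: "continuous_on UNIV f"
    and supp: "\<And>x. R < norm x \<Longrightarrow> f x = 0"
  shows "integrable lborel (\<lambda>x. u x * f x)"
proof -
  have [measurable]: "f \<in> borel_measurable borel" "u \<in> borel_measurable borel"
    using u cont by (auto intro: borel_measurable_continuous_onI simp: locally_integrable_def)
  obtain B where B: "B > 0" "\<And>x. norm (f x) \<le> B"
    using bounded_compact_support[OF cont supp] by blast
  have "integrable lborel (\<lambda>x. B * (indicator (cball 0 R) x * u x))"
    using u unfolding locally_integrable_def set_integrable_def by (intro integrable_mult_right) auto
  then show ?thesis
  proof (rule Bochner_Integration.integrable_bound)
    show "AE x in lborel. norm (u x * f x) \<le> norm (B * (indicator (cball 0 R) x * u x))"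
    proof (rule AE_I2)
      fix x
      show "norm (u x * f x) \<le> norm (B * (indicator (cball 0 R) x * u x))"
      proof (cases "norm x \<le> R")
        case True
        have "\<bar>u x\<bar> * \<bar>f x\<bar> \<le> \<bar>u x\<bar> * B" using B(2)[of x] by (intro mult_left_mono) auto
        then show ?thesis using True B(1) by (simp add: abs_mult mult.commute)
      qed (use supp in auto)
    qed
  qed measurable
qed

lemma flat_1_bounds: "0 \<le> flat 1 t" "flat 1 t \<le> 1"
  by (auto simp: flat_def)

lemma flat_1_pos: "0 < t \<Longrightarrow> 0 < flat 1 t"
  by (auto simp: flat_def)

lemma flat_1_limit: "0 < t \<Longrightarrow> (\<lambda>n. flat 1 (real (Suc n) * t)) \<longlonglongrightarrow> 1"
proof -
  assume t: "0 < t"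
  have "(\<lambda>n. exp (- (inverse (real (Suc n)) * (1 / t)))) \<longlonglongrightarrow> exp (- (0 * (1 / t)))"
    by (intro tendsto_intros LIMSEQ_inverse_real_of_nat)
  moreover have "exp (- (inverse (real (Suc n)) * (1 / t))) = flat 1 (real (Suc n) * t)" for n
    using t mult_pos_pos[of "real (Suc n)" t]
    by (simp add: flat_def not_le inverse_eq_divide del: of_nat_Suc zero_less_mult_iff)
  ultimately show ?thesis by simp
qed

text \<open>Smooth bumps on a box that increase to its indicator function.\<close>

definition box_bump :: "'a::euclidean_space \<Rightarrow> 'a \<Rightarrow> nat \<Rightarrow> 'a \<Rightarrow> real" where
  "box_bump l u n x = (\<Prod>b\<in>Basis. flat 1 (real (Suc n) * (x \<bullet> b - l \<bullet> b)) * flat 1 (real (Suc n) * (u \<bullet> b - x \<bullet> b)))"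

lemma box_bump_outside: "x \<notin> box l u \<Longrightarrow> box_bump l u n x = 0"
proof -
  assume "x \<notin> box l u"
  then obtain b where b: "b \<in> Basis" "x \<bullet> b \<le> l \<bullet> b \<or> u \<bullet> b \<le> x \<bullet> b"
    by (auto simp: mem_box not_less)
  then have "flat 1 (real (Suc n) * (x \<bullet> b - l \<bullet> b)) = 0 \<or> flat 1 (real (Suc n) * (u \<bullet> b - x \<bullet> b)) = 0"
    by (auto simp: flat_def mult_le_0_iff)
  then show ?thesis using b(1) unfolding box_bump_def by (intro prod_zero) auto
qed

lemma box_bump_bounds: "0 \<le> box_bump l u n x" "box_bump l u n x \<le> 1"
  unfolding box_bump_def
  by (auto intro!: prod_nonneg prod_le_1 mult_nonneg_nonneg mult_le_one simp: flat_1_bounds)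

lemma box_bump_limit: "(\<lambda>n. box_bump l u n x) \<longlonglongrightarrow> indicator (box l u) x"
proof (cases "x \<in> box l u")
  case True
  have "(\<lambda>n. box_bump l u n x) \<longlonglongrightarrow> (\<Prod>b\<in>(Basis::'a set). 1 * 1)"
    unfolding box_bump_def using True
    by (intro tendsto_prod tendsto_mult flat_1_limit) (auto simp: mem_box)
  then show ?thesis using True by simp
qed (simp add: box_bump_outside)

lemma box_bump_test: "box_bump l u n \<in> test_functions"
proof -
  obtain R where R: "\<And>x. x \<in> box l u \<Longrightarrow> norm x \<le> R" using bounded_box[of l u] unfolding bounded_iff by blast
  have "smooth (\<lambda>x. (real (Suc n) * (x \<bullet> b - l \<bullet> b)))" for b
    using smooth_mult[OF smooth_const smooth_affine[of b "- (l \<bullet> b)"]] by simp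
  moreover have "smooth (\<lambda>x. (real (Suc n) * (u \<bullet> b - x \<bullet> b)))" for b
    using smooth_mult[OF smooth_const smooth_diff[OF smooth_const smooth_affine[of b 0]]] by simp
  ultimately have "smooth (box_bump l u n)"
    unfolding box_bump_def[abs_def]
    by (intro smooth_prod smooth_mult[of "\<lambda>x. flat _ (_ x)" "\<lambda>x. flat _ (_ x)"] smooth_flat)
  then show ?thesis
    by (rule test_functionsI[where R=R]) (use R box_bump_outside in \<open>force simp: not_le[symmetric]\<close>)
qed

text \<open>
  The integral of \<open>h\<close> over every box vanishes, as a limit of pairings with the bumps of that box. Boxes
  are stable under intersection and generate the Borel sets, so the integral vanishes over all Borel
  sets inside a fixed box.
\<close>

lemma fundamental_lemma:
  fixes h :: "'a::euclidean_space \<Rightarrow> real"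
  assumes h: "locally_integrable h" and 0: "\<And>\<phi>. \<phi> \<in> test_functions \<Longrightarrow> (LINT x|lborel. h x * \<phi> x) = 0"
  shows "AE x in lborel. h x = 0"
proof -
  have [measurable]: "h \<in> borel_measurable borel" using h by (simp add: locally_integrable_def)
  have hint: "integrable lborel (\<lambda>x. indicator (cbox l u) x * h x)" for l u
    using h by (auto simp: locally_integrable_def set_integrable_def)
  have hbint: "integrable lborel (\<lambda>x. indicator (box l u) x * h x)" for l u
  proof -
    have *: "indicator (box l u) x *\<^sub>R (indicator (cbox l u) x * h x) = indicator (box l u) x * h x" for x
      using box_subset_cbox[of l u] by (auto simp: indicator_def)
    have "integrable lborel (\<lambda>x. indicator (box l u) x *\<^sub>R (indicator (cbox l u) x * h x))"
      by (rule integrable_mult_indicator[OF _ hint]) simp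
    then show ?thesis by (simp only: *)
  qed
  have box0: "(LINT x|lborel. indicator (box l u) x * h x) = 0" for l u
  proof -
    have "(\<lambda>n. LINT x|lborel. h x * box_bump l u n x) \<longlonglongrightarrow> (LINT x|lborel. indicator (box l u) x * h x)"
    proof (rule integral_dominated_convergence[where w="\<lambda>x. norm (indicator (cbox l u) x * h x)"])
      show "integrable lborel (\<lambda>x. norm (indicator (cbox l u) x * h x))"
        using hint by (rule integrable_norm)
      show "(\<lambda>x. h x * box_bump l u n x) \<in> borel_measurable lborel" for n
        using smooth_continuous[OF test_smooth[OF box_bump_test[of l u n]], of UNIV]
        by (intro borel_measurable_times) (auto intro: borel_measurable_continuous_onI)
      show "AE x in lborel. (\<lambda>n. h x * box_bump l u n x) \<longlonglongrightarrow> indicator (box l u) x * h x"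
        by (rule AE_I2, subst mult.commute[of _ "h x" for x], intro tendsto_mult tendsto_const box_bump_limit)
      show "AE x in lborel. norm (h x * box_bump l u n x) \<le> norm (indicator (cbox l u) x * h x)" for n
      proof (rule AE_I2)
        fix x
        show "norm (h x * box_bump l u n x) \<le> norm (indicator (cbox l u) x * h x)"
        proof (cases "x \<in> box l u")
          case True
          then have "x \<in> cbox l u" using box_subset_cbox by blast
          moreover have "\<bar>h x\<bar> * \<bar>box_bump l u n x\<bar> \<le> \<bar>h x\<bar> * 1"
            using box_bump_bounds[of l u n x] by (intro mult_left_mono) auto
          ultimately show ?thesis by (simp add: abs_mult)
        qed (simp add: box_bump_outside)
      qed
    qed measurable
    then show ?thesis by (simp add: 0[OF box_bump_test] LIMSEQ_const_iff)
  qed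
  have "AE x in lborel. indicator (box (- (real n *\<^sub>R One)) (real n *\<^sub>R One)) x * h x = 0" for n
  proof (rule sigma_finite_measure.density_zero[OF sigma_finite_lborel hbint])
    define g where "g x = indicator (box (- (real n *\<^sub>R One)) (real n *\<^sub>R One)) x * h x" for x
    have g: "integrable lborel g" unfolding g_def by (rule hbint)
    have gA: "set_integrable lborel A g" if "A \<in> sets borel" for A
      using g that unfolding set_integrable_def by (intro integrable_mult_indicator) auto
    let ?G = "range (\<lambda>(a, b). box a b::'a set)"
    fix A :: "'a set" assume "A \<in> sets lborel"
    then have A: "A \<in> sigma_sets UNIV ?G" by (simp add: borel_eq_box)
    have S: "X \<in> sets borel" if "X \<in> sigma_sets UNIV ?G" for X
      using that by (simp add: borel_eq_box)
    have "Int_stable ?G" by (auto simp: Int_stable_def box_Int_box)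
    then have "set_lebesgue_integral lborel A g = 0"
    proof (rule sigma_sets_induct_disjoint[OF _ _ A])
      fix X assume "X \<in> ?G"
      then obtain a b where X: "X = box a b" by auto
      obtain c d where cd: "box a b \<inter> box (- (real n *\<^sub>R One)) (real n *\<^sub>R One) = box c d"
        by (rule that[OF box_Int_box])
      have "indicator X x *\<^sub>R g x = indicator (box c d) x * h x" for x
        unfolding X g_def cd[symmetric] indicator_inter_arith by simp
      then show "set_lebesgue_integral lborel X g = 0"
        unfolding set_lebesgue_integral_def by (simp add: box0)
    next
      fix X assume X: "X \<in> sigma_sets UNIV ?G" "set_lebesgue_integral lborel X g = 0"
      have "set_lebesgue_integral lborel (X \<union> (UNIV - X)) g
        = set_lebesgue_integral lborel X g + set_lebesgue_integral lborel (UNIV - X) g"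
        using S[OF X(1)] by (intro set_integral_Un gA) auto
      moreover have "set_lebesgue_integral lborel (X \<union> (UNIV - X)) g = 0"
        using box0 by (simp add: set_lebesgue_integral_def g_def)
      ultimately show "set_lebesgue_integral lborel (UNIV - X) g = 0" using X(2) by simp
    next
      fix X :: "nat \<Rightarrow> 'a set"
      assume X: "disjoint_family X" "range X \<subseteq> sigma_sets UNIV ?G" "\<And>i. set_lebesgue_integral lborel (X i) g = 0"
      have "\<And>i. X i \<in> sets borel" using X(2) S by blast
      then have "set_lebesgue_integral lborel (\<Union>i. X i) g = (\<Sum>i. set_lebesgue_integral lborel (X i) g)"
        using X(1) by (intro lebesgue_integral_countable_add gA) (auto simp: disjoint_family_on_def)
      then show "set_lebesgue_integral lborel (\<Union>i. X i) g = 0" using X(3) by simp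
    qed (auto simp: set_lebesgue_integral_def)
    then show "set_lebesgue_integral lborel A (\<lambda>x. indicator (box (- (real n *\<^sub>R One)) (real n *\<^sub>R One)) x * h x) = 0"
      unfolding g_def .
  qed
  then have "AE x in lborel. \<forall>n::nat. indicator (box (- (real n *\<^sub>R One)) (real n *\<^sub>R One)) x * h x = 0"
    unfolding AE_all_countable by blast
  then show ?thesis
  proof eventually_elim
    case (elim x)
    obtain n :: nat where "x \<in> box (- (real n *\<^sub>R One)) (real n *\<^sub>R One)"
      using UN_box_eq_UNIV[where 'a='a] UNIV_I[of x] by blast
    then have "indicat_real (box (- (real n *\<^sub>R One)) (real n *\<^sub>R One)) x = 1" by simp
    then show ?case using elim[rule_format, of n] by simp
  qed
qed

section \<open>Weak gradients\<close>

lemma locally_integrable_integrable: "integrable lborel f \<Longrightarrow> locally_integrable f"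
  unfolding locally_integrable_def set_integrable_def
  by (auto intro!: integrable_mult_indicator simp: compact_imp_closed)

lemma locally_integrable_inner: "locally_integrable g \<Longrightarrow> locally_integrable (\<lambda>x. g x \<bullet> b)"
  unfolding locally_integrable_def set_integrable_def
  using integrable_inner_left[of b lborel "\<lambda>x. indicator K x *\<^sub>R g x" for K] by auto

lemma locally_integrable_diff:
  "locally_integrable f \<Longrightarrow> locally_integrable g \<Longrightarrow> locally_integrable (\<lambda>x. f x - g x)"
  unfolding locally_integrable_def by (auto intro: set_integral_diff)

lemma test_continuous: "\<phi> \<in> test_functions \<Longrightarrow> continuous_on A \<phi>"
  by (simp add: test_smooth smooth_continuous)

lemma test_measurable: "\<phi> \<in> test_functions \<Longrightarrow> \<phi> \<in> borel_measurable borel"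
  by (simp add: test_continuous borel_measurable_continuous_onI)

lemma gradient_measurable: "\<phi> \<in> test_functions \<Longrightarrow> gradient \<phi> \<in> borel_measurable borel"
  by (simp add: test_smooth continuous_gradient borel_measurable_continuous_onI)

lemma test_integrable: "\<phi> \<in> test_functions \<Longrightarrow> integrable lborel \<phi>"
  by (rule test_support[of \<phi>]) (auto intro: integrable_compact_support test_continuous)

lemma test_gradient_integrable: "\<phi> \<in> test_functions \<Longrightarrow> integrable lborel (gradient \<phi>)"
  by (rule test_support[of \<phi>])
     (auto intro!: integrable_compact_support gradient_support continuous_gradient test_smooth)

lemma loc_times_test_integrable:
  "locally_integrable u \<Longrightarrow> \<phi> \<in> test_functions \<Longrightarrow> integrable lborel (\<lambda>x. u x * \<phi> x)"
  by (rule test_support[of \<phi>]) (auto intro: integrable_loc_times_test test_continuous)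

lemma loc_times_gradient_integrable:
  assumes "locally_integrable u" "\<phi> \<in> test_functions" "b \<in> Basis"
  shows "integrable lborel (\<lambda>x. u x * frechet_derivative \<phi> (at x) b)"
  by (rule loc_times_test_integrable[OF assms(1) test_deriv[OF assms(2,3)]])

text \<open>
  Integration by parts: the derivative of the product of two test functions has integral zero.
\<close>

lemma weak_gradient_test:
  fixes \<phi> :: "'a::euclidean_space \<Rightarrow> real"
  assumes "\<phi> \<in> test_functions"
  shows "has_weak_gradient \<phi> (gradient \<phi>)"
  unfolding has_weak_gradient_def
proof (intro conjI ballI)
  show "locally_integrable \<phi>" "locally_integrable (gradient \<phi>)"
    using assms by (auto intro: locally_integrable_integrable test_integrable test_gradient_integrable)
  fix \<psi> :: "'a \<Rightarrow> real" and b :: 'a assume \<psi>: "\<psi> \<in> test_functions" and b: "b \<in> Basis"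
  obtain R where R: "\<And>x. R < norm x \<Longrightarrow> \<phi> x = 0" using test_support[OF assms] by blast
  have "(LINT x|lborel. (\<phi> x *\<^sub>R gradient \<psi> x + \<psi> x *\<^sub>R gradient \<phi> x) \<bullet> b) = 0"
  proof (rule integral_derivative_eq_0[where f = "\<lambda>x. \<phi> x * \<psi> x"])
    show "((\<lambda>x. \<phi> x * \<psi> x) has_derivative (\<lambda>h. (\<phi> x *\<^sub>R gradient \<psi> x + \<psi> x *\<^sub>R gradient \<phi> x) \<bullet> h)) (at x)" for x
      using has_derivative_mult[OF smooth_gradient smooth_gradient, of \<phi> \<psi> x] assms \<psi>
      by (simp add: test_smooth inner_add_left mult.commute)
    show "continuous_on UNIV (\<lambda>x. \<phi> x *\<^sub>R gradient \<psi> x + \<psi> x *\<^sub>R gradient \<phi> x)"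
      using assms \<psi> by (intro continuous_intros continuous_gradient test_continuous test_smooth)
    show "R < norm x \<Longrightarrow> \<phi> x * \<psi> x = 0" for x using R by simp
  qed
  then have "(LINT x|lborel. \<phi> x * frechet_derivative \<psi> (at x) b + (gradient \<phi> x \<bullet> b) * \<psi> x) = 0"
    using b by (simp add: inner_add_left gradient_inner_basis mult.commute)
  moreover have "integrable lborel (\<lambda>x. \<phi> x * frechet_derivative \<psi> (at x) b)"
    using \<open>locally_integrable \<phi>\<close> \<psi> b by (rule loc_times_gradient_integrable)
  moreover have "integrable lborel (\<lambda>x. (gradient \<phi> x \<bullet> b) * \<psi> x)"
    using \<open>locally_integrable (gradient \<phi>)\<close> \<psi> by (intro loc_times_test_integrable locally_integrable_inner)
  ultimately show "(LINT x|lborel. \<phi> x * frechet_derivative \<psi> (at x) b) = - (LINT x|lborel. gradient \<phi> x \<bullet> b * \<psi> x)"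
    by simp
qed

lemma has_weak_gradient_diff:
  fixes u v :: "'a::euclidean_space \<Rightarrow> real"
  assumes "has_weak_gradient u g" "has_weak_gradient v h"
  shows "has_weak_gradient (\<lambda>x. u x - v x) (\<lambda>x. g x - h x)"
  unfolding has_weak_gradient_def
proof (intro conjI ballI)
  have l: "locally_integrable u" "locally_integrable v" "locally_integrable g" "locally_integrable h"
    using assms by (auto simp: has_weak_gradient_def)
  then show "locally_integrable (\<lambda>x. u x - v x)" "locally_integrable (\<lambda>x. g x - h x)"
    by (auto intro: locally_integrable_diff)
  fix \<psi> :: "'a \<Rightarrow> real" and b :: 'a assume \<psi>: "\<psi> \<in> test_functions" and b: "b \<in> Basis"
  note i = loc_times_gradient_integrable[OF l(1) \<psi> b] loc_times_gradient_integrable[OF l(2) \<psi> b]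
    loc_times_test_integrable[OF locally_integrable_inner[OF l(3), of b] \<psi>]
    loc_times_test_integrable[OF locally_integrable_inner[OF l(4), of b] \<psi>]
  have "(LINT x|lborel. u x * frechet_derivative \<psi> (at x) b) = - (LINT x|lborel. (g x \<bullet> b) * \<psi> x)"
       "(LINT x|lborel. v x * frechet_derivative \<psi> (at x) b) = - (LINT x|lborel. (h x \<bullet> b) * \<psi> x)"
    using assms \<psi> b by (auto simp: has_weak_gradient_def)
  then show "(LINT x|lborel. (u x - v x) * frechet_derivative \<psi> (at x) b) = - (LINT x|lborel. ((g x - h x) \<bullet> b) * \<psi> x)"
    using i by (simp add: left_diff_distrib inner_diff_left)
qed

lemma has_weak_gradient_unique:
  fixes u :: "'a::euclidean_space \<Rightarrow> real"
  assumes "has_weak_gradient u g" "has_weak_gradient u h"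
  shows "AE x in lborel. g x = h x"
proof -
  have l: "locally_integrable g" "locally_integrable h"
    using assms by (auto simp: has_weak_gradient_def)
  have "AE x in lborel. (g x - h x) \<bullet> b = 0" if b: "b \<in> Basis" for b
  proof (rule fundamental_lemma)
    show "locally_integrable (\<lambda>x. (g x - h x) \<bullet> b)"
      using l by (intro locally_integrable_inner locally_integrable_diff)
    fix \<phi> :: "'a \<Rightarrow> real" assume \<phi>: "\<phi> \<in> test_functions"
    have "(LINT x|lborel. (u x - u x) * frechet_derivative \<phi> (at x) b) = - (LINT x|lborel. ((g x - h x) \<bullet> b) * \<phi> x)"
      using has_weak_gradient_diff[OF assms] \<phi> b unfolding has_weak_gradient_def by blast
    then show "(LINT x|lborel. ((g x - h x) \<bullet> b) * \<phi> x) = 0" by simp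
  qed
  then have "AE x in lborel. \<forall>b\<in>Basis. (g x - h x) \<bullet> b = 0"
    by (intro AE_finite_allI) auto
  then show ?thesis
    by eventually_elim (simp only: euclidean_all_zero_iff right_minus_eq)
qed

text \<open>
  The chosen weak gradient agrees almost everywhere with any other one.
\<close>

lemma dirichlet_energy_eq:
  fixes u :: "'a::euclidean_space \<Rightarrow> real"
  assumes "has_weak_gradient u g"
  shows "dirichlet_energy u = (LINT x|lborel. (norm (g x))\<^sup>2)"
proof -
  have w: "has_weak_gradient u (weak_gradient u)"
    unfolding weak_gradient_def by (rule someI[of "has_weak_gradient u"], rule assms)
  have [measurable]: "g \<in> borel_measurable borel" "weak_gradient u \<in> borel_measurable borel"
    using assms w by (auto simp: has_weak_gradient_def locally_integrable_def)
  have "AE x in lborel. weak_gradient u x = g x"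
    by (rule has_weak_gradient_unique[OF w assms])
  then show ?thesis
    unfolding dirichlet_energy_def by (intro integral_cong_AE) auto
qed

lemma locally_integrable_rescale:
  fixes u :: "'a::euclidean_space \<Rightarrow> 'b::euclidean_space"
  assumes "locally_integrable u" "c \<noteq> 0"
  shows "locally_integrable (\<lambda>x. u (c *\<^sub>R x))"
  unfolding locally_integrable_def
proof (intro conjI allI impI)
  have [measurable]: "u \<in> borel_measurable borel" using assms by (simp add: locally_integrable_def)
  show "(\<lambda>x. u (c *\<^sub>R x)) \<in> borel_measurable lborel" by measurable
  fix K :: "'a set" assume K: "compact K"
  have "integrable lborel (\<lambda>x. indicator ((\<lambda>x. c *\<^sub>R x) ` K) x *\<^sub>R u x)"
    using assms(1) compact_scaling[OF K, of c] unfolding locally_integrable_def set_integrable_def by blast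
  from integrable_rescale[OF this assms(2)]
  have "integrable lborel (\<lambda>x. indicator ((\<lambda>x. c *\<^sub>R x) ` K) (c *\<^sub>R x) *\<^sub>R u (c *\<^sub>R x))" .
  moreover have "indicator ((\<lambda>x. c *\<^sub>R x) ` K) (c *\<^sub>R x) = (indicator K x :: real)" for x
    using assms(2) by (auto simp: indicator_def)
  ultimately show "set_integrable lborel K (\<lambda>x. u (c *\<^sub>R x))"
    unfolding set_integrable_def by simp
qed

lemma has_weak_gradient_rescale:
  fixes u :: "'a::euclidean_space \<Rightarrow> real"
  assumes u: "has_weak_gradient u g" and c: "c > 0"
  shows "has_weak_gradient (\<lambda>x. u (c *\<^sub>R x)) (\<lambda>x. c *\<^sub>R g (c *\<^sub>R x))"
  unfolding has_weak_gradient_def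
proof (intro conjI ballI)
  have l: "locally_integrable u" "locally_integrable g"
    using u by (auto simp: has_weak_gradient_def)
  have [measurable]: "u \<in> borel_measurable borel" "g \<in> borel_measurable borel"
    using l by (auto simp: locally_integrable_def)
  show "locally_integrable (\<lambda>x. u (c *\<^sub>R x))"
    using l(1) c by (intro locally_integrable_rescale) auto
  have "locally_integrable (\<lambda>x. g (c *\<^sub>R x))"
    using l(2) c by (intro locally_integrable_rescale) auto
  then show "locally_integrable (\<lambda>x. c *\<^sub>R g (c *\<^sub>R x))"
    unfolding locally_integrable_def by (auto intro: set_integrable_scaleR_right)
  fix \<phi> :: "'a \<Rightarrow> real" and b :: 'a assume \<phi>: "\<phi> \<in> test_functions" and b: "b \<in> Basis"
  define \<psi> where "\<psi> y = \<phi> ((1 / c) *\<^sub>R y)" for y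
  have \<psi>: "\<psi> \<in> test_functions"
    unfolding \<psi>_def using test_rescale[OF \<phi>, of "1 / c" 0] c by simp
  have d: "(\<psi> has_derivative (\<lambda>h. ((1 / c) *\<^sub>R gradient \<phi> ((1 / c) *\<^sub>R y)) \<bullet> h)) (at y)" for y
  proof -
    have "((\<lambda>y. (1 / c) *\<^sub>R y) has_derivative (\<lambda>h. (1 / c) *\<^sub>R h)) (at y)"
      by (auto intro!: derivative_eq_intros)
    from has_derivative_compose[OF this smooth_gradient[OF test_smooth[OF \<phi>]]]
    show ?thesis unfolding \<psi>_def by simp
  qed
  have d': "frechet_derivative \<psi> (at y) b = (1 / c) * frechet_derivative \<phi> (at ((1 / c) *\<^sub>R y)) b" for y
    using b by (simp add: frechet_derivative_eq[OF d] gradient_inner_basis)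
  have [measurable]: "\<psi> \<in> borel_measurable borel" "(\<lambda>y. frechet_derivative \<psi> (at y) b) \<in> borel_measurable borel"
    using test_measurable[OF \<psi>] test_measurable[OF test_deriv[OF \<psi> b]] by auto
  have "(LINT x|lborel. u (c *\<^sub>R x) * frechet_derivative \<phi> (at x) b)
    = (LINT x|lborel. c * (u (c *\<^sub>R x) * frechet_derivative \<psi> (at (c *\<^sub>R x)) b))"
    using c by (simp add: d')
  also have "\<dots> = c * ((LINT x|lborel. u x * frechet_derivative \<psi> (at x) b) / c ^ DIM('a))"
    using integral_rescale[of "\<lambda>x. u x * frechet_derivative \<psi> (at x) b" c] c by simp
  also have "\<dots> = - (c * ((LINT x|lborel. (g x \<bullet> b) * \<psi> x) / c ^ DIM('a)))"
    using u \<psi> b by (simp add: has_weak_gradient_def)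
  also have "\<dots> = - (LINT x|lborel. c * ((g (c *\<^sub>R x) \<bullet> b) * \<psi> (c *\<^sub>R x)))"
    using integral_rescale[of "\<lambda>x. (g x \<bullet> b) * \<psi> x" c] c by simp
  also have "\<dots> = - (LINT x|lborel. ((c *\<^sub>R g (c *\<^sub>R x)) \<bullet> b) * \<phi> x)"
    using c by (simp add: \<psi>_def mult.assoc)
  finally show "(LINT x|lborel. u (c *\<^sub>R x) * frechet_derivative \<phi> (at x) b)
    = - (LINT x|lborel. ((c *\<^sub>R g (c *\<^sub>R x)) \<bullet> b) * \<phi> x)" .
qed

section \<open>Square integrable functions\<close>

lemma integral_fatou:
  fixes f :: "nat \<Rightarrow> 'a \<Rightarrow> real"
  assumes int: "\<And>n. integrable M (f n)" and nonneg: "\<And>n x. 0 \<le> f n x"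
    and le: "\<And>n. (LINT x|M. f n x) \<le> c n" and c: "c \<longlonglongrightarrow> C"
    and lim: "AE x in M. (\<lambda>n. f n x) \<longlonglongrightarrow> g x" and g[measurable]: "g \<in> borel_measurable M"
  shows "integrable M g" and "(LINT x|M. g x) \<le> C"
proof -
  have [measurable]: "f n \<in> borel_measurable M" for n using int by auto
  have g0: "AE x in M. 0 \<le> g x"
    using lim by eventually_elim (auto intro: LIMSEQ_le_const nonneg)
  have "0 \<le> c n" for n by (rule order_trans[OF _ le[of n]]) (simp add: nonneg)
  then have C0: "0 \<le> C" by (intro LIMSEQ_le_const[OF c]) auto
  have "(\<integral>\<^sup>+x. ennreal (g x) \<partial>M) = (\<integral>\<^sup>+x. liminf (\<lambda>n. ennreal (f n x)) \<partial>M)"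
    using lim by (intro nn_integral_cong_AE, eventually_elim)
      (auto intro!: lim_imp_Liminf[symmetric] tendsto_ennrealI)
  also have "\<dots> \<le> liminf (\<lambda>n. \<integral>\<^sup>+x. ennreal (f n x) \<partial>M)"
    by (rule nn_integral_liminf) measurable
  also have "\<dots> \<le> liminf (\<lambda>n. ennreal (c n))"
    using int le nonneg by (intro Liminf_mono always_eventually allI) (simp add: nn_integral_eq_integral ennreal_leI)
  also have "\<dots> = ennreal C"
    using c by (intro lim_imp_Liminf tendsto_ennrealI) auto
  finally have *: "(\<integral>\<^sup>+x. ennreal (g x) \<partial>M) \<le> ennreal C" .
  then have "(\<integral>\<^sup>+x. ennreal (g x) \<partial>M) < \<infinity>"
    by (rule le_less_trans) simp
  then show i: "integrable M g"
    using g0 by (intro integrableI_nonneg) auto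
  show "(LINT x|M. g x) \<le> C"
    using * nn_integral_eq_integral[OF i g0] C0 by simp
qed

lemma integrable_product:
  fixes f g :: "'a \<Rightarrow> real"
  assumes [measurable]: "f \<in> borel_measurable M" "g \<in> borel_measurable M"
    and "integrable M (\<lambda>x. (f x)\<^sup>2)" "integrable M (\<lambda>x. (g x)\<^sup>2)"
  shows "integrable M (\<lambda>x. f x * g x)"
proof (rule Bochner_Integration.integrable_bound[OF Bochner_Integration.integrable_add[OF assms(3,4)]])
  show "AE x in M. norm (f x * g x) \<le> norm ((f x)\<^sup>2 + (g x)\<^sup>2)"
  proof (rule AE_I2)
    fix x
    have "0 \<le> (\<bar>f x\<bar> - \<bar>g x\<bar>)\<^sup>2" by simp
    then have "2 * (\<bar>f x\<bar> * \<bar>g x\<bar>) \<le> (f x)\<^sup>2 + (g x)\<^sup>2" by (simp add: power2_diff)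
    moreover have "0 \<le> \<bar>f x\<bar> * \<bar>g x\<bar>" by simp
    moreover have "norm (f x * g x) = \<bar>f x\<bar> * \<bar>g x\<bar>" by (simp add: abs_mult)
    moreover have "norm ((f x)\<^sup>2 + (g x)\<^sup>2) = (f x)\<^sup>2 + (g x)\<^sup>2" by simp
    ultimately show "norm (f x * g x) \<le> norm ((f x)\<^sup>2 + (g x)\<^sup>2)" by linarith
  qed
qed measurable

lemma cauchy_schwarz_integral:
  fixes f g :: "'a \<Rightarrow> real"
  assumes fm: "f \<in> borel_measurable M" and gm: "g \<in> borel_measurable M"
    and f: "integrable M (\<lambda>x. (f x)\<^sup>2)" and g: "integrable M (\<lambda>x. (g x)\<^sup>2)"
  shows "\<bar>LINT x|M. f x * g x\<bar> \<le> sqrt (LINT x|M. (f x)\<^sup>2) * sqrt (LINT x|M. (g x)\<^sup>2)"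
proof -
  note fg = integrable_product[OF fm gm f g]
  define a b c where "a = (LINT x|M. (f x)\<^sup>2)" and "b = (LINT x|M. f x * g x)" and "c = (LINT x|M. (g x)\<^sup>2)"
  have ac: "0 \<le> a" "0 \<le> c" by (auto simp: a_def c_def)
  have q: "0 \<le> s\<^sup>2 * a - 2 * s * t * b + t\<^sup>2 * c" for s t
  proof -
    have "0 \<le> (LINT x|M. (s * f x - t * g x)\<^sup>2)" by simp
    also have "\<dots> = (LINT x|M. s\<^sup>2 * (f x)\<^sup>2 - 2 * s * t * (f x * g x) + t\<^sup>2 * (g x)\<^sup>2)"
      by (rule Bochner_Integration.integral_cong) (auto simp: power2_eq_square algebra_simps)
    also have "\<dots> = s\<^sup>2 * a - 2 * s * t * b + t\<^sup>2 * c"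
      using f g fg by (simp add: a_def b_def c_def)
    finally show ?thesis .
  qed
  have "b\<^sup>2 \<le> a * c"
  proof (cases "c = 0")
    case False
    then have "0 < c" using ac by simp
    moreover have "0 \<le> c * (a * c - b\<^sup>2)"
      using q[of c b] by (simp add: power2_eq_square algebra_simps)
    ultimately show ?thesis by (simp add: zero_le_mult_iff)
  next
    case True
    have "0 \<le> a - 2 * t * b" for t using q[of 1 t] True by simp
    from this[of "(a + 1) / (2 * b)"] have "b = 0" by (cases "b = 0") auto
    then show ?thesis using True by simp
  qed
  then have "\<bar>b\<bar> \<le> sqrt (a * c)" by (simp add: real_le_rsqrt)
  then show ?thesis by (simp add: a_def b_def c_def real_sqrt_mult)
qed

lemma integrable_square_diff:
  fixes f g :: "'a \<Rightarrow> 'b::euclidean_space"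
  assumes [measurable]: "f \<in> borel_measurable M" "g \<in> borel_measurable M"
    and f: "integrable M (\<lambda>x. (norm (f x))\<^sup>2)" and g: "integrable M (\<lambda>x. (norm (g x))\<^sup>2)"
  shows "integrable M (\<lambda>x. (norm (f x - g x))\<^sup>2)"
    and "(LINT x|M. (norm (f x - g x))\<^sup>2) \<le> 2 * (LINT x|M. (norm (f x))\<^sup>2) + 2 * (LINT x|M. (norm (g x))\<^sup>2)"
proof -
  have le: "(norm (f x - g x))\<^sup>2 \<le> 2 * (norm (f x))\<^sup>2 + 2 * (norm (g x))\<^sup>2" for x
  proof -
    have "(norm (f x - g x))\<^sup>2 \<le> (norm (f x) + norm (g x))\<^sup>2"
      by (intro power_mono norm_triangle_ineq4) auto
    also have "\<dots> \<le> 2 * (norm (f x))\<^sup>2 + 2 * (norm (g x))\<^sup>2"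
      using sum_squares_bound[of "norm (f x)" "norm (g x)"] by (simp add: power2_sum)
    finally show ?thesis .
  qed
  have i: "integrable M (\<lambda>x. 2 * (norm (f x))\<^sup>2 + 2 * (norm (g x))\<^sup>2)" using f g by simp
  show j: "integrable M (\<lambda>x. (norm (f x - g x))\<^sup>2)"
    by (rule Bochner_Integration.integrable_bound[OF i]) (use le in auto)
  have "(LINT x|M. (norm (f x - g x))\<^sup>2) \<le> (LINT x|M. 2 * (norm (f x))\<^sup>2 + 2 * (norm (g x))\<^sup>2)"
    using j i le by (intro integral_mono) auto
  then show "(LINT x|M. (norm (f x - g x))\<^sup>2) \<le> 2 * (LINT x|M. (norm (f x))\<^sup>2) + 2 * (LINT x|M. (norm (g x))\<^sup>2)"
    using f g by simp
qed

lemma norm_square_convergence: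
  fixes f :: "nat \<Rightarrow> 'a \<Rightarrow> 'b::euclidean_space"
  assumes [measurable]: "\<And>n. f n \<in> borel_measurable M" "g \<in> borel_measurable M"
    and f: "\<And>n. integrable M (\<lambda>x. (norm (f n x))\<^sup>2)" and g: "integrable M (\<lambda>x. (norm (g x))\<^sup>2)"
    and lim: "(\<lambda>n. LINT x|M. (norm (f n x - g x))\<^sup>2) \<longlonglongrightarrow> 0"
  shows "(\<lambda>n. LINT x|M. (norm (f n x))\<^sup>2) \<longlonglongrightarrow> (LINT x|M. (norm (g x))\<^sup>2)"
proof -
  define d where "d n = (LINT x|M. (norm (f n x - g x))\<^sup>2)" for n
  define E where "E = (LINT x|M. (norm (g x))\<^sup>2)"
  have i: "integrable M (\<lambda>x. (norm (f n x - g x))\<^sup>2)" for n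
    by (rule integrable_square_diff) (use f g in auto)
  have bd: "\<bar>(LINT x|M. (norm (f n x))\<^sup>2) - E\<bar> \<le> d n + 2 * (sqrt (d n) * sqrt E)" for n
  proof -
    have fg: "integrable M (\<lambda>x. norm (f n x - g x) * norm (g x))"
      using i g by (intro integrable_product) auto
    have "\<bar>(LINT x|M. (norm (f n x))\<^sup>2) - E\<bar> = \<bar>LINT x|M. (norm (f n x))\<^sup>2 - (norm (g x))\<^sup>2\<bar>"
      using f g by (simp add: E_def)
    also have "\<dots> \<le> (LINT x|M. \<bar>(norm (f n x))\<^sup>2 - (norm (g x))\<^sup>2\<bar>)" by (rule integral_abs_bound)
    also have "\<dots> \<le> (LINT x|M. (norm (f n x - g x))\<^sup>2 + 2 * (norm (f n x - g x) * norm (g x)))"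
    proof (rule integral_mono)
      show "integrable M (\<lambda>x. \<bar>(norm (f n x))\<^sup>2 - (norm (g x))\<^sup>2\<bar>)" using f g by simp
      show "integrable M (\<lambda>x. (norm (f n x - g x))\<^sup>2 + 2 * (norm (f n x - g x) * norm (g x)))"
        using i fg by simp
      fix x
      have "(norm (f n x))\<^sup>2 = (norm (f n x - g x))\<^sup>2 + 2 * ((f n x - g x) \<bullet> g x) + (norm (g x))\<^sup>2"
        unfolding power2_norm_eq_inner by (simp add: inner_diff_left inner_diff_right inner_commute)
      moreover have "\<bar>(f n x - g x) \<bullet> g x\<bar> \<le> norm (f n x - g x) * norm (g x)" by (rule Cauchy_Schwarz_ineq2)
      ultimately show "\<bar>(norm (f n x))\<^sup>2 - (norm (g x))\<^sup>2\<bar> \<le> (norm (f n x - g x))\<^sup>2 + 2 * (norm (f n x - g x) * norm (g x))"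
        using zero_le_power2[of "norm (f n x - g x)"] unfolding abs_le_iff by linarith
    qed
    also have "\<dots> = d n + 2 * (LINT x|M. norm (f n x - g x) * norm (g x))"
      using i fg by (simp add: d_def)
    also have "(LINT x|M. norm (f n x - g x) * norm (g x)) \<le> sqrt (d n) * sqrt E"
      unfolding d_def E_def using i g
      by (intro order_trans[OF abs_ge_self cauchy_schwarz_integral]) auto
    finally show ?thesis by simp
  qed
  have "(\<lambda>n. d n + 2 * (sqrt (d n) * sqrt E)) \<longlonglongrightarrow> 0 + 2 * (sqrt 0 * sqrt E)"
    using lim by (intro tendsto_intros) (auto simp: d_def)
  then have z: "(\<lambda>n. d n + 2 * (sqrt (d n) * sqrt E)) \<longlonglongrightarrow> 0" by simp
  have "(\<lambda>n. (LINT x|M. (norm (f n x))\<^sup>2) - E) \<longlonglongrightarrow> 0"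
    by (rule Lim_null_comparison[OF _ z]) (simp only: real_norm_def bd always_eventually simp_thms)
  then show ?thesis unfolding E_def using LIM_zero_iff by blast
qed

section \<open>The Hardy inequality\<close>

definition hardy_integral :: "('a::euclidean_space \<Rightarrow> real) \<Rightarrow> 'a \<Rightarrow> real" where
  "hardy_integral u b = (LINT x|lborel. (u x)\<^sup>2 / (norm (x - b))\<^sup>2)"

definition hardy_constant :: "'a::euclidean_space itself \<Rightarrow> real" where
  "hardy_constant _ = 4 / (real DIM('a) - 2)\<^sup>2"

text \<open>
  Integrating the divergence of \<open>\<phi>\<^sup>2 (x - b) / (|x - b|\<^sup>2 + e)\<close> and letting \<open>e\<close> tend to zero gives
  the sharp constant.
\<close>

lemma hardy_regularized:
  fixes \<phi> :: "'a::euclidean_space \<Rightarrow> real"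
  assumes \<phi>: "\<phi> \<in> test_functions" and N: "DIM('a) \<ge> 3" and e: "e > 0"
  shows "integrable lborel (\<lambda>x. (\<phi> x)\<^sup>2 / ((norm (x - b))\<^sup>2 + e))"
    and "(LINT x|lborel. (\<phi> x)\<^sup>2 / ((norm (x - b))\<^sup>2 + e)) \<le> hardy_constant TYPE('a) * (LINT x|lborel. (norm (gradient \<phi> x))\<^sup>2)"
proof -
  obtain R where R: "\<And>x. R < norm x \<Longrightarrow> \<phi> x = 0" using test_support[OF \<phi>] by blast
  define \<rho> where "\<rho> x = (norm (x - b))\<^sup>2 + e" for x
  define N where "N = real DIM('a)"
  have N3: "N \<ge> 3" using \<open>DIM('a) \<ge> 3\<close> by (simp add: N_def)
  have pos: "\<rho> x > 0" for x unfolding \<rho>_def using e by (simp add: add_nonneg_pos)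
  have ne: "\<rho> x \<noteq> 0" for x using pos[of x] by simp
  have c\<rho>: "continuous_on UNIV \<rho>" unfolding \<rho>_def by (intro continuous_intros)
  have c\<phi>: "continuous_on UNIV \<phi>" and cg: "continuous_on UNIV (gradient \<phi>)"
    using \<phi> by (auto intro: test_continuous continuous_gradient test_smooth)
  have d\<rho>: "(\<rho> has_derivative (\<lambda>h. 2 * ((x - b) \<bullet> h))) (at x)" for x
    unfolding \<rho>_def power2_norm_eq_inner
    by (auto intro!: derivative_eq_intros simp: inner_commute)
  have d\<phi>: "(\<phi> has_derivative (\<lambda>h. gradient \<phi> x \<bullet> h)) (at x)" for x
    by (rule smooth_gradient[OF test_smooth[OF \<phi>]])
  define G where "G i x = (2 * \<phi> x * ((x - b) \<bullet> i) / \<rho> x) *\<^sub>R gradient \<phi> x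
     + ((\<phi> x)\<^sup>2 / \<rho> x) *\<^sub>R i - (2 * (\<phi> x)\<^sup>2 * ((x - b) \<bullet> i) / (\<rho> x)\<^sup>2) *\<^sub>R (x - b)" for i x
  have "(LINT x|lborel. G i x \<bullet> i) = 0" for i
  proof (rule integral_derivative_eq_0[where f="\<lambda>x. (\<phi> x * \<phi> x) * (((x - b) \<bullet> i) * inverse (\<rho> x))"])
    show "((\<lambda>x. (\<phi> x * \<phi> x) * (((x - b) \<bullet> i) * inverse (\<rho> x))) has_derivative (\<lambda>h. G i x \<bullet> h)) (at x)" for x
    proof -
      have di: "((\<lambda>x. (x - b) \<bullet> i) has_derivative (\<lambda>h. h \<bullet> i)) (at x)"
        by (auto intro!: derivative_eq_intros)
      note D = has_derivative_mult[OF has_derivative_mult[OF d\<phi> d\<phi>] has_derivative_mult[OF di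
        Deriv.has_derivative_inverse[OF ne d\<rho>]]]
      define w where "w = x - b"
      show ?thesis
      proof (rule has_derivative_eq_rhs[OF D], rule ext)
        fix h
        have "G i x \<bullet> h = (2 * \<phi> x * (w \<bullet> i) * inverse (\<rho> x)) * (gradient \<phi> x \<bullet> h)
          + (\<phi> x * \<phi> x * inverse (\<rho> x)) * (h \<bullet> i)
          - (2 * \<phi> x * \<phi> x * (w \<bullet> i) * inverse (\<rho> x) * inverse (\<rho> x)) * (w \<bullet> h)"
          unfolding G_def w_def[symmetric]
          by (simp add: inner_add_left inner_diff_left divide_inverse power2_eq_square inner_commute[of i h] mult.assoc)
        then show "\<phi> x * \<phi> x * ((x - b) \<bullet> i * - (inverse (\<rho> x) * (2 * ((x - b) \<bullet> h)) * inverse (\<rho> x)) + h \<bullet> i * inverse (\<rho> x)) +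
          (\<phi> x * (gradient \<phi> x \<bullet> h) + gradient \<phi> x \<bullet> h * \<phi> x) * ((x - b) \<bullet> i * inverse (\<rho> x)) = G i x \<bullet> h"
          unfolding w_def[symmetric] by (simp add: algebra_simps)
      qed
    qed
    show "continuous_on UNIV (G i)"
      unfolding G_def using ne by (intro continuous_intros c\<phi> cg c\<rho>) auto
    show "R < norm x \<Longrightarrow> \<phi> x * \<phi> x * ((x - b) \<bullet> i * inverse (\<rho> x)) = 0" for x using R by simp
  qed
  moreover have "integrable lborel (\<lambda>x. G i x \<bullet> i)" for i
  proof (rule integrable_compact_support)
    show "continuous_on UNIV (\<lambda>x. G i x \<bullet> i)"
      unfolding G_def using ne by (intro continuous_intros c\<phi> cg c\<rho>) auto
    show "R < norm x \<Longrightarrow> G i x \<bullet> i = 0" for x using R by (simp add: G_def)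
  qed
  ultimately have 1: "(LINT x|lborel. (\<Sum>i\<in>Basis. G i x \<bullet> i)) = 0" by simp
  have 2: "(\<Sum>i\<in>Basis. G i x \<bullet> i) = 2 * \<phi> x * ((x - b) \<bullet> gradient \<phi> x) / \<rho> x
     + N * ((\<phi> x)\<^sup>2 / \<rho> x) - 2 * (\<phi> x)\<^sup>2 * ((norm (x - b))\<^sup>2) / (\<rho> x)\<^sup>2" for x
  proof -
    have "(\<Sum>i\<in>Basis. G i x \<bullet> i) = (\<Sum>i\<in>Basis. (2 * \<phi> x / \<rho> x) * (((x - b) \<bullet> i) * (gradient \<phi> x \<bullet> i))
      + ((\<phi> x)\<^sup>2 / \<rho> x) - (2 * (\<phi> x)\<^sup>2 / (\<rho> x)\<^sup>2) * (((x - b) \<bullet> i) * ((x - b) \<bullet> i)))"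
      unfolding G_def by (intro sum.cong refl) (simp add: inner_diff_left inner_add_left mult.assoc)
    also have "\<dots> = (2 * \<phi> x / \<rho> x) * ((x - b) \<bullet> gradient \<phi> x)
      + N * ((\<phi> x)\<^sup>2 / \<rho> x) - (2 * (\<phi> x)\<^sup>2 / (\<rho> x)\<^sup>2) * ((x - b) \<bullet> (x - b))"
      unfolding euclidean_inner[of "x - b" "gradient \<phi> x"] euclidean_inner[of "x - b" "x - b"]
      by (simp add: sum.distrib sum_subtractf sum_distrib_left N_def)
    finally show ?thesis by (simp add: power2_norm_eq_inner)
  qed
  show i1: "integrable lborel (\<lambda>x. (\<phi> x)\<^sup>2 / ((norm (x - b))\<^sup>2 + e))"
    unfolding \<rho>_def[symmetric]
    by (rule integrable_compact_support) (use ne R in \<open>auto intro!: continuous_intros c\<phi> c\<rho>\<close>)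
  have i2: "integrable lborel (\<lambda>x. (norm (gradient \<phi> x))\<^sup>2)"
    by (rule integrable_compact_support) (use gradient_support[OF R] in \<open>auto intro!: continuous_intros cg\<close>)
  have i3: "integrable lborel (\<lambda>x. \<Sum>i\<in>Basis. G i x \<bullet> i)"
    using \<open>\<And>i. integrable lborel (\<lambda>x. G i x \<bullet> i)\<close> by simp
  define s where "s = (N - 2) / 2"
  have s: "s > 0" using N3 by (simp add: s_def)
  have ptw: "s * ((\<phi> x)\<^sup>2 / \<rho> x) - (1 / s) * (norm (gradient \<phi> x))\<^sup>2 \<le> (\<Sum>i\<in>Basis. G i x \<bullet> i)" for x
  proof -
    define w where "w = norm (x - b)"
    have w: "w\<^sup>2 \<le> \<rho> x" using e by (simp add: w_def \<rho>_def)
    have "2 * (\<phi> x)\<^sup>2 * w\<^sup>2 / (\<rho> x)\<^sup>2 = 2 * (\<phi> x)\<^sup>2 / \<rho> x * (w\<^sup>2 / \<rho> x)"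
      by (simp add: power2_eq_square)
    also have "\<dots> \<le> 2 * (\<phi> x)\<^sup>2 / \<rho> x * 1"
      using w pos[of x] by (intro mult_left_mono) (auto simp: divide_le_eq)
    finally have a: "2 * (\<phi> x)\<^sup>2 * w\<^sup>2 / (\<rho> x)\<^sup>2 \<le> 2 * ((\<phi> x)\<^sup>2 / \<rho> x)" by simp
    define p q where "p = \<bar>\<phi> x\<bar> * w / \<rho> x" and "q = norm (gradient \<phi> x)"
    have "p\<^sup>2 = (\<phi> x)\<^sup>2 / \<rho> x * (w\<^sup>2 / \<rho> x)"
      by (simp add: p_def power2_eq_square power_divide power_mult_distrib)
    also have "\<dots> \<le> (\<phi> x)\<^sup>2 / \<rho> x * 1"
      using w pos[of x] by (intro mult_left_mono) (auto simp: divide_le_eq)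
    finally have p: "p\<^sup>2 \<le> (\<phi> x)\<^sup>2 / \<rho> x" by simp
    have "\<bar>(x - b) \<bullet> gradient \<phi> x\<bar> \<le> w * q"
      unfolding w_def q_def by (rule Cauchy_Schwarz_ineq2)
    then have "2 * \<bar>\<phi> x\<bar> * \<bar>(x - b) \<bullet> gradient \<phi> x\<bar> / \<rho> x \<le> 2 * \<bar>\<phi> x\<bar> * (w * q) / \<rho> x"
      using pos[of x] by (intro divide_right_mono mult_left_mono) auto
    then have b1: "\<bar>2 * \<phi> x * ((x - b) \<bullet> gradient \<phi> x) / \<rho> x\<bar> \<le> 2 * p * q"
      using pos[of x] by (simp add: abs_mult p_def mult.assoc)
    have "0 \<le> (s * p - q)\<^sup>2 / s" using s by simp
    also have "\<dots> = s * p\<^sup>2 - 2 * p * q + (1 / s) * q\<^sup>2"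
      using s by (simp add: power2_eq_square field_simps)
    finally have "2 * p * q \<le> s * p\<^sup>2 + (1 / s) * q\<^sup>2" by simp
    also have "\<dots> \<le> s * ((\<phi> x)\<^sup>2 / \<rho> x) + (1 / s) * q\<^sup>2"
      using mult_left_mono[OF p less_imp_le[OF s]] by linarith
    finally have b2: "2 * p * q \<le> s * ((\<phi> x)\<^sup>2 / \<rho> x) + (1 / s) * q\<^sup>2" .
    have "N = 2 * s + 2" by (simp add: s_def field_simps)
    then have c: "N * ((\<phi> x)\<^sup>2 / \<rho> x) = 2 * (s * ((\<phi> x)\<^sup>2 / \<rho> x)) + 2 * ((\<phi> x)\<^sup>2 / \<rho> x)"
      by (simp only: distrib_right mult.assoc)
    have arith: "s * P - Q \<le> D + NP - Z"
      if "NP = 2 * (s * P) + 2 * P" "Z \<le> 2 * P" "\<bar>D\<bar> \<le> B" "B \<le> s * P + Q" for P Q D NP Z B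
      using that by linarith
    show ?thesis
      unfolding 2 w_def[symmetric] q_def[symmetric] by (rule arith[OF c a b1 b2])
  qed
  have "(LINT x|lborel. s * ((\<phi> x)\<^sup>2 / \<rho> x) - (1 / s) * (norm (gradient \<phi> x))\<^sup>2) \<le> (LINT x|lborel. (\<Sum>i\<in>Basis. G i x \<bullet> i))"
    using i1 i2 i3 ptw unfolding \<rho>_def[symmetric]
    by (intro integral_mono Bochner_Integration.integrable_diff integrable_mult_right)
  then have "s * (LINT x|lborel. (\<phi> x)\<^sup>2 / \<rho> x) \<le> (1 / s) * (LINT x|lborel. (norm (gradient \<phi> x))\<^sup>2)"
    using Bochner_Integration.integral_diff[OF integrable_mult_right[OF i1[folded \<rho>_def], of s] integrable_mult_right[OF i2, of "1 / s"]]
    unfolding 1 integral_mult_right_zero by linarith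
  then have "(LINT x|lborel. (\<phi> x)\<^sup>2 / \<rho> x) \<le> (1 / s\<^sup>2) * (LINT x|lborel. (norm (gradient \<phi> x))\<^sup>2)"
    using s by (simp add: field_simps power2_eq_square)
  moreover have "1 / s\<^sup>2 = hardy_constant TYPE('a)"
    by (simp add: s_def hardy_constant_def N_def power_divide)
  ultimately show "(LINT x|lborel. (\<phi> x)\<^sup>2 / ((norm (x - b))\<^sup>2 + e)) \<le> hardy_constant TYPE('a) * (LINT x|lborel. (norm (gradient \<phi> x))\<^sup>2)"
    unfolding \<rho>_def by simp
qed

lemma AE_neq_point: "AE x in lborel. x \<noteq> (b::'a::euclidean_space)"
  by (rule AE_lborel_singleton)

lemma hardy_test:
  fixes \<phi> :: "'a::euclidean_space \<Rightarrow> real"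
  assumes \<phi>: "\<phi> \<in> test_functions" and N: "DIM('a) \<ge> 3"
  shows "integrable lborel (\<lambda>x. (\<phi> x)\<^sup>2 / (norm (x - b))\<^sup>2)"
    and "hardy_integral \<phi> b \<le> hardy_constant TYPE('a) * (LINT x|lborel. (norm (gradient \<phi> x))\<^sup>2)"
proof -
  have [measurable]: "\<phi> \<in> borel_measurable borel" using \<phi> by (rule test_measurable)
  let ?f = "\<lambda>n x. (\<phi> x)\<^sup>2 / ((norm (x - b))\<^sup>2 + inverse (real (Suc n)))"
  have lim: "AE x in lborel. (\<lambda>n. ?f n x) \<longlonglongrightarrow> (\<phi> x)\<^sup>2 / (norm (x - b))\<^sup>2"
    using AE_neq_point[of b]
  proof eventually_elim
    case (elim x)
    have "(\<lambda>n. ?f n x) \<longlonglongrightarrow> (\<phi> x)\<^sup>2 / ((norm (x - b))\<^sup>2 + 0)"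
      using elim by (intro tendsto_intros LIMSEQ_inverse_real_of_nat) auto
    then show ?case by simp
  qed
  note F = integral_fatou[of lborel ?f "\<lambda>_. hardy_constant TYPE('a) * (LINT x|lborel. (norm (gradient \<phi> x))\<^sup>2)",
    OF _ _ _ tendsto_const lim]
  show "integrable lborel (\<lambda>x. (\<phi> x)\<^sup>2 / (norm (x - b))\<^sup>2)"
    by (rule F(1)) (auto intro!: hardy_regularized \<phi> N simp del: of_nat_Suc)
  show "hardy_integral \<phi> b \<le> hardy_constant TYPE('a) * (LINT x|lborel. (norm (gradient \<phi> x))\<^sup>2)"
    unfolding hardy_integral_def
    by (rule F(2)) (auto intro!: hardy_regularized \<phi> N simp del: of_nat_Suc)
qed

section \<open>Functions in the Dirichlet space as limits of test functions\<close>

lemma gradient_diff: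
  assumes "\<phi> \<in> test_functions" "\<psi> \<in> test_functions"
  shows "gradient (\<lambda>x. \<phi> x - \<psi> x) x = gradient \<phi> x - gradient \<psi> x"
proof (rule gradient_eqI)
  show "((\<lambda>x. \<phi> x - \<psi> x) has_derivative (\<lambda>h. (gradient \<phi> x - gradient \<psi> x) \<bullet> h)) (at x)"
    unfolding inner_diff_left using assms
    by (intro has_derivative_diff smooth_gradient test_smooth)
qed

lemma test_norm_gradient_integrable:
  assumes "\<phi> \<in> test_functions"
  shows "integrable lborel (\<lambda>x. (norm (gradient \<phi> x))\<^sup>2)"
proof -
  obtain R where R: "\<And>x. R < norm x \<Longrightarrow> \<phi> x = 0" using test_support[OF assms] by blast
  show ?thesis
    by (rule integrable_compact_support[where R=R])
      (auto intro!: continuous_intros continuous_gradient test_smooth assms gradient_support[OF R])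
qed

lemma test_lipschitz:
  fixes \<phi> :: "'a::euclidean_space \<Rightarrow> real"
  assumes "\<phi> \<in> test_functions"
  obtains L where "L > 0" "\<And>x y. \<bar>\<phi> x - \<phi> y\<bar> \<le> L * norm (x - y)"
proof -
  obtain R where R: "\<And>x. R < norm x \<Longrightarrow> \<phi> x = 0" using test_support[OF assms] by blast
  obtain L where L: "L > 0" "\<And>x. norm (gradient \<phi> x) \<le> L"
    using bounded_compact_support[OF continuous_gradient[OF test_smooth[OF assms]]
      gradient_support[of R \<phi>, OF R]] by blast
  then show ?thesis
    using that has_derivative_lipschitz[OF smooth_gradient[OF test_smooth[OF assms]] L(2)] by blast
qed

lemma test_taylor:
  fixes \<phi> :: "'a::euclidean_space \<Rightarrow> real"
  assumes \<phi>: "\<phi> \<in> test_functions"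
  obtains C where "C > 0" "\<And>x h. \<bar>\<phi> (x + h) - \<phi> x - gradient \<phi> x \<bullet> h\<bar> \<le> C * (norm h)\<^sup>2"
proof -
  have "\<forall>b\<in>Basis. \<exists>L>0. \<forall>x y. \<bar>frechet_derivative \<phi> (at x) b - frechet_derivative \<phi> (at y) b\<bar> \<le> L * norm (x - y)"
    using test_lipschitz[OF test_deriv[OF \<phi>]] by metis
  then obtain L where L: "\<And>b. b \<in> Basis \<Longrightarrow> L b > 0"
    "\<And>b x y. b \<in> Basis \<Longrightarrow> \<bar>frechet_derivative \<phi> (at x) b - frechet_derivative \<phi> (at y) b\<bar> \<le> L b * norm (x - y)"
    by metis
  define C where "C = (\<Sum>b\<in>(Basis::'a set). L b)"
  have C: "C > 0" unfolding C_def using L(1) by (intro sum_pos) auto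
  have lip: "norm (gradient \<phi> x - gradient \<phi> y) \<le> C * norm (x - y)" for x y
  proof -
    have "norm (gradient \<phi> x - gradient \<phi> y) \<le> (\<Sum>b\<in>Basis. \<bar>(gradient \<phi> x - gradient \<phi> y) \<bullet> b\<bar>)"
      by (rule norm_le_l1)
    also have "\<dots> \<le> (\<Sum>b\<in>Basis. L b * norm (x - y))"
      using L(2) by (intro sum_mono) (simp add: inner_diff_left gradient_inner_basis)
    finally show ?thesis by (simp add: C_def sum_distrib_right)
  qed
  have "\<bar>\<phi> (x + h) - \<phi> x - gradient \<phi> x \<bullet> h\<bar> \<le> C * (norm h)\<^sup>2" for x h
  proof -
    define f where "f y = \<phi> y - gradient \<phi> x \<bullet> y" for y
    have d: "(f has_derivative (\<lambda>k. (gradient \<phi> y - gradient \<phi> x) \<bullet> k)) (at y)" for y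
      unfolding f_def inner_diff_left
      by (intro has_derivative_diff smooth_gradient test_smooth \<phi> bounded_linear.has_derivative[OF bounded_linear_inner_right] has_derivative_ident)
    have "norm (f (x + h) - f x) \<le> (C * norm h) * norm (x + h - x)"
    proof (rule differentiable_bound[of "cball x (norm h)"])
      fix y assume y: "y \<in> cball x (norm h)"
      show "(f has_derivative (\<lambda>k. (gradient \<phi> y - gradient \<phi> x) \<bullet> k)) (at y within cball x (norm h))"
        using d by (rule has_derivative_at_withinI)
      show "onorm (\<lambda>k. (gradient \<phi> y - gradient \<phi> x) \<bullet> k) \<le> C * norm h"
      proof (rule onorm_bound)
        show "0 \<le> C * norm h" using C by simp
        fix k
        have "\<bar>(gradient \<phi> y - gradient \<phi> x) \<bullet> k\<bar> \<le> norm (gradient \<phi> y - gradient \<phi> x) * norm k"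
          by (rule Cauchy_Schwarz_ineq2)
        also have "\<dots> \<le> (C * norm (y - x)) * norm k" by (intro mult_right_mono lip) auto
        also have "\<dots> \<le> (C * norm h) * norm k"
          using y C by (intro mult_right_mono mult_left_mono) (auto simp: dist_norm norm_minus_commute)
        finally show "norm ((gradient \<phi> y - gradient \<phi> x) \<bullet> k) \<le> C * norm h * norm k" by simp
      qed
    qed (auto simp: dist_norm)
    moreover have "f (x + h) - f x = \<phi> (x + h) - \<phi> x - gradient \<phi> x \<bullet> h"
      by (simp add: f_def inner_add_right)
    ultimately show ?thesis by (simp add: power2_eq_square mult.assoc)
  qed
  then show ?thesis using that C by blast
qed

lemma D12_sequence:
  fixes u :: "'a::euclidean_space \<Rightarrow> real"
  assumes "u \<in> D12"
  obtains g \<phi> where "has_weak_gradient u g" "integrable lborel (\<lambda>x. (norm (g x))\<^sup>2)"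
    "\<And>n. \<phi> n \<in> test_functions" "(\<lambda>n. LINT x|lborel. (norm (gradient (\<phi> n) x - g x))\<^sup>2) \<longlonglongrightarrow> 0"
proof -
  obtain g where g: "has_weak_gradient u g" "integrable lborel (\<lambda>x. (norm (g x))\<^sup>2)"
    using assms by (auto simp: D12_def D12_ambient_def)
  obtain \<phi> where \<phi>: "\<And>n. \<phi> n \<in> test_functions"
    and l: "(\<lambda>n. sqrt (dirichlet_energy (\<lambda>x. \<phi> n x - u x))) \<longlonglongrightarrow> 0"
    using assms by (auto simp: D12_def)
  have e: "dirichlet_energy (\<lambda>x. \<phi> n x - u x) = (LINT x|lborel. (norm (gradient (\<phi> n) x - g x))\<^sup>2)" for n
    by (rule dirichlet_energy_eq[OF has_weak_gradient_diff[OF weak_gradient_test[OF \<phi>] g(1)]])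
  have "(\<lambda>n. (sqrt (LINT x|lborel. (norm (gradient (\<phi> n) x - g x))\<^sup>2))\<^sup>2) \<longlonglongrightarrow> 0\<^sup>2"
    using l unfolding e by (rule tendsto_power)
  then have "(\<lambda>n. LINT x|lborel. (norm (gradient (\<phi> n) x - g x))\<^sup>2) \<longlonglongrightarrow> 0" by simp
  then show ?thesis by (rule that[OF g \<phi>])
qed

text \<open>
  A function whose weak gradient vanishes has translation-invariant pairings with test functions:
  their derivative in the translation parameter is the pairing of the weak gradient.
\<close>

lemma weak_gradient_zero_translate:
  fixes h :: "'a::euclidean_space \<Rightarrow> real"
  assumes h: "has_weak_gradient h (\<lambda>_. 0)" and \<psi>: "\<psi> \<in> test_functions" and b: "b \<in> Basis"
  shows "(LINT x|lborel. h x * \<psi> (x - s *\<^sub>R b)) = (LINT x|lborel. h x * \<psi> x)"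
proof -
  have l: "locally_integrable h" using h by (simp add: has_weak_gradient_def)
  define c where "c s = (LINT x|lborel. h x * \<psi> (x - s *\<^sub>R b))" for s
  have tr: "(\<lambda>x. \<psi> (x - s *\<^sub>R b)) \<in> test_functions" for s
    using test_rescale[OF \<psi>, of 1 "- (s *\<^sub>R b)"] by simp
  have "(c has_real_derivative 0) (at s)" for s
  proof -
    define f where "f x = \<psi> (x - s *\<^sub>R b)" for x
    have f: "f \<in> test_functions" unfolding f_def by (rule tr)
    obtain R where R: "R > 0" "\<And>x. R < norm x \<Longrightarrow> f x = 0" using test_support[OF f] by blast
    obtain C where C: "C > 0" "\<And>x h. \<bar>f (x + h) - f x - gradient f x \<bullet> h\<bar> \<le> C * (norm h)\<^sup>2"
      using test_taylor[OF f] by blast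
    have hi: "integrable lborel (\<lambda>x. indicator (cball 0 (R + 1)) x * h x)"
      using l unfolding locally_integrable_def set_integrable_def by simp
    define K where "K = C * (LINT x|lborel. \<bar>indicator (cball 0 (R + 1)) x * h x\<bar>)"
    have bound: "\<bar>c (s + \<delta>) - c s\<bar> \<le> K * \<delta>\<^sup>2" if \<delta>: "\<bar>\<delta>\<bar> \<le> 1" for \<delta>
    proof -
      have sh: "f (x + (- \<delta>) *\<^sub>R b) = \<psi> (x - (s + \<delta>) *\<^sub>R b)" for x
        unfolding f_def by (rule arg_cong[of _ _ \<psi>]) (simp add: algebra_simps)
      define T where "T x = f (x + (- \<delta>) *\<^sub>R b) - f x - gradient f x \<bullet> ((- \<delta>) *\<^sub>R b)" for x
      have i1: "integrable lborel (\<lambda>x. h x * f (x + (- \<delta>) *\<^sub>R b))"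
        unfolding sh by (rule loc_times_test_integrable[OF l tr])
      have i2: "integrable lborel (\<lambda>x. h x * f x)" by (rule loc_times_test_integrable[OF l f])
      have i3: "integrable lborel (\<lambda>x. h x * frechet_derivative f (at x) b)"
        by (rule loc_times_gradient_integrable[OF l f b])
      have z: "(LINT x|lborel. h x * frechet_derivative f (at x) b) = 0"
        using h f b unfolding has_weak_gradient_def by simp
      have T: "h x * T x = h x * f (x + (- \<delta>) *\<^sub>R b) - h x * f x + \<delta> * (h x * frechet_derivative f (at x) b)" for x
        using b by (simp add: T_def gradient_inner_basis right_diff_distrib distrib_left)
      have "c (s + \<delta>) - c s = (LINT x|lborel. h x * T x)"
        unfolding T c_def sh[symmetric] f_def[symmetric] using i1 i2 i3 z by simp
      also have "\<bar>\<dots>\<bar> \<le> (LINT x|lborel. \<bar>h x * T x\<bar>)" by (rule integral_abs_bound)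
      also have "\<dots> \<le> (LINT x|lborel. C * \<delta>\<^sup>2 * \<bar>indicator (cball 0 (R + 1)) x * h x\<bar>)"
      proof (rule integral_mono)
        show "integrable lborel (\<lambda>x. \<bar>h x * T x\<bar>)" unfolding T using i1 i2 i3 by simp
        show "integrable lborel (\<lambda>x. C * \<delta>\<^sup>2 * \<bar>indicator (cball 0 (R + 1)) x * h x\<bar>)" using hi by simp
        fix x
        show "\<bar>h x * T x\<bar> \<le> C * \<delta>\<^sup>2 * \<bar>indicator (cball 0 (R + 1)) x * h x\<bar>"
        proof (cases "norm x \<le> R + 1")
          case True
          have "\<bar>T x\<bar> \<le> C * \<delta>\<^sup>2"
            unfolding T_def using C(2)[of x "(- \<delta>) *\<^sub>R b"] b by (simp add: power_mult_distrib)
          then have "\<bar>h x\<bar> * \<bar>T x\<bar> \<le> \<bar>h x\<bar> * (C * \<delta>\<^sup>2)" by (intro mult_left_mono) auto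
          then show ?thesis using True by (simp add: abs_mult mult.commute)
        next
          case False
          have "norm x \<le> norm (x + (- \<delta>) *\<^sub>R b) + norm ((- \<delta>) *\<^sub>R b)"
            by (metis add_diff_cancel norm_triangle_ineq4)
          moreover have "norm ((- \<delta>) *\<^sub>R b) \<le> 1" using \<delta> b by simp
          ultimately have "R < norm (x + (- \<delta>) *\<^sub>R b)" using False by linarith
          moreover have "R < norm x" using False by simp
          ultimately have "T x = 0" unfolding T_def using R(2) gradient_support[of R f, OF R(2)] by simp
          then show ?thesis using C(1) by simp
        qed
      qed
      also have "\<dots> = K * \<delta>\<^sup>2" by (simp add: K_def)
      finally show ?thesis .
    qed
    have "((\<lambda>\<delta>. (c (s + \<delta>) - c s) / \<delta>) \<longlongrightarrow> 0) (at 0)"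
    proof (rule Lim_null_comparison)
      have "((\<lambda>\<delta>. K * \<bar>\<delta>\<bar>) \<longlongrightarrow> K * \<bar>0\<bar>) (at 0)" by (intro tendsto_intros)
      then show "((\<lambda>\<delta>. K * \<bar>\<delta>\<bar>) \<longlongrightarrow> 0) (at 0)" by simp
      have "eventually (\<lambda>\<delta>::real. \<delta> \<in> {-1<..<1} - {0}) (at 0)"
        by (rule eventually_at_in_open) auto
      then show "\<forall>\<^sub>F \<delta> in at 0. norm ((c (s + \<delta>) - c s) / \<delta>) \<le> K * \<bar>\<delta>\<bar>"
      proof eventually_elim
        case (elim \<delta>)
        then have "\<bar>c (s + \<delta>) - c s\<bar> \<le> K * \<delta>\<^sup>2" by (intro bound) auto
        also have "\<dots> = K * \<bar>\<delta>\<bar> * \<bar>\<delta>\<bar>" by (simp add: power2_eq_square)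
        finally show ?case using elim by (simp add: abs_divide pos_divide_le_eq)
      qed
    qed
    then show ?thesis by (simp add: DERIV_def)
  qed
  then have "c s = c 0" using DERIV_isconst_all[of c s 0] by blast
  then show ?thesis by (simp add: c_def)
qed

text \<open>
  The mass of \<open>|u|\<^sup>p\<close> far from the origin tends to zero. Where \<open>|u| \<le> \<tau>\<close> the pairing is at most \<open>\<tau>\<close> times a
  constant; where \<open>|u| > \<tau>\<close> it is controlled by \<open>\<tau>\<^sup>1\<^sup>-\<^sup>p |u|\<^sup>p\<close>.
\<close>

lemma translate_vanish_Lp:
  fixes u :: "'a::euclidean_space \<Rightarrow> real"
  assumes [measurable]: "u \<in> borel_measurable borel" and u: "integrable lborel (\<lambda>x. \<bar>u x\<bar> powr p)"
    and p: "p > 1" and \<psi>: "\<psi> \<in> test_functions" and b: "b \<in> Basis"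
  shows "(\<lambda>n. LINT x|lborel. u x * \<psi> (x - real n *\<^sub>R b)) \<longlonglongrightarrow> 0"
proof -
  have [measurable]: "\<psi> \<in> borel_measurable borel" by (rule test_measurable[OF \<psi>])
  obtain R where R: "R > 0" "\<And>x. R < norm x \<Longrightarrow> \<psi> x = 0" using test_support[OF \<psi>] by blast
  obtain M where M: "M > 0" "\<And>x. norm (\<psi> x) \<le> M"
    using bounded_compact_support[OF test_continuous[OF \<psi>] R(2)] by blast
  define I where "I = (LINT x|lborel. \<bar>\<psi> x\<bar>)"
  have I0: "I \<ge> 0" by (simp add: I_def)
  define S where "S n = {x::'a. real n - R \<le> norm x}" for n :: nat
  have [measurable]: "S n \<in> sets borel" for n unfolding S_def by measurable
  define T where "T n = (LINT x|lborel. indicator (S n) x * \<bar>u x\<bar> powr p)" for n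
  have iS: "integrable lborel (\<lambda>x. indicator (S n) x * \<bar>u x\<bar> powr p)" for n
    using integrable_mult_indicator[OF _ u, of "S n"] by simp
  have "T \<longlonglongrightarrow> (LINT x|(lborel :: 'a measure). (0::real))"
    unfolding T_def
  proof (rule integral_dominated_convergence[OF _ _ u])
    show "AE x in lborel. (\<lambda>n. indicator (S n) x * \<bar>u x\<bar> powr p) \<longlonglongrightarrow> 0"
    proof (rule AE_I2)
      fix x :: 'a
      obtain n0 where "norm x + R < real n0" using reals_Archimedean2 by blast
      then have "\<forall>n\<ge>n0. x \<notin> S n" by (force simp: S_def)
      then have "eventually (\<lambda>n. indicator (S n) x * \<bar>u x\<bar> powr p = 0) sequentially"
        by (auto simp: eventually_sequentially intro!: exI[of _ n0])
      then show "(\<lambda>n. indicator (S n) x * \<bar>u x\<bar> powr p) \<longlonglongrightarrow> 0" by (rule tendsto_eventually)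
    qed
    show "AE x in lborel. norm (indicator (S n) x * \<bar>u x\<bar> powr p) \<le> \<bar>u x\<bar> powr p" for n
      by (rule AE_I2) (simp add: indicator_def)
  qed measurable
  then have T: "T \<longlonglongrightarrow> 0" by simp
  have i\<psi>: "integrable lborel (\<lambda>x. \<bar>\<psi> (x - real n *\<^sub>R b)\<bar>)" for n
    using integrable_translate[OF integrable_abs[OF test_integrable[OF \<psi>]], of "- (real n *\<^sub>R b)"] by simp
  have bound: "\<bar>LINT x|lborel. u x * \<psi> (x - real n *\<^sub>R b)\<bar> \<le> \<tau> * I + \<tau> powr (1 - p) * M * T n" if \<tau>: "\<tau> > 0" for \<tau> n
  proof -
    let ?g = "\<lambda>x. \<tau> * \<bar>\<psi> (x - real n *\<^sub>R b)\<bar> + \<tau> powr (1 - p) * M * (indicator (S n) x * \<bar>u x\<bar> powr p)"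
    have ig: "integrable lborel ?g" using i\<psi> iS by simp
    have ptw: "\<bar>u x * \<psi> (x - real n *\<^sub>R b)\<bar> \<le> ?g x" for x
    proof (cases "\<psi> (x - real n *\<^sub>R b) = 0")
      case False
      then have "norm (x - real n *\<^sub>R b) \<le> R" using R(2) not_le by blast
      moreover have "norm (real n *\<^sub>R b) \<le> norm (x - real n *\<^sub>R b) + norm x"
        by (metis add.commute norm_minus_commute norm_triangle_sub)
      ultimately have xS: "x \<in> S n" using b by (simp add: S_def)
      show ?thesis
      proof (cases "\<bar>u x\<bar> \<le> \<tau>")
        case True
        then have "\<bar>u x\<bar> * \<bar>\<psi> (x - real n *\<^sub>R b)\<bar> \<le> \<tau> * \<bar>\<psi> (x - real n *\<^sub>R b)\<bar>" by (intro mult_right_mono) auto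
        moreover have "0 \<le> \<tau> powr (1 - p) * M * (indicator (S n) x * \<bar>u x\<bar> powr p)" using M(1) by simp
        ultimately show ?thesis unfolding abs_mult by linarith
      next
        case False
        then have u0: "\<bar>u x\<bar> > 0" using \<tau> by linarith
        have "\<bar>u x\<bar> = \<bar>u x\<bar> powr (1 - p) * \<bar>u x\<bar> powr p"
          using u0 by (simp add: powr_add[symmetric])
        also have "\<dots> \<le> \<tau> powr (1 - p) * \<bar>u x\<bar> powr p"
          using False \<tau> p by (intro mult_right_mono powr_mono2') auto
        finally have "\<bar>u x\<bar> * \<bar>\<psi> (x - real n *\<^sub>R b)\<bar> \<le> (\<tau> powr (1 - p) * \<bar>u x\<bar> powr p) * M"
          using M(2)[of "x - real n *\<^sub>R b"] by (intro mult_mono) auto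
        moreover have "0 \<le> \<tau> * \<bar>\<psi> (x - real n *\<^sub>R b)\<bar>" using \<tau> by simp
        ultimately show ?thesis using xS unfolding abs_mult by (simp add: mult_ac)
      qed
    qed (use \<tau> M in auto)
    have iu: "integrable lborel (\<lambda>x. u x * \<psi> (x - real n *\<^sub>R b))"
    proof (rule Bochner_Integration.integrable_bound[OF ig])
      show "AE x in lborel. norm (u x * \<psi> (x - real n *\<^sub>R b)) \<le> norm (?g x)"
        using ptw by (intro AE_I2) (metis abs_ge_self order_trans real_norm_def)
    qed measurable
    have "\<bar>LINT x|lborel. u x * \<psi> (x - real n *\<^sub>R b)\<bar> \<le> (LINT x|lborel. \<bar>u x * \<psi> (x - real n *\<^sub>R b)\<bar>)"
      by (rule integral_abs_bound)
    also have "\<dots> \<le> (LINT x|lborel. ?g x)"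
      by (rule integral_mono[OF integrable_abs[OF iu] ig ptw])
    also have "\<dots> = \<tau> * (LINT x|lborel. \<bar>\<psi> (x - real n *\<^sub>R b)\<bar>) + \<tau> powr (1 - p) * M * T n"
      using i\<psi> iS by (simp add: T_def)
    also have "(LINT x|lborel. \<bar>\<psi> (x - real n *\<^sub>R b)\<bar>) = I"
      using integral_translate[of "\<lambda>x. \<bar>\<psi> x\<bar>" "- (real n *\<^sub>R b)"] by (simp add: I_def)
    finally show ?thesis .
  qed
  show ?thesis
  proof (rule LIMSEQ_I)
    fix \<eta> :: real assume \<eta>: "0 < \<eta>"
    define \<tau> where "\<tau> = \<eta> / (2 * (I + 1))"
    have \<tau>: "\<tau> > 0" using \<eta> I0 by (simp add: \<tau>_def)
    have t1: "\<tau> * I < \<eta> / 2" using \<eta> I0 by (simp add: \<tau>_def field_simps)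
    have "(\<lambda>n. \<tau> powr (1 - p) * M * T n) \<longlonglongrightarrow> \<tau> powr (1 - p) * M * 0"
      by (intro tendsto_intros T)
    then have "\<forall>\<^sub>F n in sequentially. \<tau> powr (1 - p) * M * T n < \<eta> / 2"
      using \<eta> by (intro order_tendstoD(2)) auto
    then obtain n0 where n0: "\<And>n. n \<ge> n0 \<Longrightarrow> \<tau> powr (1 - p) * M * T n < \<eta> / 2"
      by (auto simp: eventually_sequentially)
    show "\<exists>no. \<forall>n\<ge>no. norm ((LINT x|lborel. u x * \<psi> (x - real n *\<^sub>R b)) - 0) < \<eta>"
    proof (intro exI allI impI)
      fix n assume "n \<ge> n0"
      then show "norm ((LINT x|lborel. u x * \<psi> (x - real n *\<^sub>R b)) - 0) < \<eta>"
        using bound[OF \<tau>, of n] t1 n0[of n] unfolding real_norm_def diff_zero by linarith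
    qed
  qed
qed

text \<open>
  Cauchy-Schwarz for \<open>v / |x - b|\<close> and \<open>|x - b| \<psi>\<close>. When \<open>\<psi>\<close> and \<open>b\<close> are translated together the second
  factor does not change, so the bound is uniform under such translations.
\<close>

lemma hardy_pairing:
  fixes v :: "'a::euclidean_space \<Rightarrow> real"
  assumes [measurable]: "v \<in> borel_measurable borel"
    and v: "integrable lborel (\<lambda>x. (v x)\<^sup>2 / (norm (x - b))\<^sup>2)" and \<psi>: "\<psi> \<in> test_functions"
  shows "integrable lborel (\<lambda>x. v x * \<psi> x)"
    and "\<bar>LINT x|lborel. v x * \<psi> x\<bar> \<le> sqrt (hardy_integral v b) * sqrt (LINT x|lborel. (norm (x - b) * \<psi> x)\<^sup>2)"
proof -
  have [measurable]: "\<psi> \<in> borel_measurable borel" by (rule test_measurable[OF \<psi>])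
  obtain R where R: "\<And>x. R < norm x \<Longrightarrow> \<psi> x = 0" using test_support[OF \<psi>] by blast
  have iv: "integrable lborel (\<lambda>x. (v x / norm (x - b))\<^sup>2)" using v by (simp add: power_divide)
  have i\<psi>: "integrable lborel (\<lambda>x. (norm (x - b) * \<psi> x)\<^sup>2)"
  proof (rule integrable_compact_support)
    show "continuous_on UNIV (\<lambda>x. (norm (x - b) * \<psi> x)\<^sup>2)"
      by (intro continuous_intros test_continuous[OF \<psi>])
    show "R < norm x \<Longrightarrow> (norm (x - b) * \<psi> x)\<^sup>2 = 0" for x using R by simp
  qed
  have ae: "AE x in lborel. v x / norm (x - b) * (norm (x - b) * \<psi> x) = v x * \<psi> x"
    using AE_neq_point[of b] by eventually_elim simp
  have "integrable lborel (\<lambda>x. v x / norm (x - b) * (norm (x - b) * \<psi> x))"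
    by (rule integrable_product[OF _ _ iv i\<psi>]) measurable
  then show "integrable lborel (\<lambda>x. v x * \<psi> x)"
    using ae by (subst (asm) integrable_cong_AE[where g="\<lambda>x. v x * \<psi> x"]) auto
  have "(LINT x|lborel. v x * \<psi> x) = (LINT x|lborel. v x / norm (x - b) * (norm (x - b) * \<psi> x))"
  proof (rule integral_cong_AE)
    show "AE x in lborel. v x * \<psi> x = v x / norm (x - b) * (norm (x - b) * \<psi> x)"
      using AE_neq_point[of b] by eventually_elim simp
  qed measurable
  then show "\<bar>LINT x|lborel. v x * \<psi> x\<bar> \<le> sqrt (hardy_integral v b) * sqrt (LINT x|lborel. (norm (x - b) * \<psi> x)\<^sup>2)"
    using cauchy_schwarz_integral[OF _ _ iv i\<psi>] by (simp add: hardy_integral_def power_divide)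
qed

lemma hardy_constant_pos: "DIM('a::euclidean_space) \<ge> 3 \<Longrightarrow> hardy_constant TYPE('a) > 0"
  by (simp add: hardy_constant_def)

lemma hardy_integral_nonneg: "0 \<le> hardy_integral u b"
  by (simp add: hardy_integral_def)

text \<open>
  The gradients of a defining sequence converge to the weak gradient of \<open>u\<close>. By the Hardy inequality the sequence
  itself converges in every weighted space, and the limit must be \<open>u\<close>: the difference has zero weak
  gradient, so its pairing with a test function does not change when the test function is moved to
  infinity, where both \<open>u\<close> and the Hardy limit contribute nothing.
\<close>

lemma D12_approximation:
  fixes u :: "'a::euclidean_space \<Rightarrow> real"
  assumes u: "u \<in> D12" and N: "DIM('a) \<ge> 3"
  obtains g \<phi> where "has_weak_gradient u g" "integrable lborel (\<lambda>x. (norm (g x))\<^sup>2)"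
    "\<And>n. \<phi> n \<in> test_functions" "(\<lambda>n. LINT x|lborel. (norm (gradient (\<phi> n) x - g x))\<^sup>2) \<longlonglongrightarrow> 0"
    "AE x in lborel. (\<lambda>n. \<phi> n x) \<longlonglongrightarrow> u x"
    "\<And>n b. integrable lborel (\<lambda>x. (\<phi> n x - u x)\<^sup>2 / (norm (x - b))\<^sup>2)"
    "\<And>n b. hardy_integral (\<lambda>x. \<phi> n x - u x) b
       \<le> 2 * hardy_constant TYPE('a) * (LINT x|lborel. (norm (gradient (\<phi> n) x - g x))\<^sup>2)"
proof -
  define H where "H = hardy_constant TYPE('a)"
  have H: "H > 0" unfolding H_def by (rule hardy_constant_pos[OF N])
  have um[measurable]: "u \<in> borel_measurable borel" using u by (simp add: D12_def D12_ambient_def)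
  obtain g \<phi>0 where g: "has_weak_gradient u g" and gi: "integrable lborel (\<lambda>x. (norm (g x))\<^sup>2)"
    and \<phi>0: "\<And>n. \<phi>0 n \<in> test_functions"
    and l0: "(\<lambda>n. LINT x|lborel. (norm (gradient (\<phi>0 n) x - g x))\<^sup>2) \<longlonglongrightarrow> 0"
    using D12_sequence[OF u] by blast
  have gm[measurable]: "g \<in> borel_measurable borel"
    using g by (simp add: has_weak_gradient_def locally_integrable_def)
  \<comment> \<open>a subsequence with geometrically decreasing errors converges almost everywhere\<close>
  have "\<forall>n. \<exists>k. (LINT x|lborel. (norm (gradient (\<phi>0 k) x - g x))\<^sup>2) < (1/4)^n"
  proof
    fix n :: nat
    have "\<forall>\<^sub>F k in sequentially. (LINT x|lborel. (norm (gradient (\<phi>0 k) x - g x))\<^sup>2) < (1/4)^n"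
      using l0 by (rule order_tendstoD(2)) simp
    then show "\<exists>k. (LINT x|lborel. (norm (gradient (\<phi>0 k) x - g x))\<^sup>2) < (1/4)^n"
      using eventually_happens[of _ sequentially] by auto
  qed
  then obtain k where k: "\<And>n. (LINT x|lborel. (norm (gradient (\<phi>0 (k n)) x - g x))\<^sup>2) < (1/4)^n"
    by metis
  define \<phi> where "\<phi> n = \<phi>0 (k n)" for n
  have \<phi>: "\<phi> n \<in> test_functions" for n using \<phi>0 by (simp add: \<phi>_def)
  have [measurable]: "\<phi> n \<in> borel_measurable borel" for n by (rule test_measurable[OF \<phi>])
  have [measurable]: "gradient (\<phi> n) \<in> borel_measurable borel" for n by (rule gradient_measurable[OF \<phi>])
  define \<epsilon> where "\<epsilon> n = (LINT x|lborel. (norm (gradient (\<phi> n) x - g x))\<^sup>2)" for n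
  have \<epsilon>0: "0 \<le> \<epsilon> n" for n by (simp add: \<epsilon>_def)
  have \<epsilon>4: "\<epsilon> n \<le> (1/4)^n" for n using k[of n] by (simp add: \<epsilon>_def \<phi>_def)
  have \<epsilon>lim: "\<epsilon> \<longlonglongrightarrow> 0"
  proof (rule Lim_null_comparison[where g="\<lambda>n. (1/4::real)^n"])
    show "(\<lambda>n. (1/4::real)^n) \<longlonglongrightarrow> 0" by (rule LIMSEQ_power_zero) simp
    show "\<forall>\<^sub>F n in sequentially. norm (\<epsilon> n) \<le> (1/4::real)^n" using \<epsilon>0 \<epsilon>4 by simp
  qed
  have ig: "integrable lborel (\<lambda>x. (norm (gradient (\<phi> n) x - g x))\<^sup>2)" for n
    by (rule integrable_square_diff(1)[OF _ _ test_norm_gradient_integrable[OF \<phi>] gi]) measurable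
  have E: "(LINT x|lborel. (norm (gradient (\<lambda>x. \<phi> m x - \<phi> n x) x))\<^sup>2) \<le> 2 * \<epsilon> m + 2 * \<epsilon> n" for m n
  proof -
    have "(LINT x|lborel. (norm (gradient (\<lambda>x. \<phi> m x - \<phi> n x) x))\<^sup>2)
      = (LINT x|lborel. (norm ((gradient (\<phi> m) x - g x) - (gradient (\<phi> n) x - g x)))\<^sup>2)"
      by (simp add: gradient_diff[OF \<phi> \<phi>])
    also have "\<dots> \<le> 2 * \<epsilon> m + 2 * \<epsilon> n"
      unfolding \<epsilon>_def by (rule integrable_square_diff(2)[OF _ _ ig ig]) measurable
    finally show ?thesis .
  qed
  note hi = hardy_test(1)[OF test_diff[OF \<phi> \<phi>] N]
  have hE: "hardy_integral (\<lambda>x. \<phi> m x - \<phi> n x) b \<le> H * (2 * \<epsilon> m + 2 * \<epsilon> n)" for m n b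
    using order_trans[OF hardy_test(2)[OF test_diff[OF \<phi> \<phi>] N] mult_left_mono[OF E]] H by (simp add: H_def)
  define d where "d n x = 2 ^ n * ((\<phi> (Suc n) x - \<phi> n x)\<^sup>2 / (norm (x - 0))\<^sup>2)" for n x
  have [measurable]: "d n \<in> borel_measurable borel" for n unfolding d_def by measurable
  have di: "integrable lborel (d n)" for n unfolding d_def by (intro integrable_mult_right hi)
  have dle: "(LINT x|lborel. d n x) \<le> 4 * H * (1/2)^n" for n
  proof -
    have "(LINT x|lborel. d n x) = 2 ^ n * hardy_integral (\<lambda>x. \<phi> (Suc n) x - \<phi> n x) 0"
      unfolding d_def hardy_integral_def by (rule integral_mult_right_zero)
    also have "\<dots> \<le> 2 ^ n * (H * (2 * \<epsilon> (Suc n) + 2 * \<epsilon> n))" by (intro mult_left_mono hE) simp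
    also have "\<dots> \<le> 2 ^ n * (H * (4 * (1/4)^n))"
    proof -
      have "\<epsilon> (Suc n) \<le> (1/4)^n"
        using \<epsilon>4[of "Suc n"] zero_le_power[of "1/4::real" n] unfolding power_Suc by linarith
      then show ?thesis using \<epsilon>4[of n] H by (intro mult_left_mono) auto
    qed
    also have "\<dots> = 4 * H * (2 * (1/4))^n" unfolding power_mult_distrib by simp
    finally show ?thesis by simp
  qed
  have "(\<integral>\<^sup>+x. (\<Sum>n. ennreal (d n x)) \<partial>lborel) = (\<Sum>n. \<integral>\<^sup>+x. ennreal (d n x) \<partial>lborel)"
    by (rule nn_integral_suminf) measurable
  also have "\<dots> \<le> (\<Sum>n. ennreal (4 * H * (1/2)^n))"
  proof (rule suminf_le)
    show "(\<integral>\<^sup>+x. ennreal (d n x) \<partial>lborel) \<le> ennreal (4 * H * (1/2)^n)" for n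
    proof -
      have "AE x in lborel. 0 \<le> d n x" by (simp add: d_def)
      from nn_integral_eq_integral[OF di this] show ?thesis by (simp only: ennreal_leI dle)
    qed
  qed auto
  also have "\<dots> = ennreal (\<Sum>n. 4 * H * (1/2)^n)"
    using H by (intro suminf_ennreal2 summable_mult summable_geometric) auto
  finally have "(\<integral>\<^sup>+x. (\<Sum>n. ennreal (d n x)) \<partial>lborel) \<noteq> \<infinity>"
    by (auto simp: top_unique)
  then have "AE x in lborel. (\<Sum>n. ennreal (d n x)) \<noteq> \<infinity>"
    by (intro nn_integral_PInf_AE) auto
  then have conv: "AE x in lborel. convergent (\<lambda>n. \<phi> n x)"
    using AE_neq_point[of 0]
  proof eventually_elim
    case (elim x)
    have "summable (\<lambda>n. d n x)"
      using elim(1) by (intro summable_suminf_not_top) (auto simp: d_def)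
    then have "(\<lambda>n. d n x) \<longlonglongrightarrow> 0" by (rule summable_LIMSEQ_zero)
    then obtain K where K: "\<And>n. norm (d n x) \<le> K"
      using convergent_imp_Bseq[OF convergentI] BseqE by metis
    have K0: "0 \<le> K" using K[of 0] norm_ge_zero order_trans by blast
    have step: "norm (\<phi> (Suc n) x - \<phi> n x) \<le> sqrt (K * (norm x)\<^sup>2) * (sqrt (1/2)) ^ n" for n
    proof -
      have "(\<phi> (Suc n) x - \<phi> n x)\<^sup>2 = d n x * (norm x)\<^sup>2 * (1/2) ^ n"
        using elim(2) by (simp add: d_def power_one_over)
      also have "\<dots> \<le> K * (norm x)\<^sup>2 * (1/2) ^ n"
        using K[of n] by (intro mult_right_mono) auto
      finally have "sqrt ((\<phi> (Suc n) x - \<phi> n x)\<^sup>2) \<le> sqrt (K * (norm x)\<^sup>2 * (1/2) ^ n)"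
        by (rule real_sqrt_le_mono)
      then show ?thesis unfolding real_sqrt_abs real_norm_def
        by (simp only: real_sqrt_mult[of _ "(1/2) ^ n"] real_sqrt_power[of "1/2"])
    qed
    have "sqrt (1/2 :: real) < 1" by simp
    then have "summable (\<lambda>n. sqrt (K * (norm x)\<^sup>2) * (sqrt (1/2)) ^ n)"
      by (intro summable_mult summable_geometric) simp
    then have "summable (\<lambda>n. \<phi> (Suc n) x - \<phi> n x)"
      by (rule summable_comparison_test') (rule step)
    then have "convergent (\<lambda>n. \<Sum>i<n. \<phi> (Suc i) x - \<phi> i x)"
      by (simp only: summable_iff_convergent)
    then have "convergent (\<lambda>n. \<phi> n x - \<phi> 0 x)"
      by (simp only: sum_lessThan_telescope[of "\<lambda>n. \<phi> n x"])
    from convergent_add[OF this convergent_const[of "\<phi> 0 x"]] show ?case by simp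
  qed
  \<comment> \<open>the limit of the sequence in the Hardy norms, for every centre at once\<close>
  define w where "w x = lim (\<lambda>n. \<phi> n x)" for x
  have wm[measurable]: "w \<in> borel_measurable borel"
    unfolding w_def[abs_def] by (rule borel_measurable_lim_metric) measurable
  have wl: "AE x in lborel. (\<lambda>n. \<phi> n x) \<longlonglongrightarrow> w x"
    using conv by eventually_elim (simp add: w_def convergent_LIMSEQ_iff)
  have cl: "(\<lambda>m. H * (2 * \<epsilon> m + 2 * \<epsilon> n)) \<longlonglongrightarrow> H * (2 * 0 + 2 * \<epsilon> n)" for n
    by (intro tendsto_intros \<epsilon>lim)
  have wl2: "AE x in lborel. (\<lambda>m. (\<phi> m x - \<phi> n x)\<^sup>2 / (norm (x - b))\<^sup>2) \<longlonglongrightarrow> (w x - \<phi> n x)\<^sup>2 / (norm (x - b))\<^sup>2" for n b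
    using wl AE_neq_point[of b] by eventually_elim (auto intro!: tendsto_intros)
  have wi: "integrable lborel (\<lambda>x. (w x - \<phi> n x)\<^sup>2 / (norm (x - b))\<^sup>2)" for n b
    by (rule integral_fatou(1)[OF hi _ hE[unfolded hardy_integral_def] cl wl2]) auto
  have wle: "hardy_integral (\<lambda>x. w x - \<phi> n x) b \<le> 2 * H * \<epsilon> n" for n b
  proof -
    have "hardy_integral (\<lambda>x. w x - \<phi> n x) b \<le> H * (2 * 0 + 2 * \<epsilon> n)"
      unfolding hardy_integral_def
      by (rule integral_fatou(2)[OF hi _ hE[unfolded hardy_integral_def] cl wl2]) auto
    also have "\<dots> = 2 * H * \<epsilon> n" by (simp add: algebra_simps)
    finally show ?thesis .
  qed
  have pair: "\<bar>LINT x|lborel. (w x - \<phi> n x) * \<psi> x\<bar> \<le> sqrt (2 * H * \<epsilon> n) * sqrt (LINT x|lborel. (norm (x - b) * \<psi> x)\<^sup>2)"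
    and ipair: "integrable lborel (\<lambda>x. (w x - \<phi> n x) * \<psi> x)"
    if \<psi>: "\<psi> \<in> test_functions" for \<psi> n b
  proof -
    show "integrable lborel (\<lambda>x. (w x - \<phi> n x) * \<psi> x)"
      by (rule hardy_pairing(1)[OF _ wi \<psi>]) measurable
    have "\<bar>LINT x|lborel. (w x - \<phi> n x) * \<psi> x\<bar> \<le> sqrt (hardy_integral (\<lambda>x. w x - \<phi> n x) b) * sqrt (LINT x|lborel. (norm (x - b) * \<psi> x)\<^sup>2)"
      by (rule hardy_pairing(2)[OF _ wi \<psi>]) measurable
    also have "\<dots> \<le> sqrt (2 * H * \<epsilon> n) * sqrt (LINT x|lborel. (norm (x - b) * \<psi> x)\<^sup>2)"
      by (intro mult_right_mono real_sqrt_le_mono wle) simp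
    finally show "\<bar>LINT x|lborel. (w x - \<phi> n x) * \<psi> x\<bar> \<le> sqrt (2 * H * \<epsilon> n) * sqrt (LINT x|lborel. (norm (x - b) * \<psi> x)\<^sup>2)" .
  qed
  have sq0: "(\<lambda>n. sqrt (2 * H * \<epsilon> n) * c) \<longlonglongrightarrow> 0" for c
  proof -
    have "(\<lambda>n. sqrt (2 * H * \<epsilon> n) * c) \<longlonglongrightarrow> sqrt (2 * H * 0) * c" by (intro tendsto_intros \<epsilon>lim)
    then show ?thesis by simp
  qed
  have wloc: "locally_integrable w"
    unfolding locally_integrable_def set_integrable_def
  proof (intro conjI allI impI)
    show "w \<in> borel_measurable lborel" by simp
    fix K :: "'a set" assume K: "compact K"
    have Kb[measurable]: "K \<in> sets borel" by (rule borel_compact[OF K])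
    have 1: "integrable lborel (\<lambda>x. \<bar>\<phi> 0 x\<bar>)" using test_integrable[OF \<phi>] by simp
    have 2: "integrable lborel (\<lambda>x. indicator K x * (norm x)\<^sup>2)"
      using borel_integrable_compact[OF K, of "\<lambda>x. (norm x)\<^sup>2"] by (simp add: continuous_intros)
    have "integrable lborel (\<lambda>x. \<bar>\<phi> 0 x\<bar> + ((w x - \<phi> 0 x)\<^sup>2 / (norm (x - 0))\<^sup>2 + indicator K x * (norm x)\<^sup>2))"
      by (intro Bochner_Integration.integrable_add 1 2 wi)
    then show "integrable lborel (\<lambda>x. indicator K x *\<^sub>R w x)"
    proof (rule Bochner_Integration.integrable_bound)
      show "AE x in lborel. norm (indicator K x *\<^sub>R w x) \<le> norm (\<bar>\<phi> 0 x\<bar> + ((w x - \<phi> 0 x)\<^sup>2 / (norm (x - 0))\<^sup>2 + indicator K x * (norm x)\<^sup>2))"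
        using AE_neq_point[of 0]
      proof eventually_elim
        case (elim x)
        have nn: "0 \<le> (w x - \<phi> 0 x)\<^sup>2 / (norm (x - 0))\<^sup>2" "0 \<le> \<bar>\<phi> 0 x\<bar>" "0 \<le> (norm x)\<^sup>2" by auto
        show ?case
        proof (cases "x \<in> K")
          case True
          define p where "p = \<bar>w x - \<phi> 0 x\<bar> / norm x"
          have "0 \<le> (p - norm x)\<^sup>2" by simp
          then have "2 * (p * norm x) \<le> p\<^sup>2 + (norm x)\<^sup>2" by (simp add: power2_diff)
          moreover have "p * norm x = \<bar>w x - \<phi> 0 x\<bar>" using elim by (simp add: p_def)
          moreover have "p\<^sup>2 = (w x - \<phi> 0 x)\<^sup>2 / (norm (x - 0))\<^sup>2" by (simp add: p_def power_divide)
          moreover have "\<bar>w x\<bar> \<le> \<bar>\<phi> 0 x\<bar> + \<bar>w x - \<phi> 0 x\<bar>" by linarith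
          ultimately have "\<bar>w x\<bar> \<le> \<bar>\<phi> 0 x\<bar> + ((w x - \<phi> 0 x)\<^sup>2 / (norm (x - 0))\<^sup>2 + (norm x)\<^sup>2)" by linarith
          then show ?thesis using True by simp
        qed (use nn in simp)
      qed
    qed measurable
  qed
  have wg: "has_weak_gradient w g"
    unfolding has_weak_gradient_def
  proof (intro conjI ballI)
    show "locally_integrable w" by (rule wloc)
    show gl: "locally_integrable g" using g by (simp add: has_weak_gradient_def)
    fix \<psi> :: "'a \<Rightarrow> real" and b :: 'a assume \<psi>: "\<psi> \<in> test_functions" and b: "b \<in> Basis"
    note \<psi>' = test_deriv[OF \<psi> b]
    have [measurable]: "\<psi> \<in> borel_measurable borel" by (rule test_measurable[OF \<psi>])
    have \<psi>2: "integrable lborel (\<lambda>x. (\<psi> x)\<^sup>2)"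
      using test_integrable[OF test_mult_smooth[OF \<psi> test_smooth[OF \<psi>]]] by (simp add: power2_eq_square)
    define W where "W = (LINT x|lborel. w x * frechet_derivative \<psi> (at x) b)"
    define G where "G = (LINT x|lborel. (g x \<bullet> b) * \<psi> x)"
    have iw: "integrable lborel (\<lambda>x. w x * frechet_derivative \<psi> (at x) b)"
      by (rule loc_times_gradient_integrable[OF wloc \<psi> b])
    have bd: "\<bar>W + G\<bar> \<le> sqrt (2 * H * \<epsilon> n) * sqrt (LINT x|lborel. (norm (x - 0) * frechet_derivative \<psi> (at x) b)\<^sup>2)
       + sqrt (\<epsilon> n) * sqrt (LINT x|lborel. (\<psi> x)\<^sup>2)" for n
    proof -
      have f\<phi>: "locally_integrable (\<phi> n)" "locally_integrable (gradient (\<phi> n))"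
        using \<phi> by (auto intro: locally_integrable_integrable test_integrable test_gradient_integrable)
      note i\<phi> = loc_times_gradient_integrable[OF f\<phi>(1) \<psi> b]
      note ig\<phi> = loc_times_test_integrable[OF locally_integrable_inner[OF f\<phi>(2), of b] \<psi>]
      note igg = loc_times_test_integrable[OF locally_integrable_inner[OF gl, of b] \<psi>]
      have ipp: "(LINT x|lborel. \<phi> n x * frechet_derivative \<psi> (at x) b) = - (LINT x|lborel. (gradient (\<phi> n) x \<bullet> b) * \<psi> x)"
        using weak_gradient_test[OF \<phi>] \<psi> b by (simp add: has_weak_gradient_def)
      have "W - (LINT x|lborel. \<phi> n x * frechet_derivative \<psi> (at x) b)
        = (LINT x|lborel. (w x - \<phi> n x) * frechet_derivative \<psi> (at x) b)"
        unfolding W_def using iw i\<phi> by (simp add: left_diff_distrib)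
      then have 1: "\<bar>W - (LINT x|lborel. \<phi> n x * frechet_derivative \<psi> (at x) b)\<bar>
        \<le> sqrt (2 * H * \<epsilon> n) * sqrt (LINT x|lborel. (norm (x - 0) * frechet_derivative \<psi> (at x) b)\<^sup>2)"
        using pair[OF \<psi>', of n 0] by simp
      have eq: "(LINT x|lborel. (gradient (\<phi> n) x \<bullet> b) * \<psi> x) - G
        = (LINT x|lborel. ((gradient (\<phi> n) x - g x) \<bullet> b) * \<psi> x)"
        unfolding G_def using ig\<phi> igg by (simp add: inner_diff_left left_diff_distrib)
      have bsq: "(((gradient (\<phi> n) x - g x) \<bullet> b))\<^sup>2 \<le> (norm (gradient (\<phi> n) x - g x))\<^sup>2" for x
        using Basis_le_norm[OF b, of "gradient (\<phi> n) x - g x"] by (intro power2_le_iff_abs_le[THEN iffD2]) auto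
      have ib: "integrable lborel (\<lambda>x. (((gradient (\<phi> n) x - g x) \<bullet> b))\<^sup>2)"
        by (rule Bochner_Integration.integrable_bound[OF ig[of n]]) (use bsq in auto)
      have "\<bar>LINT x|lborel. ((gradient (\<phi> n) x - g x) \<bullet> b) * \<psi> x\<bar>
        \<le> sqrt (LINT x|lborel. (((gradient (\<phi> n) x - g x) \<bullet> b))\<^sup>2) * sqrt (LINT x|lborel. (\<psi> x)\<^sup>2)"
        by (rule cauchy_schwarz_integral[OF _ _ ib \<psi>2]) measurable
      also have "\<dots> \<le> sqrt (\<epsilon> n) * sqrt (LINT x|lborel. (\<psi> x)\<^sup>2)"
        unfolding \<epsilon>_def by (intro mult_right_mono real_sqrt_le_mono integral_mono ib ig bsq) simp
      finally have 2: "\<bar>(LINT x|lborel. (gradient (\<phi> n) x \<bullet> b) * \<psi> x) - G\<bar> \<le> sqrt (\<epsilon> n) * sqrt (LINT x|lborel. (\<psi> x)\<^sup>2)"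
        unfolding eq .
      show ?thesis using 1 2 ipp by linarith
    qed
    have "(\<lambda>n. sqrt (2 * H * \<epsilon> n) * sqrt (LINT x|lborel. (norm (x - 0) * frechet_derivative \<psi> (at x) b)\<^sup>2)
       + sqrt (\<epsilon> n) * sqrt (LINT x|lborel. (\<psi> x)\<^sup>2)) \<longlonglongrightarrow> 0 + sqrt 0 * sqrt (LINT x|lborel. (\<psi> x)\<^sup>2)"
      by (intro tendsto_add sq0 tendsto_mult tendsto_real_sqrt \<epsilon>lim tendsto_const)
    then have "\<bar>W + G\<bar> \<le> 0 + sqrt 0 * sqrt (LINT x|lborel. (\<psi> x)\<^sup>2)"
      by (rule LIMSEQ_le_const) (use bd in blast)
    then show "(LINT x|lborel. w x * frechet_derivative \<psi> (at x) b) = - (LINT x|lborel. (g x \<bullet> b) * \<psi> x)"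
      unfolding W_def[symmetric] G_def[symmetric] by simp
  qed
  \<comment> \<open>it remains to exclude that \<open>w\<close> and \<open>u\<close> differ by a function with zero gradient\<close>
  have hg: "has_weak_gradient (\<lambda>x. w x - u x) (\<lambda>_. 0)"
    using has_weak_gradient_diff[OF wg g] by simp
  have uloc: "locally_integrable u" using g by (simp add: has_weak_gradient_def)
  have "AE x in lborel. w x - u x = 0"
  proof (rule fundamental_lemma)
    show "locally_integrable (\<lambda>x. w x - u x)" by (rule locally_integrable_diff[OF wloc uloc])
    fix \<psi> :: "'a \<Rightarrow> real" assume \<psi>: "\<psi> \<in> test_functions"
    obtain b :: 'a where b: "b \<in> Basis" using nonempty_Basis by blast
    define P where "P = (LINT x|lborel. (w x - u x) * \<psi> x)"
    define \<psi>s where "\<psi>s m x = \<psi> (x - real m *\<^sub>R b)" for m x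
    have \<psi>s: "\<psi>s m \<in> test_functions" for m
      unfolding \<psi>s_def using test_rescale[OF \<psi>, of 1 "- (real m *\<^sub>R b)"] by simp
    define Q where "Q = sqrt (LINT x|lborel. (norm x * \<psi> x)\<^sup>2)"
    have Q: "sqrt (LINT x|lborel. (norm (x - real m *\<^sub>R b) * \<psi>s m x)\<^sup>2) = Q" for m
      using integral_translate[of "\<lambda>x. (norm x * \<psi> x)\<^sup>2" "- (real m *\<^sub>R b)"] test_measurable[OF \<psi>]
      by (simp add: Q_def \<psi>s_def)
    define p where "p = critical_exponent DIM('a)"
    have p1: "p > 1" using N by (simp add: p_def critical_exponent_def)
    have up: "integrable lborel (\<lambda>x. \<bar>u x\<bar> powr p)" using u by (simp add: D12_def D12_ambient_def p_def)
    define U where "U m = (LINT x|lborel. u x * \<psi>s m x)" for m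
    have U: "U \<longlonglongrightarrow> 0"
      unfolding U_def \<psi>s_def by (rule translate_vanish_Lp[OF um up p1 \<psi> b])
    have le: "\<bar>P\<bar> \<le> sqrt (2 * H * \<epsilon> n) * Q" for n
    proof -
      obtain R where R: "R > 0" "\<And>x. R < norm x \<Longrightarrow> \<phi> n x = 0" using test_support[OF \<phi>] by blast
      obtain R' where R': "R' > 0" "\<And>x. R' < norm x \<Longrightarrow> \<psi> x = 0" using test_support[OF \<psi>] by blast
      obtain m0 :: nat where m0: "R + R' < real m0" using reals_Archimedean2 by blast
      have "\<bar>P\<bar> \<le> sqrt (2 * H * \<epsilon> n) * Q + \<bar>U m\<bar>" if m: "m \<ge> m0" for m
      proof -
        have disj: "\<phi> n x * \<psi>s m x = 0" for x
        proof (cases "R < norm x")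
          case False
          have "norm (real m *\<^sub>R b) \<le> norm (x - real m *\<^sub>R b) + norm x"
            by (metis add.commute norm_minus_commute norm_triangle_sub)
          moreover have "norm (real m *\<^sub>R b) = real m" using b by simp
          ultimately have "R' < norm (x - real m *\<^sub>R b)" using False m m0 by linarith
          then show ?thesis using R' by (simp add: \<psi>s_def)
        qed (use R in simp)
        have i1: "integrable lborel (\<lambda>x. (w x - \<phi> n x) * \<psi>s m x)" by (rule ipair[OF \<psi>s])
        have i2: "integrable lborel (\<lambda>x. u x * \<psi>s m x)" by (rule loc_times_test_integrable[OF uloc \<psi>s])
        have "P = (LINT x|lborel. (w x - u x) * \<psi>s m x)"
          unfolding P_def \<psi>s_def by (rule weak_gradient_zero_translate[OF hg \<psi> b, symmetric])
        also have "\<dots> = (LINT x|lborel. (w x - \<phi> n x) * \<psi>s m x - u x * \<psi>s m x)"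
          using disj by (intro Bochner_Integration.integral_cong) (simp_all add: left_diff_distrib)
        also have "\<dots> = (LINT x|lborel. (w x - \<phi> n x) * \<psi>s m x) - U m"
          unfolding U_def by (rule Bochner_Integration.integral_diff[OF i1 i2])
        finally show ?thesis
          using pair[OF \<psi>s, of n m "real m *\<^sub>R b"] unfolding Q by linarith
      qed
      moreover have "(\<lambda>m. sqrt (2 * H * \<epsilon> n) * Q + \<bar>U m\<bar>) \<longlonglongrightarrow> sqrt (2 * H * \<epsilon> n) * Q + \<bar>0\<bar>"
        by (intro tendsto_intros U)
      ultimately have "\<bar>P\<bar> \<le> sqrt (2 * H * \<epsilon> n) * Q + \<bar>0\<bar>"
        by (intro LIMSEQ_le_const[where a="\<bar>P\<bar>"]) auto
      then show ?thesis by simp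
    qed
    have "\<bar>P\<bar> \<le> 0" by (rule LIMSEQ_le_const[OF sq0[of Q]]) (use le in blast)
    then show "(LINT x|lborel. (w x - u x) * \<psi> x) = 0" by (simp add: P_def)
  qed
  then have wu: "AE x in lborel. w x = u x" by eventually_elim simp
  have sq: "(\<phi> n x - u x)\<^sup>2 = (u x - \<phi> n x)\<^sup>2" for n x by (rule power2_commute)
  have ae: "AE x in lborel. (w x - \<phi> n x)\<^sup>2 / (norm (x - b))\<^sup>2 = (\<phi> n x - u x)\<^sup>2 / (norm (x - b))\<^sup>2" for n b
    using wu by eventually_elim (simp only: sq)
  show ?thesis
  proof (rule that[OF g gi \<phi>])
    show "(\<lambda>n. LINT x|lborel. (norm (gradient (\<phi> n) x - g x))\<^sup>2) \<longlonglongrightarrow> 0"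
      using \<epsilon>lim unfolding \<epsilon>_def[abs_def] .
    show "AE x in lborel. (\<lambda>n. \<phi> n x) \<longlonglongrightarrow> u x"
      using wl wu by eventually_elim simp
    show "integrable lborel (\<lambda>x. (\<phi> n x - u x)\<^sup>2 / (norm (x - b))\<^sup>2)" for n b
      by (rule integrable_cong_AE_imp[OF wi[of n b]]) (measurable, use ae[of n b] in \<open>eventually_elim, simp\<close>)
    have "hardy_integral (\<lambda>x. w x - \<phi> n x) b = hardy_integral (\<lambda>x. \<phi> n x - u x) b" for n b
      unfolding hardy_integral_def by (rule integral_cong_AE[OF _ _ ae]) measurable
    then show "hardy_integral (\<lambda>x. \<phi> n x - u x) b \<le> 2 * hardy_constant TYPE('a) * (LINT x|lborel. (norm (gradient (\<phi> n) x - g x))\<^sup>2)" for n b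
      using wle[of n b] by (simp add: H_def \<epsilon>_def)
  qed
qed

section \<open>Polarization\<close>

text \<open>The signed distance, up to a factor, from the hyperplane that bisects the segment from \<open>p\<close> to \<open>q\<close>.\<close>

definition side :: "'a::euclidean_space \<Rightarrow> 'a \<Rightarrow> 'a \<Rightarrow> real" where
  "side p q x = (x - (p + q) /\<^sub>R 2) \<bullet> (p - q)"

lemma side_bisect: "side p q (bisect p q x) = - side p q x"
  by (simp add: side_def bisect_def reflection_inner)

lemma side_zero: "side p q 0 = ((norm q)\<^sup>2 - (norm p)\<^sup>2) / 2"
  by (simp add: side_def power2_norm_eq_inner inner_add_left inner_diff_right inner_commute[of p q] algebra_simps)

lemma side_self: "side p q p = (norm (p - q))\<^sup>2 / 2"
  by (simp add: side_def power2_norm_eq_inner inner_add_left inner_diff_left inner_diff_right inner_commute[of p q] algebra_simps)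

text \<open>
  Points on the same side of the hyperplane are closer to each other than one of them is to the mirror
  image of the other, and points on opposite sides are farther apart.
\<close>

lemma norm_diff_bisect:
  assumes "p \<noteq> q"
  shows "(norm (x - bisect p q y))\<^sup>2 = (norm (x - y))\<^sup>2 + 4 * side p q x * side p q y / (norm (p - q))\<^sup>2"
proof -
  define w m where "w = p - q" and "m = (p + q) /\<^sub>R 2"
  have W: "w \<bullet> w \<noteq> 0" using assms by (simp add: w_def)
  define c where "c = 2 * ((y - m) \<bullet> w) / (w \<bullet> w)"
  have b: "x - bisect p q y = (x - y) + c *\<^sub>R w"
    unfolding bisect_def reflection_def c_def w_def[symmetric] m_def[symmetric] by simp
  have s: "side p q x = (x - y) \<bullet> w + (y - m) \<bullet> w" "side p q y = (y - m) \<bullet> w"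
    unfolding side_def w_def[symmetric] m_def[symmetric] by (simp_all add: inner_diff_left)
  have "(norm (x - bisect p q y))\<^sup>2 = (norm (x - y))\<^sup>2 + 2 * (c * ((x - y) \<bullet> w)) + c * (c * (w \<bullet> w))"
    unfolding b power2_norm_eq_inner by (simp only: inner_add_left inner_add_right inner_scaleR_left inner_scaleR_right inner_commute[of w "x - y"] distrib_left)
  also have "c * (w \<bullet> w) = 2 * ((y - m) \<bullet> w)" using W by (simp add: c_def)
  also have "2 * (c * ((x - y) \<bullet> w)) = 4 * ((x - y) \<bullet> w) * ((y - m) \<bullet> w) / (w \<bullet> w)"
    by (simp add: c_def)
  also have "c * (2 * ((y - m) \<bullet> w)) = 4 * ((y - m) \<bullet> w) * ((y - m) \<bullet> w) / (w \<bullet> w)"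
    by (simp add: c_def)
  finally show ?thesis
    unfolding s w_def[symmetric] power2_norm_eq_inner[of w]
    by (simp add: distrib_left distrib_right add_divide_distrib)
qed

lemma bisect_fixed: "p \<noteq> q \<Longrightarrow> side p q x = 0 \<Longrightarrow> bisect p q x = x"
  using norm_diff_bisect[of p q x x] by simp

text \<open>
  On the side of \<open>p\<close> the larger of the two values at a point and its mirror image is taken.
\<close>

definition polarize :: "'a::euclidean_space \<Rightarrow> 'a \<Rightarrow> ('a \<Rightarrow> real) \<Rightarrow> 'a \<Rightarrow> real" where
  "polarize p q u x = (if 0 \<le> side p q x then max (u x) (u (bisect p q x)) else min (u x) (u (bisect p q x)))"

lemma polarize_nonneg_side:
  assumes "p \<noteq> q" "0 \<le> side p q x"
  shows "polarize p q u x = max (u x) (u (bisect p q x))"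
    "polarize p q u (bisect p q x) = min (u x) (u (bisect p q x))"
  using assms bisect_fixed[of p q x] by (auto simp: polarize_def side_bisect min.commute)

lemma polarize_nonpos_side:
  assumes "p \<noteq> q" "side p q x \<le> 0"
  shows "polarize p q u x = min (u x) (u (bisect p q x))"
    "polarize p q u (bisect p q x) = max (u x) (u (bisect p q x))"
proof -
  have "0 \<le> side p q (bisect p q x)" using assms(2) by (simp add: side_bisect)
  from polarize_nonneg_side[OF assms(1) this, of u, unfolded bisect_bisect]
  show "polarize p q u x = min (u x) (u (bisect p q x))"
    "polarize p q u (bisect p q x) = max (u x) (u (bisect p q x))"
    by (simp_all only: max.commute[of "u (bisect p q x)"] min.commute[of "u (bisect p q x)"])
qed

lemma polarize_measurable [measurable]:
  assumes [measurable]: "u \<in> borel_measurable borel"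
  shows "polarize p q u \<in> borel_measurable borel"
  unfolding polarize_def[abs_def] side_def by measurable

text \<open>
  Reflection preserves Lebesgue measure, so integrands may be summed over a point and its mirror
  image before they are compared. Polarization only exchanges the two values in such a pair.
\<close>

lemma nn_integral_pair:
  assumes [measurable]: "f \<in> borel_measurable borel"
  shows "(\<integral>\<^sup>+x. f x + f (bisect p q x) \<partial>lborel) = 2 * (\<integral>\<^sup>+x. f x \<partial>lborel)"
  by (simp add: nn_integral_add nn_integral_bisect mult_2)

lemma nn_integral_mono_pair:
  assumes [measurable]: "f \<in> borel_measurable borel" "g \<in> borel_measurable borel"
    and le: "\<And>x. f x + f (bisect p q x) \<le> g x + g (bisect p q x)"
  shows "(\<integral>\<^sup>+x. f x \<partial>lborel) \<le> (\<integral>\<^sup>+x. g x \<partial>lborel)"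
proof -
  have "2 * (\<integral>\<^sup>+x. f x \<partial>lborel) \<le> 2 * (\<integral>\<^sup>+x. g x \<partial>lborel)"
    unfolding nn_integral_pair[OF assms(1), of p q, symmetric] nn_integral_pair[OF assms(2), of p q, symmetric]
    by (rule nn_integral_mono) (rule le)
  then show ?thesis by (subst (asm) ennreal_mult_le_mult_iff) auto
qed

lemma polarize_nn_integral:
  assumes [measurable]: "u \<in> borel_measurable borel" "F \<in> borel_measurable borel" and pq: "p \<noteq> q"
  shows "(\<integral>\<^sup>+x. F (polarize p q u x) \<partial>lborel) = (\<integral>\<^sup>+x. F (u x) \<partial>lborel)"
proof -
  have eq: "F (polarize p q u x) + F (polarize p q u (bisect p q x)) = F (u x) + F (u (bisect p q x))" for x :: 'a
  proof (cases "0 \<le> side p q x")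
    case True
    then show ?thesis using polarize_nonneg_side[OF pq True, of u]
      by (simp add: max_def min_def add.commute)
  next
    case False
    then show ?thesis using polarize_nonpos_side[OF pq, of x u]
      by (simp add: max_def min_def add.commute)
  qed
  show ?thesis
    by (intro antisym nn_integral_mono_pair[where p=p and q=q]) (auto simp: eq)
qed

text \<open>
  Exchanging two values leaves the sum of all four squares unchanged, and pairing the larger values
  with each other minimizes the squares that carry the larger weight \<open>k\<close>.
\<close>

lemma four_point:
  fixes a a' b b' k l :: real
  assumes "0 \<le> l" "l \<le> k"
  shows "((max a a' - max b b')\<^sup>2 + (min a a' - min b b')\<^sup>2) * k
      + ((max a a' - min b b')\<^sup>2 + (min a a' - max b b')\<^sup>2) * l
    \<le> ((a - b)\<^sup>2 + (a' - b')\<^sup>2) * k + ((a - b')\<^sup>2 + (a' - b)\<^sup>2) * l"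
proof -
  define X Y X' Y' where "X = (a - b)\<^sup>2 + (a' - b')\<^sup>2" and "Y = (a - b')\<^sup>2 + (a' - b)\<^sup>2"
    and "X' = (max a a' - max b b')\<^sup>2 + (min a a' - min b b')\<^sup>2"
    and "Y' = (max a a' - min b b')\<^sup>2 + (min a a' - max b b')\<^sup>2"
  have s: "X' + Y' = X + Y"
    unfolding X_def Y_def X'_def Y'_def by (cases "a \<le> a'"; cases "b \<le> b'") (auto simp: max_def min_def)
  have "X' \<le> X"
  proof (cases "(a \<le> a') = (b \<le> b')")
    case True
    then show ?thesis unfolding X_def X'_def by (auto simp: max_def min_def)
  next
    case False
    then have "0 \<le> (a - a') * (b' - b)"
      by (auto intro: mult_nonneg_nonneg mult_nonpos_nonpos)
    then have "Y \<le> X" unfolding X_def Y_def by (simp add: power2_eq_square algebra_simps)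
    moreover have "X' = Y" using False unfolding X'_def Y_def by (auto simp: max_def min_def)
    ultimately show ?thesis by simp
  qed
  then have "X' * (k - l) \<le> X * (k - l)" using assms by (intro mult_right_mono) auto
  moreover have "X' * k + Y' * l = X' * (k - l) + (X' + Y') * l" by (simp add: algebra_simps)
  moreover have "X * k + Y * l = X * (k - l) + (X + Y) * l" by (simp add: algebra_simps)
  ultimately show ?thesis
    unfolding X_def[symmetric] Y_def[symmetric] X'_def[symmetric] Y'_def[symmetric] s by linarith
qed

section \<open>Nonlocal energies\<close>

text \<open>
  The square variation at scale \<open>e\<close>. Unlike the Dirichlet energy it needs no derivatives, it is
  lower semicontinuous under pointwise limits, and it decreases under polarization by a four-point
  inequality. After rescaling it recovers the Dirichlet energy as \<open>e\<close> tends to zero.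
\<close>

definition nonlocal_energy :: "real \<Rightarrow> ('a::euclidean_space \<Rightarrow> real) \<Rightarrow> ennreal" where
  "nonlocal_energy e u = (\<integral>\<^sup>+x. (\<integral>\<^sup>+y. ennreal ((u x - u y)\<^sup>2 * indicator {..<e} (norm (x - y))) \<partial>lborel) \<partial>lborel)"

text \<open>
  Both variables range over a point and its mirror image, which makes four points per pair.
\<close>

lemma nonlocal_energy_pairs:
  fixes u :: "'a::euclidean_space \<Rightarrow> real" and e :: real
  assumes [measurable]: "u \<in> borel_measurable borel"
  defines "K \<equiv> \<lambda>x y. ennreal ((u x - u y)\<^sup>2 * indicator {..<e} (norm (x - y)))"
  shows "4 * nonlocal_energy e u = (\<integral>\<^sup>+x. (\<integral>\<^sup>+y.
     K x y + K x (bisect p q y) + (K (bisect p q x) y + K (bisect p q x) (bisect p q y)) \<partial>lborel) \<partial>lborel)"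
proof -
  have Km[measurable]: "(\<lambda>z. K (fst z) (snd z)) \<in> borel_measurable (borel \<Otimes>\<^sub>M borel)"
    unfolding K_def by measurable
  have K1[measurable]: "(\<lambda>y. K x y) \<in> borel_measurable borel" for x unfolding K_def by measurable
  define k where "k x = (\<integral>\<^sup>+y. K x y \<partial>lborel)" for x
  have [measurable]: "k \<in> borel_measurable borel" unfolding k_def K_def by measurable
  have inner: "(\<integral>\<^sup>+y. K x y + K x (bisect p q y) \<partial>lborel) = 2 * k x" for x
    unfolding k_def by (rule nn_integral_pair) measurable
  have "(\<integral>\<^sup>+x. (\<integral>\<^sup>+y. K x y + K x (bisect p q y) + (K (bisect p q x) y + K (bisect p q x) (bisect p q y)) \<partial>lborel) \<partial>lborel)
    = (\<integral>\<^sup>+x. 2 * k x + 2 * k (bisect p q x) \<partial>lborel)"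
    by (subst nn_integral_add) (auto simp: inner)
  also have "\<dots> = 2 * (\<integral>\<^sup>+x. 2 * k x \<partial>lborel)"
    by (rule nn_integral_pair) measurable
  also have "\<dots> = 4 * (\<integral>\<^sup>+x. k x \<partial>lborel)"
    by (simp add: nn_integral_cmult mult.assoc[symmetric])
  finally show ?thesis
    unfolding k_def K_def nonlocal_energy_def by simp
qed

lemma norm_bisect_left: "norm (bisect p q x - y) = norm (x - bisect p q y)"
  using norm_bisect_diff[of p q "x" "bisect p q y"] by simp

text \<open>
  The weight is the indicator of \<open>|x - y| < e\<close>. It is at least as large for the pairing of points that lie
  on the same side of the hyperplane, which is the pairing that \<open>four_point\<close> favours.
\<close>

lemma polarize_four_point:
  fixes u :: "'a::euclidean_space \<Rightarrow> real" and e :: real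
  assumes pq: "p \<noteq> q"
  defines "K \<equiv> \<lambda>v x y. (v x - v y)\<^sup>2 * indicat_real {..<e} (norm (x - y))"
  shows "K (polarize p q u) x y + K (polarize p q u) x (bisect p q y)
      + (K (polarize p q u) (bisect p q x) y + K (polarize p q u) (bisect p q x) (bisect p q y))
    \<le> K u x y + K u x (bisect p q y) + (K u (bisect p q x) y + K u (bisect p q x) (bisect p q y))"
proof -
  define a a' b b' where "a = u x" and "a' = u (bisect p q x)" and "b = u y" and "b' = u (bisect p q y)"
  define k l where "k = indicat_real {..<e} (norm (x - y))" and "l = indicat_real {..<e} (norm (x - bisect p q y))"
  have kl: "indicat_real {..<e} (norm (bisect p q x - bisect p q y)) = k" "indicat_real {..<e} (norm (bisect p q x - y)) = l"
    unfolding k_def l_def by (simp_all add: indicator_def norm_bisect_left)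
  have nd: "(norm (x - bisect p q y))\<^sup>2 = (norm (x - y))\<^sup>2 + 4 * (side p q x * side p q y) / (norm (p - q))\<^sup>2"
    using norm_diff_bisect[OF pq, of x y] by (simp only: mult.assoc)
  have lk: "l \<le> k" if "0 \<le> side p q x * side p q y"
  proof -
    have "(norm (x - y))\<^sup>2 \<le> (norm (x - bisect p q y))\<^sup>2" unfolding nd using that by simp
    then have "norm (x - y) \<le> norm (x - bisect p q y)" by (rule power2_le_imp_le) simp
    then show ?thesis unfolding k_def l_def by (simp add: indicator_def)
  qed
  have kl': "k \<le> l" if "side p q x * side p q y \<le> 0"
  proof -
    have "4 * (side p q x * side p q y) / (norm (p - q))\<^sup>2 \<le> 0" using that by (intro divide_nonpos_nonneg) auto
    then have "(norm (x - bisect p q y))\<^sup>2 \<le> (norm (x - y))\<^sup>2" unfolding nd by simp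
    then have "norm (x - bisect p q y) \<le> norm (x - y)" by (rule power2_le_imp_le) simp
    then show ?thesis unfolding k_def l_def by (simp add: indicator_def)
  qed
  have nn: "0 \<le> k" "0 \<le> l" by (simp_all add: k_def l_def)
  note four = four_point[OF nn(2), of k a a' b b'] four_point[OF nn(1), of l a a' b' b]
  have goal: "((A - B)\<^sup>2 + (A' - B')\<^sup>2) * k + ((A - B')\<^sup>2 + (A' - B)\<^sup>2) * l
     \<le> ((a - b)\<^sup>2 + (a' - b')\<^sup>2) * k + ((a - b')\<^sup>2 + (a' - b)\<^sup>2) * l"
    if "A = polarize p q u x" "A' = polarize p q u (bisect p q x)" "B = polarize p q u y" "B' = polarize p q u (bisect p q y)"
    for A A' B B'
  proof -
    consider "0 \<le> side p q x" "0 \<le> side p q y" | "0 \<le> side p q x" "side p q y \<le> 0"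
      | "side p q x \<le> 0" "0 \<le> side p q y" | "side p q x \<le> 0" "side p q y \<le> 0" by linarith
    then show ?thesis
    proof cases
      case 1
      then have "l \<le> k" by (intro lk mult_nonneg_nonneg)
      then show ?thesis
        using four(1) unfolding that polarize_nonneg_side[OF pq 1(1)] polarize_nonneg_side[OF pq 1(2)]
          a_def[symmetric] a'_def[symmetric] b_def[symmetric] b'_def[symmetric] by blast
    next
      case 2
      then have "k \<le> l" by (intro kl' mult_nonneg_nonpos)
      then show ?thesis
        using four(2) unfolding that polarize_nonneg_side[OF pq 2(1)] polarize_nonpos_side[OF pq 2(2)]
          a_def[symmetric] a'_def[symmetric] b_def[symmetric] b'_def[symmetric] max.commute[of b' b] min.commute[of b' b]
        by (simp only: add.commute)
    next
      case 3
      then have "k \<le> l" by (intro kl' mult_nonpos_nonneg)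
      then show ?thesis
        using four(2) unfolding that polarize_nonpos_side[OF pq 3(1)] polarize_nonneg_side[OF pq 3(2)]
          a_def[symmetric] a'_def[symmetric] b_def[symmetric] b'_def[symmetric] max.commute[of b' b] min.commute[of b' b]
        by (simp only: add.commute)
    next
      case 4
      then have "l \<le> k" by (intro lk mult_nonpos_nonpos)
      then show ?thesis
        using four(1) unfolding that polarize_nonpos_side[OF pq 4(1)] polarize_nonpos_side[OF pq 4(2)]
          a_def[symmetric] a'_def[symmetric] b_def[symmetric] b'_def[symmetric] by (simp only: add.commute)
    qed
  qed
  show ?thesis
    unfolding K_def kl k_def[symmetric] l_def[symmetric] a_def[symmetric] a'_def[symmetric] b_def[symmetric] b'_def[symmetric]
    using goal[OF refl refl refl refl] by (simp only: distrib_right)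
qed

lemma polarize_nonlocal_energy:
  fixes u :: "'a::euclidean_space \<Rightarrow> real"
  assumes um[measurable]: "u \<in> borel_measurable borel" and pq: "p \<noteq> q"
  shows "nonlocal_energy e (polarize p q u) \<le> nonlocal_energy e u"
proof -
  have "4 * nonlocal_energy e (polarize p q u) \<le> 4 * nonlocal_energy e u"
    unfolding nonlocal_energy_pairs[OF um, of e p q] nonlocal_energy_pairs[OF polarize_measurable[OF um, of p q], of e p q]
  proof (intro nn_integral_mono)
    fix x y
    show "ennreal ((polarize p q u x - polarize p q u y)\<^sup>2 * indicator {..<e} (norm (x - y)))
      + ennreal ((polarize p q u x - polarize p q u (bisect p q y))\<^sup>2 * indicator {..<e} (norm (x - bisect p q y)))
      + (ennreal ((polarize p q u (bisect p q x) - polarize p q u y)\<^sup>2 * indicator {..<e} (norm (bisect p q x - y)))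
      + ennreal ((polarize p q u (bisect p q x) - polarize p q u (bisect p q y))\<^sup>2 * indicator {..<e} (norm (bisect p q x - bisect p q y))))
      \<le> ennreal ((u x - u y)\<^sup>2 * indicator {..<e} (norm (x - y)))
      + ennreal ((u x - u (bisect p q y))\<^sup>2 * indicator {..<e} (norm (x - bisect p q y)))
      + (ennreal ((u (bisect p q x) - u y)\<^sup>2 * indicator {..<e} (norm (bisect p q x - y)))
      + ennreal ((u (bisect p q x) - u (bisect p q y))\<^sup>2 * indicator {..<e} (norm (bisect p q x - bisect p q y))))"
      using polarize_four_point[OF pq, where u=u and e=e and x=x and y=y]
      by (simp add: ennreal_plus[symmetric] ennreal_leI del: ennreal_plus)
  qed
  then show ?thesis by (subst (asm) ennreal_mult_le_mult_iff) auto
qed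

text \<open>
  Fatou's lemma, applied to both integrals.
\<close>

lemma nonlocal_energy_pointwise_limit:
  fixes u :: "nat \<Rightarrow> 'a::euclidean_space \<Rightarrow> real"
  assumes [measurable]: "\<And>n. u n \<in> borel_measurable borel"
    and lim: "\<And>x. (\<lambda>n. u n x) \<longlonglongrightarrow> v x" and le: "\<And>n. nonlocal_energy e (u n) \<le> C"
  shows "nonlocal_energy e v \<le> C"
proof -
  have "nonlocal_energy e v = (\<integral>\<^sup>+x. (\<integral>\<^sup>+y. liminf (\<lambda>n. ennreal ((u n x - u n y)\<^sup>2 * indicator {..<e} (norm (x - y)))) \<partial>lborel) \<partial>lborel)"
    unfolding nonlocal_energy_def
    by (intro nn_integral_cong lim_imp_Liminf[symmetric] tendsto_ennrealI tendsto_intros lim) auto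
  also have "\<dots> \<le> (\<integral>\<^sup>+x. liminf (\<lambda>n. \<integral>\<^sup>+y. ennreal ((u n x - u n y)\<^sup>2 * indicator {..<e} (norm (x - y))) \<partial>lborel) \<partial>lborel)"
    by (intro nn_integral_mono nn_integral_liminf) measurable
  also have "\<dots> \<le> liminf (\<lambda>n. \<integral>\<^sup>+x. (\<integral>\<^sup>+y. ennreal ((u n x - u n y)\<^sup>2 * indicator {..<e} (norm (x - y))) \<partial>lborel) \<partial>lborel)"
    by (intro nn_integral_liminf) measurable
  also have "\<dots> \<le> liminf (\<lambda>n. C)"
    using le unfolding nonlocal_energy_def by (intro Liminf_mono always_eventually allI)
  finally show ?thesis by (simp add: Liminf_const)
qed

section \<open>The Dirichlet energy as a limit of nonlocal energies\<close>

lemma reflection_swap: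
  fixes v w :: "'a::euclidean_space"
  assumes "norm v = norm w" "v \<noteq> w"
  shows "reflection (v - w) v = w"
proof -
  have "v \<bullet> v = w \<bullet> w" using assms(1) by (simp only: power2_norm_eq_inner[symmetric])
  then have eq: "(v - w) \<bullet> (v - w) = 2 * (v \<bullet> (v - w))"
    by (simp add: inner_diff_left inner_diff_right inner_commute[of w v])
  have "(v - w) \<bullet> (v - w) \<noteq> 0" using assms(2) by simp
  then have "2 * (v \<bullet> (v - w)) / ((v - w) \<bullet> (v - w)) = 1"
    unfolding eq[symmetric] by (rule divide_self)
  then show ?thesis by (simp only: reflection_def) simp
qed

lemma reflection_adjoint: "v \<bullet> reflection w h = reflection w v \<bullet> h"
  by (simp add: reflection_def inner_diff_left inner_diff_right inner_commute[of w h])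

text \<open>
  The nonlocal energy of the linear function \<open>h \<mapsto> v \<bullet> h\<close> at one point.
\<close>

definition second_moment :: "real \<Rightarrow> 'a::euclidean_space \<Rightarrow> ennreal" where
  "second_moment e v = (\<integral>\<^sup>+h. ennreal ((v \<bullet> h)\<^sup>2 * indicator {..<e} (norm h)) \<partial>lborel)"

text \<open>
  A reflection exchanges two vectors of equal norm and preserves the ball.
\<close>

lemma second_moment_cong:
  fixes v w :: "'a::euclidean_space"
  assumes "norm v = norm w" shows "second_moment e v = second_moment e w"
proof (cases "v = w")
  case False
  let ?f = "\<lambda>h. ennreal ((v \<bullet> h)\<^sup>2 * indicator {..<e} (norm h))"
  have "second_moment e v = (\<integral>\<^sup>+h. ?f (reflection (v - w) h) \<partial>lborel)"
    unfolding second_moment_def by (rule nn_integral_reflection[symmetric]) measurable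
  also have "\<dots> = second_moment e w"
    unfolding second_moment_def reflection_adjoint reflection_swap[OF assms False] norm_reflection ..
  finally show ?thesis .
qed simp

lemma second_moment_scale: "second_moment e (c *\<^sub>R v) = ennreal (c\<^sup>2) * second_moment e v"
proof -
  have "second_moment e (c *\<^sub>R v) = (\<integral>\<^sup>+h. ennreal (c\<^sup>2) * ennreal ((v \<bullet> h)\<^sup>2 * indicator {..<e} (norm h)) \<partial>lborel)"
    unfolding second_moment_def
    by (intro nn_integral_cong) (simp add: power_mult_distrib mult.assoc ennreal_mult[symmetric])
  also have "\<dots> = ennreal (c\<^sup>2) * second_moment e v"
    unfolding second_moment_def by (rule nn_integral_cmult) measurable
  finally show ?thesis .
qed

text \<open>The normalizing constant: the second moment of the ball of radius \<open>e\<close> in a coordinate direction.\<close>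

definition kappa :: "'a::euclidean_space itself \<Rightarrow> real \<Rightarrow> ennreal" where
  "kappa _ e = second_moment e (SOME b::'a. b \<in> Basis)"

lemma second_moment_eq: "second_moment e (v::'a::euclidean_space) = ennreal ((norm v)\<^sup>2) * kappa TYPE('a) e"
proof -
  define b :: 'a where "b = (SOME b. b \<in> Basis)"
  have "b \<in> Basis" unfolding b_def using nonempty_Basis by (rule some_in_eq[THEN iffD2])
  then have "norm v = norm (norm v *\<^sub>R b)" by simp
  then show ?thesis
    unfolding kappa_def b_def[symmetric] second_moment_scale[symmetric] by (rule second_moment_cong)
qed

lemma norm_second_moment:
  "(\<integral>\<^sup>+h. ennreal ((norm h)\<^sup>2 * indicator {..<e} (norm h)) \<partial>(lborel :: 'a::euclidean_space measure))
    = ennreal (real DIM('a)) * kappa TYPE('a) e"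
proof -
  let ?f = "\<lambda>h::'a. ennreal ((norm h)\<^sup>2 * indicator {..<e} (norm h))"
  have f: "?f h = (\<Sum>b\<in>Basis. ennreal ((b \<bullet> h)\<^sup>2 * indicator {..<e} (norm h)))" for h :: 'a
  proof -
    have "(norm h)\<^sup>2 = (\<Sum>b\<in>Basis. (b \<bullet> h)\<^sup>2)"
      unfolding power2_norm_eq_inner euclidean_inner[of h h] by (simp add: power2_eq_square inner_commute)
    then show ?thesis by (simp add: sum_distrib_right sum_ennreal)
  qed
  have "(\<integral>\<^sup>+h. ?f h \<partial>(lborel :: 'a measure)) = (\<Sum>b\<in>(Basis::'a set). second_moment e b)"
    unfolding second_moment_def f by (rule nn_integral_sum) measurable
  also have "\<dots> = (\<Sum>b\<in>(Basis::'a set). kappa TYPE('a) e)"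
    by (intro sum.cong refl) (simp add: second_moment_eq)
  finally show ?thesis by (simp add: ennreal_of_nat_eq_real_of_nat)
qed

lemma kappa_finite: "kappa TYPE('a::euclidean_space) e \<noteq> \<infinity>"
proof -
  define b :: 'a where "b = (SOME b. b \<in> Basis)"
  have b: "b \<in> Basis" unfolding b_def using nonempty_Basis by (rule some_in_eq[THEN iffD2])
  have "kappa TYPE('a) e \<le> (\<integral>\<^sup>+h. ennreal (e\<^sup>2) * indicator (ball (0::'a) e) h \<partial>lborel)"
    unfolding kappa_def second_moment_def b_def[symmetric]
  proof (rule nn_integral_mono)
    fix h :: 'a
    show "ennreal ((b \<bullet> h)\<^sup>2 * indicator {..<e} (norm h)) \<le> ennreal (e\<^sup>2) * indicator (ball 0 e) h"
    proof (cases "norm h < e")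
      case True
      have "\<bar>b \<bullet> h\<bar> \<le> norm h" using Basis_le_norm[OF b, of h] by (simp add: inner_commute)
      then have "\<bar>b \<bullet> h\<bar> \<le> \<bar>e\<bar>" using True by linarith
      then have "(b \<bullet> h)\<^sup>2 \<le> e\<^sup>2" by (simp only: abs_le_square_iff)
      then show ?thesis using True by (simp add: ennreal_leI)
    qed simp
  qed
  also have "\<dots> = ennreal (e\<^sup>2) * emeasure lborel (ball (0::'a) e)"
    by (rule nn_integral_cmult_indicator) simp
  also have "\<dots> < \<infinity>"
    using emeasure_lborel_ball_finite[of "0::'a" e] by (simp add: ennreal_mult_less_top)
  finally show ?thesis by simp
qed

lemma AE_open_nonempty:
  fixes U :: "'a::euclidean_space set"
  assumes "AE x in lborel. P x" "open U" "U \<noteq> {}"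
  obtains x where "x \<in> U" "P x"
proof -
  obtain z r where r: "r > 0" "ball z r \<subseteq> U" using assms(2,3) open_contains_ball by blast
  have "\<exists>x\<in>U. P x"
  proof (rule ccontr)
    assume "\<not> (\<exists>x\<in>U. P x)"
    then have "AE x in lborel. x \<notin> ball z r"
      using assms(1) r(2) by (auto elim!: eventually_mono)
    then have "emeasure lborel (ball z r) = 0"
      by (subst (asm) AE_iff_measurable[where N="ball z r"]) auto
    then show False using content_ball_pos[OF r(1), of z] by (simp add: measure_def)
  qed
  then show ?thesis using that by blast
qed

lemma kappa_pos: assumes "e > 0" shows "kappa TYPE('a::euclidean_space) e \<noteq> 0"
proof
  assume "kappa TYPE('a) e = 0"
  then have "(\<integral>\<^sup>+h. ennreal ((norm h)\<^sup>2 * indicator {..<e} (norm h)) \<partial>(lborel :: 'a measure)) = 0"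
    using norm_second_moment[where 'a='a, of e] by simp
  then have "AE h in (lborel :: 'a measure). ennreal ((norm h)\<^sup>2 * indicator {..<e} (norm h)) = 0"
    by (subst (asm) nn_integral_0_iff_AE) auto
  then have "AE h in (lborel :: 'a measure). h \<noteq> 0 \<and> ennreal ((norm h)\<^sup>2 * indicator {..<e} (norm h)) = 0"
    using AE_neq_point[of "0::'a"] by eventually_elim simp
  from AE_open_nonempty[OF this, of "ball 0 e"] obtain h :: 'a
    where "h \<in> ball 0 e" "h \<noteq> 0" "ennreal ((norm h)\<^sup>2 * indicator {..<e} (norm h)) = 0"
    using assms by auto
  then show False by (simp add: ennreal_eq_0_iff)
qed

lemma nonlocal_energy_shift:
  fixes u :: "'a::euclidean_space \<Rightarrow> real"
  assumes [measurable]: "u \<in> borel_measurable borel"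
  shows "nonlocal_energy e u = (\<integral>\<^sup>+x. (\<integral>\<^sup>+h. ennreal ((u (x + h) - u x)\<^sup>2 * indicator {..<e} (norm h)) \<partial>lborel) \<partial>lborel)"
  unfolding nonlocal_energy_def
proof (rule nn_integral_cong)
  fix x :: 'a
  have "(\<integral>\<^sup>+y. ennreal ((u x - u y)\<^sup>2 * indicator {..<e} (norm (x - y))) \<partial>lborel)
    = (\<integral>\<^sup>+h. ennreal ((u x - u (h + x))\<^sup>2 * indicator {..<e} (norm (x - (h + x)))) \<partial>lborel)"
    by (rule nn_integral_translate[symmetric]) measurable
  then show "(\<integral>\<^sup>+y. ennreal ((u x - u y)\<^sup>2 * indicator {..<e} (norm (x - y))) \<partial>lborel)
    = (\<integral>\<^sup>+h. ennreal ((u (x + h) - u x)\<^sup>2 * indicator {..<e} (norm h)) \<partial>lborel)"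
    by (simp add: power2_commute[of "u x"] add.commute)
qed

text \<open>Taylor's formula to second order gives an error of relative size \<open>e\<close>.\<close>

lemma nonlocal_energy_test:
  fixes \<phi> :: "'a::euclidean_space \<Rightarrow> real"
  assumes \<phi>: "\<phi> \<in> test_functions"
  defines "D \<equiv> LINT x|lborel. (norm (gradient \<phi> x))\<^sup>2"
  obtains C where "C \<ge> 0"
    "\<And>e. 0 < e \<Longrightarrow> e \<le> 1 \<Longrightarrow> nonlocal_energy e \<phi> \<le> kappa TYPE('a) e * ennreal (D + C * e)"
    "\<And>e. 0 < e \<Longrightarrow> e \<le> 1 \<Longrightarrow> kappa TYPE('a) e * ennreal D \<le> nonlocal_energy e \<phi> + kappa TYPE('a) e * ennreal (C * e)"
proof -
  have [measurable]: "\<phi> \<in> borel_measurable borel" "gradient \<phi> \<in> borel_measurable borel"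
    using test_measurable[OF \<phi>] gradient_measurable[OF \<phi>] by auto
  obtain R where R: "R > 0" "\<And>x. R < norm x \<Longrightarrow> \<phi> x = 0" using test_support[OF \<phi>] by blast
  obtain C where C: "C > 0" "\<And>x h. \<bar>\<phi> (x + h) - \<phi> x - gradient \<phi> x \<bullet> h\<bar> \<le> C * (norm h)\<^sup>2"
    using test_taylor[OF \<phi>] by blast
  obtain L where L: "L > 0" "\<And>x. norm (gradient \<phi> x) \<le> L"
    using bounded_compact_support[OF continuous_gradient[OF test_smooth[OF \<phi>]] gradient_support[of R \<phi>, OF R(2)]] by blast
  define K where "K = C * (2 * L + C)"
  have K: "K > 0" using C L by (simp add: K_def)
  define ch where "ch x = indicat_real (cball (0::'a) (R + 1)) x" for x
  have [measurable]: "ch \<in> borel_measurable borel" unfolding ch_def by (intro borel_measurable_indicator) simp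
  have ch0: "0 \<le> ch x" for x by (simp add: ch_def)
  define V where "V = measure lborel (cball (0::'a) (R + 1))"
  have V: "(\<integral>\<^sup>+x. ennreal (ch x) \<partial>lborel) = ennreal V"
    unfolding ch_def V_def ennreal_indicator using emeasure_lborel_cball_finite[of "0::'a" "R + 1"]
    by (simp add: emeasure_eq_ennreal_measure less_top)
  have i2: "integrable lborel (\<lambda>x. (norm (gradient \<phi> x))\<^sup>2)" by (rule test_norm_gradient_integrable[OF \<phi>])
  have D: "(\<integral>\<^sup>+x. ennreal ((norm (gradient \<phi> x))\<^sup>2) \<partial>lborel) = ennreal D"
    unfolding D_def by (rule nn_integral_eq_integral[OF i2]) simp
  have D0: "D \<ge> 0" by (simp add: D_def)
  have ptw: "\<bar>(\<phi> (x + h) - \<phi> x)\<^sup>2 - (gradient \<phi> x \<bullet> h)\<^sup>2\<bar> \<le> K * e * ch x * (norm h)\<^sup>2"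
    if e: "e \<le> 1" "norm h < e" for x h e
  proof (cases "norm x \<le> R + 1")
    case True
    define T G where "T = \<phi> (x + h) - \<phi> x" and "G = gradient \<phi> x \<bullet> h"
    have TG: "\<bar>T - G\<bar> \<le> C * (norm h)\<^sup>2" unfolding T_def G_def by (rule C(2))
    have "\<bar>G\<bar> \<le> norm (gradient \<phi> x) * norm h" unfolding G_def by (rule Cauchy_Schwarz_ineq2)
    also have "\<dots> \<le> L * norm h" by (intro mult_right_mono L(2)) simp
    finally have G: "\<bar>G\<bar> \<le> L * norm h" .
    have "C * (norm h)\<^sup>2 \<le> C * norm h"
      using C e by (simp add: power2_eq_square mult_left_le)
    then have "\<bar>T + G\<bar> \<le> (2 * L + C) * norm h" using TG G by (simp add: distrib_right)
    also have "\<dots> \<le> (2 * L + C) * e" using e L C by (intro mult_left_mono) auto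
    finally have "\<bar>T - G\<bar> * \<bar>T + G\<bar> \<le> (C * (norm h)\<^sup>2) * ((2 * L + C) * e)"
      using TG C by (intro mult_mono) auto
    moreover have "T\<^sup>2 - G\<^sup>2 = (T - G) * (T + G)" by (simp add: power2_eq_square algebra_simps)
    ultimately show ?thesis
      using True unfolding T_def[symmetric] G_def[symmetric] by (simp add: ch_def K_def abs_mult mult_ac)
  next
    case False
    have "norm x \<le> norm (x + h) + norm h" by (metis add_diff_cancel norm_triangle_ineq4)
    then have "R < norm (x + h)" "R < norm x" using False e by linarith+
    then have "\<phi> (x + h) = 0" "\<phi> x = 0" "gradient \<phi> x = 0"
      using R(2) gradient_support[of R \<phi>, OF R(2)] by auto
    then show ?thesis using False by (simp add: ch_def)
  qed
  define N where "N = real DIM('a)"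
  define Ct where "Ct = K * N * V"
  have Ct: "Ct \<ge> 0" using K by (simp add: Ct_def N_def V_def)
  have err: "(\<integral>\<^sup>+x. (\<integral>\<^sup>+h. ennreal (K * e * ch x) * ennreal ((norm h)\<^sup>2 * indicator {..<e} (norm h)) \<partial>(lborel :: 'a measure)) \<partial>lborel)
    = kappa TYPE('a) e * ennreal (Ct * e)" if e: "0 < e" for e
  proof -
    have "(\<integral>\<^sup>+x. (\<integral>\<^sup>+h. ennreal (K * e * ch x) * ennreal ((norm h)\<^sup>2 * indicator {..<e} (norm h)) \<partial>(lborel :: 'a measure)) \<partial>lborel)
      = (\<integral>\<^sup>+x. (ennreal (K * e) * (ennreal N * kappa TYPE('a) e)) * ennreal (ch x) \<partial>lborel)"
    proof (rule nn_integral_cong)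
      fix x :: 'a
      have 1: "(\<integral>\<^sup>+h. ennreal (K * e * ch x) * ennreal ((norm h)\<^sup>2 * indicator {..<e} (norm h)) \<partial>(lborel :: 'a measure))
        = ennreal (K * e * ch x) * (ennreal N * kappa TYPE('a) e)"
        unfolding N_def norm_second_moment[symmetric] by (rule nn_integral_cmult) measurable
      have 2: "ennreal (K * e * ch x) = ennreal (K * e) * ennreal (ch x)"
        using K e ch0 by (intro ennreal_mult) auto
      show "(\<integral>\<^sup>+h. ennreal (K * e * ch x) * ennreal ((norm h)\<^sup>2 * indicator {..<e} (norm h)) \<partial>(lborel :: 'a measure))
        = (ennreal (K * e) * (ennreal N * kappa TYPE('a) e)) * ennreal (ch x)"
        unfolding 1 unfolding 2 by (simp only: mult_ac)
    qed
    also have "\<dots> = (ennreal (K * e) * (ennreal N * kappa TYPE('a) e)) * ennreal V"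
      unfolding V[symmetric] by (rule nn_integral_cmult) measurable
    also have "\<dots> = kappa TYPE('a) e * (ennreal (K * e) * ennreal N * ennreal V)" by (simp only: mult_ac)
    also have "ennreal (K * e) * ennreal N * ennreal V = ennreal (Ct * e)"
      using K e by (simp add: ennreal_mult[symmetric] Ct_def N_def V_def mult_ac)
    finally show ?thesis .
  qed
  have main: "(\<integral>\<^sup>+x. (\<integral>\<^sup>+h. ennreal ((gradient \<phi> x \<bullet> h)\<^sup>2 * indicator {..<e} (norm h)) \<partial>lborel) \<partial>lborel) = kappa TYPE('a) e * ennreal D" for e
  proof -
    have "(\<integral>\<^sup>+x. (\<integral>\<^sup>+h. ennreal ((gradient \<phi> x \<bullet> h)\<^sup>2 * indicator {..<e} (norm h)) \<partial>lborel) \<partial>lborel)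
      = (\<integral>\<^sup>+x. ennreal ((norm (gradient \<phi> x))\<^sup>2) * kappa TYPE('a) e \<partial>lborel)"
      unfolding second_moment_eq[symmetric] second_moment_def ..
    also have "\<dots> = ennreal D * kappa TYPE('a) e"
      unfolding D[symmetric] by (rule nn_integral_multc) measurable
    finally show ?thesis by (simp only: mult.commute)
  qed
  have split: "(\<integral>\<^sup>+x. (\<integral>\<^sup>+h. ennreal (a x h) + ennreal (K * e * ch x) * ennreal ((norm h)\<^sup>2 * indicator {..<e} (norm h)) \<partial>(lborel :: 'a measure)) \<partial>lborel)
    = (\<integral>\<^sup>+x. (\<integral>\<^sup>+h. ennreal (a x h) \<partial>(lborel :: 'a measure)) \<partial>lborel) + kappa TYPE('a) e * ennreal (Ct * e)"
    if e: "0 < e" and am[measurable]: "(\<lambda>z. a (fst z) (snd z)) \<in> borel_measurable (borel \<Otimes>\<^sub>M borel)" for e and a :: "'a \<Rightarrow> 'a \<Rightarrow> real"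
  proof -
    have a1[measurable]: "a x \<in> borel_measurable borel" for x
      using measurable_compose_Pair1[OF _ am, of x] by simp
    have a2[measurable]: "(\<lambda>x. \<integral>\<^sup>+h. ennreal (a x h) \<partial>(lborel :: 'a measure)) \<in> borel_measurable borel"
    proof (rule lborel.borel_measurable_nn_integral)
      have "(\<lambda>z. ennreal (a (fst z) (snd z))) \<in> borel_measurable (borel \<Otimes>\<^sub>M borel)" using am by measurable
      then show "(\<lambda>(x, h). ennreal (a x h)) \<in> borel_measurable (borel \<Otimes>\<^sub>M lborel)"
        by (simp add: split_beta' measurable_cong_sets[OF sets_pair_measure_cong[OF refl sets_lborel] refl])
    qed
    have "(\<integral>\<^sup>+h. ennreal (a x h) + ennreal (K * e * ch x) * ennreal ((norm h)\<^sup>2 * indicator {..<e} (norm h)) \<partial>(lborel :: 'a measure))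
      = (\<integral>\<^sup>+h. ennreal (a x h) \<partial>(lborel :: 'a measure)) + (\<integral>\<^sup>+h. ennreal (K * e * ch x) * ennreal ((norm h)\<^sup>2 * indicator {..<e} (norm h)) \<partial>(lborel :: 'a measure))" for x
      by (rule nn_integral_add) measurable
    then show ?thesis
      unfolding err[OF e, symmetric] by (simp only:) (rule nn_integral_add, measurable)
  qed
  have ad: "ennreal (A * i) \<le> ennreal (B * i) + ennreal (K * e * ch x) * ennreal ((norm h)\<^sup>2 * i)"
    if "i = 0 \<or> i = 1" "i = 1 \<Longrightarrow> \<bar>A - B\<bar> \<le> K * e * ch x * (norm h)\<^sup>2" "0 \<le> B" "0 < e" for A B i e x and h :: 'a
  proof (cases "i = 0")
    case False
    then have i: "i = 1" using that by simp
    have "0 \<le> K * e * ch x" using K that ch0 by simp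
    then show ?thesis
      using that(2)[OF i] that(3) unfolding i
      by (simp add: ennreal_mult[symmetric] ennreal_plus[symmetric] ennreal_leI del: ennreal_plus)
  qed simp
  have mT: "(\<lambda>z. (\<phi> (fst z + snd z) - \<phi> (fst z))\<^sup>2 * indicator {..<e} (norm (snd z))) \<in> borel_measurable (borel \<Otimes>\<^sub>M borel)" for e
    by measurable
  have mG: "(\<lambda>z. (gradient \<phi> (fst z) \<bullet> snd z)\<^sup>2 * indicator {..<e} (norm (snd z))) \<in> borel_measurable (borel \<Otimes>\<^sub>M borel)" for e
    by measurable
  show ?thesis
  proof (rule that[OF Ct])
    fix e :: real assume e: "0 < e" "e \<le> 1"
    have i01: "indicat_real {..<e} (norm h) = 0 \<or> indicat_real {..<e} (norm h) = 1" for h :: 'a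
      by (simp add: indicator_def)
    have i1: "norm h < e" if "indicat_real {..<e} (norm h) = 1" for h :: 'a
      using that by (simp add: indicator_eq_1_iff)
    have "nonlocal_energy e \<phi> \<le> (\<integral>\<^sup>+x. (\<integral>\<^sup>+h. ennreal ((gradient \<phi> x \<bullet> h)\<^sup>2 * indicator {..<e} (norm h))
       + ennreal (K * e * ch x) * ennreal ((norm h)\<^sup>2 * indicator {..<e} (norm h)) \<partial>(lborel :: 'a measure)) \<partial>lborel)"
      unfolding nonlocal_energy_shift[OF \<open>\<phi> \<in> borel_measurable borel\<close>]
      by (intro nn_integral_mono ad i01 ptw[OF e(2) i1] e(1)) auto
    also have "\<dots> = kappa TYPE('a) e * ennreal D + kappa TYPE('a) e * ennreal (Ct * e)"
      unfolding split[OF e(1) mG] main ..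
    also have "\<dots> = kappa TYPE('a) e * ennreal (D + Ct * e)"
      using D0 Ct e by (simp add: distrib_left)
    finally show "nonlocal_energy e \<phi> \<le> kappa TYPE('a) e * ennreal (D + Ct * e)" .
    have ptw': "\<bar>(gradient \<phi> x \<bullet> h)\<^sup>2 - (\<phi> (x + h) - \<phi> x)\<^sup>2\<bar> \<le> K * e * ch x * (norm h)\<^sup>2" if "norm h < e" for x h
      using ptw[OF e(2) that, of x] by (simp add: abs_minus_commute)
    have "kappa TYPE('a) e * ennreal D \<le> (\<integral>\<^sup>+x. (\<integral>\<^sup>+h. ennreal ((\<phi> (x + h) - \<phi> x)\<^sup>2 * indicator {..<e} (norm h))
       + ennreal (K * e * ch x) * ennreal ((norm h)\<^sup>2 * indicator {..<e} (norm h)) \<partial>(lborel :: 'a measure)) \<partial>lborel)"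
      unfolding main[symmetric]
      by (intro nn_integral_mono ad i01 ptw'[OF i1] e(1)) auto
    also have "\<dots> = nonlocal_energy e \<phi> + kappa TYPE('a) e * ennreal (Ct * e)"
      unfolding split[OF e(1) mT] nonlocal_energy_shift[OF \<open>\<phi> \<in> borel_measurable borel\<close>] ..
    finally show "kappa TYPE('a) e * ennreal D \<le> nonlocal_energy e \<phi> + kappa TYPE('a) e * ennreal (Ct * e)" .
  qed
qed

text \<open>
  Divide by \<open>kappa\<close>, which is positive and finite, and let \<open>e\<close> tend to zero.
\<close>

lemma dirichlet_le_of_nonlocal_le:
  fixes v \<phi> :: "'a::euclidean_space \<Rightarrow> real"
  assumes v: "v \<in> test_functions" and \<phi>: "\<phi> \<in> test_functions"
    and le: "\<And>e. 0 < e \<Longrightarrow> nonlocal_energy e v \<le> nonlocal_energy e \<phi>"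
  shows "(LINT x|lborel. (norm (gradient v x))\<^sup>2) \<le> (LINT x|lborel. (norm (gradient \<phi> x))\<^sup>2)"
proof -
  define A B where "A = (LINT x|lborel. (norm (gradient v x))\<^sup>2)" and "B = (LINT x|lborel. (norm (gradient \<phi> x))\<^sup>2)"
  have AB: "A \<ge> 0" "B \<ge> 0" by (simp_all add: A_def B_def)
  obtain C where C: "C \<ge> 0"
    "\<And>e. 0 < e \<Longrightarrow> e \<le> 1 \<Longrightarrow> kappa TYPE('a) e * ennreal A \<le> nonlocal_energy e v + kappa TYPE('a) e * ennreal (C * e)"
    unfolding A_def using nonlocal_energy_test[OF v] by metis
  obtain C' where C': "C' \<ge> 0"
    "\<And>e. 0 < e \<Longrightarrow> e \<le> 1 \<Longrightarrow> nonlocal_energy e \<phi> \<le> kappa TYPE('a) e * ennreal (B + C' * e)"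
    unfolding B_def using nonlocal_energy_test[OF \<phi>] by metis
  have bd: "A \<le> B + (C' + C) * e" if e: "0 < e" "e \<le> 1" for e
  proof -
    have "kappa TYPE('a) e * ennreal A \<le> kappa TYPE('a) e * ennreal (B + C' * e) + kappa TYPE('a) e * ennreal (C * e)"
      using order_trans[OF C(2)[OF e] add_right_mono[OF order_trans[OF le[OF e(1)] C'(2)[OF e]]]] .
    also have "\<dots> = kappa TYPE('a) e * ennreal (B + (C' + C) * e)"
      using AB C(1) C'(1) e by (simp add: distrib_left[symmetric] distrib_right ennreal_plus[symmetric] add.assoc del: ennreal_plus)
    finally have "ennreal A \<le> ennreal (B + (C' + C) * e)"
      using kappa_pos[OF e(1), where 'a='a] kappa_finite[where 'a='a, of e]
      by (subst (asm) ennreal_mult_le_mult_iff) auto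
    then show ?thesis using AB C(1) C'(1) e by (subst (asm) ennreal_le_iff) auto
  qed
  have "(\<lambda>n. B + (C' + C) * inverse (real (Suc n))) \<longlonglongrightarrow> B + (C' + C) * 0"
    by (intro tendsto_intros LIMSEQ_inverse_real_of_nat)
  then have "A \<le> B + (C' + C) * 0"
    by (rule LIMSEQ_le_const) (use bd in \<open>auto simp: inverse_le_1_iff simp del: of_nat_Suc\<close>)
  then show ?thesis by (simp add: A_def B_def)
qed

section \<open>Mollification\<close>

lemma has_derivative_quadratic:
  fixes f :: "'a::euclidean_space \<Rightarrow> real"
  assumes "\<And>h. \<bar>f (x + h) - f x - F \<bullet> h\<bar> \<le> K * (norm h)\<^sup>2"
  shows "(f has_derivative (\<lambda>h. F \<bullet> h)) (at x)"
  unfolding has_derivative_at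
proof
  show "bounded_linear (\<lambda>h. F \<bullet> h)" by (rule bounded_linear_inner_right)
  show "(\<lambda>h. norm (f (x + h) - f x - F \<bullet> h) / norm h) \<midarrow>0\<rightarrow> 0"
  proof (rule Lim_null_comparison)
    have "((\<lambda>h::'a. K * norm h) \<longlongrightarrow> K * norm (0::'a)) (at 0)" by (intro tendsto_intros)
    then show "((\<lambda>h::'a. K * norm h) \<longlongrightarrow> 0) (at 0)" by simp
    have "norm (norm (f (x + h) - f x - F \<bullet> h) / norm h) \<le> K * norm h" if "h \<noteq> 0" for h
      using assms[of h] that by (simp add: pos_divide_le_eq power2_eq_square mult.assoc)
    then show "\<forall>\<^sub>F h in at 0. norm (norm (f (x + h) - f x - F \<bullet> h) / norm h) \<le> K * norm h"
      by (simp add: eventually_at_filter)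
  qed
qed

lemma integral_uminus:
  fixes f :: "'a::euclidean_space \<Rightarrow> real"
  assumes [measurable]: "f \<in> borel_measurable borel"
  shows "(LINT x|lborel. f (- x)) = (LINT x|lborel. f x)"
proof -
  have U: "distr lborel borel uminus = (lborel :: 'a measure)"
    by (rule lborel_distr_isometric_involution) (auto intro: linearI)
  show ?thesis by (subst (2) U[symmetric]) (simp add: integral_distr)
qed

lemma integral_reflection:
  fixes f :: "'a::euclidean_space \<Rightarrow> real"
  assumes [measurable]: "f \<in> borel_measurable borel"
  shows "(LINT x|lborel. f (reflection w x)) = (LINT x|lborel. f x)"
  by (subst (2) lborel_distr_reflection[of w, symmetric]) (simp add: integral_distr)

definition convolve :: "('a::euclidean_space \<Rightarrow> real) \<Rightarrow> ('a \<Rightarrow> real) \<Rightarrow> 'a \<Rightarrow> real" where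
  "convolve \<rho> w x = (LINT y|lborel. w y * \<rho> (x - y))"

lemma convolve_swap:
  assumes [measurable]: "w \<in> borel_measurable borel" "\<rho> \<in> borel_measurable borel"
  shows "convolve \<rho> w x = (LINT z|lborel. w (x - z) * \<rho> z)"
proof -
  have "convolve \<rho> w x = (LINT y|lborel. w (y + x) * \<rho> (x - (y + x)))"
    unfolding convolve_def by (rule integral_translate[symmetric]) measurable
  also have "\<dots> = (LINT y|lborel. w (- y + x) * \<rho> (x - (- y + x)))"
    by (rule integral_uminus[symmetric]) measurable
  finally show ?thesis by simp
qed

text \<open>Derivatives fall on the kernel, so the convolutions of \<open>w\<close> with test functions are closed under differentiation.\<close>

lemma convolve_smooth:
  fixes w :: "'a::euclidean_space \<Rightarrow> real"
  assumes w: "continuous_on UNIV w" and supp: "\<And>x. R < norm x \<Longrightarrow> w x = 0" and \<rho>: "\<rho> \<in> test_functions"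
  shows "smooth (convolve \<rho> w)"
proof -
  have wi: "integrable lborel (\<lambda>y. \<bar>w y\<bar>)" using integrable_compact_support[OF w supp] by simp
  have D: "(convolve \<rho> w has_derivative (\<lambda>h. (LINT y|lborel. w y *\<^sub>R gradient \<rho> (x - y)) \<bullet> h)) (at x)"
    if \<rho>: "\<rho> \<in> test_functions" for \<rho> x
  proof -
    obtain C where C: "C > 0" "\<And>x h. \<bar>\<rho> (x + h) - \<rho> x - gradient \<rho> x \<bullet> h\<bar> \<le> C * (norm h)\<^sup>2"
      using test_taylor[OF \<rho>] by blast
    have i1: "integrable lborel (\<lambda>y. w y * \<rho> (x - y))" for x
    proof (rule integrable_compact_support)
      show "continuous_on UNIV (\<lambda>y. w y * \<rho> (x - y))"
        by (intro continuous_intros w continuous_on_compose2[OF test_continuous[OF \<rho>, of UNIV]]) auto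
    qed (use supp in auto)
    have i2: "integrable lborel (\<lambda>y. w y *\<^sub>R gradient \<rho> (x - y))" for x
    proof (rule integrable_compact_support)
      show "continuous_on UNIV (\<lambda>y. w y *\<^sub>R gradient \<rho> (x - y))"
        by (intro continuous_intros w continuous_on_compose2[OF continuous_gradient[OF test_smooth[OF \<rho>], of UNIV]]) auto
    qed (use supp in auto)
    show ?thesis
    proof (rule has_derivative_quadratic)
      fix h
      have i3: "integrable lborel (\<lambda>y. (w y *\<^sub>R gradient \<rho> (x - y)) \<bullet> h)"
        using integrable_inner_left[OF i2[of x], of h] by simp
      have eq: "convolve \<rho> w (x + h) - convolve \<rho> w x - (LINT y|lborel. w y *\<^sub>R gradient \<rho> (x - y)) \<bullet> h
        = (LINT y|lborel. w y * \<rho> (x + h - y) - w y * \<rho> (x - y) - (w y *\<^sub>R gradient \<rho> (x - y)) \<bullet> h)"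
        unfolding convolve_def integral_inner_left[OF i2, symmetric]
        using i1[of "x + h"] i1[of x] i3 by (simp del: inner_scaleR_left)
      have "\<bar>\<dots>\<bar> \<le> (LINT y|lborel. \<bar>w y * \<rho> (x + h - y) - w y * \<rho> (x - y) - (w y *\<^sub>R gradient \<rho> (x - y)) \<bullet> h\<bar>)"
        by (rule integral_abs_bound)
      also have "\<dots> \<le> (LINT y|lborel. C * (norm h)\<^sup>2 * \<bar>w y\<bar>)"
      proof (rule integral_mono)
        show "integrable lborel (\<lambda>y. \<bar>w y * \<rho> (x + h - y) - w y * \<rho> (x - y) - (w y *\<^sub>R gradient \<rho> (x - y)) \<bullet> h\<bar>)"
          by (intro integrable_abs Bochner_Integration.integrable_diff i1 i3)
        show "integrable lborel (\<lambda>y. C * (norm h)\<^sup>2 * \<bar>w y\<bar>)" by (intro integrable_mult_right wi)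
        fix y
        have "\<bar>\<rho> ((x - y) + h) - \<rho> (x - y) - gradient \<rho> (x - y) \<bullet> h\<bar> \<le> C * (norm h)\<^sup>2" by (rule C(2))
        then have "\<bar>w y\<bar> * \<bar>\<rho> ((x - y) + h) - \<rho> (x - y) - gradient \<rho> (x - y) \<bullet> h\<bar> \<le> \<bar>w y\<bar> * (C * (norm h)\<^sup>2)"
          by (intro mult_left_mono) auto
        moreover have "w y * \<rho> (x + h - y) - w y * \<rho> (x - y) - (w y *\<^sub>R gradient \<rho> (x - y)) \<bullet> h
          = w y * (\<rho> ((x - y) + h) - \<rho> (x - y) - gradient \<rho> (x - y) \<bullet> h)"
          by (simp add: right_diff_distrib algebra_simps)
        ultimately show "\<bar>w y * \<rho> (x + h - y) - w y * \<rho> (x - y) - (w y *\<^sub>R gradient \<rho> (x - y)) \<bullet> h\<bar> \<le> C * (norm h)\<^sup>2 * \<bar>w y\<bar>"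
          by (simp only: abs_mult mult.commute)
      qed
      also have "\<dots> = (C * (LINT y|lborel. \<bar>w y\<bar>)) * (norm h)\<^sup>2" by simp
      finally show "\<bar>convolve \<rho> w (x + h) - convolve \<rho> w x - (LINT y|lborel. w y *\<^sub>R gradient \<rho> (x - y)) \<bullet> h\<bar>
        \<le> (C * (LINT y|lborel. \<bar>w y\<bar>)) * (norm h)\<^sup>2" unfolding eq .
    qed
  qed
  show ?thesis
  proof (rule smooth_coinduct[of _ "{convolve \<rho> w |\<rho>. \<rho> \<in> test_functions}"])
    show "convolve \<rho> w \<in> {convolve \<rho> w |\<rho>. \<rho> \<in> test_functions}" using \<rho> by blast
    fix g :: "'a \<Rightarrow> real" assume "g \<in> {convolve \<rho> w |\<rho>. \<rho> \<in> test_functions}"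
    then obtain \<rho> where g: "g = convolve \<rho> w" and \<rho>: "\<rho> \<in> test_functions" by blast
    show "g differentiable (at x)" for x unfolding g differentiable_def using D[OF \<rho>] by blast
    fix b :: 'a assume b: "b \<in> Basis"
    have "frechet_derivative g (at x) b = convolve (\<lambda>x. frechet_derivative \<rho> (at x) b) w x" for x
    proof -
      have i2: "integrable lborel (\<lambda>y. w y *\<^sub>R gradient \<rho> (x - y))"
      proof (rule integrable_compact_support)
        show "continuous_on UNIV (\<lambda>y. w y *\<^sub>R gradient \<rho> (x - y))"
          by (intro continuous_intros w continuous_on_compose2[OF continuous_gradient[OF test_smooth[OF \<rho>], of UNIV]]) auto
      qed (use supp in auto)
      show ?thesis
        unfolding g frechet_derivative_eq[OF D[OF \<rho>]] integral_inner_left[OF i2, symmetric] convolve_def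
        using b by (simp add: gradient_inner_basis)
    qed
    then have "(\<lambda>x. frechet_derivative g (at x) b) = convolve (\<lambda>x. frechet_derivative \<rho> (at x) b) w" by blast
    then show "(\<lambda>x. frechet_derivative g (at x) b) \<in> {convolve \<rho> w |\<rho>. \<rho> \<in> test_functions}"
      using test_deriv[OF \<rho> b] by blast
  qed
qed

lemma radial_kernel:
  fixes \<delta> :: real
  assumes "\<delta> > 0"
  obtains \<rho> :: "'a::euclidean_space \<Rightarrow> real" where "\<rho> \<in> test_functions" "\<And>x. 0 \<le> \<rho> x"
    "\<And>x. \<delta> \<le> norm x \<Longrightarrow> \<rho> x = 0" "(LINT x|lborel. \<rho> x) = 1" "\<And>x y. norm x = norm y \<Longrightarrow> \<rho> x = \<rho> y"
proof -
  define f :: "'a \<Rightarrow> real" where "f x = flat 1 (\<delta>\<^sup>2 - (norm (x - 0))\<^sup>2)" for x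
  have sm: "smooth f" unfolding f_def[abs_def] by (intro smooth_flat smooth_diff smooth_const smooth_norm2)
  have out: "f x = 0" if "\<delta> \<le> norm x" for x
    using power_mono[OF that, of 2] assms by (simp add: f_def flat_def)
  have f: "f \<in> test_functions" using sm out by (intro test_functionsI[where R=\<delta>]) auto
  have f0: "0 \<le> f x" for x unfolding f_def by (rule flat_1_bounds)
  define c where "c = (LINT x|lborel. f x)"
  have "c \<noteq> 0"
  proof
    assume "c = 0"
    then have "AE x in lborel. f x = 0"
      using integral_nonneg_eq_0_iff_AE[OF test_integrable[OF f]] f0 by (simp add: c_def)
    from AE_open_nonempty[OF this, of "ball 0 \<delta>"] obtain x where x: "x \<in> ball 0 \<delta>" "f x = 0" using assms by auto
    then have "(norm x)\<^sup>2 < \<delta>\<^sup>2" by (intro power_strict_mono) auto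
    then have "0 < f x" unfolding f_def by (intro flat_1_pos) simp
    then show False using x by simp
  qed
  moreover have "0 \<le> c" unfolding c_def using f0 by simp
  ultimately have c: "c > 0" by simp
  show ?thesis
  proof (rule that[of "\<lambda>x. (1 / c) * f x"])
    show "(\<lambda>x. (1 / c) * f x) \<in> test_functions" by (rule test_mult_smooth[OF f smooth_const])
    show "(LINT x|lborel. (1 / c) * f x) = 1" using c by (simp add: c_def)
  qed (use c f0 out in \<open>auto simp: f_def\<close>)
qed

text \<open>
  Averaging translates does not increase the nonlocal energies, by Jensen's inequality, and keeps
  radial functions radial, because the kernel is radial.
\<close>

lemma mollify:
  fixes w :: "'a::euclidean_space \<Rightarrow> real"
  assumes lip: "\<And>x y. \<bar>w x - w y\<bar> \<le> L * norm (x - y)" and supp: "\<And>x. R < norm x \<Longrightarrow> w x = 0"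
    and rad: "\<And>x y. norm x = norm y \<Longrightarrow> w x = w y" and \<delta>: "\<delta> > 0" and L: "L \<ge> 0"
  obtains v where "v \<in> test_functions" "\<And>x y. norm x = norm y \<Longrightarrow> v x = v y"
    "\<And>x. \<bar>v x - w x\<bar> \<le> L * \<delta>" "\<And>x. R + \<delta> < norm x \<Longrightarrow> v x = 0"
    "\<And>e. nonlocal_energy e v \<le> nonlocal_energy e w"
proof -
  have cw: "continuous_on UNIV w"
  proof (rule lipschitz_on_continuous_on[of L], rule lipschitz_onI)
    show "dist (w x) (w y) \<le> L * dist x y" for x y using lip[of x y] by (simp add: dist_norm)
  qed (rule L)
  have wm[measurable]: "w \<in> borel_measurable borel" using cw by (rule borel_measurable_continuous_onI)
  obtain \<rho> :: "'a \<Rightarrow> real" where \<rho>: "\<rho> \<in> test_functions" and \<rho>0: "\<And>x. 0 \<le> \<rho> x"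
    and \<rho>s: "\<And>x. \<delta> \<le> norm x \<Longrightarrow> \<rho> x = 0" and \<rho>1: "(LINT x|lborel. \<rho> x) = 1"
    and \<rho>r: "\<And>x y. norm x = norm y \<Longrightarrow> \<rho> x = \<rho> y"
    using radial_kernel[OF \<delta>] by blast
  have \<rho>m[measurable]: "\<rho> \<in> borel_measurable borel" by (rule test_measurable[OF \<rho>])
  have \<rho>i: "integrable lborel \<rho>" by (rule test_integrable[OF \<rho>])
  define v where "v = convolve \<rho> w"
  have vz: "v x = (LINT z|lborel. w (x - z) * \<rho> z)" for x unfolding v_def by (rule convolve_swap) measurable
  have vs: "v x = 0" if x: "R + \<delta> < norm x" for x
  proof -
    have z: "w y * \<rho> (x - y) = 0" for y
    proof (cases "R < norm y")
      case False
      have "norm x \<le> norm (x - y) + norm y" by (metis diff_add_cancel norm_triangle_ineq)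
      then have "\<delta> \<le> norm (x - y)" using x False by linarith
      then show ?thesis using \<rho>s by simp
    qed (simp add: supp)
    show ?thesis unfolding v_def convolve_def z by simp
  qed
  have vt: "v \<in> test_functions"
    by (rule test_functionsI[OF _ vs]) (simp add: v_def convolve_smooth[OF cw supp \<rho>])
  have int: "integrable lborel (\<lambda>z. f z * \<rho> z)" if "continuous_on UNIV f" for f
  proof (rule integrable_compact_support)
    show "continuous_on UNIV (\<lambda>z. f z * \<rho> z)" by (intro continuous_intros that test_continuous[OF \<rho>])
    show "\<delta> < norm z \<Longrightarrow> f z * \<rho> z = 0" for z using \<rho>s by simp
  qed
  have cwx: "continuous_on UNIV (\<lambda>z. w (x - z))" for x
    by (intro continuous_on_compose2[OF cw] continuous_intros) auto
  have near: "\<bar>v x - w x\<bar> \<le> L * \<delta>" for x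
  proof -
    have "v x - w x = (LINT z|lborel. w (x - z) * \<rho> z) - (LINT z|lborel. w x * \<rho> z)"
      by (simp add: vz \<rho>1)
    also have "\<dots> = (LINT z|lborel. w (x - z) * \<rho> z - w x * \<rho> z)"
      by (rule Bochner_Integration.integral_diff[symmetric]) (intro int cwx continuous_on_const)+
    also have "\<bar>\<dots>\<bar> \<le> (LINT z|lborel. \<bar>w (x - z) * \<rho> z - w x * \<rho> z\<bar>)" by (rule integral_abs_bound)
    also have "\<dots> \<le> (LINT z|lborel. L * \<delta> * \<rho> z)"
    proof (rule integral_mono)
      show "integrable lborel (\<lambda>z. \<bar>w (x - z) * \<rho> z - w x * \<rho> z\<bar>)"
        by (intro integrable_abs Bochner_Integration.integrable_diff int cwx continuous_on_const)
      show "integrable lborel (\<lambda>z. L * \<delta> * \<rho> z)" by (intro integrable_mult_right \<rho>i)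
      fix z
      show "\<bar>w (x - z) * \<rho> z - w x * \<rho> z\<bar> \<le> L * \<delta> * \<rho> z"
      proof (cases "\<delta> \<le> norm z")
        case False
        have "\<bar>w (x - z) - w x\<bar> \<le> L * norm z" using lip[of "x - z" x] by simp
        also have "\<dots> \<le> L * \<delta>" using False L by (intro mult_left_mono) auto
        finally have "\<bar>w (x - z) - w x\<bar> * \<rho> z \<le> L * \<delta> * \<rho> z" by (intro mult_right_mono \<rho>0)
        moreover have "\<bar>w (x - z) * \<rho> z - w x * \<rho> z\<bar> = \<bar>w (x - z) - w x\<bar> * \<rho> z"
          using \<rho>0[of z] by (simp add: abs_mult left_diff_distrib[symmetric])
        ultimately show ?thesis by simp
      qed (simp add: \<rho>s)
    qed
    also have "\<dots> = L * \<delta>" by (simp add: \<rho>1)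
    finally show ?thesis .
  qed
  have vr: "v x = v y" if xy: "norm x = norm y" for x y
  proof (cases "x = y")
    case False
    define T where "T = reflection (x - y)"
    have Tx: "T x = y" unfolding T_def by (rule reflection_swap[OF xy False])
    have "v y = (LINT z|lborel. w (T z) * \<rho> (y - T z))"
      unfolding v_def convolve_def T_def by (rule integral_reflection[symmetric]) measurable
    also have "\<dots> = (LINT z|lborel. w z * \<rho> (x - z))"
    proof (rule Bochner_Integration.integral_cong[OF refl])
      fix z
      have "norm (y - T z) = norm (T (x - z))"
        unfolding Tx[symmetric] by (simp add: T_def linear_diff[OF linear_reflection])
      then have "norm (y - T z) = norm (x - z)" by (simp add: T_def)
      moreover have "norm (T z) = norm z" by (simp add: T_def)
      ultimately show "w (T z) * \<rho> (y - T z) = w z * \<rho> (x - z)" using rad \<rho>r by metis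
    qed
    finally show ?thesis unfolding v_def convolve_def by simp
  qed simp
  have en: "nonlocal_energy e v \<le> nonlocal_energy e w" for e
  proof -
    have jensen: "ennreal ((v x - v y)\<^sup>2) \<le> (\<integral>\<^sup>+z. ennreal (\<rho> z) * ennreal ((w (x - z) - w (y - z))\<^sup>2) \<partial>lborel)" for x y
    proof -
      define a where "a z = w (x - z) - w (y - z)" for z
      have ca: "continuous_on UNIV a" unfolding a_def by (intro continuous_intros cwx)
      define m where "m = (LINT z|lborel. a z * \<rho> z)"
      have m: "v x - v y = m"
        unfolding vz m_def a_def left_diff_distrib
        by (rule Bochner_Integration.integral_diff[symmetric]) (intro int cwx)+
      have i2: "integrable lborel (\<lambda>z. (a z)\<^sup>2 * \<rho> z)" by (intro int continuous_intros ca)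
      have i1: "integrable lborel (\<lambda>z. a z * \<rho> z)" by (intro int ca)
      have "0 \<le> (LINT z|lborel. (a z - m)\<^sup>2 * \<rho> z)" using \<rho>0 by (intro integral_nonneg_AE AE_I2) simp
      also have "\<dots> = (LINT z|lborel. (a z)\<^sup>2 * \<rho> z - 2 * m * (a z * \<rho> z) + m\<^sup>2 * \<rho> z)"
        by (rule Bochner_Integration.integral_cong) (auto simp: power2_eq_square algebra_simps)
      also have "\<dots> = (LINT z|lborel. (a z)\<^sup>2 * \<rho> z) - 2 * m * m + m\<^sup>2"
        using i1 i2 \<rho>i by (simp add: m_def[symmetric] \<rho>1)
      finally have "m\<^sup>2 \<le> (LINT z|lborel. (a z)\<^sup>2 * \<rho> z)" by (simp add: power2_eq_square)
      then have "ennreal (m\<^sup>2) \<le> ennreal (LINT z|lborel. (a z)\<^sup>2 * \<rho> z)" by (rule ennreal_leI)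
      also have "\<dots> = (\<integral>\<^sup>+z. ennreal ((a z)\<^sup>2 * \<rho> z) \<partial>lborel)"
        using \<rho>0 by (intro nn_integral_eq_integral[symmetric] i2 AE_I2) simp
      also have "\<dots> = (\<integral>\<^sup>+z. ennreal (\<rho> z) * ennreal ((a z)\<^sup>2) \<partial>lborel)"
        using \<rho>0 by (intro nn_integral_cong) (simp add: ennreal_mult[symmetric] mult.commute)
      finally show ?thesis unfolding m a_def .
    qed
    define I where "I x y = ennreal (indicator {..<e} (norm (x - y)))" for x y :: 'a
    define k where "k x y = ennreal ((w x - w y)\<^sup>2) * I x y" for x y
    have Ish: "I (x - z) (y - z) = I x y" for x y z by (simp add: I_def)
    have [measurable]: "(\<lambda>z. I (fst z) (snd z)) \<in> borel_measurable (borel \<Otimes>\<^sub>M borel)" unfolding I_def by measurable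
    have [measurable]: "I x \<in> borel_measurable borel" for x unfolding I_def by measurable
    have Em: "nonlocal_energy e f = (\<integral>\<^sup>+x. (\<integral>\<^sup>+y. ennreal ((f x - f y)\<^sup>2) * I x y \<partial>lborel) \<partial>lborel)" for f :: "'a \<Rightarrow> real"
      unfolding nonlocal_energy_def I_def by (simp add: ennreal_mult)
    have "nonlocal_energy e v \<le> (\<integral>\<^sup>+x. (\<integral>\<^sup>+y. (\<integral>\<^sup>+z. ennreal (\<rho> z) * ennreal ((w (x - z) - w (y - z))\<^sup>2) \<partial>lborel) * I x y \<partial>lborel) \<partial>lborel)"
      unfolding Em by (intro nn_integral_mono mult_right_mono jensen) simp
    also have "\<dots> = (\<integral>\<^sup>+x. (\<integral>\<^sup>+y. (\<integral>\<^sup>+z. ennreal (\<rho> z) * k (x - z) (y - z) \<partial>lborel) \<partial>lborel) \<partial>lborel)"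
      by (intro nn_integral_cong, subst nn_integral_multc[symmetric]) (auto simp: k_def Ish mult.assoc)
    also have "\<dots> = (\<integral>\<^sup>+x. (\<integral>\<^sup>+z. (\<integral>\<^sup>+y. ennreal (\<rho> z) * k (x - z) (y - z) \<partial>lborel) \<partial>lborel) \<partial>lborel)"
      unfolding k_def I_def by (intro nn_integral_cong lborel_pair.Fubini') measurable
    also have "\<dots> = (\<integral>\<^sup>+z. (\<integral>\<^sup>+x. (\<integral>\<^sup>+y. ennreal (\<rho> z) * k (x - z) (y - z) \<partial>lborel) \<partial>lborel) \<partial>lborel)"
      unfolding k_def I_def by (intro lborel_pair.Fubini') measurable
    also have "\<dots> = (\<integral>\<^sup>+z. ennreal (\<rho> z) * nonlocal_energy e w \<partial>lborel)"
    proof (rule nn_integral_cong)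
      fix z :: 'a
      define g where "g x = (\<integral>\<^sup>+y. ennreal (\<rho> z) * k x y \<partial>lborel)" for x
      have gm: "g \<in> borel_measurable borel" unfolding g_def k_def I_def by measurable
      have "(\<integral>\<^sup>+y. ennreal (\<rho> z) * k (x - z) (y - z) \<partial>lborel) = g (x + - z)" for x
        using nn_integral_translate[of "\<lambda>y. ennreal (\<rho> z) * k (x - z) y" "- z"]
        unfolding g_def by (simp add: k_def)
      then have "(\<integral>\<^sup>+x. (\<integral>\<^sup>+y. ennreal (\<rho> z) * k (x - z) (y - z) \<partial>lborel) \<partial>lborel) = (\<integral>\<^sup>+x. g x \<partial>lborel)"
        using nn_integral_translate[OF gm, of "- z"] by simp
      also have "\<dots> = (\<integral>\<^sup>+x. ennreal (\<rho> z) * (\<integral>\<^sup>+y. k x y \<partial>lborel) \<partial>lborel)"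
        unfolding g_def by (intro nn_integral_cong nn_integral_cmult) (simp add: k_def)
      also have "\<dots> = ennreal (\<rho> z) * (\<integral>\<^sup>+x. (\<integral>\<^sup>+y. k x y \<partial>lborel) \<partial>lborel)"
      proof (rule nn_integral_cmult)
        show "(\<lambda>x. \<integral>\<^sup>+y. k x y \<partial>lborel) \<in> borel_measurable lborel" unfolding k_def I_def by measurable
      qed
      also have "(\<integral>\<^sup>+x. (\<integral>\<^sup>+y. k x y \<partial>lborel) \<partial>lborel) = nonlocal_energy e w"
        unfolding Em k_def ..
      finally show "(\<integral>\<^sup>+x. (\<integral>\<^sup>+y. ennreal (\<rho> z) * k (x - z) (y - z) \<partial>lborel) \<partial>lborel) = ennreal (\<rho> z) * nonlocal_energy e w" .
    qed
    also have "\<dots> = (\<integral>\<^sup>+z. ennreal (\<rho> z) \<partial>lborel) * nonlocal_energy e w"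
      by (rule nn_integral_multc) measurable
    also have "(\<integral>\<^sup>+z. ennreal (\<rho> z) \<partial>lborel) = 1"
      using nn_integral_eq_integral[OF \<rho>i] \<rho>0 \<rho>1 by simp
    finally show ?thesis by simp
  qed
  show ?thesis by (rule that[OF vt vr near vs en])
qed

section \<open>Symmetrization of test functions\<close>

text \<open>
  The Hardy inequality for a test function that is bounded below on the ball.
\<close>

lemma inverse_square_integrable:
  assumes N: "DIM('a::euclidean_space) \<ge> 3"
  shows "integrable lborel (\<lambda>x::'a. indicator (cball 0 R) x * (1 / (norm x)\<^sup>2))"
proof (cases "R \<ge> 0")
  case True
  define f :: "'a \<Rightarrow> real" where "f x = flat 1 ((R + 1)\<^sup>2 - (norm (x - 0))\<^sup>2)" for x
  have sm: "smooth f" unfolding f_def[abs_def] by (intro smooth_flat smooth_diff smooth_const smooth_norm2)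
  have out: "f x = 0" if "R + 1 < norm x" for x
    using power_mono[of "R + 1" "norm x" 2] that True by (simp add: f_def flat_def)
  have f: "f \<in> test_functions" using sm out by (rule test_functionsI)
  have low: "exp (-1) \<le> f x" if "norm x \<le> R" for x
  proof -
    define t where "t = (R + 1)\<^sup>2 - (norm (x - 0))\<^sup>2"
    have "(norm x)\<^sup>2 \<le> R\<^sup>2" using that by (intro power_mono) auto
    moreover have "(R + 1)\<^sup>2 = R\<^sup>2 + 2 * R + 1" by (simp add: power2_sum)
    ultimately have t: "1 \<le> t" using True unfolding t_def diff_zero by linarith
    then have "1 / t \<le> 1" by simp
    then have "exp (-1) \<le> exp (- (1 / t))" by simp
    moreover have "f x = exp (- (1 / t))" using t unfolding f_def t_def[symmetric] by (simp add: flat_def)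
    ultimately show ?thesis by simp
  qed
  have i: "integrable lborel (\<lambda>x. exp 1 ^ 2 * ((f x)\<^sup>2 / (norm (x - 0))\<^sup>2))"
    by (intro integrable_mult_right hardy_test(1) f N)
  have cb[measurable]: "indicat_real (cball (0::'a) R) \<in> borel_measurable borel"
    by (intro borel_measurable_indicator) simp
  show ?thesis
  proof (rule Bochner_Integration.integrable_bound[OF i])
    show "AE x in lborel. norm (indicator (cball 0 R) x * (1 / (norm (x::'a))\<^sup>2)) \<le> norm (exp 1 ^ 2 * ((f x)\<^sup>2 / (norm (x - 0))\<^sup>2))"
    proof (rule AE_I2)
      fix x :: 'a
      show "norm (indicator (cball 0 R) x * (1 / (norm x)\<^sup>2)) \<le> norm (exp 1 ^ 2 * ((f x)\<^sup>2 / (norm (x - 0))\<^sup>2))"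
      proof (cases "norm x \<le> R")
        case True
        have "exp 1 * exp (-1) \<le> exp 1 * f x" using low[OF True] by (intro mult_left_mono) auto
        then have "1 \<le> exp 1 * f x" by (simp add: exp_minus)
        then have "1 \<le> (exp 1 * f x)\<^sup>2" by simp
        then have "1 / (norm x)\<^sup>2 \<le> (exp 1 * f x)\<^sup>2 / (norm x)\<^sup>2" by (intro divide_right_mono) auto
        then show ?thesis using True by (simp add: power_mult_distrib)
      qed simp
    qed
  qed measurable
qed (simp add: indicator_def)

lemma bounded_support_convergence:
  fixes f :: "nat \<Rightarrow> 'a::euclidean_space \<Rightarrow> real"
  assumes N: "DIM('a) \<ge> 3" and fm[measurable]: "\<And>n. f n \<in> borel_measurable borel"
    and B: "\<And>n x. \<bar>f n x\<bar> \<le> B" and supp: "\<And>n x. R < norm x \<Longrightarrow> f n x = 0"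
    and lim: "\<And>x. (\<lambda>n. f n x) \<longlonglongrightarrow> g x" and p: "p > 0"
  shows "(\<lambda>n. LINT x|lborel. \<bar>f n x\<bar> powr p) \<longlonglongrightarrow> (LINT x|lborel. \<bar>g x\<bar> powr p)"
    and "(\<lambda>n. hardy_integral (f n) 0) \<longlonglongrightarrow> hardy_integral g 0"
proof -
  have B0: "B \<ge> 0" using B[of 0 0] by linarith
  have gm[measurable]: "g \<in> borel_measurable borel"
    by (rule borel_measurable_LIMSEQ_real[OF lim fm])
  have cb[measurable]: "indicat_real (cball (0::'a) R) \<in> borel_measurable borel"
    by (intro borel_measurable_indicator) simp
  show "(\<lambda>n. LINT x|lborel. \<bar>f n x\<bar> powr p) \<longlonglongrightarrow> (LINT x|lborel. \<bar>g x\<bar> powr p)"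
  proof (rule integral_dominated_convergence[where w="\<lambda>x. indicator (cball 0 R) x * (B powr p)"])
    show "integrable lborel (\<lambda>x. indicator (cball (0::'a) R) x * (B powr p))"
      using borel_integrable_compact[of "cball (0::'a) R" "\<lambda>_. B powr p"] by simp
    show "AE x in lborel. (\<lambda>n. \<bar>f n x\<bar> powr p) \<longlonglongrightarrow> \<bar>g x\<bar> powr p"
      using lim p by (intro AE_I2 tendsto_powr' tendsto_rabs tendsto_const) auto
    show "AE x in lborel. norm (\<bar>f n x\<bar> powr p) \<le> indicator (cball 0 R) x * (B powr p)" for n
    proof (rule AE_I2)
      fix x :: 'a
      show "norm (\<bar>f n x\<bar> powr p) \<le> indicator (cball 0 R) x * (B powr p)"
        using B[of n x] supp[of x n] p by (cases "norm x \<le> R") (auto intro: powr_mono2)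
    qed
  qed measurable
  show "(\<lambda>n. hardy_integral (f n) 0) \<longlonglongrightarrow> hardy_integral g 0"
    unfolding hardy_integral_def
  proof (rule integral_dominated_convergence[where w="\<lambda>x. B\<^sup>2 * (indicator (cball 0 R) x * (1 / (norm x)\<^sup>2))"])
    show "integrable lborel (\<lambda>x::'a. B\<^sup>2 * (indicator (cball 0 R) x * (1 / (norm x)\<^sup>2)))"
      by (intro integrable_mult_right inverse_square_integrable N)
    show "AE x in lborel. (\<lambda>n. (f n x)\<^sup>2 / (norm (x - 0))\<^sup>2) \<longlonglongrightarrow> (g x)\<^sup>2 / (norm (x - 0))\<^sup>2"
      using AE_neq_point[of 0] by eventually_elim (auto intro!: tendsto_intros lim)
    show "AE x in lborel. norm ((f n x)\<^sup>2 / (norm (x - 0))\<^sup>2) \<le> B\<^sup>2 * (indicator (cball 0 R) x * (1 / (norm x)\<^sup>2))" for n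
    proof (rule AE_I2)
      fix x :: 'a
      show "norm ((f n x)\<^sup>2 / (norm (x - 0))\<^sup>2) \<le> B\<^sup>2 * (indicator (cball 0 R) x * (1 / (norm x)\<^sup>2))"
      proof (cases "norm x \<le> R")
        case True
        have "(f n x)\<^sup>2 \<le> B\<^sup>2" using B[of n x] B0 abs_le_square_iff[of "f n x" B] by linarith
        then have "(f n x)\<^sup>2 / (norm x)\<^sup>2 \<le> B\<^sup>2 / (norm x)\<^sup>2" by (intro divide_right_mono) auto
        then show ?thesis using True by simp
      qed (simp add: supp)
    qed
  qed measurable
qed

text \<open>
  The functions that have the same norm as \<open>\<phi>\<close>, no larger nonlocal energies, and a common modulus of
  continuity and support. The set is compact and closed under those polarizations that move mass
  towards the origin; a maximizer of the Hardy integral in it has to be radial.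
\<close>

definition competitor :: "real \<Rightarrow> real \<Rightarrow> real \<Rightarrow> ('a::euclidean_space \<Rightarrow> real) \<Rightarrow> ('a \<Rightarrow> real) \<Rightarrow> bool" where
  "competitor L R p \<phi> w \<longleftrightarrow> (\<forall>x. 0 \<le> w x) \<and> (\<forall>x y. \<bar>w x - w y\<bar> \<le> L * norm (x - y)) \<and> (\<forall>x. R < norm x \<longrightarrow> w x = 0)
    \<and> (LINT x|lborel. \<bar>w x\<bar> powr p) = (LINT x|lborel. \<bar>\<phi> x\<bar> powr p)
    \<and> (\<forall>e. nonlocal_energy e w \<le> nonlocal_energy e \<phi>)"

lemma lipschitz_continuous:
  fixes w :: "'a::euclidean_space \<Rightarrow> real"
  assumes "\<And>x y. \<bar>w x - w y\<bar> \<le> L * norm (x - y)" "L \<ge> 0"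
  shows "continuous_on UNIV w"
proof (rule lipschitz_on_continuous_on[of L], rule lipschitz_onI)
  show "dist (w x) (w y) \<le> L * dist x y" for x y using assms(1)[of x y] by (simp add: dist_norm)
qed (rule assms(2))

lemma competitor_props:
  assumes "competitor L R p \<phi> w" "L \<ge> 0" "R \<ge> 0"
  shows "\<And>x. 0 \<le> w x" "\<And>x y. \<bar>w x - w y\<bar> \<le> L * norm (x - y)" "\<And>x. R < norm x \<Longrightarrow> w x = 0"
    "(LINT x|lborel. \<bar>w x\<bar> powr p) = (LINT x|lborel. \<bar>\<phi> x\<bar> powr p)"
    "\<And>e. nonlocal_energy e w \<le> nonlocal_energy e \<phi>"
    "continuous_on UNIV w" "w \<in> borel_measurable borel" "\<And>x. \<bar>w x\<bar> \<le> L * (2 * R + 1)"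
proof -
  show 1: "\<And>x. 0 \<le> w x" and 2: "\<And>x y. \<bar>w x - w y\<bar> \<le> L * norm (x - y)" and 3: "\<And>x. R < norm x \<Longrightarrow> w x = 0"
    and "(LINT x|lborel. \<bar>w x\<bar> powr p) = (LINT x|lborel. \<bar>\<phi> x\<bar> powr p)"
    "\<And>e. nonlocal_energy e w \<le> nonlocal_energy e \<phi>"
    using assms(1) by (auto simp: competitor_def)
  show c: "continuous_on UNIV w" using 2 assms(2) by (rule lipschitz_continuous)
  then show "w \<in> borel_measurable borel" by (rule borel_measurable_continuous_onI)
  fix x
  show "\<bar>w x\<bar> \<le> L * (2 * R + 1)"
  proof (cases "norm x \<le> R")
    case True
    obtain b :: 'a where b: "b \<in> Basis" using nonempty_Basis by blast
    define y where "y = (R + 1) *\<^sub>R b"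
    have y: "norm y = R + 1" using b assms(3) by (simp add: y_def)
    then have "w y = 0" by (intro 3) simp
    then have "\<bar>w x\<bar> \<le> L * norm (x - y)" using 2[of x y] by simp
    also have "\<dots> \<le> L * (2 * R + 1)"
      using norm_triangle_ineq4[of x y] True y assms(2) by (intro mult_left_mono) auto
    finally show ?thesis .
  next
    case False
    then show ?thesis using 3[of x] assms by simp
  qed
qed

lemma competitor_abs:
  assumes "\<And>x y. \<bar>\<phi> x - \<phi> y\<bar> \<le> L * norm (x - y)" "\<And>x. R < norm x \<Longrightarrow> \<phi> x = 0"
  shows "competitor L R p \<phi> (\<lambda>x. \<bar>\<phi> x\<bar>)"
  unfolding competitor_def
proof (intro conjI allI impI)
  show "\<bar>\<bar>\<phi> x\<bar> - \<bar>\<phi> y\<bar>\<bar> \<le> L * norm (x - y)" for x y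
    using assms(1)[of x y] abs_triangle_ineq3[of "\<phi> x" "\<phi> y"] by linarith
  show "nonlocal_energy e (\<lambda>x. \<bar>\<phi> x\<bar>) \<le> nonlocal_energy e \<phi>" for e
    unfolding nonlocal_energy_def
  proof (intro nn_integral_mono ennreal_leI mult_right_mono)
    show "(\<bar>\<phi> x\<bar> - \<bar>\<phi> y\<bar>)\<^sup>2 \<le> (\<phi> x - \<phi> y)\<^sup>2" for x y
      unfolding abs_le_square_iff[symmetric] by (rule abs_triangle_ineq3)
  qed simp
qed (use assms in auto)

text \<open>
  For points on opposite sides the mirror image of one is closer to the other, so that the exchanged
  values differ by no more than the distance allows.
\<close>

lemma polarize_lipschitz:
  assumes lip: "\<And>x y. \<bar>w x - w y\<bar> \<le> L * norm (x - y)" and L: "L \<ge> 0" and pq: "p \<noteq> q"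
  shows "\<bar>polarize p q w x - polarize p q w y\<bar> \<le> L * norm (x - y)"
proof -
  define a a' b b' D where "a = w x" and "a' = w (bisect p q x)" and "b = w y" and "b' = w (bisect p q y)"
    and "D = L * norm (x - y)"
  note ds = a_def[symmetric] a'_def[symmetric] b_def[symmetric] b'_def[symmetric] D_def[symmetric]
  have 1: "\<bar>a - b\<bar> \<le> D" unfolding a_def b_def D_def by (rule lip)
  have 2: "\<bar>a' - b'\<bar> \<le> D" unfolding a'_def b'_def D_def using lip[of "bisect p q x" "bisect p q y"] by simp
  have cross: "\<bar>a - b'\<bar> \<le> D \<and> \<bar>a' - b\<bar> \<le> D" if "side p q x * side p q y \<le> 0"
  proof -
    have "4 * (side p q x * side p q y) / (norm (p - q))\<^sup>2 \<le> 0" using that by (intro divide_nonpos_nonneg) auto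
    then have "(norm (x - bisect p q y))\<^sup>2 \<le> (norm (x - y))\<^sup>2" unfolding norm_diff_bisect[OF pq] by (simp add: mult.assoc)
    then have "norm (x - bisect p q y) \<le> norm (x - y)" by (rule power2_le_imp_le) simp
    then have n: "L * norm (x - bisect p q y) \<le> D" unfolding D_def by (rule mult_left_mono) (rule L)
    show ?thesis
      using lip[of x "bisect p q y"] lip[of "bisect p q x" y] n unfolding norm_bisect_left ds by linarith
  qed
  consider "0 \<le> side p q x" "0 \<le> side p q y" | "0 \<le> side p q x" "side p q y \<le> 0"
    | "side p q x \<le> 0" "0 \<le> side p q y" | "side p q x \<le> 0" "side p q y \<le> 0" by linarith
  then show ?thesis
  proof cases
    case 1
    show ?thesis
      unfolding polarize_nonneg_side(1)[OF pq 1(1)] polarize_nonneg_side(1)[OF pq 1(2)] ds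
      using \<open>\<bar>a - b\<bar> \<le> D\<close> 2 by (simp add: max_def abs_le_iff)
  next
    case 2
    then have "side p q x * side p q y \<le> 0" by (intro mult_nonneg_nonpos)
    with cross have "\<bar>a - b'\<bar> \<le> D" "\<bar>a' - b\<bar> \<le> D" by auto
    then show ?thesis
      unfolding polarize_nonneg_side(1)[OF pq 2(1)] polarize_nonpos_side(1)[OF pq 2(2)] ds
      using 1 \<open>\<bar>a' - b'\<bar> \<le> D\<close> by (simp add: max_def min_def abs_le_iff)
  next
    case 3
    then have "side p q x * side p q y \<le> 0" by (intro mult_nonpos_nonneg)
    with cross have "\<bar>a - b'\<bar> \<le> D" "\<bar>a' - b\<bar> \<le> D" by auto
    then show ?thesis
      unfolding polarize_nonpos_side(1)[OF pq 3(1)] polarize_nonneg_side(1)[OF pq 3(2)] ds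
      using 1 \<open>\<bar>a' - b'\<bar> \<le> D\<close> by (simp add: max_def min_def abs_le_iff)
  next
    case 4
    show ?thesis
      unfolding polarize_nonpos_side(1)[OF pq 4(1)] polarize_nonpos_side(1)[OF pq 4(2)] ds
      using 1 \<open>\<bar>a' - b'\<bar> \<le> D\<close> by (simp add: min_def abs_le_iff)
  qed
qed

lemma norm_bisect:
  assumes "p \<noteq> q"
  shows "(norm (bisect p q x))\<^sup>2 = (norm x)\<^sup>2 + 2 * ((norm q)\<^sup>2 - (norm p)\<^sup>2) * side p q x / (norm (p - q))\<^sup>2"
proof -
  have "4 * side p q 0 = 2 * ((norm q)\<^sup>2 - (norm p)\<^sup>2)" unfolding side_zero by simp
  then show ?thesis
    using norm_diff_bisect[OF assms, of 0 x] by (simp only: diff_0 norm_minus_cancel)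
qed

lemma norm_le_bisect:
  assumes "norm p < norm q" "0 \<le> side p q x"
  shows "norm x \<le> norm (bisect p q x)"
proof (rule power2_le_imp_le)
  have pq: "p \<noteq> q" using assms(1) by auto
  have "(norm p)\<^sup>2 \<le> (norm q)\<^sup>2" using assms(1) by (intro power_mono) auto
  then show "(norm x)\<^sup>2 \<le> (norm (bisect p q x))\<^sup>2" unfolding norm_bisect[OF pq] using assms(2) by simp
qed simp

lemma norm_less_bisect:
  assumes "norm p < norm q" "0 < side p q x"
  shows "norm x < norm (bisect p q x)"
proof (rule power2_less_imp_less)
  have pq: "p \<noteq> q" using assms(1) by auto
  have "(norm p)\<^sup>2 < (norm q)\<^sup>2" using assms(1) by (intro power_strict_mono) auto
  then show "(norm x)\<^sup>2 < (norm (bisect p q x))\<^sup>2" unfolding norm_bisect[OF pq] using assms(2) pq by simp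
qed simp

lemma competitor_polarize:
  assumes w: "competitor L R p \<phi> w" and L: "L \<ge> 0" and R: "R \<ge> 0" and ab: "norm a < norm b"
  shows "competitor L R p \<phi> (polarize a b w)"
proof -
  note P = competitor_props[OF w L R]
  note [measurable] = P(7)
  have pq: "a \<noteq> b" using ab by auto
  have nn: "0 \<le> polarize a b w x" for x using P(1) by (simp add: polarize_def le_max_iff_disj)
  have "(\<integral>\<^sup>+x. ennreal (\<bar>polarize a b w x\<bar> powr p) \<partial>lborel) = (\<integral>\<^sup>+x. ennreal (\<bar>w x\<bar> powr p) \<partial>lborel)"
    by (rule polarize_nn_integral[where F="\<lambda>t. ennreal (\<bar>t\<bar> powr p)", OF _ _ pq]) measurable
  then have "(LINT x|lborel. \<bar>polarize a b w x\<bar> powr p) = (LINT x|lborel. \<bar>w x\<bar> powr p)"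
    by (simp add: integral_eq_nn_integral)
  moreover have "polarize a b w x = 0" if x: "R < norm x" for x
  proof (cases "0 \<le> side a b x")
    case True
    then have "R < norm (bisect a b x)" using norm_le_bisect[OF ab True] x by simp
    then show ?thesis using P(3) x by (simp add: polarize_def)
  next
    case False
    then show ?thesis using P(1)[of "bisect a b x"] P(3)[OF x] by (simp add: polarize_def)
  qed
  moreover have "nonlocal_energy e (polarize a b w) \<le> nonlocal_energy e \<phi>" for e
    using order_trans[OF polarize_nonlocal_energy[OF P(7) pq] P(5)] .
  moreover have "\<bar>polarize a b w x - polarize a b w y\<bar> \<le> L * norm (x - y)" for x y
    using P(2) L pq by (rule polarize_lipschitz)
  ultimately show ?thesis unfolding competitor_def using nn P(4) by simp
qed

lemma competitor_limit:
  fixes w :: "nat \<Rightarrow> 'a::euclidean_space \<Rightarrow> real"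
  assumes N: "DIM('a) \<ge> 3" and w: "\<And>n. competitor L R p \<phi> (w n)" and L: "L \<ge> 0" and R: "R \<ge> 0" and p: "p > 0"
    and lim: "\<And>x. (\<lambda>n. w n x) \<longlonglongrightarrow> v x"
  shows "competitor L R p \<phi> v" "(\<lambda>n. hardy_integral (w n) 0) \<longlonglongrightarrow> hardy_integral v 0"
proof -
  note P = competitor_props[OF w L R]
  note conv = bounded_support_convergence[OF N P(7) P(8) P(3) lim p]
  show "(\<lambda>n. hardy_integral (w n) 0) \<longlonglongrightarrow> hardy_integral v 0" by (rule conv(2))
  have "0 \<le> v x" for x by (rule LIMSEQ_le_const[OF lim]) (use P(1) in blast)
  moreover have "\<bar>v x - v y\<bar> \<le> L * norm (x - y)" for x y
    by (rule LIMSEQ_le_const2[OF tendsto_rabs[OF tendsto_diff[OF lim lim]]]) (use P(2) in blast)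
  moreover have "v x = 0" if "R < norm x" for x
    using lim[of x] P(3)[OF that] by (simp add: LIMSEQ_const_iff)
  moreover have "(LINT x|lborel. \<bar>v x\<bar> powr p) = (LINT x|lborel. \<bar>\<phi> x\<bar> powr p)"
    using conv(1) unfolding P(4) by (simp add: LIMSEQ_const_iff)
  moreover have "nonlocal_energy e v \<le> nonlocal_energy e \<phi>" for e
    by (rule nonlocal_energy_pointwise_limit[OF P(7) lim P(5)])
  ultimately show "competitor L R p \<phi> v" unfolding competitor_def by blast
qed

lemma competitor_hardy_bound:
  fixes w :: "'a::euclidean_space \<Rightarrow> real"
  assumes N: "DIM('a) \<ge> 3" and w: "competitor L R p \<phi> w" and L: "L \<ge> 0" and R: "R \<ge> 0"
  shows "integrable lborel (\<lambda>x. (w x)\<^sup>2 / (norm (x - 0))\<^sup>2)"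
    "hardy_integral w 0 \<le> (L * (2 * R + 1))\<^sup>2 * (LINT x|lborel. indicator (cball (0::'a) R) x * (1 / (norm x)\<^sup>2))"
proof -
  note P = competitor_props[OF w L R]
  note [measurable] = P(7)
  define B where "B = L * (2 * R + 1)"
  have i: "integrable lborel (\<lambda>x::'a. B\<^sup>2 * (indicator (cball 0 R) x * (1 / (norm x)\<^sup>2)))"
    by (intro integrable_mult_right inverse_square_integrable N)
  have le: "(w x)\<^sup>2 / (norm (x - 0))\<^sup>2 \<le> B\<^sup>2 * (indicator (cball 0 R) x * (1 / (norm x)\<^sup>2))" for x
  proof (cases "norm x \<le> R")
    case True
    have "(w x)\<^sup>2 \<le> B\<^sup>2" using P(8)[of x] unfolding B_def[symmetric] abs_le_square_iff[symmetric] by linarith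
    then have "(w x)\<^sup>2 / (norm x)\<^sup>2 \<le> B\<^sup>2 / (norm x)\<^sup>2" by (intro divide_right_mono) auto
    then show ?thesis using True by simp
  qed (simp add: P(3))
  show j: "integrable lborel (\<lambda>x. (w x)\<^sup>2 / (norm (x - 0))\<^sup>2)"
    by (rule Bochner_Integration.integrable_bound[OF i]) (measurable, use le in \<open>auto intro!: AE_I2 order_trans[OF _ abs_ge_self]\<close>)
  have "hardy_integral w 0 \<le> (LINT x|lborel. B\<^sup>2 * (indicator (cball (0::'a) R) x * (1 / (norm x)\<^sup>2)))"
    unfolding hardy_integral_def by (rule integral_mono[OF j i le])
  then show "hardy_integral w 0 \<le> (L * (2 * R + 1))\<^sup>2 * (LINT x|lborel. indicator (cball (0::'a) R) x * (1 / (norm x)\<^sup>2))"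
    by (simp only: integral_mult_right_zero B_def)
qed

text \<open>
  Arzela-Ascoli extracts from a maximizing sequence a locally uniform limit; all constraints and the
  Hardy integral pass to the limit, since the supports lie in one ball.
\<close>

lemma competitor_maximizer:
  fixes \<phi> :: "'a::euclidean_space \<Rightarrow> real"
  assumes N: "DIM('a) \<ge> 3" and L: "L \<ge> 0" and R: "R \<ge> 0" and p: "p > 0" and ne: "competitor L R p \<phi> w0"
  obtains w where "competitor L R p \<phi> w" "\<And>v. competitor L R p \<phi> v \<Longrightarrow> hardy_integral v 0 \<le> hardy_integral w 0"
proof -
  define A where "A = {hardy_integral v 0 |v. competitor L R p \<phi> v}"
  have bdd: "bdd_above A" unfolding A_def bdd_above_def using competitor_hardy_bound(2)[OF N _ L R] by blast
  have nonempty: "A \<noteq> {}" using ne unfolding A_def by blast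
  define s where "s = Sup A"
  have "\<exists>v. competitor L R p \<phi> v \<and> s - inverse (real (Suc n)) < hardy_integral v 0" for n
  proof -
    have "s - inverse (real (Suc n)) < Sup A" by (simp add: s_def)
    then obtain y where "y \<in> A" "s - inverse (real (Suc n)) < y" using less_cSup_iff[OF nonempty bdd] by blast
    then show ?thesis unfolding A_def by blast
  qed
  then obtain W where W: "\<And>n. competitor L R p \<phi> (W n)" "\<And>n. s - inverse (real (Suc n)) < hardy_integral (W n) 0"
    by metis
  note P = competitor_props[OF W(1) L R]
  have "\<exists>d>0. \<forall>n y. y \<in> cball 0 R \<and> norm (x - y) < d \<longrightarrow> norm (W n x - W n y) < e" if "0 < e" for x e
  proof (intro exI conjI allI impI)
    show "0 < e / (L + 1)" using that L by simp
    fix n y assume "y \<in> cball 0 R \<and> norm (x - y) < e / (L + 1)"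
    then have "(L + 1) * norm (x - y) < e" using L by (simp add: pos_less_divide_eq mult.commute)
    moreover have "\<bar>W n x - W n y\<bar> \<le> L * norm (x - y)" by (rule P(2))
    moreover have "L * norm (x - y) \<le> (L + 1) * norm (x - y)" by (intro mult_right_mono) auto
    ultimately show "norm (W n x - W n y) < e" by simp
  qed
  then obtain g k where g: "strict_mono (k :: nat \<Rightarrow> nat)"
    "\<And>e. 0 < e \<Longrightarrow> \<exists>N. \<forall>n x. n \<ge> N \<and> x \<in> cball 0 R \<longrightarrow> norm (W (k n) x - g x) < e"
    using Arzela_Ascoli[of "cball 0 R" W "L * (2 * R + 1)"] P(8) by (metis compact_cball real_norm_def)
  define v where "v x = (if norm x \<le> R then g x else 0)" for x
  have lim: "(\<lambda>n. W (k n) x) \<longlonglongrightarrow> v x" for x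
  proof (cases "norm x \<le> R")
    case True
    show ?thesis
    proof (rule LIMSEQ_I)
      fix e :: real assume "0 < e"
      from g(2)[OF this] obtain M where "\<forall>n x. n \<ge> M \<and> x \<in> cball 0 R \<longrightarrow> norm (W (k n) x - g x) < e" by blast
      then show "\<exists>M. \<forall>n\<ge>M. norm (W (k n) x - v x) < e" using True by (auto simp: v_def)
    qed
  qed (simp add: v_def P(3))
  note cl = competitor_limit[OF N W(1) L R p lim]
  have "(\<lambda>n. s - inverse (real (Suc (k n)))) \<longlonglongrightarrow> s - 0"
    using LIMSEQ_subseq_LIMSEQ[OF LIMSEQ_inverse_real_of_nat g(1)] by (intro tendsto_intros) (simp add: o_def)
  then have "s - 0 \<le> hardy_integral v 0"
    by (rule LIMSEQ_le[OF _ cl(2)]) (use W(2) less_imp_le in blast)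
  then have "hardy_integral u 0 \<le> hardy_integral v 0" if "competitor L R p \<phi> u" for u
    using cSup_upper[OF _ bdd, of "hardy_integral u 0"] that unfolding s_def A_def by force
  then show ?thesis using that cl(1) by blast
qed

lemma integral_bisect:
  fixes f :: "'a::euclidean_space \<Rightarrow> real"
  assumes "integrable lborel f"
  shows "integrable lborel (\<lambda>x. f (bisect p q x))" "(LINT x|lborel. f (bisect p q x)) = (LINT x|lborel. f x)"
proof -
  have [measurable]: "f \<in> borel_measurable borel" using assms by auto
  have "integrable (distr lborel borel (bisect p q)) f" using assms by (simp add: lborel_distr_bisect)
  then show "integrable lborel (\<lambda>x. f (bisect p q x))" by (subst (asm) integrable_distr_eq) auto
  show "(LINT x|lborel. f (bisect p q x)) = (LINT x|lborel. f x)"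
    by (subst (2) lborel_distr_bisect[of p q, symmetric]) (simp add: integral_distr)
qed

lemma continuous_bisect: "continuous_on A (bisect p q)"
  unfolding bisect_def reflection_def divide_inverse by (intro continuous_intros)

text \<open>
  Otherwise the polarization that favours \<open>a\<close> over \<open>b\<close> moves, on an open set around \<open>a\<close>, larger values to
  points nearer to the origin. It stays a competitor and its Hardy integral is strictly larger.
\<close>

lemma maximizer_decreasing:
  fixes \<phi> :: "'a::euclidean_space \<Rightarrow> real"
  assumes N: "DIM('a) \<ge> 3" and L: "L \<ge> 0" and R: "R \<ge> 0" and w: "competitor L R p \<phi> w"
    and max: "\<And>v. competitor L R p \<phi> v \<Longrightarrow> hardy_integral v 0 \<le> hardy_integral w 0"
    and ab: "norm a < norm b"
  shows "w b \<le> w a"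
proof (rule ccontr)
  assume less: "\<not> w b \<le> w a"
  note P = competitor_props[OF w L R]
  define v where "v = polarize a b w"
  have v: "competitor L R p \<phi> v" unfolding v_def by (rule competitor_polarize[OF w L R ab])
  note iv = competitor_hardy_bound(1)[OF N v L R] and iw = competitor_hardy_bound(1)[OF N w L R]
  have pq: "a \<noteq> b" using ab by auto
  define D where "D x = (v x)\<^sup>2 / (norm (x - 0))\<^sup>2 - (w x)\<^sup>2 / (norm (x - 0))\<^sup>2" for x
  have iD: "integrable lborel D" unfolding D_def[abs_def] by (intro Bochner_Integration.integrable_diff iv iw)
  have "(LINT x|lborel. D x) = hardy_integral v 0 - hardy_integral w 0"
    unfolding D_def hardy_integral_def by (rule Bochner_Integration.integral_diff[OF iv iw])
  then have D0: "(LINT x|lborel. D x) \<le> 0" using max[OF v] by simp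
  define S where "S x = D x + D (bisect a b x)" for x
  have iS: "integrable lborel S" unfolding S_def[abs_def] by (intro Bochner_Integration.integrable_add iD integral_bisect)
  have S0: "(LINT x|lborel. S x) \<le> 0"
    unfolding S_def using D0 by (simp add: Bochner_Integration.integral_add[OF iD integral_bisect(1)[OF iD]] integral_bisect(2)[OF iD])
  have Seq: "S x = ((max (w x) (w (bisect a b x)))\<^sup>2 - (w x)\<^sup>2) * (1 / (norm x)\<^sup>2 - 1 / (norm (bisect a b x))\<^sup>2)"
    if s: "0 \<le> side a b x" for x
    unfolding S_def D_def v_def polarize_nonneg_side[OF pq s]
    by (cases "w x \<le> w (bisect a b x)") (simp_all add: max_def min_def diff_divide_distrib algebra_simps)
  have sq: "(w x)\<^sup>2 \<le> (max (w x) (w (bisect a b x)))\<^sup>2" for x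
    using P(1) by (intro power_mono) auto
  have pos: "0 \<le> S x" if "x \<noteq> 0" "0 \<le> side a b x" for x
    unfolding Seq[OF that(2)] using that sq norm_le_bisect[OF ab that(2)]
    by (intro mult_nonneg_nonneg) (auto intro!: divide_left_mono power_mono mult_pos_pos)
  have Ssym: "S (bisect a b x) = S x" for x by (simp add: S_def add.commute)
  have "AE x in lborel. 0 \<le> S x"
    using AE_neq_point[of 0] AE_neq_point[of "bisect a b 0"]
  proof eventually_elim
    case (elim x)
    then have "bisect a b x \<noteq> 0" by (metis bisect_bisect)
    then show ?case using pos[of x] pos[of "bisect a b x"] elim Ssym[of x] side_bisect[of a b x] by (cases "0 \<le> side a b x") auto
  qed
  then have nn: "AE x in lborel. 0 \<le> S x" .
  have "0 \<le> (LINT x|lborel. S x)" by (rule integral_nonneg_AE[OF nn])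
  then have "(LINT x|lborel. S x) = 0" using S0 by simp
  then have AE0: "AE x in lborel. S x = 0"
    using integral_nonneg_eq_0_iff_AE[OF iS nn] by simp
  define U where "U = {x. 0 < side a b x} \<inter> {x. w x < w (bisect a b x)}"
  have "open U"
    unfolding U_def side_def
    by (intro open_Int open_Collect_less continuous_intros P(6) continuous_on_compose2[OF P(6) continuous_bisect]) auto
  moreover have "a \<in> U" using less pq by (simp add: U_def side_self bisect_swap)
  moreover have "AE x in lborel. x \<noteq> 0 \<and> S x = 0" using AE_neq_point[of 0] AE0 by eventually_elim simp
  ultimately obtain x where x: "x \<in> U" "x \<noteq> 0" "S x = 0" using AE_open_nonempty[of _ U] by blast
  then have s: "0 < side a b x" and l: "w x < w (bisect a b x)" by (auto simp: U_def)
  have "(w x)\<^sup>2 < (w (bisect a b x))\<^sup>2" using l P(1) by (intro power_strict_mono) auto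
  moreover have "1 / (norm (bisect a b x))\<^sup>2 < 1 / (norm x)\<^sup>2"
    using norm_less_bisect[OF ab s] x(2) by (intro divide_strict_left_mono mult_pos_pos power_strict_mono) auto
  ultimately have "0 < S x" unfolding Seq[OF less_imp_le[OF s]] using l by (simp add: max_def)
  then show False using x(3) by simp
qed

text \<open>
  Points of equal norm are limits of points of larger norm.
\<close>

lemma maximizer_radial:
  fixes w :: "'a::euclidean_space \<Rightarrow> real"
  assumes c: "continuous_on UNIV w" and dec: "\<And>a b. norm a < norm b \<Longrightarrow> w b \<le> w a" and eq: "norm x = norm y"
  shows "w x = w y"
proof -
  have le: "w y \<le> w x" if eq: "norm x = norm y" for x y
  proof (cases "y = 0")
    case False
    define z where "z n = (1 + inverse (real (Suc n))) *\<^sub>R y" for n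
    have "z \<longlonglongrightarrow> (1 + 0) *\<^sub>R y" unfolding z_def by (intro tendsto_intros LIMSEQ_inverse_real_of_nat)
    then have "z \<longlonglongrightarrow> y" by simp
    then have l: "(\<lambda>n. w (z n)) \<longlonglongrightarrow> w y"
      using continuous_on_tendsto_compose[OF c, of z y] by simp
    have "norm x < norm (z n)" for n using eq False by (simp add: z_def distrib_right del: of_nat_Suc)
    then show ?thesis by (intro LIMSEQ_le_const2[OF l] exI[of _ 0] allI impI dec)
  qed (use eq in simp)
  show ?thesis using le[OF eq] le[OF eq[symmetric]] by simp
qed

text \<open>
  The radial maximizer among the competitors of \<open>\<phi>\<close> has the same norm as \<open>\<phi>\<close> and at least the same
  Hardy integral. Its mollifications are radial test functions whose Dirichlet energy does not exceed
  that of \<open>\<phi>\<close>, so the assumed inequality applies to them.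
\<close>

theorem radial_reduction:
  fixes \<phi> :: "'a::euclidean_space \<Rightarrow> real"
  assumes N: "DIM('a) \<ge> 3" and p: "p > 0" and M: "M \<ge> 0"
    and rad: "\<And>v :: 'a \<Rightarrow> real. v \<in> test_functions \<Longrightarrow> (\<And>x y. norm x = norm y \<Longrightarrow> v x = v y) \<Longrightarrow>
      S * (LINT x|lborel. \<bar>v x\<bar> powr p) powr (2 / p) \<le> (LINT x|lborel. (norm (gradient v x))\<^sup>2) - M * hardy_integral v 0"
    and \<phi>: "\<phi> \<in> test_functions"
  shows "S * (LINT x|lborel. \<bar>\<phi> x\<bar> powr p) powr (2 / p) \<le> (LINT x|lborel. (norm (gradient \<phi> x))\<^sup>2) - M * hardy_integral \<phi> 0"
proof -
  obtain R where R: "R > 0" "\<And>x. R < norm x \<Longrightarrow> \<phi> x = 0" using test_support[OF \<phi>] by blast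
  obtain L where L: "L > 0" "\<And>x y. \<bar>\<phi> x - \<phi> y\<bar> \<le> L * norm (x - y)" using test_lipschitz[OF \<phi>] by blast
  have R0: "R \<ge> 0" and L0: "L \<ge> 0" using R L by auto
  have c0: "competitor L R p \<phi> (\<lambda>x. \<bar>\<phi> x\<bar>)" using L(2) R(2) by (rule competitor_abs)
  obtain w where w: "competitor L R p \<phi> w" and max: "\<And>v. competitor L R p \<phi> v \<Longrightarrow> hardy_integral v 0 \<le> hardy_integral w 0"
    using competitor_maximizer[OF N L0 R0 p c0] by blast
  note P = competitor_props[OF w L0 R0]
  have wr: "w x = w y" if "norm x = norm y" for x y
    using P(6) maximizer_decreasing[OF N L0 R0 w max] that by (rule maximizer_radial)
  have h: "hardy_integral \<phi> 0 \<le> hardy_integral w 0" using max[OF c0] by (simp add: hardy_integral_def)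
  have "\<exists>v. v \<in> test_functions \<and> (\<forall>x y. norm x = norm y \<longrightarrow> v x = v y) \<and> (\<forall>x. \<bar>v x - w x\<bar> \<le> L * inverse (real (Suc n)))
     \<and> (\<forall>x. R + 1 < norm x \<longrightarrow> v x = 0) \<and> (\<forall>e. nonlocal_energy e v \<le> nonlocal_energy e w)" for n
  proof -
    define \<delta> where "\<delta> = inverse (real (Suc n))"
    have \<delta>: "\<delta> > 0" "\<delta> \<le> 1" by (auto simp: \<delta>_def inverse_le_1_iff simp del: of_nat_Suc)
    obtain v where "v \<in> test_functions" "\<And>x y. norm x = norm y \<Longrightarrow> v x = v y"
      "\<And>x. \<bar>v x - w x\<bar> \<le> L * \<delta>" "\<And>x. R + \<delta> < norm x \<Longrightarrow> v x = 0" "\<And>e. nonlocal_energy e v \<le> nonlocal_energy e w"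
      using mollify[OF P(2) P(3) wr \<delta>(1) L0] by blast
    moreover have "v x = 0" if "R + 1 < norm x" for x using \<delta> that by (intro \<open>\<And>x. R + \<delta> < norm x \<Longrightarrow> v x = 0\<close>) linarith
    ultimately show ?thesis unfolding \<delta>_def[symmetric] by blast
  qed
  then obtain V where V: "\<And>n. V n \<in> test_functions" "\<And>n x y. norm x = norm y \<Longrightarrow> V n x = V n y"
    "\<And>n x. \<bar>V n x - w x\<bar> \<le> L * inverse (real (Suc n))" "\<And>n x. R + 1 < norm x \<Longrightarrow> V n x = 0"
    "\<And>n e. nonlocal_energy e (V n) \<le> nonlocal_energy e w"
    by metis
  have lim: "(\<lambda>n. V n x) \<longlonglongrightarrow> w x" for x
  proof (rule LIM_zero_cancel, rule Lim_null_comparison)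
    have "(\<lambda>n. L * inverse (real (Suc n))) \<longlonglongrightarrow> L * 0" by (intro tendsto_intros LIMSEQ_inverse_real_of_nat)
    then show "(\<lambda>n. L * inverse (real (Suc n))) \<longlonglongrightarrow> 0" by simp
    show "\<forall>\<^sub>F n in sequentially. norm (V n x - w x) \<le> L * inverse (real (Suc n))" using V(3) by simp
  qed
  have bound: "\<bar>V n x\<bar> \<le> L * (2 * R + 1) + L" for n x
  proof -
    have "inverse (real (Suc n)) \<le> 1" by (simp add: inverse_le_1_iff)
    then have "L * inverse (real (Suc n)) \<le> L" using L0 by (simp add: mult_left_le)
    then show ?thesis using V(3)[of n x] P(8)[of x] by linarith
  qed
  note conv = bounded_support_convergence[OF N test_measurable[OF V(1)] bound V(4) lim p]
  have e: "(LINT x|lborel. (norm (gradient (V n) x))\<^sup>2) \<le> (LINT x|lborel. (norm (gradient \<phi> x))\<^sup>2)" for n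
    by (rule dirichlet_le_of_nonlocal_le[OF V(1) \<phi> order_trans[OF V(5) P(5)]])
  have bd: "S * (LINT x|lborel. \<bar>V n x\<bar> powr p) powr (2 / p) \<le> (LINT x|lborel. (norm (gradient \<phi> x))\<^sup>2) - M * hardy_integral (V n) 0" for n
    using rad[OF V(1) V(2), of n] e[of n] by linarith
  have "(\<lambda>n. S * (LINT x|lborel. \<bar>V n x\<bar> powr p) powr (2 / p)) \<longlonglongrightarrow> S * (LINT x|lborel. \<bar>w x\<bar> powr p) powr (2 / p)"
    using p by (intro tendsto_mult tendsto_const tendsto_powr' conv(1)) (auto intro!: always_eventually)
  moreover have "(\<lambda>n. (LINT x|lborel. (norm (gradient \<phi> x))\<^sup>2) - M * hardy_integral (V n) 0)
    \<longlonglongrightarrow> (LINT x|lborel. (norm (gradient \<phi> x))\<^sup>2) - M * hardy_integral w 0"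
    by (intro tendsto_intros conv(2))
  ultimately have "S * (LINT x|lborel. \<bar>w x\<bar> powr p) powr (2 / p) \<le> (LINT x|lborel. (norm (gradient \<phi> x))\<^sup>2) - M * hardy_integral w 0"
    by (rule LIMSEQ_le) (use bd in blast)
  also have "\<dots> \<le> (LINT x|lborel. (norm (gradient \<phi> x))\<^sup>2) - M * hardy_integral \<phi> 0"
    using mult_left_mono[OF h M] by simp
  finally show ?thesis unfolding P(4) .
qed

section \<open>The Hardy inequality in the Dirichlet space\<close>

lemma critical_exponent_gt_1: "DIM('a::euclidean_space) \<ge> 3 \<Longrightarrow> critical_exponent DIM('a) > 1"
  by (simp add: critical_exponent_def)

lemma D12_test_approximation:
  fixes u :: "'a::euclidean_space \<Rightarrow> real"
  assumes u: "u \<in> D12" and N: "DIM('a) \<ge> 3"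
  obtains \<phi> \<epsilon> where "\<And>n. \<phi> n \<in> test_functions" "AE x in lborel. (\<lambda>n. \<phi> n x) \<longlonglongrightarrow> u x"
    "(\<lambda>n. LINT x|lborel. (norm (gradient (\<phi> n) x))\<^sup>2) \<longlonglongrightarrow> dirichlet_energy u"
    "\<And>b. (\<lambda>n. hardy_integral (\<phi> n) b) \<longlonglongrightarrow> hardy_integral u b"
    "\<And>n b. integrable lborel (\<lambda>x. (\<phi> n x - u x)\<^sup>2 / (norm (x - b))\<^sup>2)"
    "\<And>n b. hardy_integral (\<lambda>x. \<phi> n x - u x) b \<le> \<epsilon> n" "\<epsilon> \<longlonglongrightarrow> (0::real)"
    "\<And>b. integrable lborel (\<lambda>x. (u x)\<^sup>2 / (norm (x - b))\<^sup>2)"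
proof -
  obtain g \<phi> where g: "has_weak_gradient u g" "integrable lborel (\<lambda>x. (norm (g x))\<^sup>2)"
    and \<phi>: "\<And>n. \<phi> n \<in> test_functions"
    and l: "(\<lambda>n. LINT x|lborel. (norm (gradient (\<phi> n) x - g x))\<^sup>2) \<longlonglongrightarrow> 0"
    and ae: "AE x in lborel. (\<lambda>n. \<phi> n x) \<longlonglongrightarrow> u x"
    and i: "\<And>n b. integrable lborel (\<lambda>x. (\<phi> n x - u x)\<^sup>2 / (norm (x - b))\<^sup>2)"
    and h: "\<And>n b. hardy_integral (\<lambda>x. \<phi> n x - u x) b
       \<le> 2 * hardy_constant TYPE('a) * (LINT x|lborel. (norm (gradient (\<phi> n) x - g x))\<^sup>2)"
    by (rule D12_approximation[OF u N]) (rule that, assumption+)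
  have [measurable]: "u \<in> borel_measurable borel" using u by (simp add: D12_def D12_ambient_def)
  have [measurable]: "g \<in> borel_measurable borel"
    using g by (simp add: has_weak_gradient_def locally_integrable_def)
  have [measurable]: "\<phi> n \<in> borel_measurable borel" "gradient (\<phi> n) \<in> borel_measurable borel" for n
    using \<phi> by (auto intro: test_measurable gradient_measurable)
  define \<epsilon> where "\<epsilon> n = 2 * hardy_constant TYPE('a) * (LINT x|lborel. (norm (gradient (\<phi> n) x - g x))\<^sup>2)" for n
  have "\<epsilon> \<longlonglongrightarrow> 2 * hardy_constant TYPE('a) * 0" unfolding \<epsilon>_def by (intro tendsto_intros l)
  then have \<epsilon>: "\<epsilon> \<longlonglongrightarrow> 0" by simp
  have en: "(\<lambda>n. LINT x|lborel. (norm (gradient (\<phi> n) x))\<^sup>2) \<longlonglongrightarrow> dirichlet_energy u"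
    unfolding dirichlet_energy_eq[OF g(1)]
    by (rule norm_square_convergence[OF _ _ test_norm_gradient_integrable[OF \<phi>] g(2) l]) measurable
  have sq: "(norm (s / norm y))\<^sup>2 = s\<^sup>2 / (norm y)\<^sup>2" for s :: real and y :: 'a
    by (simp add: power_divide)
  have i1: "integrable lborel (\<lambda>x. (norm (\<phi> n x / norm (x - b)))\<^sup>2)" for n b
    unfolding sq by (rule hardy_test(1)[OF \<phi> N])
  have i2: "integrable lborel (\<lambda>x. (norm ((\<phi> n x - u x) / norm (x - b)))\<^sup>2)" for n b
    using i[of n b] by (simp only: sq)
  have iu: "integrable lborel (\<lambda>x. (norm (u x / norm (x - b)))\<^sup>2)" for b
  proof -
    have "integrable lborel (\<lambda>x. (norm (\<phi> 0 x / norm (x - b) - (\<phi> 0 x - u x) / norm (x - b)))\<^sup>2)"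
      by (rule integrable_square_diff(1)[OF _ _ i1 i2]) measurable
    then show ?thesis by (simp add: diff_divide_distrib)
  qed
  have hl: "(\<lambda>n. hardy_integral (\<phi> n) b) \<longlonglongrightarrow> hardy_integral u b" for b
  proof -
    have "(\<lambda>n. hardy_integral (\<lambda>x. \<phi> n x - u x) b) \<longlonglongrightarrow> 0"
    proof (rule Lim_null_comparison[OF _ \<epsilon>])
      show "\<forall>\<^sub>F n in sequentially. norm (hardy_integral (\<lambda>x. \<phi> n x - u x) b) \<le> \<epsilon> n"
      proof (rule always_eventually, rule allI)
        fix n
        show "norm (hardy_integral (\<lambda>x. \<phi> n x - u x) b) \<le> \<epsilon> n"
          using h[of n b] hardy_integral_nonneg[of "\<lambda>x. \<phi> n x - u x" b] by (simp add: \<epsilon>_def)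
      qed
    qed
    then have z: "(\<lambda>n. LINT x|lborel. (norm (\<phi> n x / norm (x - b) - u x / norm (x - b)))\<^sup>2) \<longlonglongrightarrow> 0"
      unfolding hardy_integral_def by (simp only: diff_divide_distrib[symmetric] sq)
    have "(\<lambda>n. LINT x|lborel. (norm (\<phi> n x / norm (x - b)))\<^sup>2) \<longlonglongrightarrow> (LINT x|lborel. (norm (u x / norm (x - b)))\<^sup>2)"
      by (rule norm_square_convergence[OF _ _ i1 iu z]) measurable
    then show ?thesis unfolding hardy_integral_def by (simp only: sq)
  qed
  show ?thesis
    by (rule that[OF \<phi> ae en hl i _ \<epsilon> iu[unfolded sq]]) (simp only: \<epsilon>_def h)
qed

lemma D12_hardy_integrable:
  fixes u :: "'a::euclidean_space \<Rightarrow> real"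
  assumes "u \<in> D12" "DIM('a) \<ge> 3"
  shows "integrable lborel (\<lambda>x. (u x)\<^sup>2 / (norm (x - b))\<^sup>2)"
proof (rule D12_test_approximation[OF assms])
  assume "\<And>b. integrable lborel (\<lambda>x. (u x)\<^sup>2 / (norm (x - b))\<^sup>2)"
  then show ?thesis .
qed

lemma D12_hardy:
  fixes u :: "'a::euclidean_space \<Rightarrow> real"
  assumes u: "u \<in> D12" and N: "DIM('a) \<ge> 3"
  shows "hardy_integral u b \<le> hardy_constant TYPE('a) * dirichlet_energy u"
proof -
  obtain \<phi> where \<phi>: "\<And>n. \<phi> n \<in> test_functions"
    and en: "(\<lambda>n. LINT x|lborel. (norm (gradient (\<phi> n) x))\<^sup>2) \<longlonglongrightarrow> dirichlet_energy u"
    and hl: "\<And>b. (\<lambda>n. hardy_integral (\<phi> n) b) \<longlonglongrightarrow> hardy_integral u b"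
    by (rule D12_test_approximation[OF u N]) (rule that, assumption+)
  show ?thesis
    by (rule LIMSEQ_le[OF hl tendsto_mult[OF tendsto_const en]]) (use hardy_test(2)[OF \<phi> N] in blast)
qed

lemma D12_measurable: "u \<in> D12 \<Longrightarrow> u \<in> borel_measurable borel"
  by (simp add: D12_def D12_ambient_def)

lemma dirichlet_energy_nonneg: "0 \<le> dirichlet_energy u"
  by (simp add: dirichlet_energy_def)

lemma hardy_integral_pos:
  fixes u :: "'a::euclidean_space \<Rightarrow> real"
  assumes u: "u \<in> D12" and N: "DIM('a) \<ge> 3" and ne: "u \<notin> null_functions"
  shows "0 < hardy_integral u b"
proof (rule ccontr)
  assume "\<not> 0 < hardy_integral u b"
  then have "hardy_integral u b = 0" using hardy_integral_nonneg[of u b] by linarith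
  then have "(LINT x|lborel. (u x)\<^sup>2 / (norm (x - b))\<^sup>2) = 0" unfolding hardy_integral_def .
  then have "AE x in lborel. (u x)\<^sup>2 / (norm (x - b))\<^sup>2 = 0"
    using integral_nonneg_eq_0_iff_AE[OF D12_hardy_integrable[OF u N]] by simp
  then have "AE x in lborel. u x = 0"
    using AE_neq_point[of b] by eventually_elim simp
  then show False using ne by (simp add: null_functions_def)
qed

text \<open>
  For a test function the integral is of the order of the inverse square distance of the centre from
  the support. The Hardy inequality makes the approximation by test functions uniform in the centre.
\<close>

lemma hardy_integral_vanishes:
  fixes u :: "'a::euclidean_space \<Rightarrow> real"
  assumes u: "u \<in> D12" and N: "DIM('a) \<ge> 3" and \<eta>: "\<eta> > 0"
  obtains r where "r > 0" "\<And>b. r \<le> norm b \<Longrightarrow> hardy_integral u b < \<eta>"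
proof -
  obtain \<phi> \<epsilon> where \<phi>: "\<And>n. \<phi> n \<in> test_functions"
    and i: "\<And>n b. integrable lborel (\<lambda>x. (\<phi> n x - u x)\<^sup>2 / (norm (x - b))\<^sup>2)"
    and h: "\<And>n b. hardy_integral (\<lambda>x. \<phi> n x - u x) b \<le> \<epsilon> n" and \<epsilon>: "\<epsilon> \<longlonglongrightarrow> (0::real)"
    by (rule D12_test_approximation[OF u N]) (rule that, assumption+)
  have [measurable]: "u \<in> borel_measurable borel" by (rule D12_measurable[OF u])
  have "\<forall>\<^sub>F n in sequentially. \<epsilon> n < \<eta> / 4" using \<epsilon> \<eta> by (intro order_tendstoD(2)) auto
  then obtain n where n: "\<epsilon> n < \<eta> / 4" using eventually_happens[of _ sequentially] by auto
  define f where "f = \<phi> n"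
  have f: "f \<in> test_functions" unfolding f_def by (rule \<phi>)
  have [measurable]: "f \<in> borel_measurable borel" by (rule test_measurable[OF f])
  obtain R where R: "R > 0" "\<And>x. R < norm x \<Longrightarrow> f x = 0" using test_support[OF f] by blast
  have f2: "integrable lborel (\<lambda>x. (f x)\<^sup>2)"
    using test_integrable[OF test_mult_smooth[OF f test_smooth[OF f]]] by (simp add: power2_eq_square)
  define I where "I = (LINT x|lborel. (f x)\<^sup>2)"
  have I: "I \<ge> 0" by (simp add: I_def)
  define s where "s = sqrt (8 * (I + 1) / \<eta>)"
  have s: "s > 0" "s\<^sup>2 = 8 * (I + 1) / \<eta>" using \<eta> I by (auto simp: s_def)
  have far: "hardy_integral f b < \<eta> / 4" if b: "R + s \<le> norm b" for b
  proof -
    have "hardy_integral f b \<le> (LINT x|lborel. (1 / s\<^sup>2) * (f x)\<^sup>2)"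
      unfolding hardy_integral_def
    proof (rule integral_mono[OF hardy_test(1)[OF f N] integrable_mult_right[OF f2]])
      fix x
      show "(f x)\<^sup>2 / (norm (x - b))\<^sup>2 \<le> (1 / s\<^sup>2) * (f x)\<^sup>2"
      proof (cases "norm x \<le> R")
        case True
        have "norm b \<le> norm (x - b) + norm x" by (metis add.commute norm_minus_commute norm_triangle_sub)
        then have "s \<le> norm (x - b)" using b True by linarith
        then have "s\<^sup>2 \<le> (norm (x - b))\<^sup>2" using s by (intro power_mono) auto
        then have "(f x)\<^sup>2 / (norm (x - b))\<^sup>2 \<le> (f x)\<^sup>2 / s\<^sup>2" using s(1) by (intro divide_left_mono) (auto intro!: mult_pos_pos)
        then show ?thesis by simp
      qed (use R in simp)
    qed
    also have "\<dots> = I / s\<^sup>2" by (simp add: I_def)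
    also have "\<dots> < \<eta> / 4" unfolding s(2) using \<eta> I by (simp add: field_simps add_pos_nonneg)
    finally show ?thesis .
  qed
  have sq: "(norm (s / norm y))\<^sup>2 = s\<^sup>2 / (norm y)\<^sup>2" for s :: real and y :: 'a
    by (simp add: power_divide)
  have "hardy_integral u b < \<eta>" if b: "R + s \<le> norm b" for b
  proof -
    have i1: "integrable lborel (\<lambda>x. (norm (f x / norm (x - b)))\<^sup>2)"
      unfolding sq by (rule hardy_test(1)[OF f N])
    have i2: "integrable lborel (\<lambda>x. (norm ((f x - u x) / norm (x - b)))\<^sup>2)"
      using i[of n b] by (simp only: sq f_def)
    have "(LINT x|lborel. (norm (f x / norm (x - b) - (f x - u x) / norm (x - b)))\<^sup>2)
      \<le> 2 * (LINT x|lborel. (norm (f x / norm (x - b)))\<^sup>2) + 2 * (LINT x|lborel. (norm ((f x - u x) / norm (x - b)))\<^sup>2)"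
      by (rule integrable_square_diff(2)[OF _ _ i1 i2]) measurable
    moreover have "f x / norm (x - b) - (f x - u x) / norm (x - b) = u x / norm (x - b)" for x
      by (simp add: diff_divide_distrib)
    ultimately have "hardy_integral u b \<le> 2 * hardy_integral f b + 2 * hardy_integral (\<lambda>x. f x - u x) b"
      unfolding hardy_integral_def by (simp only: sq)
    then show ?thesis using far[OF b] h[of n b] n unfolding f_def by linarith
  qed
  then show ?thesis using that[of "R + s"] R(1) s(1) by simp
qed

lemma hardy_integral_translate:
  fixes u :: "'a::euclidean_space \<Rightarrow> real"
  assumes [measurable]: "u \<in> borel_measurable borel"
  shows "hardy_integral u b = hardy_integral (\<lambda>x. u (x + b)) 0"
proof -
  have "(LINT x|lborel. (u (x + b))\<^sup>2 / (norm (x + b - b))\<^sup>2) = (LINT x|lborel. (u x)\<^sup>2 / (norm (x - b))\<^sup>2)"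
    by (rule integral_translate[of "\<lambda>x. (u x)\<^sup>2 / (norm (x - b))\<^sup>2" b]) measurable
  then show ?thesis unfolding hardy_integral_def by (simp only: add_diff_cancel diff_zero)
qed

lemma test_hardy_continuous:
  fixes \<phi> :: "'a::euclidean_space \<Rightarrow> real"
  assumes \<phi>: "\<phi> \<in> test_functions" and N: "DIM('a) \<ge> 3" and \<eta>: "\<eta> > 0"
  obtains r where "r > 0" "\<And>b. norm b < r \<Longrightarrow> hardy_integral \<phi> 0 - \<eta> < hardy_integral \<phi> b"
proof -
  have "\<exists>r>0. \<forall>b. norm b < r \<longrightarrow> hardy_integral \<phi> 0 - \<eta> < hardy_integral \<phi> b"
  proof (rule ccontr)
    assume *: "\<not> (\<exists>r>0. \<forall>b. norm b < r \<longrightarrow> hardy_integral \<phi> 0 - \<eta> < hardy_integral \<phi> b)"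
    have "\<exists>b. norm b < inverse (real (Suc n)) \<and> hardy_integral \<phi> b \<le> hardy_integral \<phi> 0 - \<eta>" for n
      using * by (metis inverse_positive_iff_positive not_less of_nat_0_less_iff zero_less_Suc)
    then obtain B where B: "\<And>n. norm (B n) < inverse (real (Suc n))" "\<And>n. hardy_integral \<phi> (B n) \<le> hardy_integral \<phi> 0 - \<eta>"
      by metis
    have "B \<longlonglongrightarrow> 0"
      by (rule Lim_null_comparison[OF _ LIMSEQ_inverse_real_of_nat]) (use B(1) less_imp_le in \<open>auto intro!: always_eventually\<close>)
    have B1: "norm (B n) \<le> 1" for n
      using B(1)[of n] inverse_le_1_iff[of "real (Suc n)"] by simp
    obtain R where R: "R > 0" "\<And>x. R < norm x \<Longrightarrow> \<phi> x = 0" using test_support[OF \<phi>] by blast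
    obtain C where C: "\<And>x. norm (\<phi> x) \<le> C" using bounded_compact_support[OF test_continuous[OF \<phi>] R(2)] by blast
    have m[measurable]: "\<phi> \<in> borel_measurable borel" by (rule test_measurable[OF \<phi>])
    have "(\<lambda>n. hardy_integral \<phi> (B n)) \<longlonglongrightarrow> hardy_integral \<phi> 0"
      unfolding hardy_integral_translate[OF m, of "B n" for n]
    proof (rule bounded_support_convergence(2)[OF N, where B=C and R="R + 1" and p=1])
      show "\<bar>\<phi> (x + B n)\<bar> \<le> C" for n x using C[of "x + B n"] by simp
      show "\<phi> (x + B n) = 0" if "R + 1 < norm x" for n x
      proof (rule R(2))
        have "norm x \<le> norm (x + B n) + norm (B n)" by (metis add_diff_cancel norm_triangle_ineq4)
        then show "R < norm (x + B n)" using that B1[of n] by linarith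
      qed
      show "(\<lambda>n. \<phi> (x + B n)) \<longlonglongrightarrow> \<phi> x" for x
        using continuous_on_tendsto_compose[OF test_continuous[OF \<phi>, of UNIV], of "\<lambda>n. x + B n" x]
          tendsto_add[OF tendsto_const[of x] \<open>B \<longlonglongrightarrow> 0\<close>] by simp
      show "(\<lambda>x. \<phi> (x + B n)) \<in> borel_measurable borel" for n by measurable
    qed simp
    then have "hardy_integral \<phi> 0 \<le> hardy_integral \<phi> 0 - \<eta>"
      by (rule LIMSEQ_le_const2) (use B(2) in blast)
    then show False using \<eta> by simp
  qed
  then show ?thesis using that by blast
qed

section \<open>Dilations and perturbations\<close>

lemma hardy_integral_rescale:
  fixes u :: "'a::euclidean_space \<Rightarrow> real"
  assumes [measurable]: "u \<in> borel_measurable borel" and c: "c > 0"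
  shows "hardy_integral (\<lambda>x. u (c *\<^sub>R x)) b = c\<^sup>2 / c ^ DIM('a) * hardy_integral u (c *\<^sub>R b)"
proof -
  have "norm (c *\<^sub>R x - c *\<^sub>R b) = c * norm (x - b)" for x :: 'a
    unfolding scaleR_diff_right[symmetric] using c by simp
  then have "hardy_integral (\<lambda>x. u (c *\<^sub>R x)) b = (LINT x|lborel. c\<^sup>2 * ((u (c *\<^sub>R x))\<^sup>2 / (norm (c *\<^sub>R x - c *\<^sub>R b))\<^sup>2))"
    unfolding hardy_integral_def using c by (simp add: power_mult_distrib)
  also have "\<dots> = c\<^sup>2 * (hardy_integral u (c *\<^sub>R b) / c ^ DIM('a))"
    unfolding hardy_integral_def integral_mult_right_zero
    using integral_rescale[of "\<lambda>x. (u x)\<^sup>2 / (norm (x - c *\<^sub>R b))\<^sup>2" c] c by simp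
  finally show ?thesis by simp
qed

lemma dirichlet_energy_rescale:
  fixes u :: "'a::euclidean_space \<Rightarrow> real"
  assumes u: "has_weak_gradient u g" and c: "c > 0"
  shows "dirichlet_energy (\<lambda>x. u (c *\<^sub>R x)) = c\<^sup>2 / c ^ DIM('a) * dirichlet_energy u"
proof -
  have [measurable]: "g \<in> borel_measurable borel" using u by (simp add: has_weak_gradient_def locally_integrable_def)
  show ?thesis
    unfolding dirichlet_energy_eq[OF has_weak_gradient_rescale[OF u c]] dirichlet_energy_eq[OF u]
    using integral_rescale[of "\<lambda>x. (norm (g x))\<^sup>2" c] c by (simp add: power_mult_distrib)
qed

lemma D12_rescale:
  fixes u :: "'a::euclidean_space \<Rightarrow> real"
  assumes u: "u \<in> D12" and c: "c > 0"
  shows "(\<lambda>x. u (c *\<^sub>R x)) \<in> D12"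
proof -
  have [measurable]: "u \<in> borel_measurable borel" by (rule D12_measurable[OF u])
  have p: "integrable lborel (\<lambda>x. \<bar>u x\<bar> powr critical_exponent DIM('a))" using u by (simp add: D12_def D12_ambient_def)
  obtain g where g: "has_weak_gradient u g" "integrable lborel (\<lambda>x. (norm (g x))\<^sup>2)"
    using u by (auto simp: D12_def D12_ambient_def)
  obtain \<phi> where \<phi>: "\<And>n. \<phi> n \<in> test_functions"
    and l: "(\<lambda>n. sqrt (dirichlet_energy (\<lambda>x. \<phi> n x - u x))) \<longlonglongrightarrow> 0"
    using u by (auto simp: D12_def)
  have "integrable lborel (\<lambda>x. c\<^sup>2 * (norm (g (c *\<^sub>R x)))\<^sup>2)"
    using integrable_rescale[OF g(2), of c] c by (intro integrable_mult_right) simp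
  then have "integrable lborel (\<lambda>x. (norm (c *\<^sub>R g (c *\<^sub>R x)))\<^sup>2)" by (simp add: power_mult_distrib)
  then have amb: "(\<lambda>x. u (c *\<^sub>R x)) \<in> D12_ambient"
    unfolding D12_ambient_def using has_weak_gradient_rescale[OF g(1) c] integrable_rescale[OF p, of c] c by auto
  have e: "sqrt (dirichlet_energy (\<lambda>x. \<phi> n (c *\<^sub>R x) - u (c *\<^sub>R x))) = sqrt (c\<^sup>2 / c ^ DIM('a)) * sqrt (dirichlet_energy (\<lambda>x. \<phi> n x - u x))" for n
    unfolding dirichlet_energy_rescale[OF has_weak_gradient_diff[OF weak_gradient_test[OF \<phi>] g(1)] c] real_sqrt_mult ..
  have "(\<lambda>n. sqrt (c\<^sup>2 / c ^ DIM('a)) * sqrt (dirichlet_energy (\<lambda>x. \<phi> n x - u x))) \<longlonglongrightarrow> sqrt (c\<^sup>2 / c ^ DIM('a)) * 0"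
    by (intro tendsto_intros l)
  then have "(\<lambda>n. sqrt (dirichlet_energy (\<lambda>x. \<phi> n (c *\<^sub>R x) - u (c *\<^sub>R x)))) \<longlonglongrightarrow> 0" unfolding e by simp
  moreover have "(\<lambda>x. \<phi> n (c *\<^sub>R x)) \<in> test_functions" for n using test_rescale[OF \<phi>[of n], where s=c and v=0] c by simp
  ultimately show ?thesis
    unfolding D12_def using amb by (intro CollectI conjI exI[of _ "\<lambda>n x. \<phi> n (c *\<^sub>R x)"] allI)
qed

lemma test_powr_integrable:
  fixes \<phi> :: "'a::euclidean_space \<Rightarrow> real"
  assumes \<phi>: "\<phi> \<in> test_functions" and p: "p > 0"
  shows "integrable lborel (\<lambda>x. \<bar>\<phi> x\<bar> powr p)"
proof -
  obtain R where R: "\<And>x. R < norm x \<Longrightarrow> \<phi> x = 0" using test_support[OF \<phi>] by blast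
  show ?thesis
  proof (rule integrable_compact_support[where R=R])
    show "continuous_on UNIV (\<lambda>x. \<bar>\<phi> x\<bar> powr p)"
      using p by (intro continuous_on_powr' continuous_intros test_continuous[OF \<phi>]) auto
  qed (use R in auto)
qed

lemma D12_diff_test:
  fixes u :: "'a::euclidean_space \<Rightarrow> real"
  assumes u: "u \<in> D12" and \<eta>: "\<eta> \<in> test_functions" and N: "DIM('a) \<ge> 3"
  shows "(\<lambda>x. u x - \<eta> x) \<in> D12"
proof -
  define p where "p = critical_exponent DIM('a)"
  have p: "p > 1" unfolding p_def by (rule critical_exponent_gt_1[OF N])
  have um[measurable]: "u \<in> borel_measurable borel" by (rule D12_measurable[OF u])
  have hm[measurable]: "\<eta> \<in> borel_measurable borel" by (rule test_measurable[OF \<eta>])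
  have up: "integrable lborel (\<lambda>x. \<bar>u x\<bar> powr p)" using u by (simp add: D12_def D12_ambient_def p_def)
  obtain g where g: "has_weak_gradient u g" "integrable lborel (\<lambda>x. (norm (g x))\<^sup>2)"
    using u by (auto simp: D12_def D12_ambient_def)
  have gm[measurable]: "g \<in> borel_measurable borel" using g by (simp add: has_weak_gradient_def locally_integrable_def)
  have [measurable]: "gradient \<eta> \<in> borel_measurable borel" by (rule gradient_measurable[OF \<eta>])
  obtain \<phi> where \<phi>: "\<And>n. \<phi> n \<in> test_functions"
    and l: "(\<lambda>n. sqrt (dirichlet_energy (\<lambda>x. \<phi> n x - u x))) \<longlonglongrightarrow> 0"
    using u by (auto simp: D12_def)
  have "integrable lborel (\<lambda>x. 2 powr p * (\<bar>u x\<bar> powr p + \<bar>\<eta> x\<bar> powr p))"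
    using p by (intro integrable_mult_right Bochner_Integration.integrable_add up test_powr_integrable[OF \<eta>]) simp
  then have "integrable lborel (\<lambda>x. \<bar>u x - \<eta> x\<bar> powr p)"
  proof (rule Bochner_Integration.integrable_bound)
    show "AE x in lborel. norm (\<bar>u x - \<eta> x\<bar> powr p) \<le> norm (2 powr p * (\<bar>u x\<bar> powr p + \<bar>\<eta> x\<bar> powr p))"
    proof (rule AE_I2)
      fix x
      have "\<bar>u x - \<eta> x\<bar> powr p \<le> (2 * max \<bar>u x\<bar> \<bar>\<eta> x\<bar>) powr p"
        using p by (intro powr_mono2) auto
      also have "\<dots> = 2 powr p * (max \<bar>u x\<bar> \<bar>\<eta> x\<bar>) powr p" by (simp add: powr_mult)
      also have "\<dots> \<le> 2 powr p * (\<bar>u x\<bar> powr p + \<bar>\<eta> x\<bar> powr p)"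
        by (intro mult_left_mono) (auto simp: max_def)
      finally show "norm (\<bar>u x - \<eta> x\<bar> powr p) \<le> norm (2 powr p * (\<bar>u x\<bar> powr p + \<bar>\<eta> x\<bar> powr p))" by simp
    qed
  qed measurable
  moreover have "has_weak_gradient (\<lambda>x. u x - \<eta> x) (\<lambda>x. g x - gradient \<eta> x)"
    by (rule has_weak_gradient_diff[OF g(1) weak_gradient_test[OF \<eta>]])
  moreover have "integrable lborel (\<lambda>x. (norm (g x - gradient \<eta> x))\<^sup>2)"
    by (rule integrable_square_diff(1)[OF _ _ g(2) test_norm_gradient_integrable[OF \<eta>]]) measurable
  ultimately have amb: "(\<lambda>x. u x - \<eta> x) \<in> D12_ambient" unfolding D12_ambient_def p_def by auto
  have "(\<lambda>x. (\<phi> n x - \<eta> x) - (u x - \<eta> x)) = (\<lambda>x. \<phi> n x - u x)" for n by auto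
  then have "(\<lambda>n. sqrt (dirichlet_energy (\<lambda>x. (\<phi> n x - \<eta> x) - (u x - \<eta> x)))) \<longlonglongrightarrow> 0" using l by simp
  moreover have "(\<lambda>x. \<phi> n x - \<eta> x) \<in> test_functions" for n by (rule test_diff[OF \<phi> \<eta>])
  ultimately show ?thesis unfolding D12_def using amb by (intro CollectI conjI exI[of _ "\<lambda>n x. \<phi> n x - \<eta> x"]) auto
qed

lemma test_in_D12:
  fixes \<phi> :: "'a::euclidean_space \<Rightarrow> real"
  assumes \<phi>: "\<phi> \<in> test_functions" and N: "DIM('a) \<ge> 3"
  shows "\<phi> \<in> D12"
proof -
  have "critical_exponent DIM('a) > 0" using critical_exponent_gt_1[OF N] by simp
  then have amb: "\<phi> \<in> D12_ambient"
    unfolding D12_ambient_def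
    using test_measurable[OF \<phi>] test_powr_integrable[OF \<phi>] weak_gradient_test[OF \<phi>] test_norm_gradient_integrable[OF \<phi>] by auto
  have "dirichlet_energy (\<lambda>x. \<phi> x - \<phi> x) = 0"
    unfolding dirichlet_energy_eq[OF has_weak_gradient_diff[OF weak_gradient_test[OF \<phi>] weak_gradient_test[OF \<phi>]]] by simp
  then show ?thesis unfolding D12_def using amb \<phi> by (intro CollectI conjI exI[of _ "\<lambda>_. \<phi>"]) auto
qed

lemma dirichlet_energy_test: "\<phi> \<in> test_functions \<Longrightarrow> dirichlet_energy \<phi> = (LINT x|lborel. (norm (gradient \<phi> x))\<^sup>2)"
  by (rule dirichlet_energy_eq[OF weak_gradient_test])

section \<open>Extension to the Dirichlet space and the two-centre contradiction\<close>

definition power_integral :: "real \<Rightarrow> ('a::euclidean_space \<Rightarrow> real) \<Rightarrow> real" where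
  "power_integral p u = (LINT x|lborel. \<bar>u x\<bar> powr p)"

lemma power_integral_nonneg: "0 \<le> power_integral p u"
  by (simp add: power_integral_def)

lemma D12_power_integrable:
  fixes u :: "'a::euclidean_space \<Rightarrow> real"
  shows "u \<in> D12 \<Longrightarrow> integrable lborel (\<lambda>x. \<bar>u x\<bar> powr critical_exponent DIM('a))"
  by (simp add: D12_def D12_ambient_def)

text \<open>
  The right-hand side is continuous along an approximating sequence, and the left-hand side is lower
  semicontinuous by Fatou's lemma. The Hardy inequality keeps the limit of the right-hand side
  nonnegative, so that roots may be taken.
\<close>

lemma D12_extension:
  fixes u :: "'a::euclidean_space \<Rightarrow> real"
  assumes N: "DIM('a) \<ge> 3" and p: "p > 0" and S: "S \<ge> 0" and M: "0 \<le> M" "M * hardy_constant TYPE('a) \<le> 1"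
    and test: "\<And>\<phi> :: 'a \<Rightarrow> real. \<phi> \<in> test_functions \<Longrightarrow>
      S * power_integral p \<phi> powr (2 / p) \<le> (LINT x|lborel. (norm (gradient \<phi> x))\<^sup>2) - M * hardy_integral \<phi> b"
    and u: "u \<in> D12"
  shows "S * power_integral p u powr (2 / p) \<le> dirichlet_energy u - M * hardy_integral u b"
proof -
  obtain \<phi> where \<phi>: "\<And>n. \<phi> n \<in> test_functions" and ae: "AE x in lborel. (\<lambda>n. \<phi> n x) \<longlonglongrightarrow> u x"
    and en: "(\<lambda>n. LINT x|lborel. (norm (gradient (\<phi> n) x))\<^sup>2) \<longlonglongrightarrow> dirichlet_energy u"
    and hl: "\<And>b. (\<lambda>n. hardy_integral (\<phi> n) b) \<longlonglongrightarrow> hardy_integral u b"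
    by (rule D12_test_approximation[OF u N]) (rule that, assumption+)
  have [measurable]: "u \<in> borel_measurable borel" by (rule D12_measurable[OF u])
  define Q where "Q n = (LINT x|lborel. (norm (gradient (\<phi> n) x))\<^sup>2) - M * hardy_integral (\<phi> n) b" for n
  define q where "q = dirichlet_energy u - M * hardy_integral u b"
  have Ql: "Q \<longlonglongrightarrow> q" unfolding Q_def q_def by (intro tendsto_intros en hl)
  have "M * hardy_integral u b \<le> M * (hardy_constant TYPE('a) * dirichlet_energy u)"
    by (intro mult_left_mono D12_hardy[OF u N] M)
  also have "\<dots> \<le> 1 * dirichlet_energy u"
    unfolding mult.assoc[symmetric] by (intro mult_right_mono M dirichlet_energy_nonneg)
  finally have q0: "q \<ge> 0" by (simp add: q_def)
  show ?thesis
  proof (cases "S = 0")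
    case False
    then have S: "S > 0" using S by simp
    have Qn: "power_integral p (\<phi> n) powr (2 / p) \<le> Q n / S" for n
      using test[OF \<phi>, of n] S by (simp add: Q_def pos_le_divide_eq mult.commute)
    then have Q0: "0 \<le> Q n / S" for n using powr_ge_zero order_trans by blast
    have le: "power_integral p (\<phi> n) \<le> (Q n / S) powr (p / 2)" for n
    proof -
      have "power_integral p (\<phi> n) = (power_integral p (\<phi> n) powr (2 / p)) powr (p / 2)"
        using p power_integral_nonneg[of p "\<phi> n"] by (simp add: powr_powr)
      also have "\<dots> \<le> (Q n / S) powr (p / 2)" using p by (intro powr_mono2 Qn) auto
      finally show ?thesis .
    qed
    have cl: "(\<lambda>n. (Q n / S) powr (p / 2)) \<longlonglongrightarrow> (q / S) powr (p / 2)"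
      using p S Q0 by (intro tendsto_powr' tendsto_divide Ql tendsto_const) (auto intro!: always_eventually)
    have aep: "AE x in lborel. (\<lambda>n. \<bar>\<phi> n x\<bar> powr p) \<longlonglongrightarrow> \<bar>u x\<bar> powr p"
      using ae
    proof eventually_elim
      case (elim x)
      then show ?case using p by (intro tendsto_powr' tendsto_rabs tendsto_const) auto
    qed
    have "power_integral p u \<le> (q / S) powr (p / 2)"
      unfolding power_integral_def
      by (rule integral_fatou(2)[OF test_powr_integrable[OF \<phi> p] _ le[unfolded power_integral_def] cl aep]) (simp, measurable)
    then have "power_integral p u powr (2 / p) \<le> ((q / S) powr (p / 2)) powr (2 / p)"
      using p power_integral_nonneg by (intro powr_mono2) auto
    also have "\<dots> = q / S" using p q0 S by (simp add: powr_powr)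
    finally show ?thesis using S by (simp add: q_def[symmetric] pos_le_divide_eq mult.commute)
  qed (use q0 in \<open>simp add: q_def\<close>)
qed

lemma powr_convex_combination:
  fixes x y :: real
  assumes p: "p \<ge> 1" and xy: "0 \<le> x" "0 \<le> y" and l: "0 \<le> l" "l \<le> 1"
  shows "((1 - l) * x + l * y) powr p \<le> (1 - l) * x powr p + l * y powr p"
proof -
  have pos: "((1 - l) * x + l * y) powr p \<le> (1 - l) * x powr p + l * y powr p" if "0 < x" "0 < y" for x y
    using convex_onD[OF powr_convex[OF p] l, of x y] that by simp
  have "(\<lambda>n. ((1 - l) * (x + inverse (real (Suc n))) + l * (y + inverse (real (Suc n)))) powr p)
    \<longlonglongrightarrow> ((1 - l) * (x + 0) + l * (y + 0)) powr p"
    using p l xy by (intro tendsto_powr' tendsto_add tendsto_mult tendsto_const LIMSEQ_inverse_real_of_nat)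
      (auto intro!: always_eventually add_nonneg_nonneg mult_nonneg_nonneg)
  moreover have "(\<lambda>n. (1 - l) * (x + inverse (real (Suc n))) powr p + l * (y + inverse (real (Suc n))) powr p)
    \<longlonglongrightarrow> (1 - l) * (x + 0) powr p + l * (y + 0) powr p"
    using p xy by (intro tendsto_add tendsto_mult tendsto_powr' tendsto_const LIMSEQ_inverse_real_of_nat)
      (auto intro!: always_eventually)
  ultimately have "((1 - l) * (x + 0) + l * (y + 0)) powr p \<le> (1 - l) * (x + 0) powr p + l * (y + 0) powr p"
    by (rule LIMSEQ_le) (intro exI[of _ 0] allI impI pos, use xy in \<open>auto intro: add_nonneg_pos simp del: of_nat_Suc\<close>)
  then show ?thesis by simp
qed

text \<open>
  Minkowski's inequality: the convexity of \<open>t\<^sup>p\<close> is used with weights proportional to the two norms. The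
  norms are enlarged by \<open>d\<close> because they may vanish.
\<close>

lemma norm_midpoint:
  fixes u v :: "'a::euclidean_space \<Rightarrow> real"
  assumes p: "p \<ge> 1" and [measurable]: "u \<in> borel_measurable borel" "v \<in> borel_measurable borel"
    and u: "integrable lborel (\<lambda>x. \<bar>u x\<bar> powr p)" and v: "integrable lborel (\<lambda>x. \<bar>v x\<bar> powr p)"
  shows "2 * power_integral p (\<lambda>x. (u x + v x) / 2) powr (1 / p)
    \<le> power_integral p u powr (1 / p) + power_integral p v powr (1 / p)"
proof -
  define A B where "A = power_integral p u powr (1 / p)" and "B = power_integral p v powr (1 / p)"
  have AB: "A \<ge> 0" "B \<ge> 0" by (simp_all add: A_def B_def)
  have App: "A powr p = power_integral p u" "B powr p = power_integral p v"
    using p power_integral_nonneg[of p u] power_integral_nonneg[of p v] by (simp_all add: A_def B_def powr_powr)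
  have main: "2 * power_integral p (\<lambda>x. (u x + v x) / 2) powr (1 / p) \<le> A + B + 2 * d" if d: "d > 0" for d
  proof -
    define a b where "a = A + d" and "b = B + d"
    have ab: "a > 0" "b > 0" using AB d by (auto simp: a_def b_def)
    define l where "l = b / (a + b)"
    have l: "0 \<le> l" "l \<le> 1" "1 - l = a / (a + b)" using ab by (auto simp: l_def field_simps)
    define c where "c = (a + b) / 2"
    have c: "c > 0" using ab by (simp add: c_def)
    have ptw: "\<bar>(u x + v x) / 2\<bar> powr p \<le> c powr p * ((1 - l) * (\<bar>u x\<bar> powr p / a powr p) + l * (\<bar>v x\<bar> powr p / b powr p))" for x
    proof -
      have e1: "(1 - l) * (\<bar>u x\<bar> / a) = \<bar>u x\<bar> / (a + b)" using ab by (simp add: l(3))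
      have e2: "l * (\<bar>v x\<bar> / b) = \<bar>v x\<bar> / (a + b)" using ab by (simp add: l_def)
      have "\<bar>(u x + v x) / 2\<bar> \<le> (\<bar>u x\<bar> + \<bar>v x\<bar>) / 2" by simp
      also have "\<dots> = c * ((1 - l) * (\<bar>u x\<bar> / a) + l * (\<bar>v x\<bar> / b))"
      proof -
        have "s / 2 * (X / s) = X / 2" if "s \<noteq> 0" for s X :: real using that by simp
        from this[of "a + b" "\<bar>u x\<bar> + \<bar>v x\<bar>"] show ?thesis
          unfolding e1 e2 c_def add_divide_distrib[symmetric] using ab by simp
      qed
      finally have "\<bar>(u x + v x) / 2\<bar> powr p \<le> (c * ((1 - l) * (\<bar>u x\<bar> / a) + l * (\<bar>v x\<bar> / b))) powr p"
        using p by (intro powr_mono2) auto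
      also have "\<dots> = c powr p * ((1 - l) * (\<bar>u x\<bar> / a) + l * (\<bar>v x\<bar> / b)) powr p"
        by (rule powr_mult)
      also have "\<dots> \<le> c powr p * ((1 - l) * (\<bar>u x\<bar> / a) powr p + l * (\<bar>v x\<bar> / b) powr p)"
        using ab l by (intro mult_left_mono powr_convex_combination p) auto
      finally show ?thesis using ab by (simp add: powr_divide)
    qed
    have i: "integrable lborel (\<lambda>x. c powr p * ((1 - l) * (\<bar>u x\<bar> powr p / a powr p) + l * (\<bar>v x\<bar> powr p / b powr p)))"
      by (intro integrable_mult_right Bochner_Integration.integrable_add integrable_divide_zero u v)
    have j: "integrable lborel (\<lambda>x. \<bar>(u x + v x) / 2\<bar> powr p)"
    proof (rule Bochner_Integration.integrable_bound[OF i])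
      show "AE x in lborel. norm (\<bar>(u x + v x) / 2\<bar> powr p) \<le> norm (c powr p * ((1 - l) * (\<bar>u x\<bar> powr p / a powr p) + l * (\<bar>v x\<bar> powr p / b powr p)))"
        using ptw by (intro AE_I2) (simp only: real_norm_def abs_of_nonneg powr_ge_zero, meson abs_ge_self order_trans)
    qed measurable
    have "power_integral p (\<lambda>x. (u x + v x) / 2) \<le> c powr p * ((1 - l) * (power_integral p u / a powr p) + l * (power_integral p v / b powr p))"
      using integral_mono[OF j i ptw] u v by (simp add: power_integral_def)
    also have "\<dots> \<le> c powr p * ((1 - l) * 1 + l * 1)"
    proof (intro mult_left_mono add_mono)
      show "power_integral p u / a powr p \<le> 1"
        unfolding App(1)[symmetric] using AB d ab p by (simp add: divide_le_eq_1 a_def powr_mono2)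
      show "power_integral p v / b powr p \<le> 1"
        unfolding App(2)[symmetric] using AB d ab p by (simp add: divide_le_eq_1 b_def powr_mono2)
    qed (use l in auto)
    finally have "power_integral p (\<lambda>x. (u x + v x) / 2) \<le> c powr p" by simp
    then have "power_integral p (\<lambda>x. (u x + v x) / 2) powr (1 / p) \<le> (c powr p) powr (1 / p)"
      using p power_integral_nonneg by (intro powr_mono2) auto
    also have "\<dots> = c" using p c by (simp add: powr_powr)
    finally show ?thesis by (simp add: c_def a_def b_def)
  qed
  have "2 * power_integral p (\<lambda>x. (u x + v x) / 2) powr (1 / p) \<le> A + B"
    by (rule field_le_epsilon) (use main[of "e / 2" for e] in auto)
  then show ?thesis by (simp add: A_def B_def)
qed

lemma linear_term_zero:
  fixes c K :: real
  assumes "\<And>t. 0 \<le> t * c + t\<^sup>2 * K"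
  shows "c = 0"
proof (rule ccontr)
  assume c: "c \<noteq> 0"
  define t where "t = - c / (2 * (\<bar>K\<bar> + 1))"
  have k: "2 * (\<bar>K\<bar> + 1) > 0" by simp
  have "t * c + t\<^sup>2 * K \<le> t * c + t\<^sup>2 * (\<bar>K\<bar> + 1)" by (intro add_left_mono mult_left_mono) auto
  also have "\<dots> = - (c\<^sup>2 / (4 * (\<bar>K\<bar> + 1)))"
  proof -
    have "- c / (2 * D) * c + (- c / (2 * D))\<^sup>2 * D = - (c\<^sup>2 / (4 * D))" if "D > 0" for D
      using that by (simp add: power2_eq_square field_simps)
    from this[of "\<bar>K\<bar> + 1"] show ?thesis unfolding t_def by simp
  qed
  also have "\<dots> < 0" using c by (simp add: zero_less_divide_iff)
  finally show False using assms[of t] by simp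
qed

lemma dirichlet_energy_parallelogram:
  fixes u :: "'a::euclidean_space \<Rightarrow> real"
  assumes u: "u \<in> D12" and \<eta>: "\<eta> \<in> test_functions"
  shows "dirichlet_energy (\<lambda>x. u x - t * \<eta> x) + dirichlet_energy (\<lambda>x. u x - - t * \<eta> x)
    = 2 * dirichlet_energy u + 2 * (t\<^sup>2 * dirichlet_energy \<eta>)"
proof -
  obtain g where g: "has_weak_gradient u g" "integrable lborel (\<lambda>x. (norm (g x))\<^sup>2)"
    using u by (auto simp: D12_def D12_ambient_def)
  have [measurable]: "g \<in> borel_measurable borel" using g by (simp add: has_weak_gradient_def locally_integrable_def)
  have [measurable]: "gradient \<eta> \<in> borel_measurable borel" by (rule gradient_measurable[OF \<eta>])
  have th: "(\<lambda>x. s * \<eta> x) \<in> test_functions" for s by (rule test_mult_smooth[OF \<eta> smooth_const])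
  have gr: "gradient (\<lambda>x. s * \<eta> x) x = s *\<^sub>R gradient \<eta> x" for s x
    by (rule gradient_eqI) (use has_derivative_mult_right[OF smooth_gradient[OF test_smooth[OF \<eta>]], of s x] in simp)
  have i\<eta>: "integrable lborel (\<lambda>x. (norm (gradient \<eta> x))\<^sup>2)" by (rule test_norm_gradient_integrable[OF \<eta>])
  have i\<eta>t: "integrable lborel (\<lambda>x. (norm (s *\<^sub>R gradient \<eta> x))\<^sup>2)" for s
    using integrable_mult_right[OF i\<eta>, of "s\<^sup>2"] by (simp add: power_mult_distrib)
  have e: "dirichlet_energy (\<lambda>x. u x - s * \<eta> x) = (LINT x|lborel. (norm (g x - s *\<^sub>R gradient \<eta> x))\<^sup>2)" for s
    using dirichlet_energy_eq[OF has_weak_gradient_diff[OF g(1) weak_gradient_test[OF th[of s]]]] by (simp add: gr)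
  have i: "integrable lborel (\<lambda>x. (norm (g x - s *\<^sub>R gradient \<eta> x))\<^sup>2)" for s
    by (rule integrable_square_diff(1)[OF _ _ g(2) i\<eta>t]) measurable
  have ptw: "(norm (g x - t *\<^sub>R gradient \<eta> x))\<^sup>2 + (norm (g x - (- t) *\<^sub>R gradient \<eta> x))\<^sup>2
    = 2 * (norm (g x))\<^sup>2 + 2 * (t\<^sup>2 * (norm (gradient \<eta> x))\<^sup>2)" for x
  proof -
    define G where "G = t *\<^sub>R gradient \<eta> x"
    have "t\<^sup>2 * (norm (gradient \<eta> x))\<^sup>2 = (norm G)\<^sup>2" by (simp add: G_def power_mult_distrib)
    then show ?thesis
      unfolding scaleR_minus_left G_def[symmetric]
      by (simp add: power2_norm_eq_inner inner_add_left inner_add_right inner_diff_left inner_diff_right inner_commute[of G "g x"])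
  qed
  have "dirichlet_energy (\<lambda>x. u x - t * \<eta> x) + dirichlet_energy (\<lambda>x. u x - - t * \<eta> x)
    = (LINT x|lborel. (norm (g x - t *\<^sub>R gradient \<eta> x))\<^sup>2 + (norm (g x - (- t) *\<^sub>R gradient \<eta> x))\<^sup>2)"
    unfolding e by (rule Bochner_Integration.integral_add[OF i i, symmetric])
  also have "\<dots> = 2 * dirichlet_energy u + 2 * (t\<^sup>2 * dirichlet_energy \<eta>)"
    unfolding ptw dirichlet_energy_eq[OF g(1)] dirichlet_energy_test[OF \<eta>] using g(2) i\<eta> by simp
  finally show ?thesis .
qed

lemma hardy_product_integrable:
  fixes u \<eta> :: "'a::euclidean_space \<Rightarrow> real"
  assumes [measurable]: "u \<in> borel_measurable borel" "\<eta> \<in> borel_measurable borel"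
    and u: "integrable lborel (\<lambda>x. (u x)\<^sup>2 / (norm (x - b))\<^sup>2)" and \<eta>: "integrable lborel (\<lambda>x. (\<eta> x)\<^sup>2 / (norm (x - b))\<^sup>2)"
  shows "integrable lborel (\<lambda>x. u x * \<eta> x / (norm (x - b))\<^sup>2)"
proof -
  have "integrable lborel (\<lambda>x. (u x / norm (x - b)) * (\<eta> x / norm (x - b)))"
    by (rule integrable_product) (use u \<eta> in \<open>simp_all add: power_divide\<close>)
  then show ?thesis by (simp add: power2_eq_square)
qed

lemma hardy_integral_perturb:
  fixes u \<eta> :: "'a::euclidean_space \<Rightarrow> real"
  assumes um: "u \<in> borel_measurable borel" and hm: "\<eta> \<in> borel_measurable borel"
    and u: "integrable lborel (\<lambda>x. (u x)\<^sup>2 / (norm (x - b))\<^sup>2)" and \<eta>: "integrable lborel (\<lambda>x. (\<eta> x)\<^sup>2 / (norm (x - b))\<^sup>2)"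
  shows "hardy_integral (\<lambda>x. u x - t * \<eta> x) b
    = hardy_integral u b - 2 * t * (LINT x|lborel. u x * \<eta> x / (norm (x - b))\<^sup>2) + t\<^sup>2 * hardy_integral \<eta> b"
proof -
  note i = hardy_product_integrable[OF um hm u \<eta>]
  have "hardy_integral (\<lambda>x. u x - t * \<eta> x) b
    = (LINT x|lborel. (u x)\<^sup>2 / (norm (x - b))\<^sup>2 - (2 * t) * (u x * \<eta> x / (norm (x - b))\<^sup>2) + t\<^sup>2 * ((\<eta> x)\<^sup>2 / (norm (x - b))\<^sup>2))"
    unfolding hardy_integral_def
    by (intro Bochner_Integration.integral_cong refl)
       (simp add: power2_diff power_mult_distrib diff_divide_distrib add_divide_distrib algebra_simps)
  also have "\<dots> = (LINT x|lborel. (u x)\<^sup>2 / (norm (x - b))\<^sup>2) - (2 * t) * (LINT x|lborel. u x * \<eta> x / (norm (x - b))\<^sup>2)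
      + t\<^sup>2 * (LINT x|lborel. (\<eta> x)\<^sup>2 / (norm (x - b))\<^sup>2)"
    by (simp only: Bochner_Integration.integral_add Bochner_Integration.integral_diff Bochner_Integration.integrable_diff
        integrable_mult_right u i \<eta> integral_mult_right_zero)
  finally show ?thesis by (simp add: hardy_integral_def)
qed

lemma AE_off_bisector:
  fixes a :: "'a::euclidean_space"
  assumes "a \<noteq> 0"
  shows "AE x in lborel. (norm x)\<^sup>2 - (norm (x - a))\<^sup>2 \<noteq> 0"
proof -
  have "negligible {x. a \<bullet> x = (a \<bullet> a) / 2}" using assms by (intro negligible_hyperplane) simp
  moreover have "{x. a \<bullet> x = (a \<bullet> a) / 2} \<in> sets lborel" by measurable
  ultimately have "{x. a \<bullet> x = (a \<bullet> a) / 2} \<in> null_sets lborel"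
    by (simp add: negligible_iff_null_sets null_sets_completion_iff)
  then show ?thesis
    by (rule AE_I') (auto simp: power2_norm_eq_inner inner_diff_left inner_diff_right inner_commute)
qed

text \<open>
  The two functionals \<open>\<integral>|\<nabla>v|\<^sup>2 - M \<integral>v\<^sup>2/|x|\<^sup>2\<close> and \<open>\<integral>|\<nabla>v|\<^sup>2 - M \<integral>v\<^sup>2/|x - a|\<^sup>2\<close> lie above the same convex function
  \<open>S \<parallel>v\<parallel>\<^sup>2\<close> and touch it at \<open>u\<close>. Hence their first variations at \<open>u\<close> agree, that is, \<open>u\<close> is orthogonal to
  all test functions times the difference of the potentials. Approximation of \<open>u\<close> by test functions
  shows that \<open>u\<close> vanishes off the hyperplane where the potentials agree. Convexity is used at the
  midpoint of \<open>u - t \<eta>\<close> and \<open>u + t \<eta>\<close> only, with one centre for each of the two points.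
\<close>

lemma two_centres:
  fixes u :: "'a::euclidean_space \<Rightarrow> real" and a :: 'a
  assumes N: "DIM('a) \<ge> 3" and S: "S \<ge> 0" and M: "M > 0" and a: "a \<noteq> 0"
    and p: "p = critical_exponent DIM('a)"
    and ineq: "\<And>v b. v \<in> D12 \<Longrightarrow> S * power_integral p v powr (2 / p) \<le> dirichlet_energy v - M * hardy_integral v (b::'a)"
    and u: "u \<in> D12"
    and eq0: "S * power_integral p u powr (2 / p) = dirichlet_energy u - M * hardy_integral u 0"
    and eqa: "S * power_integral p u powr (2 / p) = dirichlet_energy u - M * hardy_integral u a"
  shows "u \<in> null_functions"
proof -
  have p1: "p > 1" unfolding p by (rule critical_exponent_gt_1[OF N])
  have um[measurable]: "u \<in> borel_measurable borel" by (rule D12_measurable[OF u])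
  define cross where "cross \<eta> b = (LINT x|lborel. u x * \<eta> x / (norm (x - b))\<^sup>2)" for \<eta> b
  note iu = D12_hardy_integrable[OF u N]
  have variation: "cross \<eta> 0 = cross \<eta> a" if \<eta>: "\<eta> \<in> test_functions" for \<eta>
  proof -
    have hm[measurable]: "\<eta> \<in> borel_measurable borel" by (rule test_measurable[OF \<eta>])
    define K where "K = 2 * dirichlet_energy \<eta> - M * hardy_integral \<eta> 0 - M * hardy_integral \<eta> a"
    have "0 \<le> t * (2 * M * (cross \<eta> 0 - cross \<eta> a)) + t\<^sup>2 * K" for t
    proof -
      define v where "v s x = u x - s * \<eta> x" for s x
      have v: "v s \<in> D12" for s
        unfolding v_def by (rule D12_diff_test[OF u test_mult_smooth[OF \<eta> smooth_const] N])
      define n where "n f = power_integral p f powr (1 / p)" for f :: "'a \<Rightarrow> real"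
      have n2: "power_integral p f powr (2 / p) = (n f)\<^sup>2" for f :: "'a \<Rightarrow> real"
        unfolding n_def using power_integral_nonneg[of p f] by (simp add: power2_eq_square powr_add[symmetric])
      have n0: "0 \<le> n f" for f by (simp add: n_def)
      have "2 * n (\<lambda>x. (v t x + v (- t) x) / 2) \<le> n (v t) + n (v (- t))"
        unfolding n_def using p1 D12_measurable[OF v] D12_power_integrable[OF v]
        by (intro norm_midpoint) (auto simp: p)
      moreover have "(\<lambda>x. (v t x + v (- t) x) / 2) = u" by (auto simp: v_def)
      ultimately have "2 * n u \<le> n (v t) + n (v (- t))" by simp
      then have "(2 * n u)\<^sup>2 \<le> (n (v t) + n (v (- t)))\<^sup>2" using n0 by (intro power_mono) auto
      also have "\<dots> \<le> 2 * (n (v t))\<^sup>2 + 2 * (n (v (- t)))\<^sup>2"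
        using sum_squares_bound[of "n (v t)" "n (v (- t))"] by (simp add: power2_sum)
      finally have "2 * (n u)\<^sup>2 \<le> (n (v t))\<^sup>2 + (n (v (- t)))\<^sup>2" by (simp add: power_mult_distrib)
      then have "S * (2 * (n u)\<^sup>2) \<le> S * ((n (v t))\<^sup>2 + (n (v (- t)))\<^sup>2)" by (intro mult_left_mono S)
      then have conv: "2 * (S * (n u)\<^sup>2) \<le> S * (n (v t))\<^sup>2 + S * (n (v (- t)))\<^sup>2" by (simp add: distrib_left)
      have en: "dirichlet_energy (v t) + dirichlet_energy (v (- t)) = 2 * dirichlet_energy u + 2 * (t\<^sup>2 * dirichlet_energy \<eta>)"
        unfolding v_def by (rule dirichlet_energy_parallelogram[OF u \<eta>])
      have h: "hardy_integral (v s) b = hardy_integral u b - 2 * s * cross \<eta> b + s\<^sup>2 * hardy_integral \<eta> b" for s b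
        unfolding v_def cross_def by (rule hardy_integral_perturb[OF um hm iu hardy_test(1)[OF \<eta> N]])
      have 1: "S * (n (v t))\<^sup>2 \<le> dirichlet_energy (v t) - M * (hardy_integral u 0 - 2 * t * cross \<eta> 0 + t\<^sup>2 * hardy_integral \<eta> 0)"
        using ineq[OF v, of t 0] unfolding n2 h .
      have 2: "S * (n (v (- t)))\<^sup>2 \<le> dirichlet_energy (v (- t)) - M * (hardy_integral u a - 2 * (- t) * cross \<eta> a + (- t)\<^sup>2 * hardy_integral \<eta> a)"
        using ineq[OF v, of "- t" a] unfolding n2 h .
      have "2 * (S * (n u)\<^sup>2) = 2 * dirichlet_energy u - M * hardy_integral u 0 - M * hardy_integral u a"
        using eq0 eqa unfolding n2 by linarith
      then have "0 \<le> 2 * (t\<^sup>2 * dirichlet_energy \<eta>) - M * (- 2 * t * cross \<eta> 0 + t\<^sup>2 * hardy_integral \<eta> 0)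
        - M * (- 2 * (- t) * cross \<eta> a + (- t)\<^sup>2 * hardy_integral \<eta> a)"
        using conv 1 2 en by (simp only: distrib_left right_diff_distrib)
      also have "\<dots> = t * (2 * M * (cross \<eta> 0 - cross \<eta> a)) + t\<^sup>2 * K"
        by (simp add: K_def algebra_simps)
      finally show ?thesis .
    qed
    then have "2 * M * (cross \<eta> 0 - cross \<eta> a) = 0" by (rule linear_term_zero)
    then show ?thesis using M by simp
  qed
  obtain \<phi> \<epsilon> where \<phi>: "\<And>n. \<phi> n \<in> test_functions"
    and i: "\<And>n b. integrable lborel (\<lambda>x. (\<phi> n x - u x)\<^sup>2 / (norm (x - b))\<^sup>2)"
    and h: "\<And>n b. hardy_integral (\<lambda>x. \<phi> n x - u x) b \<le> \<epsilon> n" and \<epsilon>: "\<epsilon> \<longlonglongrightarrow> (0::real)"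
    by (rule D12_test_approximation[OF u N]) (rule that, assumption+)
  \<comment> \<open>the difference of the potentials is \<open>- q / (|x|\<^sup>2 |x - a|\<^sup>2)\<close>; multiplying \<open>\<phi>\<close> by \<open>q\<close> makes the weight nonnegative\<close>
  define q where "q x = (norm (x - 0))\<^sup>2 - (norm (x - a))\<^sup>2" for x :: 'a
  have qs: "smooth q" unfolding q_def[abs_def] by (intro smooth_diff smooth_norm2)
  have qm[measurable]: "q \<in> borel_measurable borel" unfolding q_def by measurable
  define W where "W x = q x / (norm x * norm (x - a))" for x
  have Wm[measurable]: "W \<in> borel_measurable borel" unfolding W_def by measurable
  define C where "C = 2 * (norm a)\<^sup>2"
  have W2: "(W x)\<^sup>2 \<le> C * (1 / (norm (x - 0))\<^sup>2 + 1 / (norm (x - a))\<^sup>2)" for x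
  proof (cases "x = 0 \<or> x = a")
    case True
    then have "W x = 0" by (auto simp: W_def)
    then show ?thesis by (simp add: C_def)
  next
    case False
    define s t where "s = norm x" and "t = norm (x - a)"
    have st: "s > 0" "t > 0" using False by (auto simp: s_def t_def)
    have "\<bar>s - t\<bar> \<le> norm a" using norm_triangle_ineq3[of x "x - a"] by (simp add: s_def t_def)
    then have "(s - t)\<^sup>2 \<le> (norm a)\<^sup>2" unfolding abs_le_square_iff[symmetric] by simp
    moreover have "(s + t)\<^sup>2 \<le> 2 * (s\<^sup>2 + t\<^sup>2)" using sum_squares_bound[of s t] by (simp add: power2_sum)
    ultimately have "(s - t)\<^sup>2 * (s + t)\<^sup>2 \<le> (norm a)\<^sup>2 * (2 * (s\<^sup>2 + t\<^sup>2))" by (intro mult_mono) auto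
    moreover have "(q x)\<^sup>2 = (s - t)\<^sup>2 * (s + t)\<^sup>2"
      unfolding power_mult_distrib[symmetric] by (simp add: q_def s_def[symmetric] t_def[symmetric] power2_eq_square algebra_simps)
    moreover have "(norm a)\<^sup>2 * (2 * (s\<^sup>2 + t\<^sup>2)) = C * (s\<^sup>2 + t\<^sup>2)" by (simp add: C_def)
    ultimately have "(q x)\<^sup>2 \<le> C * (s\<^sup>2 + t\<^sup>2)" by (simp only:)
    then have "(q x)\<^sup>2 / (s\<^sup>2 * t\<^sup>2) \<le> C * (s\<^sup>2 + t\<^sup>2) / (s\<^sup>2 * t\<^sup>2)"
      by (rule divide_right_mono) simp
    also have "\<dots> = C * (1 / s\<^sup>2 + 1 / t\<^sup>2)" using st by (simp add: field_simps)
    finally show ?thesis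
      by (simp add: W_def s_def[symmetric] t_def[symmetric] power_divide power_mult_distrib)
  qed
  have C0: "C \<ge> 0" by (simp add: C_def)
  have fW: "integrable lborel (\<lambda>x. (f x * W x)\<^sup>2)" "(LINT x|lborel. (f x * W x)\<^sup>2) \<le> C * (hardy_integral f 0 + hardy_integral f a)"
    if [measurable]: "f \<in> borel_measurable borel" and f: "\<And>b. integrable lborel (\<lambda>x. (f x)\<^sup>2 / (norm (x - b))\<^sup>2)" for f
  proof -
    have k: "integrable lborel (\<lambda>x. C * ((f x)\<^sup>2 / (norm (x - 0))\<^sup>2 + (f x)\<^sup>2 / (norm (x - a))\<^sup>2))"
      by (intro integrable_mult_right Bochner_Integration.integrable_add f)
    have le: "(f x * W x)\<^sup>2 \<le> C * ((f x)\<^sup>2 / (norm (x - 0))\<^sup>2 + (f x)\<^sup>2 / (norm (x - a))\<^sup>2)" for x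
    proof -
      have "(f x)\<^sup>2 * (W x)\<^sup>2 \<le> (f x)\<^sup>2 * (C * (1 / (norm (x - 0))\<^sup>2 + 1 / (norm (x - a))\<^sup>2))"
        by (intro mult_left_mono W2) simp
      then show ?thesis by (simp add: power_mult_distrib algebra_simps)
    qed
    show j: "integrable lborel (\<lambda>x. (f x * W x)\<^sup>2)"
    proof (rule Bochner_Integration.integrable_bound[OF k])
      show "AE x in lborel. norm ((f x * W x)\<^sup>2) \<le> norm (C * ((f x)\<^sup>2 / (norm (x - 0))\<^sup>2 + (f x)\<^sup>2 / (norm (x - a))\<^sup>2))"
        using le by (intro AE_I2) (simp only: real_norm_def abs_power2, meson abs_ge_self order_trans)
    qed measurable
    show "(LINT x|lborel. (f x * W x)\<^sup>2) \<le> C * (hardy_integral f 0 + hardy_integral f a)"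
      using integral_mono[OF j k le] Bochner_Integration.integral_add[OF f[of 0] f[of a]]
      by (simp only: integral_mult_right_zero hardy_integral_def)
  qed
  have ortho: "(LINT x|lborel. (u x * W x) * (\<phi> n x * W x)) = 0" for n
  proof -
    have \<eta>: "(\<lambda>x. q x * \<phi> n x) \<in> test_functions" by (rule test_mult_smooth[OF \<phi> qs])
    have \<eta>m: "(\<lambda>x. q x * \<phi> n x) \<in> borel_measurable borel" by (rule test_measurable[OF \<eta>])
    note ip = hardy_product_integrable[OF um \<eta>m iu hardy_test(1)[OF \<eta> N]]
    have [measurable]: "\<phi> n \<in> borel_measurable borel" by (rule test_measurable[OF \<phi>])
    have "(LINT x|lborel. (u x * W x) * (\<phi> n x * W x))
      = (LINT x|lborel. u x * (q x * \<phi> n x) / (norm (x - a))\<^sup>2 - u x * (q x * \<phi> n x) / (norm (x - 0))\<^sup>2)"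
    proof (rule integral_cong_AE)
      show "AE x in lborel. (u x * W x) * (\<phi> n x * W x) = u x * (q x * \<phi> n x) / (norm (x - a))\<^sup>2 - u x * (q x * \<phi> n x) / (norm (x - 0))\<^sup>2"
        using AE_neq_point[of 0] AE_neq_point[of a]
      proof eventually_elim
        case (elim x)
        define A B where "A = (norm x)\<^sup>2" and "B = (norm (x - a))\<^sup>2"
        have AB: "A \<noteq> 0" "B \<noteq> 0" using elim by (auto simp: A_def B_def)
        have W: "W x * W x = q x * q x / (A * B)" by (simp add: W_def A_def B_def power2_eq_square)
        have "q x / (A * B) = 1 / B - 1 / A" using AB by (simp add: q_def A_def[symmetric] B_def[symmetric] diff_divide_distrib)
        then have "u x * \<phi> n x * q x * (q x / (A * B)) = u x * \<phi> n x * q x * (1 / B - 1 / A)" by simp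
        moreover have "(u x * W x) * (\<phi> n x * W x) = u x * \<phi> n x * (W x * W x)" by (simp only: mult_ac)
        moreover have "u x * \<phi> n x * (W x * W x) = u x * \<phi> n x * q x * (q x / (A * B))"
          unfolding W by simp
        moreover have "u x * \<phi> n x * q x * (1 / B - 1 / A) = u x * (q x * \<phi> n x) / B - u x * (q x * \<phi> n x) / A"
          by (simp add: right_diff_distrib mult_ac)
        ultimately show ?case by (simp only: A_def B_def diff_zero)
      qed
    qed measurable
    also have "\<dots> = cross (\<lambda>x. q x * \<phi> n x) a - cross (\<lambda>x. q x * \<phi> n x) 0"
      unfolding cross_def by (rule Bochner_Integration.integral_diff[OF ip ip])
    also have "\<dots> = 0" using variation[OF \<eta>] by simp
    finally show ?thesis .
  qed
  define J where "J = (LINT x|lborel. (u x * W x)\<^sup>2)"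
  have iuW: "integrable lborel (\<lambda>x. (u x * W x)\<^sup>2)" by (rule fW(1)[OF um iu])
  have bd: "J \<le> sqrt J * sqrt (C * (2 * \<epsilon> n))" for n
  proof -
    have [measurable]: "\<phi> n \<in> borel_measurable borel" by (rule test_measurable[OF \<phi>])
    have dm: "(\<lambda>x. \<phi> n x - u x) \<in> borel_measurable borel" by measurable
    note id = fW(1)[OF dm i]
    have i1: "integrable lborel (\<lambda>x. (u x * W x) * ((\<phi> n x - u x) * W x))"
      by (rule integrable_product[OF _ _ iuW id]) measurable
    have "(LINT x|lborel. (u x * W x) * (\<phi> n x * W x)) = (LINT x|lborel. (u x * W x) * ((\<phi> n x - u x) * W x) + (u x * W x)\<^sup>2)"
      by (intro Bochner_Integration.integral_cong refl) (simp add: power2_eq_square algebra_simps)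
    also have "\<dots> = (LINT x|lborel. (u x * W x) * ((\<phi> n x - u x) * W x)) + J"
      unfolding J_def by (rule Bochner_Integration.integral_add[OF i1 iuW])
    finally have "J = - (LINT x|lborel. (u x * W x) * ((\<phi> n x - u x) * W x))" unfolding ortho by simp
    also have "\<dots> \<le> \<bar>LINT x|lborel. (u x * W x) * ((\<phi> n x - u x) * W x)\<bar>" by simp
    also have "\<dots> \<le> sqrt J * sqrt (LINT x|lborel. ((\<phi> n x - u x) * W x)\<^sup>2)"
      unfolding J_def by (rule cauchy_schwarz_integral[OF _ _ iuW id]) measurable
    also have "\<dots> \<le> sqrt J * sqrt (C * (2 * \<epsilon> n))"
    proof (intro mult_left_mono real_sqrt_le_mono order_trans[OF fW(2)[OF dm i]])
      show "hardy_integral (\<lambda>x. \<phi> n x - u x) 0 + hardy_integral (\<lambda>x. \<phi> n x - u x) a \<le> 2 * \<epsilon> n"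
        using h[of n 0] h[of n a] by simp
    qed (use C0 in \<open>auto simp: J_def\<close>)
    finally show ?thesis .
  qed
  have "(\<lambda>n. sqrt J * sqrt (C * (2 * \<epsilon> n))) \<longlonglongrightarrow> sqrt J * sqrt (C * (2 * 0))" by (intro tendsto_intros \<epsilon>)
  then have "J \<le> sqrt J * sqrt (C * (2 * 0))" by (rule LIMSEQ_le_const) (use bd in blast)
  then have "J \<le> 0" by simp
  moreover have "0 \<le> J" unfolding J_def by simp
  ultimately have "J = 0" by simp
  then have "AE x in lborel. (u x * W x)\<^sup>2 = 0"
    using integral_nonneg_eq_0_iff_AE[OF iuW] by (simp add: J_def)
  then have "AE x in lborel. u x = 0"
    using AE_neq_point[of 0] AE_neq_point[of a] AE_off_bisector[OF a]
    by eventually_elim (simp add: W_def q_def)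
  then show ?thesis by (simp add: null_functions_def)
qed

section \<open>Non-attainment for averages of Hardy potentials\<close>

lemma hardy_constant_eq: "hardy_constant TYPE('a::euclidean_space) = 1 / ((real DIM('a) - 2)\<^sup>2 / 4)"
  by (simp add: hardy_constant_def)

lemma power_integral_rescale:
  fixes u :: "'a::euclidean_space \<Rightarrow> real"
  assumes N: "DIM('a) \<ge> 3" and [measurable]: "u \<in> borel_measurable borel" and c: "c > 0"
    and p: "p = critical_exponent DIM('a)"
  shows "power_integral p (\<lambda>x. u (c *\<^sub>R x)) powr (2 / p) = c\<^sup>2 / c ^ DIM('a) * power_integral p u powr (2 / p)"
proof -
  define n where "n = real DIM('a)"
  have n: "n \<ge> 3" using N by (simp add: n_def)
  have "power_integral p (\<lambda>x. u (c *\<^sub>R x)) = power_integral p u / c ^ DIM('a)"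
    unfolding power_integral_def using integral_rescale[of "\<lambda>x. \<bar>u x\<bar> powr p" c] c by simp
  then have "power_integral p (\<lambda>x. u (c *\<^sub>R x)) powr (2 / p) = power_integral p u powr (2 / p) / (c ^ DIM('a)) powr (2 / p)"
    using c power_integral_nonneg[of p u] by (simp add: powr_divide)
  moreover have "(c ^ DIM('a)) powr (2 / p) = c powr (n - 2)"
  proof -
    have "n * (2 / p) = n - 2" using n unfolding p critical_exponent_def n_def[symmetric] by (simp add: field_simps)
    then show ?thesis using c by (simp add: powr_realpow[symmetric] powr_powr n_def)
  qed
  moreover have "c powr (n - 2) = c ^ DIM('a) / c\<^sup>2"
    using c by (simp add: powr_diff n_def powr_realpow)
  ultimately show ?thesis by simp
qed

text \<open>
  \<open>G l\<close> stands for a mean over points of norm \<open>r l\<close>, such as the mean over the vertices of a polygon or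
  over a circle; the hypotheses \<open>less\<close> and \<open>greater\<close> express that a mean lies strictly between strict
  bounds. \<open>X\<close> stands for one of the symmetric subspaces, which are invariant under dilations and
  contain the radial test functions.
\<close>

theorem nonattainment:
  fixes V :: "'a::euclidean_space \<Rightarrow> real" and X :: "('a \<Rightarrow> real) set" and G :: "nat \<Rightarrow> ('a \<Rightarrow> real) \<Rightarrow> real"
  assumes N: "DIM('a) \<ge> 3" and sub: "X \<subseteq> D12"
    and scale: "\<And>u c. u \<in> X \<Longrightarrow> c > 0 \<Longrightarrow> (\<lambda>x. u (c *\<^sub>R x)) \<in> X"
    and radial: "\<And>v. v \<in> test_functions \<Longrightarrow> (\<And>x y. norm x = norm y \<Longrightarrow> v x = v y) \<Longrightarrow> v \<in> X"
    and V: "\<And>u. u \<in> D12 \<Longrightarrow> (LINT x|lborel. V x * (u x)\<^sup>2) = lam0 * hardy_integral u 0 + (\<Sum>l=1..m. \<Lambda> l * G l (hardy_integral u))"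
    and less: "\<And>l u C. l \<in> {1..m} \<Longrightarrow> u \<in> D12 \<Longrightarrow> (\<And>b. norm b = r l \<Longrightarrow> hardy_integral u b < C) \<Longrightarrow> G l (hardy_integral u) < C"
    and greater: "\<And>l u C. l \<in> {1..m} \<Longrightarrow> u \<in> D12 \<Longrightarrow> (\<And>b. norm b = r l \<Longrightarrow> C < hardy_integral u b) \<Longrightarrow> C < G l (hardy_integral u)"
    and r: "\<forall>l\<in>{1..m}. r l > 0" and m: "m \<ge> 1"
    and small: "max lam0 0 + (\<Sum>l=1..m. max (\<Lambda> l) 0) < (real DIM('a) - 2)\<^sup>2 / 4"
    and sign: "(\<forall>l\<in>{1..m}. \<Lambda> l < 0) \<or> (lam0 > 0 \<and> (\<forall>l\<in>{1..m}. \<Lambda> l > 0))"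
  shows "\<not> (\<exists>u\<in>X - null_functions. rayleigh_quotient V u = (INF u\<in>X - null_functions. rayleigh_quotient V u))"
proof
  assume "\<exists>u\<in>X - null_functions. rayleigh_quotient V u = (INF u\<in>X - null_functions. rayleigh_quotient V u)"
  then obtain u where uX: "u \<in> X" and une: "u \<notin> null_functions"
    and uS: "rayleigh_quotient V u = (INF u\<in>X - null_functions. rayleigh_quotient V u)" by blast
  have u: "u \<in> D12" using uX sub by blast
  define p where "p = critical_exponent DIM('a)"
  have p1: "p > 1" unfolding p_def by (rule critical_exponent_gt_1[OF N])
  define H where "H = hardy_constant TYPE('a)"
  have H: "H > 0" unfolding H_def by (rule hardy_constant_pos[OF N])
  define T where "T = max lam0 0 + (\<Sum>l=1..m. max (\<Lambda> l) 0)"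
  have TH: "T * H \<le> 1"
  proof -
    have "0 < (real DIM('a) - 2)\<^sup>2 / 4" using N by simp
    then have "T / ((real DIM('a) - 2)\<^sup>2 / 4) \<le> 1"
      using small unfolding T_def by (subst divide_le_eq_1_pos) auto
    then show ?thesis unfolding H_def hardy_constant_eq by simp
  qed
  define P where "P v = power_integral p v powr (2 / p)" for v :: "'a \<Rightarrow> real"
  define A where "A v = dirichlet_energy v - (LINT x|lborel. V x * (v x)\<^sup>2)" for v
  define S where "S = (INF u\<in>X - null_functions. rayleigh_quotient V u)"
  have rq: "rayleigh_quotient V v = A v / P v" for v
    by (simp add: rayleigh_quotient_def A_def P_def power_integral_def p_def)
  have Ppos: "P v > 0" if "v \<in> D12" "v \<notin> null_functions" for v
  proof -
    have "power_integral p v \<noteq> 0"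
    proof
      assume "power_integral p v = 0"
      then have "AE x in lborel. \<bar>v x\<bar> powr p = 0"
        using integral_nonneg_eq_0_iff_AE[OF D12_power_integrable[OF that(1)]] by (simp add: power_integral_def p_def)
      then have "AE x in lborel. v x = 0" by eventually_elim simp
      then show False using that by (simp add: null_functions_def)
    qed
    then show ?thesis using power_integral_nonneg[of p v] by (simp add: P_def)
  qed
  have Gle: "G l (hardy_integral v) \<le> C" if "l \<in> {1..m}" "v \<in> D12" "\<And>b. norm b = r l \<Longrightarrow> hardy_integral v b \<le> C" for l v C
  proof (rule field_le_epsilon)
    fix e :: real assume "e > 0"
    then have "G l (hardy_integral v) < C + e" using that(3) by (intro less that(1,2)) (simp add: add_le_less_mono[of _ C 0, simplified])
    then show "G l (hardy_integral v) \<le> C + e" by simp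
  qed
  have Gge: "C \<le> G l (hardy_integral v)" if "l \<in> {1..m}" "v \<in> D12" "\<And>b. norm b = r l \<Longrightarrow> C \<le> hardy_integral v b" for l v C
  proof (rule field_le_epsilon)
    fix e :: real assume e: "e > 0"
    have "C - e < G l (hardy_integral v)"
    proof (rule greater[OF that(1,2)])
      fix b :: 'a assume "norm b = r l"
      then show "C - e < hardy_integral v b" using that(3)[of b] e by linarith
    qed
    then show "C \<le> G l (hardy_integral v) + e" by simp
  qed
  have A0: "0 \<le> A v" if v: "v \<in> D12" for v
  proof -
    have h: "0 \<le> hardy_integral v b" "hardy_integral v b \<le> H * dirichlet_energy v" for b
      using hardy_integral_nonneg D12_hardy[OF v N] by (auto simp: H_def)
    define E where "E = H * dirichlet_energy v"
    have bound: "t * g \<le> max t 0 * E" if "0 \<le> g" "g \<le> E" for t g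
    proof -
      have "t * g \<le> max t 0 * g" using that by (intro mult_right_mono) auto
      also have "\<dots> \<le> max t 0 * E" using that by (intro mult_left_mono) auto
      finally show ?thesis .
    qed
    have "lam0 * hardy_integral v 0 \<le> max lam0 0 * E" using h by (intro bound) (auto simp: E_def)
    moreover have "(\<Sum>l=1..m. \<Lambda> l * G l (hardy_integral v)) \<le> (\<Sum>l=1..m. max (\<Lambda> l) 0 * E)"
      using h by (intro sum_mono bound Gge Gle v) (auto simp: E_def)
    ultimately have "(LINT x|lborel. V x * (v x)\<^sup>2) \<le> T * E"
      unfolding V[OF v] T_def by (simp only: distrib_right sum_distrib_right)
    also have "\<dots> \<le> 1 * dirichlet_energy v"
      unfolding E_def mult.assoc[symmetric] by (intro mult_right_mono TH dirichlet_energy_nonneg)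
    finally show ?thesis by (simp add: A_def)
  qed
  have rq0: "0 \<le> rayleigh_quotient V v" if "v \<in> X" for v
    unfolding rq using A0 that sub by (intro divide_nonneg_nonneg) (auto simp: P_def)
  have bdd: "bdd_below (rayleigh_quotient V ` (X - null_functions))"
    by (rule bdd_belowI2[where m=0]) (use rq0 in blast)
  have S0: "S \<ge> 0" using rq0[OF uX] uS by (simp add: S_def)
  have Sle: "S * P v \<le> A v" if v: "v \<in> X" for v
  proof (cases "v \<in> null_functions")
    case True
    then have ae: "AE x in lborel. v x = 0" by (simp add: null_functions_def)
    have "power_integral p v = (LINT x|(lborel :: 'a measure). 0)"
      unfolding power_integral_def
    proof (rule integral_cong_AE)
      show "AE x in lborel. \<bar>v x\<bar> powr p = 0" using ae by eventually_elim (use p1 in simp)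
      show "(\<lambda>x. \<bar>v x\<bar> powr p) \<in> borel_measurable lborel"
        using D12_measurable[of v] v sub by auto
    qed simp
    then have "P v = 0" by (simp add: P_def)
    then show ?thesis using A0 v sub by auto
  next
    case False
    then have "S \<le> A v / P v" unfolding S_def rq[symmetric] using v bdd by (intro cINF_lower) auto
    then show ?thesis using Ppos[of v] v sub False by (simp add: pos_le_divide_eq subset_iff)
  qed
  have Su: "S * P u = A u"
  proof -
    have "rayleigh_quotient V u = S" unfolding S_def by (rule uS)
    then have "A u / P u = S" by (simp only: rq[of u])
    then show ?thesis using Ppos[OF u une] by (simp add: field_simps)
  qed
  \<comment> \<open>the inequality for dilations of \<open>v\<close>, expressed through \<open>v\<close>\<close>
  have dilate: "\<exists>\<gamma>. S * P v \<le> dirichlet_energy v - lam0 * hardy_integral v 0 - (\<Sum>l=1..m. \<Lambda> l * \<gamma> l)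
      \<and> (\<forall>l\<in>{1..m}. \<forall>C. (\<forall>b. norm b = r l \<longrightarrow> hardy_integral v (c *\<^sub>R b) < C) \<longrightarrow> \<gamma> l < C)
      \<and> (\<forall>l\<in>{1..m}. \<forall>C. (\<forall>b. norm b = r l \<longrightarrow> C < hardy_integral v (c *\<^sub>R b)) \<longrightarrow> C < \<gamma> l)"
    if vX: "v \<in> X" and c: "c > 0" for v c
  proof -
    define w where "w x = v (c *\<^sub>R x)" for x
    have wX: "w \<in> X" unfolding w_def by (rule scale[OF vX c])
    have v: "v \<in> D12" and w: "w \<in> D12" using vX wX sub by auto
    have vm: "v \<in> borel_measurable borel" by (rule D12_measurable[OF v])
    define k where "k = c\<^sup>2 / c ^ DIM('a)"
    have k: "k > 0" using c by (simp add: k_def)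
    obtain g where g: "has_weak_gradient v g" using v by (auto simp: D12_def D12_ambient_def)
    have e: "dirichlet_energy w = k * dirichlet_energy v"
      unfolding w_def k_def by (rule dirichlet_energy_rescale[OF g c])
    have h: "hardy_integral w b = k * hardy_integral v (c *\<^sub>R b)" for b
      unfolding w_def k_def by (rule hardy_integral_rescale[OF vm c])
    have Pw: "P w = k * P v" unfolding P_def w_def k_def by (rule power_integral_rescale[OF N vm c p_def])
    define \<gamma> where "\<gamma> l = G l (hardy_integral w) / k" for l
    have \<gamma>: "G l (hardy_integral w) = k * \<gamma> l" for l using k by (simp add: \<gamma>_def)
    have "S * P w \<le> dirichlet_energy w - (lam0 * hardy_integral w 0 + (\<Sum>l=1..m. \<Lambda> l * G l (hardy_integral w)))"
      using Sle[OF wX] unfolding A_def V[OF w] .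
    moreover have "(\<Sum>l=1..m. \<Lambda> l * (k * \<gamma> l)) = k * (\<Sum>l=1..m. \<Lambda> l * \<gamma> l)"
      by (simp only: sum_distrib_left mult.left_commute)
    ultimately have "k * (S * P v) \<le> k * (dirichlet_energy v - lam0 * hardy_integral v 0 - (\<Sum>l=1..m. \<Lambda> l * \<gamma> l))"
      unfolding e h Pw \<gamma> by (simp add: algebra_simps)
    then have 1: "S * P v \<le> dirichlet_energy v - lam0 * hardy_integral v 0 - (\<Sum>l=1..m. \<Lambda> l * \<gamma> l)"
      using k by (simp only: mult_le_cancel_left_pos)
    have 2: "\<gamma> l < C" if l: "l \<in> {1..m}" and b: "\<forall>b. norm b = r l \<longrightarrow> hardy_integral v (c *\<^sub>R b) < C" for l C
    proof -
      have "G l (hardy_integral w) < k * C"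
      proof (rule less[OF l w])
        fix b :: 'a assume "norm b = r l"
        then show "hardy_integral w b < k * C" unfolding h using k b by simp
      qed
      then show ?thesis unfolding \<gamma> using k by simp
    qed
    have 3: "C < \<gamma> l" if l: "l \<in> {1..m}" and b: "\<forall>b. norm b = r l \<longrightarrow> C < hardy_integral v (c *\<^sub>R b)" for l C
    proof -
      have "k * C < G l (hardy_integral w)"
      proof (rule greater[OF l w])
        fix b :: 'a assume "norm b = r l"
        then show "k * C < hardy_integral w b" unfolding h using k b by simp
      qed
      then show ?thesis unfolding \<gamma> using k by simp
    qed
    show ?thesis using 1 2 3 by blast
  qed
  have Au: "A u = dirichlet_energy u - lam0 * hardy_integral u 0 - (\<Sum>l=1..m. \<Lambda> l * G l (hardy_integral u))"
    unfolding A_def V[OF u] by simp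
  define rmin rmax where "rmin = Min (r ` {1..m})" and "rmax = Max (r ` {1..m})"
  have ne: "r ` {1..m} \<noteq> {}" using m by simp
  have rmin: "rmin > 0" "\<And>l. l \<in> {1..m} \<Longrightarrow> rmin \<le> r l" and rmax: "\<And>l. l \<in> {1..m} \<Longrightarrow> r l \<le> rmax"
    unfolding rmin_def rmax_def using ne r by auto
  have m1: "1 \<in> {1..m}" using m by simp
  then have rmax0: "rmax > 0" using rmax[of 1] r by (meson less_le_trans)
  from sign show False
  proof
    assume neg: "\<forall>l\<in>{1..m}. \<Lambda> l < 0"
    define L where "L = (\<Sum>l=1..m. \<bar>\<Lambda> l\<bar>) + 1"
    have L: "L > 0" unfolding L_def by (simp add: add_nonneg_pos sum_nonneg)
    \<comment> \<open>the dilation factor \<open>c\<close> pushes all points of the means beyond the radius \<open>R\<close>\<close>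
    have "S * P u \<le> dirichlet_energy u - lam0 * hardy_integral u 0"
    proof (rule field_le_epsilon)
      fix e :: real assume e: "e > 0"
      define \<eta> where "\<eta> = e / L"
      have \<eta>: "\<eta> > 0" using e L by (simp add: \<eta>_def)
      obtain R where R: "R > 0" "\<And>b. R \<le> norm b \<Longrightarrow> hardy_integral u b < \<eta>"
        using hardy_integral_vanishes[OF u N \<eta>] by blast
      define c where "c = R / rmin"
      have c: "c > 0" using R rmin by (simp add: c_def)
      obtain \<gamma> where \<gamma>: "S * P u \<le> dirichlet_energy u - lam0 * hardy_integral u 0 - (\<Sum>l=1..m. \<Lambda> l * \<gamma> l)"
        "\<And>l C. l \<in> {1..m} \<Longrightarrow> (\<forall>b. norm b = r l \<longrightarrow> hardy_integral u (c *\<^sub>R b) < C) \<Longrightarrow> \<gamma> l < C"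
        using dilate[OF uX c] by blast
      have "\<gamma> l < \<eta>" if l: "l \<in> {1..m}" for l
      proof (rule \<gamma>(2)[OF l], intro allI impI R(2))
        fix b :: 'a assume b: "norm b = r l"
        have "c * rmin \<le> c * norm b" using rmin(2)[OF l] c b by simp
        moreover have "c * rmin = R" using rmin(1) by (simp add: c_def)
        ultimately show "R \<le> norm (c *\<^sub>R b)" using c by simp
      qed
      then have "- (\<Lambda> l * \<gamma> l) \<le> \<bar>\<Lambda> l\<bar> * \<eta>" if "l \<in> {1..m}" for l
        using that neg mult_left_mono[of "\<gamma> l" \<eta> "- \<Lambda> l"] by force
      then have "(\<Sum>l=1..m. - (\<Lambda> l * \<gamma> l)) \<le> (\<Sum>l=1..m. \<bar>\<Lambda> l\<bar> * \<eta>)" by (rule sum_mono)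
      also have "\<dots> = (L - 1) * \<eta>" by (simp add: L_def sum_distrib_right)
      also have "\<dots> \<le> L * \<eta>" using \<eta> by (intro mult_right_mono) auto
      also have "\<dots> = e" using L by (simp add: \<eta>_def)
      finally show "S * P u \<le> dirichlet_energy u - lam0 * hardy_integral u 0 + e"
        using \<gamma>(1) by (simp add: sum_negf)
    qed
    moreover have "(\<Sum>l=1..m. \<Lambda> l * G l (hardy_integral u)) < (\<Sum>l=1..m. 0)"
    proof (rule sum_strict_mono)
      fix l assume l: "l \<in> {1..m}"
      have "0 < G l (hardy_integral u)" by (rule greater[OF l u]) (rule hardy_integral_pos[OF u N une])
      then show "\<Lambda> l * G l (hardy_integral u) < 0" using neg l by (intro mult_neg_pos) auto
    qed (use m in auto)
    ultimately show False using Su unfolding Au by simp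
  next
    assume pos: "lam0 > 0 \<and> (\<forall>l\<in>{1..m}. \<Lambda> l > 0)"
    define M where "M = lam0 + (\<Sum>l=1..m. \<Lambda> l)"
    have sumnn: "0 \<le> (\<Sum>l=1..m. \<Lambda> l)" using pos by (intro sum_nonneg) (auto intro: less_imp_le)
    have M: "M > 0" unfolding M_def using pos sumnn by linarith
    have "(\<Sum>l=1..m. max (\<Lambda> l) 0) = (\<Sum>l=1..m. \<Lambda> l)" using pos by (intro sum.cong) (simp_all add: max_absorb1 less_imp_le)
    then have "M = T" unfolding M_def T_def using pos by simp
    then have MH: "M * H \<le> 1" using TH by simp
    \<comment> \<open>here the dilation factor \<open>c\<close> pulls all points of the means into the ball of radius \<open>R\<close>\<close>
    have rad: "S * (LINT x|lborel. \<bar>v x\<bar> powr p) powr (2 / p) \<le> (LINT x|lborel. (norm (gradient v x))\<^sup>2) - M * hardy_integral v 0"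
      if v: "v \<in> test_functions" and vr: "\<And>x y. norm x = norm y \<Longrightarrow> v x = v y" for v :: "'a \<Rightarrow> real"
    proof -
      have vX: "v \<in> X" by (rule radial[OF v vr])
      have "S * P v \<le> dirichlet_energy v - M * hardy_integral v 0"
      proof (rule field_le_epsilon)
        fix e :: real assume e: "e > 0"
        define \<eta> where "\<eta> = e / M"
        have \<eta>: "\<eta> > 0" using e M by (simp add: \<eta>_def)
        obtain R where R: "R > 0" "\<And>b. norm b < R \<Longrightarrow> hardy_integral v 0 - \<eta> < hardy_integral v b"
          using test_hardy_continuous[OF v N \<eta>] by blast
        define c where "c = R / (2 * rmax)"
        have c: "c > 0" using R rmax0 by (simp add: c_def)
        obtain \<gamma> where \<gamma>: "S * P v \<le> dirichlet_energy v - lam0 * hardy_integral v 0 - (\<Sum>l=1..m. \<Lambda> l * \<gamma> l)"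
          "\<And>l C. l \<in> {1..m} \<Longrightarrow> (\<forall>b. norm b = r l \<longrightarrow> C < hardy_integral v (c *\<^sub>R b)) \<Longrightarrow> C < \<gamma> l"
          using dilate[OF vX c] by blast
        have "hardy_integral v 0 - \<eta> < \<gamma> l" if l: "l \<in> {1..m}" for l
        proof (rule \<gamma>(2)[OF l], intro allI impI R(2))
          fix b :: 'a assume b: "norm b = r l"
          have "c * norm b \<le> c * rmax" using rmax[OF l] c b by simp
          also have "\<dots> = R / 2" using rmax0 by (simp add: c_def)
          also have "\<dots> < R" using R by simp
          finally show "norm (c *\<^sub>R b) < R" using c by simp
        qed
        then have "(\<Sum>l=1..m. \<Lambda> l * (hardy_integral v 0 - \<eta>)) \<le> (\<Sum>l=1..m. \<Lambda> l * \<gamma> l)"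
          using pos by (intro sum_mono mult_left_mono) (auto intro: less_imp_le)
        then have "(\<Sum>l=1..m. \<Lambda> l) * hardy_integral v 0 - (\<Sum>l=1..m. \<Lambda> l) * \<eta> \<le> (\<Sum>l=1..m. \<Lambda> l * \<gamma> l)"
          by (simp only: sum_distrib_right[symmetric] right_diff_distrib sum_subtractf)
        moreover have "(\<Sum>l=1..m. \<Lambda> l) * \<eta> \<le> M * \<eta>" using \<eta> pos by (intro mult_right_mono) (auto simp: M_def)
        moreover have "M * \<eta> = e" using M by (simp add: \<eta>_def)
        moreover have "M * hardy_integral v 0 = lam0 * hardy_integral v 0 + (\<Sum>l=1..m. \<Lambda> l) * hardy_integral v 0"
          unfolding M_def by (rule distrib_right)
        ultimately show "S * P v \<le> dirichlet_energy v - M * hardy_integral v 0 + e" using \<gamma>(1) by linarith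
      qed
      then show ?thesis unfolding P_def power_integral_def dirichlet_energy_test[OF v] .
    qed
    have p0: "p > 0" using p1 by simp
    have test: "S * power_integral p \<phi> powr (2 / p) \<le> (LINT x|lborel. (norm (gradient \<phi> x))\<^sup>2) - M * hardy_integral \<phi> b"
      if \<phi>: "\<phi> \<in> test_functions" for \<phi> :: "'a \<Rightarrow> real" and b
    proof -
      define \<psi> where "\<psi> x = \<phi> (x + b)" for x
      have \<psi>: "\<psi> \<in> test_functions" unfolding \<psi>_def using test_rescale[OF \<phi>, of 1 b] by simp
      have "gradient \<psi> x = gradient \<phi> (x + b)" for x
      proof (rule gradient_eqI)
        have "((\<lambda>x. x + b) has_derivative (\<lambda>h. h)) (at x)" by (auto intro!: derivative_eq_intros)
        from has_derivative_compose[OF this smooth_gradient[OF test_smooth[OF \<phi>]]]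
        show "(\<psi> has_derivative (\<lambda>h. gradient \<phi> (x + b) \<bullet> h)) (at x)" unfolding \<psi>_def .
      qed
      then have e: "(LINT x|lborel. (norm (gradient \<psi> x))\<^sup>2) = (LINT x|lborel. (norm (gradient \<phi> x))\<^sup>2)"
        using integral_translate[of "\<lambda>x. (norm (gradient \<phi> x))\<^sup>2" b] gradient_measurable[OF \<phi>] by simp
      have "(LINT x|lborel. \<bar>\<psi> x\<bar> powr p) = power_integral p \<phi>"
        unfolding \<psi>_def power_integral_def
        using integral_translate[of "\<lambda>x. \<bar>\<phi> x\<bar> powr p" b] test_measurable[OF \<phi>] by simp
      moreover have "hardy_integral \<psi> 0 = hardy_integral \<phi> b"
        unfolding \<psi>_def by (rule hardy_integral_translate[OF test_measurable[OF \<phi>], symmetric])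
      moreover have "S * (LINT x|lborel. \<bar>\<psi> x\<bar> powr p) powr (2 / p) \<le> (LINT x|lborel. (norm (gradient \<psi> x))\<^sup>2) - M * hardy_integral \<psi> 0"
        by (rule radial_reduction[OF N p0 less_imp_le[OF M] rad \<psi>])
      ultimately show ?thesis by (simp only: e)
    qed
    have ineq: "S * power_integral p v powr (2 / p) \<le> dirichlet_energy v - M * hardy_integral v b" if "v \<in> D12" for v :: "'a \<Rightarrow> real" and b
      by (rule D12_extension[OF N p0 S0 less_imp_le[OF M] _ test that]) (use MH H_def in auto)
    \<comment> \<open>the largest value that \<open>hardy_integral u b\<close> can take; its mean against the masses equals it\<close>
    define h where "h = (dirichlet_energy u - S * P u) / M"
    have Mh: "M * h = dirichlet_energy u - S * P u" using M by (simp add: h_def)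
    have hb: "hardy_integral u b \<le> h" for b
    proof -
      have "M * hardy_integral u b \<le> M * h" using ineq[OF u, of b] unfolding Mh P_def by simp
      then show ?thesis using M by simp
    qed
    have Gh: "G l (hardy_integral u) \<le> h" if "l \<in> {1..m}" for l by (rule Gle[OF that u hb])
    have total: "lam0 * hardy_integral u 0 + (\<Sum>l=1..m. \<Lambda> l * G l (hardy_integral u)) = lam0 * h + (\<Sum>l=1..m. \<Lambda> l * h)"
      using Su Mh unfolding Au M_def distrib_right sum_distrib_right by linarith
    have sle: "(\<Sum>l=1..m. \<Lambda> l * G l (hardy_integral u)) \<le> (\<Sum>l=1..m. \<Lambda> l * h)"
      using pos Gh by (intro sum_mono mult_left_mono) (auto intro: less_imp_le)
    have l0le: "lam0 * hardy_integral u 0 \<le> lam0 * h" using pos hb by (intro mult_left_mono) auto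
    have "lam0 * hardy_integral u 0 = lam0 * h" using total sle l0le by linarith
    then have h0: "hardy_integral u 0 = h" using pos by simp
    have "\<exists>a. norm a = r 1 \<and> hardy_integral u a = h"
    proof (rule ccontr)
      assume no: "\<not> (\<exists>a. norm a = r 1 \<and> hardy_integral u a = h)"
      have "G 1 (hardy_integral u) < h"
      proof (rule less[OF m1 u])
        fix b :: 'a assume "norm b = r 1"
        then show "hardy_integral u b < h" using no hb[of b] by (auto simp: less_le)
      qed
      then have "(\<Sum>l=1..m. \<Lambda> l * G l (hardy_integral u)) < (\<Sum>l=1..m. \<Lambda> l * h)"
        using pos Gh m1 by (intro sum_strict_mono_ex1) (auto intro!: mult_left_mono less_imp_le bexI[of _ 1])
      then show False using total l0le by linarith
    qed
    then obtain a where a: "norm a = r 1" "hardy_integral u a = h" by blast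
    have "a \<noteq> 0" using a(1) bspec[OF r m1] by auto
    have "u \<in> null_functions"
      by (rule two_centres[OF N S0 M \<open>a \<noteq> 0\<close> p_def ineq u]) (use Mh h0 a(2) in \<open>auto simp: P_def\<close>)
    then show False using une by simp
  qed
qed

section \<open>The two symmetric spaces\<close>

text \<open>
  A point may be replaced by one of the same norm whose two components are nonnegative multiples of
  fixed unit vectors.
\<close>

lemma radial_profile:
  fixes v :: "complex \<times> (real^'n) \<Rightarrow> real"
  assumes "\<And>x y. norm x = norm y \<Longrightarrow> v x = v y"
  shows "\<exists>f. \<forall>z y. v (z, y) = f (norm z) (norm y)"
proof -
  obtain e :: "real^'n" where e: "norm e = 1" using vector_choose_size[of 1] by auto
  have "v (z, y) = v (complex_of_real (norm z), norm y *\<^sub>R e)" for z y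
    by (rule assms) (simp add: norm_Pair e)
  then show ?thesis by (intro exI[of _ "\<lambda>s t. v (complex_of_real s, t *\<^sub>R e)"]) blast
qed

lemma D12_k_rescale:
  fixes u :: "complex \<times> (real^'n) \<Rightarrow> real"
  assumes u: "u \<in> D12_k k" and c: "c > 0"
  shows "(\<lambda>x. u (c *\<^sub>R x)) \<in> D12_k k"
proof -
  have 1: "AE x in lborel. case x of (z, y) \<Rightarrow> u (cis (2 * pi / real k) * z, y) = u (z, y)"
    using u by (simp add: D12_k_def)
  obtain v where 2: "AE x in lborel. case x of (z, y) \<Rightarrow> u (z, y) = v z (norm y)"
    using u by (auto simp: D12_k_def)
  have "AE x in lborel. case c *\<^sub>R x of (z, y) \<Rightarrow> u (cis (2 * pi / real k) * z, y) = u (z, y)"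
    using 1 c by (intro AE_rescale) auto
  then have a: "AE x in lborel. case x of (z, y) \<Rightarrow> u (c *\<^sub>R (cis (2 * pi / real k) * z, y)) = u (c *\<^sub>R (z, y))"
    by eventually_elim (auto simp: scaleR_Pair mult_scaleR_right)
  have "AE x in lborel. case c *\<^sub>R x of (z, y) \<Rightarrow> u (z, y) = v z (norm y)"
    using 2 c by (intro AE_rescale) auto
  then have "AE x in lborel. case x of (z, y) \<Rightarrow> u (c *\<^sub>R (z, y)) = v (c *\<^sub>R z) (c * norm y)"
    by eventually_elim (use c in \<open>auto simp: scaleR_Pair\<close>)
  then have b: "\<exists>v. AE x in lborel. case x of (z, y) \<Rightarrow> u (c *\<^sub>R (z, y)) = v z (norm y)"
    by (intro exI[of _ "\<lambda>z t. v (c *\<^sub>R z) (c * t)"])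
  show ?thesis using a b D12_rescale[of u c] u c by (simp add: D12_k_def)
qed

lemma D12_circ_rescale:
  fixes u :: "complex \<times> (real^'n) \<Rightarrow> real"
  assumes u: "u \<in> D12_circ" and c: "c > 0"
  shows "(\<lambda>x. u (c *\<^sub>R x)) \<in> D12_circ"
proof -
  obtain v where "AE x in lborel. case x of (z, y) \<Rightarrow> u (z, y) = v (norm z) (norm y)"
    using u by (auto simp: D12_circ_def)
  then have "AE x in lborel. case c *\<^sub>R x of (z, y) \<Rightarrow> u (z, y) = v (norm z) (norm y)"
    using c by (intro AE_rescale) auto
  then have "AE x in lborel. case x of (z, y) \<Rightarrow> u (c *\<^sub>R (z, y)) = v (c * norm z) (c * norm y)"
    by eventually_elim (use c in \<open>auto simp: scaleR_Pair\<close>)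
  then have b: "\<exists>v. AE x in lborel. case x of (z, y) \<Rightarrow> u (c *\<^sub>R (z, y)) = v (norm z) (norm y)"
    by (intro exI[of _ "\<lambda>s t. v (c * s) (c * t)"])
  show ?thesis using b D12_rescale[of u c] u c by (simp add: D12_circ_def)
qed

lemma radial_in_D12_circ:
  fixes v :: "complex \<times> (real^'n) \<Rightarrow> real"
  assumes "v \<in> test_functions" "\<And>x y. norm x = norm y \<Longrightarrow> v x = v y" "DIM(complex \<times> (real^'n)) \<ge> 3"
  shows "v \<in> D12_circ"
proof -
  obtain f where "\<And>z y. v (z, y) = f (norm z) (norm y)" using radial_profile[of v, OF assms(2)] by blast
  then have "AE x in lborel. case x of (z, y) \<Rightarrow> v (z, y) = f (norm z) (norm y)" by simp
  then show ?thesis using test_in_D12[OF assms(1,3)] unfolding D12_circ_def by blast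
qed

lemma radial_in_D12_k:
  fixes v :: "complex \<times> (real^'n) \<Rightarrow> real"
  assumes v: "v \<in> test_functions" and rad: "\<And>x y. norm x = norm y \<Longrightarrow> v x = v y" and N: "DIM(complex \<times> (real^'n)) \<ge> 3"
  shows "v \<in> D12_k k"
proof -
  obtain f where f: "\<And>z y. v (z, y) = f (norm z) (norm y)" using radial_profile[of v, OF rad] by blast
  have 1: "v (cis (2 * pi / real k) * z, y) = v (z, y)" for z y
    by (simp add: f norm_mult)
  have 2: "\<exists>h. AE x in lborel. case x of (z, y) \<Rightarrow> v (z, y) = h z (norm y)"
    by (rule exI[of _ "\<lambda>z t. f (norm z) t"]) (simp add: f)
  show ?thesis using 1 2 test_in_D12[OF v N] by (simp add: D12_k_def)
qed

lemma potential_k_integral: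
  fixes u :: "'a::euclidean_space \<Rightarrow> real"
  assumes u: "u \<in> D12" and N: "DIM('a) \<ge> 3"
  shows "(LINT x|lborel. potential_k lam0 m \<Lambda> k a x * (u x)\<^sup>2)
    = lam0 * hardy_integral u 0 + (\<Sum>l=1..m. \<Lambda> l * ((\<Sum>i=1..k. hardy_integral u (a l i)) / real k))"
proof -
  note i = D12_hardy_integrable[OF u N]
  have "potential_k lam0 m \<Lambda> k a x * (u x)\<^sup>2 = lam0 * ((u x)\<^sup>2 / (norm (x - 0))\<^sup>2)
    + (\<Sum>l=1..m. \<Sum>i=1..k. (\<Lambda> l / real k) * ((u x)\<^sup>2 / (norm (x - a l i))\<^sup>2))" for x
    by (simp add: potential_k_def distrib_right sum_distrib_right)
  then have "(LINT x|lborel. potential_k lam0 m \<Lambda> k a x * (u x)\<^sup>2)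
    = lam0 * hardy_integral u 0 + (\<Sum>l=1..m. \<Sum>i=1..k. (\<Lambda> l / real k) * hardy_integral u (a l i))"
    unfolding hardy_integral_def
    by (simp only: Bochner_Integration.integral_add Bochner_Integration.integral_sum integrable_mult_right i
       Bochner_Integration.integrable_sum integral_mult_right_zero)
  moreover have "(\<Sum>i=1..k. (\<Lambda> l / real k) * hardy_integral u (a l i)) = \<Lambda> l * ((\<Sum>i=1..k. hardy_integral u (a l i)) / real k)" for l
    unfolding sum_distrib_left[symmetric] by simp
  ultimately show ?thesis by (simp only:)
qed

definition circle_point :: "real \<Rightarrow> real \<Rightarrow> complex \<times> (real^'n)" where
  "circle_point \<rho> \<theta> = (of_real \<rho> * cis \<theta>, 0)"

lemma norm_circle_point: "0 \<le> \<rho> \<Longrightarrow> norm (circle_point \<rho> \<theta>) = \<rho>"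
  by (simp add: circle_point_def norm_Pair norm_mult)

lemma circle_integral_eq:
  fixes f :: "complex \<times> (real^'n) \<Rightarrow> real"
  assumes "0 \<le> \<rho>"
  shows "circle_integral \<rho> f = \<rho> * (LINT \<theta>:{0..2 * pi}|lborel. f (circle_point \<rho> \<theta>))"
proof -
  have d: "vector_derivative (\<lambda>\<theta>. (of_real \<rho> * cis \<theta>, 0::real^'n)) (at \<theta>) = (of_real \<rho> * (\<i> * cis \<theta>), 0)" for \<theta>
  proof (rule vector_derivative_at)
    have "(cis has_vector_derivative (\<i> * cis \<theta>)) (at \<theta>)"
      unfolding has_vector_derivative_def by (auto intro!: derivative_eq_intros simp: scaleR_conv_of_real)
    then have "((\<lambda>\<theta>. of_real \<rho> * cis \<theta>) has_vector_derivative (of_real \<rho> * (\<i> * cis \<theta>))) (at \<theta>)"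
      by (rule has_vector_derivative_mult_right)
    from has_vector_derivative_Pair[OF this has_vector_derivative_const]
    show "((\<lambda>\<theta>. (of_real \<rho> * cis \<theta>, 0::real^'n)) has_vector_derivative (of_real \<rho> * (\<i> * cis \<theta>), 0)) (at \<theta>)" .
  qed
  have n: "norm (of_real \<rho> * (\<i> * cis \<theta>), 0::real^'n) = \<rho>" for \<theta>
    using assms by (simp add: norm_Pair norm_mult)
  show ?thesis
    unfolding circle_integral_def arc_length_integral_def d n circle_point_def by (simp add: mult.commute)
qed

lemma circle_point_measurable [measurable]: "circle_point \<rho> \<in> borel_measurable borel"
  unfolding circle_point_def[abs_def]
  by (intro borel_measurable_continuous_onI continuous_intros)

text \<open>Exchanging the two integrations turns the circular potential into a mean of Hardy integrals.\<close>

lemma circle_hardy: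
  fixes u :: "complex \<times> (real^'n) \<Rightarrow> real"
  assumes u: "u \<in> D12" and N: "DIM(complex \<times> (real^'n)) \<ge> 3"
  shows "integrable lborel (\<lambda>y. (LINT \<theta>:{0..2 * pi}|lborel. 1 / (norm (circle_point \<rho> \<theta> - y))\<^sup>2) * (u y)\<^sup>2)"
    "(LINT y|lborel. (LINT \<theta>:{0..2 * pi}|lborel. 1 / (norm (circle_point \<rho> \<theta> - y))\<^sup>2) * (u y)\<^sup>2)
      = (LINT \<theta>:{0..2 * pi}|lborel. hardy_integral u (circle_point \<rho> \<theta>))"
    "set_integrable lborel {0..2 * pi} (\<lambda>\<theta>. hardy_integral u (circle_point \<rho> \<theta>))"
proof -
  have um[measurable]: "u \<in> borel_measurable borel" by (rule D12_measurable[OF u])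
  note hi = D12_hardy_integrable[OF u N]
  define F where "F \<theta> y = indicat_real {0..2 * pi} \<theta> * ((u y)\<^sup>2 / (norm (y - circle_point \<rho> \<theta>))\<^sup>2)" for \<theta> y
  have Fm: "case_prod F \<in> borel_measurable (lborel \<Otimes>\<^sub>M lborel)"
    unfolding F_def case_prod_beta by measurable
  have Fint: "(LINT y|lborel. F \<theta> y) = indicat_real {0..2 * pi} \<theta> * hardy_integral u (circle_point \<rho> \<theta>)" for \<theta>
    unfolding F_def hardy_integral_def by (rule integral_mult_right_zero)
  have Fnn: "norm (F \<theta> y) = F \<theta> y" for \<theta> y by (simp add: F_def)
  have hm: "(\<lambda>\<theta>. indicat_real {0..2 * pi} \<theta> * hardy_integral u (circle_point \<rho> \<theta>)) \<in> borel_measurable lborel"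
    unfolding Fint[symmetric] using lborel.borel_measurable_lebesgue_integral[OF Fm] .
  have ih: "integrable lborel (\<lambda>\<theta>. indicat_real {0..2 * pi} \<theta> * hardy_integral u (circle_point \<rho> \<theta>))"
  proof (rule Bochner_Integration.integrable_bound[OF _ hm])
    show "integrable lborel (\<lambda>\<theta>. indicat_real {0..2 * pi} \<theta> * (hardy_constant TYPE(complex \<times> (real^'n)) * dirichlet_energy u))"
      by (intro integrable_mult_left) simp
    show "AE \<theta> in lborel. norm (indicat_real {0..2 * pi} \<theta> * hardy_integral u (circle_point \<rho> \<theta>))
      \<le> norm (indicat_real {0..2 * pi} \<theta> * (hardy_constant TYPE(complex \<times> (real^'n)) * dirichlet_energy u))"
    proof (rule AE_I2)
      fix \<theta>
      show "norm (indicat_real {0..2 * pi} \<theta> * hardy_integral u (circle_point \<rho> \<theta>))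
        \<le> norm (indicat_real {0..2 * pi} \<theta> * (hardy_constant TYPE(complex \<times> (real^'n)) * dirichlet_energy u))"
        using D12_hardy[OF u N, of "circle_point \<rho> \<theta>"] hardy_integral_nonneg[of u "circle_point \<rho> \<theta>"]
        by (cases "\<theta> \<in> {0..2 * pi}") (simp_all del: atLeastAtMost_iff)
    qed
  qed
  then show "set_integrable lborel {0..2 * pi} (\<lambda>\<theta>. hardy_integral u (circle_point \<rho> \<theta>))"
    by (simp add: set_integrable_def)
  have FI: "integrable (lborel \<Otimes>\<^sub>M lborel) (case_prod F)"
  proof (rule lborel_pair.Fubini_integrable[OF Fm])
    show "integrable lborel (\<lambda>\<theta>. LINT y|lborel. norm (case_prod F (\<theta>, y)))"
      by (simp only: case_prod_conv Fnn Fint ih)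
    show "AE \<theta> in lborel. integrable lborel (\<lambda>y. case_prod F (\<theta>, y))"
      unfolding F_def case_prod_conv by (intro AE_I2 integrable_mult_right hi)
  qed
  have inner: "(LINT \<theta>|lborel. F \<theta> y) = (LINT \<theta>:{0..2 * pi}|lborel. 1 / (norm (circle_point \<rho> \<theta> - y))\<^sup>2) * (u y)\<^sup>2" for y
  proof -
    have "(LINT \<theta>|lborel. F \<theta> y) = (LINT \<theta>|lborel. (indicat_real {0..2 * pi} \<theta> *\<^sub>R (1 / (norm (circle_point \<rho> \<theta> - y))\<^sup>2)) * (u y)\<^sup>2)"
      by (intro Bochner_Integration.integral_cong refl) (simp add: F_def norm_minus_commute)
    also have "\<dots> = (LINT \<theta>|lborel. indicat_real {0..2 * pi} \<theta> *\<^sub>R (1 / (norm (circle_point \<rho> \<theta> - y))\<^sup>2)) * (u y)\<^sup>2"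
      by (rule integral_mult_left_zero)
    finally show ?thesis by (simp only: set_lebesgue_integral_def)
  qed
  show "integrable lborel (\<lambda>y. (LINT \<theta>:{0..2 * pi}|lborel. 1 / (norm (circle_point \<rho> \<theta> - y))\<^sup>2) * (u y)\<^sup>2)"
    unfolding inner[symmetric] by (rule lborel_pair.integrable_snd[OF FI])
  have "(LINT y|lborel. (LINT \<theta>|lborel. F \<theta> y)) = (LINT \<theta>|lborel. (LINT y|lborel. F \<theta> y))"
    by (rule lborel_pair.Fubini_integral[OF FI])
  then show "(LINT y|lborel. (LINT \<theta>:{0..2 * pi}|lborel. 1 / (norm (circle_point \<rho> \<theta> - y))\<^sup>2) * (u y)\<^sup>2)
      = (LINT \<theta>:{0..2 * pi}|lborel. hardy_integral u (circle_point \<rho> \<theta>))"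
    unfolding inner Fint by (simp add: set_lebesgue_integral_def)
qed

lemma potential_circ_integral:
  fixes u :: "complex \<times> (real^'n) \<Rightarrow> real"
  assumes u: "u \<in> D12" and N: "DIM(complex \<times> (real^'n)) \<ge> 3" and r: "\<forall>l\<in>{1..m}. r l > 0"
  shows "(LINT x|lborel. potential_circ lam0 m \<Lambda> r x * (u x)\<^sup>2)
    = lam0 * hardy_integral u 0 + (\<Sum>l=1..m. \<Lambda> l * ((LINT \<theta>:{0..2 * pi}|lborel. hardy_integral u (circle_point (r l) \<theta>)) / (2 * pi)))"
proof -
  define I where "I l y = (LINT \<theta>:{0..2 * pi}|lborel. 1 / (norm (circle_point (r l) \<theta> - y))\<^sup>2) * (u y)\<^sup>2" for l y
  note hi = D12_hardy_integrable[OF u N]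
  have iI: "integrable lborel (I l)" for l unfolding I_def[abs_def] by (rule circle_hardy(1)[OF u N])
  have "\<Lambda> l / (2 * pi * r l) * circle_integral (r l) (\<lambda>x. 1 / (norm (x - y))\<^sup>2) * (u y)\<^sup>2 = (\<Lambda> l / (2 * pi)) * I l y"
    if "l \<in> {1..m}" for l y
  proof -
    have rl: "r l > 0" using r that by blast
    show ?thesis using rl by (simp add: I_def circle_integral_eq[OF less_imp_le[OF rl]])
  qed
  then have "potential_circ lam0 m \<Lambda> r y * (u y)\<^sup>2 = lam0 * ((u y)\<^sup>2 / (norm (y - 0))\<^sup>2) + (\<Sum>l=1..m. (\<Lambda> l / (2 * pi)) * I l y)" for y
    unfolding potential_circ_def distrib_right sum_distrib_right by simp
  then have "(LINT x|lborel. potential_circ lam0 m \<Lambda> r x * (u x)\<^sup>2)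
    = lam0 * hardy_integral u 0 + (\<Sum>l=1..m. (\<Lambda> l / (2 * pi)) * (LINT y|lborel. I l y))"
    unfolding hardy_integral_def
    by (simp only: Bochner_Integration.integral_add Bochner_Integration.integral_sum integrable_mult_right hi iI
       Bochner_Integration.integrable_sum integral_mult_right_zero)
  then show ?thesis unfolding I_def circle_hardy(2)[OF u N] by simp
qed

text \<open>
  The continuous mean inherits strictness because a nonnegative function with zero integral vanishes
  almost everywhere.
\<close>

lemma circle_mean_less:
  assumes i: "set_integrable lborel {0..2 * pi} f" and less: "\<And>\<theta>. f \<theta> < (C::real)"
  shows "(LINT \<theta>:{0..2 * pi}|lborel. f \<theta>) / (2 * pi) < C"
proof -
  have ic: "set_integrable lborel {0..2 * pi} (\<lambda>\<theta>. C)" by (simp add: set_integrable_def)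
  have d: "(LINT \<theta>:{0..2 * pi}|lborel. C - f \<theta>) = 2 * pi * C - (LINT \<theta>:{0..2 * pi}|lborel. f \<theta>)"
    using set_integral_diff(2)[OF ic i] by (simp add: set_lebesgue_integral_def)
  have id: "integrable lborel (\<lambda>\<theta>. indicat_real {0..2 * pi} \<theta> * (C - f \<theta>))"
    using set_integral_diff(1)[OF ic i] by (simp add: set_integrable_def)
  have nn: "0 \<le> indicat_real {0..2 * pi} \<theta> * (C - f \<theta>)" for \<theta> using less[of \<theta>] by simp
  have "(LINT \<theta>|lborel. indicat_real {0..2 * pi} \<theta> * (C - f \<theta>)) \<noteq> 0"
  proof
    assume "(LINT \<theta>|lborel. indicat_real {0..2 * pi} \<theta> * (C - f \<theta>)) = 0"
    then have "AE \<theta> in lborel. indicat_real {0..2 * pi} \<theta> * (C - f \<theta>) = 0"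
      using integral_nonneg_eq_0_iff_AE[OF id] nn by simp
    moreover have "{0<..<2 * pi} \<noteq> {}" using pi_gt_zero by (simp add: not_le)
    ultimately obtain \<theta> where "\<theta> \<in> {0<..<2 * pi}" "indicat_real {0..2 * pi} \<theta> * (C - f \<theta>) = 0"
      by (rule AE_open_nonempty[OF _ open_greaterThanLessThan])
    then show False using less[of \<theta>] by simp
  qed
  moreover have "0 \<le> (LINT \<theta>|lborel. indicat_real {0..2 * pi} \<theta> * (C - f \<theta>))" using nn by simp
  ultimately have "0 < (LINT \<theta>:{0..2 * pi}|lborel. C - f \<theta>)" by (simp add: set_lebesgue_integral_def)
  then have "(LINT \<theta>:{0..2 * pi}|lborel. f \<theta>) < C * (2 * pi)" unfolding d by (simp add: mult.commute)
  then show ?thesis by (simp add: pos_divide_less_eq)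
qed

lemma circle_mean_greater:
  assumes i: "set_integrable lborel {0..2 * pi} f" and greater: "\<And>\<theta>. (C::real) < f \<theta>"
  shows "C < (LINT \<theta>:{0..2 * pi}|lborel. f \<theta>) / (2 * pi)"
proof -
  have "set_integrable lborel {0..2 * pi} (\<lambda>\<theta>. - f \<theta>)"
    using i by (simp add: set_integrable_def)
  then have "(LINT \<theta>:{0..2 * pi}|lborel. - f \<theta>) / (2 * pi) < - C"
    by (rule circle_mean_less) (use greater in simp)
  then show ?thesis by (simp add: set_lebesgue_integral_def)
qed

lemma vertex_mean_bounds:
  fixes f :: "nat \<Rightarrow> real"
  assumes "k \<ge> 1"
  shows "(\<And>i. i \<in> {1..k} \<Longrightarrow> f i < C) \<Longrightarrow> (\<Sum>i=1..k. f i) / real k < C"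
    and "(\<And>i. i \<in> {1..k} \<Longrightarrow> C < f i) \<Longrightarrow> C < (\<Sum>i=1..k. f i) / real k"
proof -
  have k: "0 < real k" "{1..k} \<noteq> {}" using assms by auto
  show "(\<Sum>i=1..k. f i) / real k < C" if "\<And>i. i \<in> {1..k} \<Longrightarrow> f i < C"
    using sum_strict_mono[of "{1..k}" f "\<lambda>_. C"] k that by (simp add: pos_divide_less_eq mult.commute)
  show "C < (\<Sum>i=1..k. f i) / real k" if "\<And>i. i \<in> {1..k} \<Longrightarrow> C < f i"
    using sum_strict_mono[of "{1..k}" "\<lambda>_. C" f] k that by (simp add: pos_less_divide_eq mult.commute)
qed

theorem theorem1p2:
  fixes N m k :: nat and lam0 :: real and \<Lambda> r :: "nat \<Rightarrow> real"
    and a :: "nat \<Rightarrow> nat \<Rightarrow> complex \<times> (real^'n)"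
  assumes "N = DIM(complex \<times> (real^'n))" and "N \<ge> 4" and "m \<ge> 1" and "k \<ge> 1"
    and "\<forall>l\<in>{1..m}. r l > 0"
    and "polygon_vertices m k r a"
    and "max lam0 0 + (\<Sum>l=1..m. max (\<Lambda> l) 0) < (real N - 2)\<^sup>2 / 4"
    and "(\<forall>l\<in>{1..m}. \<Lambda> l < 0) \<or> (lam0 > 0 \<and> (\<forall>l\<in>{1..m}. \<Lambda> l > 0))"
  shows "\<not> (\<exists>u\<in>D12_k k - null_functions.
              rayleigh_quotient (potential_k lam0 m \<Lambda> k a) u = S_k lam0 m \<Lambda> k a) \<and>
         \<not> (\<exists>u\<in>(D12_circ :: (complex \<times> (real^'n) \<Rightarrow> real) set) - null_functions.
              rayleigh_quotient (potential_circ lam0 m \<Lambda> r) u = S_circ TYPE('n) lam0 m \<Lambda> r)"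
proof
  have N: "DIM(complex \<times> (real^'n)) \<ge> 3" using assms(1,2) by linarith
  note small = assms(7)[unfolded assms(1)]
  have norm_a: "norm (a l i) = r l" if "l \<in> {1..m}" "i \<in> {1..k}" for l i
    using assms(6) that by (simp add: polygon_vertices_def)
  show "\<not> (\<exists>u\<in>D12_k k - null_functions. rayleigh_quotient (potential_k lam0 m \<Lambda> k a) u = S_k lam0 m \<Lambda> k a)"
    unfolding S_k_def
  proof (rule nonattainment[OF N _ D12_k_rescale radial_in_D12_k[OF _ _ N] potential_k_integral[OF _ N] _ _ assms(5,3) small assms(8)])
    show "D12_k k \<subseteq> (D12 :: (complex \<times> (real^'n) \<Rightarrow> real) set)" by (auto simp: D12_k_def)
    fix l C and u :: "complex \<times> (real^'n) \<Rightarrow> real" assume l: "l \<in> {1..m}"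
    show "(\<Sum>i=1..k. hardy_integral u (a l i)) / real k < C" if "\<And>b. norm b = r l \<Longrightarrow> hardy_integral u b < C"
      by (rule vertex_mean_bounds(1)[OF assms(4)]) (rule that, rule norm_a[OF l])
    show "C < (\<Sum>i=1..k. hardy_integral u (a l i)) / real k" if "\<And>b. norm b = r l \<Longrightarrow> C < hardy_integral u b"
      by (rule vertex_mean_bounds(2)[OF assms(4)]) (rule that, rule norm_a[OF l])
  qed
  show "\<not> (\<exists>u\<in>(D12_circ :: (complex \<times> (real^'n) \<Rightarrow> real) set) - null_functions.
              rayleigh_quotient (potential_circ lam0 m \<Lambda> r) u = S_circ TYPE('n) lam0 m \<Lambda> r)"
    unfolding S_circ_def
  proof (rule nonattainment[OF N _ D12_circ_rescale radial_in_D12_circ[OF _ _ N] potential_circ_integral[OF _ N assms(5)] _ _ assms(5,3) small assms(8)])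
    show "D12_circ \<subseteq> (D12 :: (complex \<times> (real^'n) \<Rightarrow> real) set)" by (auto simp: D12_circ_def)
    fix l C and u :: "complex \<times> (real^'n) \<Rightarrow> real" assume l: "l \<in> {1..m}" and u: "u \<in> D12"
    have n: "norm (circle_point (r l) \<theta> :: complex \<times> (real^'n)) = r l" for \<theta>
      using assms(5) l by (intro norm_circle_point) (simp add: less_imp_le)
    show "(LINT \<theta>:{0..2 * pi}|lborel. hardy_integral u (circle_point (r l) \<theta>)) / (2 * pi) < C" if "\<And>b. norm b = r l \<Longrightarrow> hardy_integral u b < C"
      by (rule circle_mean_less[OF circle_hardy(3)[OF u N]]) (rule that, rule n)
    show "C < (LINT \<theta>:{0..2 * pi}|lborel. hardy_integral u (circle_point (r l) \<theta>)) / (2 * pi)" if "\<And>b. norm b = r l \<Longrightarrow> C < hardy_integral u b"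
      by (rule circle_mean_greater[OF circle_hardy(3)[OF u N]]) (rule that, rule n)
  qed
qed

end
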